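(* There exists a constant $K>0$ such that the following holds. Let $\lambda'\in(0,1)$, $D>0$, and let $d'>0$ be an integer. Let $d=\max\{2^{2d'},(K\log\frac{1}{\lambda'})^2\}$ and let $\lambda\le\frac{1}{4d}$. If $Y$ is a $[d,n,D,\lambda]$-poset, then the $d'$-skeleton $\mathcal{SP}(Y)^{\le d'}$ of $\mathcal{SP}(Y)$ is a $[d',n',D',\lambda']$-poset, where $n'=n^2$ and $D'=d\cdot D$.
   Context: All vector spaces are over $\mathbb{F}_2$. An $\ell$-dimensional Grassmann poset over a vector space $V$ is a set $Y$ of subspaces of $V$, closed under taking subspaces, all of whose maximal elements have dimension $\ell$; $Y(i)$ denotes its $i$-dimensional members; the ambient space of $Y$ is the span of the subspaces in $Y(1)$. $Y$ is measured by a distribution $\mu$ on $Y(\ell)$ with full support; a random flag $v_1\subsetneq\dots\subsetneq v_\ell$ is sampled by $v_\ell\sim\mu$ and then a uniform complete flag in $v_\ell$. For $i\le\ell-2$ and $w\in Y(i)$, the link graph $Y_w$ has vertices $\{v: \mathrm{span}(v)+w\in Y(i+1)\}$ and edges $\{v,v'\}$ with $\mathrm{span}(v,v')+w\in Y(i+2)$, weighted via the random flag conditioned on $v_i=w$. $\lambda(G)$ is the second largest absolute eigenvalue of the random walk operator of a weighted graph $G$; $Y$ is a $\lambda$-expander if $\lambda(Y_w)\le\lambda$ for all $i\le\ell-2$, $w\in Y(i)$. A $[d,n,D,\lambda]$-poset is a $d$-dimensional Grassmann poset that is a $\lambda$-expander, with ambient space $\mathbb{F}_2^n$ and $|Y(1)|\le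 2^D$. The $k$-skeleton $Y^{\le k}$ consists of the members of $Y$ of dimension $\le k$, with the measure given by the marginal of the random flag on $v_k$. The construction $\mathcal{SP}$: let $Y$ be a $d$-dimensional Grassmann poset over $\mathbb{F}_2^n$, where $d$ is a power of $2$, and let $L=\log_2 d$. Identify $\mathbb{F}_2^{n^2}$ with $n\times n$ matrices over $\mathbb{F}_2$. A function $s:\mathbb{F}_2^{L}\setminus\{0\}\to\mathbb{F}_2^{n\times n}$ (not necessarily linear) is admissible if every $s(v)$ has rank $1$, the matrix $M_s=\sum_{v\ne 0}s(v)$ has rank $2^L-1$, and the row space and column space of $M_s$ lie in $Y(2^L-1)$. Its Hadamard encoding is the linear map $\widehat{s}:\mathbb{F}_2^L\to\mathbb{F}_2^{n\times n}$, $\widehat{s}(x)=\sum_{v\ne0}\langle x,v\rangle s(v)$ with $\langle x,v\rangle=\sum_i x_iv_i$; it is injective. $\mathcal{SP}(Y)$ is the $L$-dimensional Grassmann poset consisting of all subspaces of $\mathrm{Im}(\widehat{s})$ over all admissible $s$, with distribution on top spaces: sample $w_1,w_2\in Y(d-1)$ independently according to $Y$'s distribution, sample uniformly an admissible $s$ with row space of $M_s$ equal to $w_1$ and column space equal to $w_2$, and output $\mathrm{Im}(\widehat{s})$.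
   Formalization: Since SP(Y) is defined only when d is a power of 2, d is taken to be max{2^{2d'},(K log(1/λ'))^2} rounded up to the nearest power of 2 (equal to the maximum when that already is one); log is base 2. *)

theory Defs
  imports "HOL-Probability.Probability" "HOL-Library.Z2" "HOL-Library.Function_Algebras"
begin

section \<open>Coordinate spaces\<close>

text \<open>
  Vectors are functions on an index type. The dimension has to be quantified inside the final
  statement (the constant there does not depend on it), so it is carried by an index set and not
  by a type.
\<close>

definition fscale :: "'a::field \<Rightarrow> ('i \<Rightarrow> 'a) \<Rightarrow> 'i \<Rightarrow> 'a" where
  "fscale c f = (\<lambda>i. c * f i)"

global_interpretation fvs: vector_space "fscale :: 'a::field \<Rightarrow> ('i \<Rightarrow> 'a) \<Rightarrow> 'i \<Rightarrow> 'a"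
  by unfold_locales (auto simp: fscale_def algebra_simps)

text \<open>\<open>F2 {..<n}\<close> is \<open>\<bbbF>\<^sub>2\<^sup>n\<close>, and \<open>F2 ({..<n} \<times> {..<n})\<close> is the space of \<open>n \<times> n\<close> matrices.\<close>

definition F2 :: "'i set \<Rightarrow> ('i \<Rightarrow> bit) set" where
  "F2 I = {x. \<forall>i. i \<notin> I \<longrightarrow> x i = 0}"

section \<open>Grassmann posets\<close>

definition faces :: "('i \<Rightarrow> bit) set set \<Rightarrow> nat \<Rightarrow> ('i \<Rightarrow> bit) set set" where
  "faces Y k = {w \<in> Y. fvs.dim w = k}"

definition grassmann_poset :: "('i \<Rightarrow> bit) set \<Rightarrow> nat \<Rightarrow> ('i \<Rightarrow> bit) set set \<Rightarrow> bool" where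
  "grassmann_poset V l Y \<longleftrightarrow>
     (\<forall>w\<in>Y. fvs.subspace w \<and> w \<subseteq> V) \<and>
     (\<forall>w\<in>Y. \<forall>u. fvs.subspace u \<and> u \<subseteq> w \<longrightarrow> u \<in> Y) \<and>
     (\<forall>w\<in>Y. (\<forall>u\<in>Y. w \<subseteq> u \<longrightarrow> u = w) \<longrightarrow> fvs.dim w = l)"

definition ambient_space :: "('i \<Rightarrow> bit) set set \<Rightarrow> ('i \<Rightarrow> bit) set" where
  "ambient_space Y = fvs.span (\<Union>(faces Y 1))"

type_synonym 'i measured_poset = "('i \<Rightarrow> bit) set set \<times> ('i \<Rightarrow> bit) set pmf"

text \<open>A complete flag is a list whose entry at position \<open>i\<close> is \<open>v\<^sub>i\<close>; it starts with \<open>v\<^sub>0 = {0}\<close>.\<close>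

definition complete_flags :: "('i \<Rightarrow> bit) set \<Rightarrow> ('i \<Rightarrow> bit) set list set" where
  "complete_flags v = {fl. length fl = fvs.dim v + 1 \<and> (\<forall>u\<in>set fl. fvs.subspace u) \<and>
                           sorted_wrt (\<subset>) fl \<and> last fl = v}"

definition random_flag :: "('i \<Rightarrow> bit) set pmf \<Rightarrow> ('i \<Rightarrow> bit) set list pmf" where
  "random_flag \<mu> = bind_pmf \<mu> (\<lambda>v. pmf_of_set (complete_flags v))"

definition flag_marginal :: "nat \<Rightarrow> ('i \<Rightarrow> bit) set pmf \<Rightarrow> ('i \<Rightarrow> bit) set pmf" where
  "flag_marginal k \<mu> = map_pmf (\<lambda>fl. fl ! k) (random_flag \<mu>)"

definition skeleton :: "nat \<Rightarrow> 'i measured_poset \<Rightarrow> 'i measured_poset" where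
  "skeleton k = (\<lambda>(Y, \<mu>). ({w \<in> Y. fvs.dim w \<le> k}, flag_marginal k \<mu>))"

section \<open>Spectral expansion\<close>

text \<open>
  A weighted graph is a finite vertex set \<open>U\<close> with a symmetric distribution \<open>E\<close> on ordered pairs
  of vertices: the weight of an edge is split evenly between its two orientations.
\<close>

definition walk_op :: "'v set \<Rightarrow> ('v \<times> 'v) pmf \<Rightarrow> ('v \<Rightarrow> real) \<Rightarrow> 'v \<Rightarrow> real" where
  "walk_op U E f v = (\<Sum>u\<in>U. pmf E (v, u) / pmf (map_pmf fst E) v * f u)"

definition eigenspace :: "'v set \<Rightarrow> ('v \<times> 'v) pmf \<Rightarrow> real \<Rightarrow> ('v \<Rightarrow> real) set" where
  "eigenspace U E \<theta> = {f. (\<forall>v. v \<notin> U \<longrightarrow> f v = 0) \<and> (\<forall>v\<in>U. walk_op U E f v = \<theta> * f v)}"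

text \<open>
  Absolute values of the eigenvalues, with multiplicity. The walk operator is self-adjoint with
  respect to its stationary distribution, so geometric multiplicities add up to \<open>card U\<close>.
\<close>

definition abs_spectrum :: "'v set \<Rightarrow> ('v \<times> 'v) pmf \<Rightarrow> real multiset" where
  "abs_spectrum U E =
     (\<Sum>\<theta>\<in>{\<theta>. eigenspace U E \<theta> \<noteq> {0}}. replicate_mset (fvs.dim (eigenspace U E \<theta>)) \<bar>\<theta>\<bar>)"

definition graph_lambda :: "'v set \<Rightarrow> ('v \<times> 'v) pmf \<Rightarrow> real" where
  "graph_lambda U E = rev (sorted_list_of_multiset (abs_spectrum U E)) ! 1"

definition link_verts :: "('i \<Rightarrow> bit) set set \<Rightarrow> ('i \<Rightarrow> bit) set \<Rightarrow> ('i \<Rightarrow> bit) set" where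
  "link_verts Y w = {v. fvs.span (insert v w) \<in> faces Y (fvs.dim w + 1)}"

text \<open>
  A random (oriented) edge of the link of an \<open>i\<close>-dimensional \<open>w\<close>: given the random flag conditioned
  on \<open>v\<^sub>i = w\<close>, a uniform pair \<open>(v, v')\<close> with \<open>span(v, v') + w = v\<^sub>i\<^sub>+\<^sub>2\<close>. When \<open>\<mu>\<close> has full support,
  the pairs of positive weight are exactly those with \<open>span(v, v') + w \<in> Y(i+2)\<close>.
\<close>

definition link_edge_pmf ::
  "('i \<Rightarrow> bit) set pmf \<Rightarrow> ('i \<Rightarrow> bit) set \<Rightarrow> (('i \<Rightarrow> bit) \<times> ('i \<Rightarrow> bit)) pmf" where
  "link_edge_pmf \<mu> w =
     bind_pmf (cond_pmf (random_flag \<mu>) {fl. fl ! fvs.dim w = w})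
       (\<lambda>fl. pmf_of_set {(v, v'). fvs.span ({v, v'} \<union> w) = fl ! (fvs.dim w + 2)})"

definition poset_expander :: "nat \<Rightarrow> real \<Rightarrow> 'i measured_poset \<Rightarrow> bool" where
  "poset_expander l lam = (\<lambda>(Y, \<mu>).
     \<forall>i w. i + 2 \<le> l \<longrightarrow> w \<in> faces Y i \<longrightarrow>
       graph_lambda (link_verts Y w) (link_edge_pmf \<mu> w) \<le> lam)"

text \<open>
  \<open>X\<close> is a \<open>[d, n, D, \<lambda>]\<close>-poset; the index set \<open>I\<close> of size \<open>n\<close> names the coordinates of
  \<open>\<bbbF>\<^sub>2\<^sup>n\<close>.
\<close>

definition params_poset ::
  "'i set \<Rightarrow> nat \<Rightarrow> nat \<Rightarrow> real \<Rightarrow> real \<Rightarrow> 'i measured_poset \<Rightarrow> bool" where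
  "params_poset I d n D lam X \<longleftrightarrow>
     finite I \<and> card I = n \<and>
     grassmann_poset (F2 I) d (fst X) \<and>
     set_pmf (snd X) = faces (fst X) d \<and>
     poset_expander d lam X \<and>
     ambient_space (fst X) = F2 I \<and>
     real (card (faces (fst X) 1)) \<le> 2 powr D"

section \<open>The construction SP\<close>

definition row_space :: "(nat \<times> nat \<Rightarrow> bit) \<Rightarrow> (nat \<Rightarrow> bit) set" where
  "row_space M = fvs.span (range (\<lambda>i j. M (i, j)))"

definition col_space :: "(nat \<times> nat \<Rightarrow> bit) \<Rightarrow> (nat \<Rightarrow> bit) set" where
  "col_space M = fvs.span (range (\<lambda>j i. M (i, j)))"

definition mrank :: "(nat \<times> nat \<Rightarrow> bit) \<Rightarrow> nat" where
  "mrank M = fvs.dim (row_space M)"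

definition msum :: "nat \<Rightarrow> ((nat \<Rightarrow> bit) \<Rightarrow> (nat \<times> nat \<Rightarrow> bit)) \<Rightarrow> (nat \<times> nat \<Rightarrow> bit)" where
  "msum L s = (\<Sum>v\<in>F2 {..<L} - {0}. s v)"

text \<open>
  Here \<open>Y\<close> is a poset of dimension \<open>d = 2\<^sup>L\<close> over \<open>\<bbbF>\<^sub>2\<^sup>n\<close>. The functions are extensional, so that
  each function on \<open>\<bbbF>\<^sub>2\<^sup>L \<setminus> {0}\<close> is represented exactly once in the uniform choice below.
\<close>

definition admissible ::
  "nat \<Rightarrow> nat \<Rightarrow> (nat \<Rightarrow> bit) set set \<Rightarrow> ((nat \<Rightarrow> bit) \<Rightarrow> (nat \<times> nat \<Rightarrow> bit)) set" where
  "admissible n L Y =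
     {s \<in> (F2 {..<L} - {0}) \<rightarrow>\<^sub>E F2 ({..<n} \<times> {..<n}).
        (\<forall>v \<in> F2 {..<L} - {0}. mrank (s v) = 1) \<and>
        mrank (msum L s) = 2 ^ L - 1 \<and>
        row_space (msum L s) \<in> faces Y (2 ^ L - 1) \<and>
        col_space (msum L s) \<in> faces Y (2 ^ L - 1)}"

definition hadamard ::
  "nat \<Rightarrow> ((nat \<Rightarrow> bit) \<Rightarrow> (nat \<times> nat \<Rightarrow> bit)) \<Rightarrow> (nat \<Rightarrow> bit) \<Rightarrow> (nat \<times> nat \<Rightarrow> bit)" where
  "hadamard L s x = (\<Sum>v\<in>F2 {..<L} - {0}. fscale (\<Sum>i<L. x i * v i) (s v))"

definition hadamard_image ::
  "nat \<Rightarrow> ((nat \<Rightarrow> bit) \<Rightarrow> (nat \<times> nat \<Rightarrow> bit)) \<Rightarrow> (nat \<times> nat \<Rightarrow> bit) set" where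
  "hadamard_image L s = hadamard L s ` F2 {..<L}"

definition SP_dist ::
  "nat \<Rightarrow> nat \<Rightarrow> nat measured_poset \<Rightarrow> (nat \<times> nat \<Rightarrow> bit) set pmf" where
  "SP_dist n L = (\<lambda>(Y, \<mu>).
     bind_pmf (flag_marginal (2 ^ L - 1) \<mu>) (\<lambda>w1.
     bind_pmf (flag_marginal (2 ^ L - 1) \<mu>) (\<lambda>w2.
     map_pmf (hadamard_image L)
       (pmf_of_set {s \<in> admissible n L Y. row_space (msum L s) = w1 \<and> col_space (msum L s) = w2}))))"

definition SP :: "nat \<Rightarrow> nat \<Rightarrow> nat measured_poset \<Rightarrow> (nat \<times> nat) measured_poset" where
  "SP n L X =
     ({u. fvs.subspace u \<and> (\<exists>s\<in>admissible n L (fst X). u \<subseteq> hadamard_image L s)}, SP_dist n L X)"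

end

theory Submission
  imports Defs
begin

text \<open>
  Fix a basis \<open>b\<close> of a face \<open>w\<close> of dimension \<open>i\<close>. Writing \<open>s u = x u \<otimes> y u\<close> with independent families
  \<open>x, y\<close>, a random edge of the link of \<open>w\<close> is the pair of images of the unit vectors \<open>e\<^sub>i\<close>, \<open>e\<^sub>i\<^sub>+\<^sub>1\<close> under
  the encoding of a random \<open>(x, y)\<close> conditioned on \<open>e\<^sub>t\<close> being sent to \<open>b t\<close> for \<open>t < i\<close>. To bound how much the
  second endpoint tells about a mean-zero function \<open>f\<close> of the first one, reveal more than the endpoint,
  namely all \<open>x u, y u\<close> with \<open>u\<^sub>i\<^sub>+\<^sub>1 = 1\<close>, one vector at a time. The unrevealed indices \<open>v\<close> that agree with
  \<open>u\<close> in the first \<open>i + 1\<close> coordinates allow the transvections \<open>x u \<mapsto> x u + x v\<close>, \<open>y v \<mapsto> y v + y u\<close>, which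
  change neither the conditioning nor \<open>f\<close>. Averaging over them makes the revealed vector nearly uniform,
  so each step costs either \<open>2\<close> to the minus the number of such \<open>v\<close>, or the expansion of a link of low dimension
  in \<open>Y\<close>; by trickling down the latter decays geometrically in the codimension. With \<open>q = 2\<^bsup>L-i-2\<^esup> \<ge> \<surd>d\<close>
  the total is exponentially small in \<open>q\<close>.
\<close>

section \<open>Subset sums over the two-element field\<close>

text \<open>The obstacle is that conditioning on the face \<open>w\<close> ties the vectors
  together, so the unrevealed part has no product form. What helps is that prescribing the first
  \<open>i\<close> encodings fixes the sum of the tensors over every nonzero block
  (\<open>Omb_blkdet\<close>). Such a sum determines the span of the unrevealed \<open>x u\<close>
  of the block, or a coset of it once \<open>y u\<close> is known. A function with conditional mean
  zero therefore has no positive correlation between its values at \<open>x u\<close> and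
  \<open>x u + x v\<close>, whatever \<open>Y\<close> is. In the zero block the sum is free; there
  the vectors form a random independent family, two of them are an edge of a link of
  \<open>Y\<close>, and the expansion of \<open>Y\<close> enters. The costs add up because squared
  norms of conditional expectations grow by martingale differences. All measures stay unnormalised
  and are handled through the containment weight of a subspace; normalising constants depend on
  dimensions only and cancel. The trickling-down bound \<open>lam / (2 * (1 - lam))\<close> decays
  because a vector and its translate by the link's base point are the same point of the quotient;
  without this averaging the factor 1 / 2 would be missing.\<close>

lemma vadd_self [simp]: "(v :: 'i \<Rightarrow> bit) + v = 0"
proof
  fix i
  show "(v + v) i = 0 i" by (cases "v i") auto
qed

lemma vadd_self_left [simp]: "(v :: 'i \<Rightarrow> bit) + (v + w) = w"
  by (simp add: add.assoc[symmetric])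

lemma vadd_eq_iff: "(a :: 'i \<Rightarrow> bit) + b = c \<longleftrightarrow> a = c + b"
  by (auto simp: add.assoc)

lemma vadd_eq_0_iff: "(a :: 'i \<Rightarrow> bit) + b = 0 \<longleftrightarrow> a = b"
  using vadd_eq_iff[of a b 0] by simp

lemma sum_fun_app: "(sum f A) i = (\<Sum>a\<in>A. f a i)"
  by (induction A rule: infinite_finite_induct) auto

lemma subspace_bit_iff:
  "fvs.subspace (S :: ('i \<Rightarrow> bit) set) \<longleftrightarrow> 0 \<in> S \<and> (\<forall>a\<in>S. \<forall>b\<in>S. a + b \<in> S)"
proof -
  have sc: "fscale c x = (if c = 0 then 0 else x)" for c and x :: "'i \<Rightarrow> bit"
    by (auto simp: fscale_def fun_eq_iff)
  show ?thesis by (auto simp: fvs.subspace_def sc)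
qed

lemma subspace_add_iff:
  assumes "fvs.subspace (S :: ('i \<Rightarrow> bit) set)" "b \<in> S"
  shows "a + b \<in> S \<longleftrightarrow> a \<in> S"
proof
  assume "a + b \<in> S"
  then have "(a + b) + b \<in> S" using assms(1,2) unfolding subspace_bit_iff by blast
  then show "a \<in> S" by (simp add: add.assoc)
qed (use assms in \<open>auto simp: subspace_bit_iff\<close>)

lemma subspace_sum_mem:
  assumes "fvs.subspace (S :: ('i \<Rightarrow> bit) set)" "\<And>c. c \<in> C \<Longrightarrow> z c \<in> S"
  shows "sum z C \<in> S"
  using fvs.subspace_sum[OF assms(1)] assms(2) by blast

definition Z0 :: "('i \<Rightarrow> bit) set" where "Z0 = {0}"

lemma subspace_Z0 [simp]: "fvs.subspace Z0"
  by (simp add: Z0_def subspace_bit_iff)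

lemma Z0_simps [simp]: "finite Z0" "card Z0 = 1" "v \<in> Z0 \<longleftrightarrow> v = 0" "fvs.span Z0 = Z0" "fvs.span (Z0 \<union> A) = fvs.span A"
  by (auto simp: Z0_def)

lemma subspace_F2: "fvs.subspace (F2 I)"
  by (auto simp: subspace_bit_iff F2_def)

lemma sum_sym_diff:
  fixes z :: "'k \<Rightarrow> 'i \<Rightarrow> bit"
  assumes "finite C" "finite D"
  shows "sum z C + sum z D = sum z (sym_diff C D)"
proof -
  have C: "sum z C = sum z (C - D) + sum z (C \<inter> D)"
    using sum.Int_Diff[OF assms(1), of z D] by (simp add: add.commute)
  have D: "sum z D = sum z (D - C) + sum z (C \<inter> D)"
    using sum.Int_Diff[OF assms(2), of z C] by (simp add: add.commute inf_commute)
  have "sum z (sym_diff C D) = sum z (C - D) + sum z (D - C)"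
    using assms by (intro sum.union_disjoint) auto
  then show ?thesis by (simp add: C D ac_simps)
qed

text \<open>Over the two-element field a linear combination is a subset sum, so this is a span
  (\<open>ssp_eq_span\<close>). It is taken of an indexed family and not of a set, because the
  indices carry the structure of the construction.\<close>

definition ssp :: "('i \<Rightarrow> bit) set \<Rightarrow> ('k \<Rightarrow> 'i \<Rightarrow> bit) \<Rightarrow> 'k set \<Rightarrow> ('i \<Rightarrow> bit) set" where
  "ssp S z K = {s + sum z C | s C. s \<in> S \<and> C \<subseteq> K}"

text \<open>Linear independence of the family \<open>z\<close> in the quotient by \<open>S\<close>.
  As a condition on families it also rules out repeated vectors.\<close>

definition indm :: "('i \<Rightarrow> bit) set \<Rightarrow> ('k \<Rightarrow> 'i \<Rightarrow> bit) \<Rightarrow> 'k set \<Rightarrow> bool" where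
  "indm S z K \<longleftrightarrow> (\<forall>C\<subseteq>K. C \<noteq> {} \<longrightarrow> sum z C \<notin> S)"

lemma ssp_empty [simp]: "ssp S z {} = S"
  by (auto simp: ssp_def)

lemma indm_empty [simp]: "indm S z {}"
  by (auto simp: indm_def)

lemma ssp_image: "ssp S z K = (\<lambda>(s, C). s + sum z C) ` (S \<times> Pow K)"
  by (auto simp: ssp_def)

lemma ssp_cong: "(\<And>k. k \<in> K \<Longrightarrow> z k = z' k) \<Longrightarrow> ssp S z K = ssp S z' K"
proof -
  assume a: "\<And>k. k \<in> K \<Longrightarrow> z k = z' k"
  have "sum z C = sum z' C" if "C \<subseteq> K" for C using that a by (intro sum.cong) auto
  then show ?thesis unfolding ssp_image by (intro image_cong) auto
qed

lemma indm_cong: "(\<And>k. k \<in> K \<Longrightarrow> z k = z' k) \<Longrightarrow> indm S z K \<longleftrightarrow> indm S z' K"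
proof -
  assume a: "\<And>k. k \<in> K \<Longrightarrow> z k = z' k"
  have "sum z C = sum z' C" if "C \<subseteq> K" for C using that a by (intro sum.cong) auto
  then show ?thesis unfolding indm_def by auto
qed

lemma ssp_eq_span:
  assumes "fvs.subspace S" "finite K"
  shows "ssp S z K = fvs.span (S \<union> z ` K)"
proof
  show "ssp S z K \<subseteq> fvs.span (S \<union> z ` K)"
    by (auto simp: ssp_def intro!: fvs.span_add fvs.span_sum intro: fvs.span_base)
  have "fvs.subspace (ssp S z K)"
    unfolding subspace_bit_iff
  proof (intro conjI ballI)
    show "0 \<in> ssp S z K" unfolding ssp_def
      using assms(1) by (auto intro!: exI[of _ "0::'a \<Rightarrow> bit"] exI[of _ "{}"] simp: subspace_bit_iff)
    fix a b assume "a \<in> ssp S z K" "b \<in> ssp S z K"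
    then obtain s C t D where *: "a = s + sum z C" "s \<in> S" "C \<subseteq> K" "b = t + sum z D" "t \<in> S" "D \<subseteq> K"
      by (auto simp: ssp_def)
    have "a + b = (s + t) + (sum z C + sum z D)" using * by (simp add: ac_simps)
    also have "sum z C + sum z D = sum z (sym_diff C D)"
      using * assms(2) finite_subset by (intro sum_sym_diff) auto
    finally show "a + b \<in> ssp S z K"
      using * assms(1) unfolding ssp_def subspace_bit_iff by blast
  qed
  moreover have "S \<union> z ` K \<subseteq> ssp S z K"
  proof
    fix v assume "v \<in> S \<union> z ` K"
    then consider "v \<in> S" | k where "k \<in> K" "v = z k" by auto
    then show "v \<in> ssp S z K"
    proof cases
      case 1 then show ?thesis unfolding ssp_def by (auto intro!: exI[of _ v] exI[of _ "{}"])
    next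
      case 2 then show ?thesis unfolding ssp_def using assms(1)
        by (auto intro!: exI[of _ "0::'a \<Rightarrow> bit"] exI[of _ "{k}"] simp: subspace_bit_iff)
    qed
  qed
  ultimately show "fvs.span (S \<union> z ` K) \<subseteq> ssp S z K" by (intro fvs.span_minimal)
qed

lemma subspace_ssp: "fvs.subspace S \<Longrightarrow> finite K \<Longrightarrow> fvs.subspace (ssp S z K)"
  by (simp add: ssp_eq_span)

lemma ssp_mono: "K \<subseteq> K' \<Longrightarrow> ssp S z K \<subseteq> ssp S z K'"
  by (auto simp: ssp_def)

lemma ssp_base: "fvs.subspace S \<Longrightarrow> S \<subseteq> ssp S z K"
  unfolding ssp_def by (auto intro!: exI[of _ "{}"])

lemma ssp_gen: "fvs.subspace S \<Longrightarrow> finite K \<Longrightarrow> k \<in> K \<Longrightarrow> z k \<in> ssp S z K"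
  by (simp add: ssp_eq_span fvs.span_base)

lemma ssp_sum: "fvs.subspace S \<Longrightarrow> C \<subseteq> K \<Longrightarrow> sum z C \<in> ssp S z K"
  unfolding ssp_def mem_Collect_eq
  by (rule exI[of _ 0], rule exI[of _ C]) (simp add: subspace_bit_iff)

lemma ssp_subset:
  assumes "fvs.subspace W" "S \<subseteq> W" "\<And>k. k \<in> K \<Longrightarrow> z k \<in> W"
  shows "ssp S z K \<subseteq> W"
proof
  fix v assume "v \<in> ssp S z K"
  then obtain s C where v: "v = s + sum z C" "s \<in> S" "C \<subseteq> K" by (auto simp: ssp_def)
  have "sum z C \<in> W" using v assms by (intro subspace_sum_mem) auto
  then show "v \<in> W" using assms v by (auto simp: subspace_bit_iff)
qed

lemma ssp_union:
  assumes "fvs.subspace S" "finite K" "finite K'"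
  shows "ssp S z (K \<union> K') = ssp (ssp S z K) z K'"
proof -
  have "fvs.span (S \<union> z ` K \<union> z ` K') = fvs.span (fvs.span (S \<union> z ` K) \<union> z ` K')"
  proof
    show "fvs.span (S \<union> z ` K \<union> z ` K') \<subseteq> fvs.span (fvs.span (S \<union> z ` K) \<union> z ` K')"
      by (intro fvs.span_mono) (auto intro: fvs.span_base)
    show "fvs.span (fvs.span (S \<union> z ` K) \<union> z ` K') \<subseteq> fvs.span (S \<union> z ` K \<union> z ` K')"
      by (intro fvs.span_minimal) (auto intro: fvs.span_base fvs.span_mono[THEN subsetD, rotated])
  qed
  then show ?thesis
    using assms by (simp add: ssp_eq_span subspace_ssp image_Un Un_assoc)
qed

lemma ssp_insert:
  assumes "fvs.subspace S" "finite K"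
  shows "ssp S z (insert k K) = ssp (ssp S z K) z {k}"
  using ssp_union[OF assms, of "{k}" z] by simp

lemma ssp_single: "ssp S z {k} = S \<union> (\<lambda>s. s + z k) ` S"
proof -
  have *: "C \<subseteq> {k} \<longleftrightarrow> C = {} \<or> C = {k}" for C by auto
  have "ssp S z {k} = {s + sum z {} | s. s \<in> S} \<union> {s + sum z {k} | s. s \<in> S}"
    unfolding ssp_def * by blast
  then show ?thesis by auto
qed

text \<open>A relation that involves \<open>K'\<close> becomes a relation modulo the span over
  \<open>K\<close> once the part of the sum outside \<open>K'\<close> is moved to the other
  side.\<close>

lemma indm_union:
  assumes "fvs.subspace S" "finite K" "finite K'" "K \<inter> K' = {}"
  shows "indm S z (K \<union> K') \<longleftrightarrow> indm S z K \<and> indm (ssp S z K) z K'"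
proof
  assume i: "indm S z (K \<union> K')"
  have "indm S z K" using i by (auto simp: indm_def)
  moreover have "indm (ssp S z K) z K'"
    unfolding indm_def
  proof (intro allI impI notI)
    fix C assume C: "C \<subseteq> K'" "C \<noteq> {}" "sum z C \<in> ssp S z K"
    then obtain s D where D: "sum z C = s + sum z D" "s \<in> S" "D \<subseteq> K" by (auto simp: ssp_def)
    have "finite C" "finite D" "C \<inter> D = {}" using C D assms finite_subset by blast+
    then have "sum z (C \<union> D) = sum z C + sum z D" by (intro sum.union_disjoint) auto
    also have "\<dots> = s" by (simp add: D(1) add.assoc)
    finally have "sum z (C \<union> D) \<in> S" using D by simp
    moreover have "C \<union> D \<subseteq> K \<union> K'" "C \<union> D \<noteq> {}" using C D by auto
    ultimately show False using i by (auto simp: indm_def)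
  qed
  ultimately show "indm S z K \<and> indm (ssp S z K) z K'" ..
next
  assume i: "indm S z K \<and> indm (ssp S z K) z K'"
  show "indm S z (K \<union> K')"
    unfolding indm_def
  proof (intro allI impI notI)
    fix C assume C: "C \<subseteq> K \<union> K'" "C \<noteq> {}" "sum z C \<in> S"
    show False
    proof (cases "C \<inter> K' = {}")
      case True
      then have "C \<subseteq> K" using C(1) by auto
      then show False using C i by (auto simp: indm_def)
    next
      case False
      have fC: "finite C" using C assms finite_subset by blast
      have "sum z C = sum z (C \<inter> K') + sum z (C - K')" using sum.Int_Diff[OF fC, of z K'] .
      then have "sum z (C \<inter> K') = sum z C + sum z (C - K')" by (simp add: add.assoc)
      moreover have "C - K' \<subseteq> K" using C by auto
      ultimately have "sum z (C \<inter> K') \<in> ssp S z K" using C(3) unfolding ssp_def by blast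
      then show False using i False by (auto simp: indm_def)
    qed
  qed
qed

lemma indm_single: "indm S z {k} \<longleftrightarrow> z k \<notin> S"
proof -
  have "C \<subseteq> {k} \<longleftrightarrow> C = {} \<or> C = {k}" for C by auto
  then show ?thesis unfolding indm_def by auto
qed

lemma indm_insert:
  assumes "fvs.subspace S" "finite K" "k \<notin> K"
  shows "indm S z (insert k K) \<longleftrightarrow> indm S z K \<and> z k \<notin> ssp S z K"
  using indm_union[of S K "{k}" z] assms by (simp add: indm_single)

lemma indm_mono: "indm S z K \<Longrightarrow> K' \<subseteq> K \<Longrightarrow> indm S z K'"
  by (auto simp: indm_def)

lemma card_ssp_single:
  assumes "fvs.subspace S" "finite S" "z k \<notin> S"
  shows "card (ssp S z {k}) = 2 * card S"
proof -
  have "S \<inter> (\<lambda>s. s + z k) ` S = {}"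
    using assms by (auto simp: add.commute[of _ "z k"] subspace_add_iff)
  moreover have "card ((\<lambda>s. s + z k) ` S) = card S" by (intro card_image) (auto simp: inj_on_def)
  ultimately show ?thesis using assms by (simp add: ssp_single card_Un_disjoint)
qed

lemma finite_ssp: "finite S \<Longrightarrow> finite K \<Longrightarrow> finite (ssp S z K)"
proof -
  assume "finite S" "finite K"
  then have "finite ((\<lambda>(s, C). s + sum z C) ` (S \<times> Pow K))" by auto
  moreover have "ssp S z K \<subseteq> (\<lambda>(s, C). s + sum z C) ` (S \<times> Pow K)" by (auto simp: ssp_def)
  ultimately show ?thesis by (rule finite_subset[rotated])
qed

lemma card_ssp:
  assumes "finite K" "fvs.subspace S" "finite S" "indm S z K"
  shows "card (ssp S z K) = card S * 2 ^ card K"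
  using assms(1,4)
proof (induction K)
  case (insert k K)
  then have "z k \<notin> ssp S z K" "indm S z K" using assms by (auto simp: indm_insert)
  then show ?case using insert assms
    by (subst ssp_insert) (auto simp: card_ssp_single subspace_ssp finite_ssp)
qed simp

text \<open>Two subset sums add up to the sum over the symmetric difference, so independence makes
  subset sums pairwise distinct modulo \<open>S\<close>.\<close>

lemma indm_inj: 
  assumes "finite K" "fvs.subspace S" "indm S z K" "C \<subseteq> K" "D \<subseteq> K" "sum z C + sum z D \<in> S"
  shows "C = D"
proof (rule ccontr)
  assume "C \<noteq> D"
  then have "sym_diff C D \<noteq> {}" "sym_diff C D \<subseteq> K" using assms by auto
  moreover have "sum z C + sum z D = sum z (sym_diff C D)"
    using assms finite_subset by (intro sum_sym_diff) auto
  ultimately show False using assms by (auto simp: indm_def)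
qed

lemma indm_imp_independent:
  assumes "finite K" "indm Z0 z K"
  shows "fvs.independent (z ` K) \<and> card (z ` K) = card K"
  using assms
proof (induction K)
  case empty
  then show ?case by (simp add: fvs.independent_empty)
next
  case (insert k K)
  then have *: "z k \<notin> ssp Z0 z K" "indm Z0 z K" by (auto simp: indm_insert subspace_Z0)
  then have "z k \<notin> fvs.span (z ` K)" using insert by (simp add: ssp_eq_span subspace_Z0)
  moreover have "z k \<notin> z ` K" using calculation fvs.span_base by blast
  ultimately show ?case using insert * by (auto simp: fvs.independent_insertI)
qed

lemma dim_ssp_0:
  assumes "finite K" "indm Z0 z K"
  shows "fvs.dim (ssp Z0 z K) = card K"
  using assms indm_imp_independent[OF assms] 
  by (simp add: ssp_eq_span subspace_Z0 fvs.dim_span_eq_card_independent fvs.dim_eq_card_independent)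

text \<open>Links the dimension of the library to subset sums: a largest independent subset of
  \<open>W\<close>, indexed by itself through \<open>id\<close>, has to span, since any vector
  outside its span could be added.\<close>

lemma exists_basis_family:
  assumes "fvs.subspace (W :: ('i \<Rightarrow> bit) set)" "finite W"
  shows "\<exists>B. B \<subseteq> W \<and> finite B \<and> indm Z0 id B \<and> ssp Z0 id B = W \<and> card B = fvs.dim W"
proof -
  define A where "A = {B. B \<subseteq> W \<and> indm Z0 id B}"
  have "finite A" using assms unfolding A_def by auto
  moreover have "{} \<in> A" by (simp add: A_def)
  ultimately have "Max (card ` A) \<in> card ` A" by (intro Max_in) auto
  then obtain B where "B \<in> A" "card B = Max (card ` A)" by auto
  then have B: "B \<in> A" "\<And>B'. B' \<in> A \<Longrightarrow> card B' \<le> card B"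
    using Max_ge[of "card ` A"] \<open>finite A\<close> by auto
  have fB: "finite B" using B(1) assms finite_subset by (auto simp: A_def)
  have sub: "ssp Z0 id B \<subseteq> W" using B(1) assms by (intro ssp_subset) (auto simp: A_def subspace_bit_iff)
  have "ssp Z0 id B = W"
  proof (rule ccontr)
    assume "ssp Z0 id B \<noteq> W"
    then obtain v where v: "v \<in> W" "v \<notin> ssp Z0 id B" using sub by auto
    then have "v \<notin> B" using ssp_gen[OF subspace_Z0 fB, of v id] by auto
    then have "insert v B \<in> A" using v B(1) fB by (auto simp: A_def indm_insert subspace_Z0)
    then show False using B(2) \<open>v \<notin> B\<close> fB by fastforce
  qed
  then show ?thesis using B(1) fB dim_ssp_0[OF fB, of id] by (auto simp: A_def)
qed

lemma card_subspace:
  assumes "fvs.subspace (W :: ('i \<Rightarrow> bit) set)" "finite W"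
  shows "card W = 2 ^ fvs.dim W"
proof -
  obtain B where "finite B" "indm Z0 id B" "ssp Z0 id B = W" "card B = fvs.dim W"
    using exists_basis_family[OF assms] by auto
  then show ?thesis using card_ssp[of B "Z0" id] by (simp add: subspace_Z0)
qed

lemma dim_ssp:
  assumes "finite K" "fvs.subspace S" "finite S" "indm S z K"
  shows "fvs.dim (ssp S z K) = fvs.dim S + card K"
proof -
  have "2 ^ fvs.dim (ssp S z K) = (2::nat) ^ (fvs.dim S + card K)"
    using card_subspace[OF subspace_ssp[OF assms(2,1)] finite_ssp[OF assms(3,1)], of z] card_ssp[OF assms]
      card_subspace[OF assms(2,3)] by (simp add: power_add)
  then show ?thesis by simp
qed

lemma subspace_eq_of_dim:
  assumes "fvs.subspace U" "fvs.subspace (W :: ('i \<Rightarrow> bit) set)" "finite W" "U \<subseteq> W" "fvs.dim W \<le> fvs.dim U"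
  shows "U = W"
proof -
  have "finite U" using assms finite_subset by auto
  then have "card W \<le> card U" using assms by (simp add: card_subspace)
  then show ?thesis using assms by (simp add: card_seteq)
qed

lemma dim_mono_subspace:
  assumes "fvs.subspace U" "fvs.subspace (W :: ('i \<Rightarrow> bit) set)" "finite W" "U \<subseteq> W"
  shows "fvs.dim U \<le> fvs.dim W"
proof -
  have "card U \<le> card W" "finite U" using assms by (auto intro: card_mono finite_subset)
  then show ?thesis using assms by (simp add: card_subspace)
qed

lemma finite_F2: "finite I \<Longrightarrow> finite (F2 I)"
proof -
  assume f: "finite I"
  have "finite (PiE I (\<lambda>_. UNIV :: bit set))"
  proof (intro finite_PiE f)
    have "(UNIV :: bit set) = {0, 1}" by (auto intro: bit.exhaust)
    then show "finite (UNIV :: bit set)" by (metis finite.emptyI finite.insertI)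
  qed
  moreover have "F2 I \<subseteq> (\<lambda>f i. if i \<in> I then f i else 0) ` (PiE I (\<lambda>_. UNIV))"
  proof
    fix x assume "x \<in> F2 I"
    then have "x = (\<lambda>i. if i \<in> I then restrict x I i else 0)" by (auto simp: F2_def)
    then show "x \<in> (\<lambda>f i. if i \<in> I then f i else 0) ` (PiE I (\<lambda>_. UNIV))"
      by (intro image_eqI[of _ _ "restrict x I"]) auto
  qed
  ultimately show ?thesis by (meson finite_surj)
qed

lemma card_F2: "finite I \<Longrightarrow> card (F2 I) = 2 ^ card I"
proof -
  assume f: "finite I"
  have "bij_betw (\<lambda>C i. if i \<in> C then 1 else 0) (Pow I) (F2 I)"
  proof (rule bij_betwI[where g = "\<lambda>x. {i. x i = 1}"])
    show "(\<lambda>C i. if i \<in> C then 1 else 0) \<in> Pow I \<rightarrow> F2 I" by (auto simp: F2_def)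
    show "(\<lambda>x. {i. x i = 1}) \<in> F2 I \<rightarrow> Pow I"
    proof
      fix x assume "x \<in> F2 I"
      then have "x i = 0" if "i \<notin> I" for i using that by (auto simp: F2_def)
      then have "x i \<noteq> 1" if "i \<notin> I" for i using that by auto
      then show "{i. x i = 1} \<in> Pow I" by blast
    qed
  qed (auto simp: fun_eq_iff)
  then have "card (F2 I) = card (Pow I)" by (metis bij_betw_same_card)
  then show ?thesis by (simp add: card_Pow f)
qed

text \<open>One further vector adds a single coset. This explicit form of the span makes membership
  a case distinction (\<open>mem_sp1\<close>) and the cardinality a doubling
  (\<open>card_sp1\<close>).\<close>

definition sp1 :: "('i \<Rightarrow> bit) set \<Rightarrow> ('i \<Rightarrow> bit) \<Rightarrow> ('i \<Rightarrow> bit) set" where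
  "sp1 S v = S \<union> (\<lambda>s. s + v) ` S"

lemma ssp_single_sp1: "ssp S z {k} = sp1 S (z k)"
  by (simp add: ssp_single sp1_def)

lemma ssp_insert_sp1:
  assumes "fvs.subspace S" "finite K"
  shows "ssp S z (insert k K) = sp1 (ssp S z K) (z k)"
  using ssp_insert[OF assms] by (simp add: ssp_single_sp1)

lemma sp1_eq_span: "fvs.subspace S \<Longrightarrow> sp1 S v = fvs.span (insert v S)"
  using ssp_single_sp1[of S "\<lambda>_. v" "()"] ssp_eq_span[of S "{()}" "\<lambda>_. v"] by simp

lemma subspace_sp1: "fvs.subspace S \<Longrightarrow> fvs.subspace (sp1 S v)"
  by (simp add: sp1_eq_span)

lemma sp1_subset: "fvs.subspace W \<Longrightarrow> S \<subseteq> W \<Longrightarrow> v \<in> W \<Longrightarrow> sp1 S v \<subseteq> W"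
  by (auto simp: sp1_def subspace_bit_iff)

lemma sp1_subset_iff: "fvs.subspace W \<Longrightarrow> fvs.subspace S \<Longrightarrow> sp1 S v \<subseteq> W \<longleftrightarrow> S \<subseteq> W \<and> v \<in> W"
proof -
  assume a: "fvs.subspace W" "fvs.subspace S"
  have "v \<in> sp1 S v" unfolding sp1_eq_span[OF a(2)] by (simp add: fvs.span_base)
  moreover have "S \<subseteq> sp1 S v" by (auto simp: sp1_def)
  ultimately show ?thesis using sp1_subset[OF a(1), of S v] by blast
qed

lemma card_sp1: "fvs.subspace S \<Longrightarrow> finite S \<Longrightarrow> v \<notin> S \<Longrightarrow> card (sp1 S v) = 2 * card S"
  using card_ssp_single[of S "\<lambda>_. v" "()"] by (simp add: ssp_single_sp1)

lemma finite_sp1: "finite S \<Longrightarrow> finite (sp1 S v)"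
  by (simp add: sp1_def)

lemma dim_sp1: "fvs.subspace S \<Longrightarrow> finite S \<Longrightarrow> v \<notin> S \<Longrightarrow> fvs.dim (sp1 S v) = fvs.dim S + 1"
  using dim_ssp[of "{()}" S "\<lambda>_. v"] by (simp add: ssp_single_sp1 indm_single)

lemma sp1_commute:
  assumes "fvs.subspace S" shows "sp1 (sp1 S a) b = sp1 (sp1 S b) a"
proof -
  have *: "sp1 (sp1 S a) b = fvs.span (insert b (insert a S))" for a b
  proof -
    have "fvs.span (insert b (fvs.span (insert a S))) = fvs.span (insert b (insert a S))"
    proof
      show "fvs.span (insert b (fvs.span (insert a S))) \<subseteq> fvs.span (insert b (insert a S))"
        by (intro fvs.span_minimal)
          (auto intro: fvs.span_base fvs.span_mono[THEN subsetD, rotated])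
      show "fvs.span (insert b (insert a S)) \<subseteq> fvs.span (insert b (fvs.span (insert a S)))"
        by (intro fvs.span_mono) (auto intro: fvs.span_base)
    qed
    then show ?thesis using assms by (simp add: sp1_eq_span)
  qed
  show ?thesis by (simp add: * insert_commute)
qed

lemma sp1_shift:
  assumes "fvs.subspace S" "s \<in> S" shows "sp1 S (v + s) = sp1 S v"
proof -
  have *: "(\<lambda>t. t + (v + s)) ` S = (\<lambda>t. t + v) ` ((\<lambda>t. t + s) ` S)"
    by (simp add: image_image ac_simps)
  have "(\<lambda>t. t + s) ` S = S"
  proof
    show "(\<lambda>t. t + s) ` S \<subseteq> S" using assms by (auto simp: subspace_bit_iff)
    show "S \<subseteq> (\<lambda>t. t + s) ` S"
    proof
      fix t assume "t \<in> S"
      then have "t + s \<in> S" using assms by (auto simp: subspace_bit_iff)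
      then show "t \<in> (\<lambda>t. t + s) ` S" by (intro image_eqI[of _ _ "t + s"]) (simp add: add.assoc, simp)
    qed
  qed
  then show ?thesis unfolding sp1_def * by simp
qed

lemma mem_sp1: "v \<in> sp1 S w \<longleftrightarrow> v \<in> S \<or> v + w \<in> S"
proof -
  have "v \<in> (\<lambda>s. s + w) ` S \<longleftrightarrow> v + w \<in> S"
  proof
    assume "v + w \<in> S"
    then show "v \<in> (\<lambda>s. s + w) ` S" by (intro image_eqI[of _ _ "v + w"]) (simp add: add.assoc, simp)
  qed (auto simp: add.assoc)
  then show ?thesis by (auto simp: sp1_def)
qed

section \<open>Harmonic weights on subspaces\<close>

text \<open>Extensionality outside \<open>K\<close> makes each family a single element, so that
  these sets are finite and can be summed over. Inside a finite space, with \<open>S = Z0\<close>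
  and \<open>K\<close> as large as the dimension, they are the ordered bases.\<close>

definition Ind :: "('i \<Rightarrow> bit) set \<Rightarrow> ('i \<Rightarrow> bit) set \<Rightarrow> 'k set \<Rightarrow> ('k \<Rightarrow> 'i \<Rightarrow> bit) set" where
  "Ind V S K = {z \<in> PiE K (\<lambda>_. V). indm S z K}"

text \<open>Abstracts the map from \<open>S\<close> to the probability that a random
  \<open>d\<close>-dimensional space \<open>W\<close> contains \<open>S\<close>: given
  \<open>S \<subseteq> W\<close>, exactly \<open>2 ^ d - card S\<close> further vectors lie in
  \<open>W\<close>. The spectral arguments use weights through this averaging identity; the constant
  weight 1 is another instance and does the counting.\<close>

definition harm :: "('i \<Rightarrow> bit) set \<Rightarrow> nat \<Rightarrow> (('i \<Rightarrow> bit) set \<Rightarrow> real) \<Rightarrow> bool" where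
  "harm V d n \<longleftrightarrow> finite V \<and> fvs.subspace V \<and>
     (\<forall>S. fvs.subspace S \<longrightarrow> S \<subseteq> V \<longrightarrow> n S \<ge> 0 \<and>
       (\<Sum>\<xi>\<in>V - S. n (sp1 S \<xi>)) = (2 ^ d - real (card S)) * n S)"

text \<open>The number of ways to extend a \<open>j\<close>-dimensional subspace of a
  \<open>d\<close>-dimensional space by \<open>k\<close> successive independent vectors.\<close>

definition extc :: "nat \<Rightarrow> nat \<Rightarrow> nat \<Rightarrow> real" where
  "extc d j k = (\<Prod>t<k. 2 ^ d - 2 ^ (j + t))"

lemma extc_pos: "j + k \<le> d \<Longrightarrow> extc d j k > 0"
  unfolding extc_def
proof (intro prod_pos)
  fix t assume "j + k \<le> d" "t \<in> {..<k}"
  then have "(2::real) ^ (j + t) < 2 ^ d" by (intro power_strict_increasing) auto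
  then show "(2::real) ^ d - 2 ^ (j + t) > 0" by simp
qed

lemma finite_Ind: "finite V \<Longrightarrow> finite K \<Longrightarrow> finite (Ind V S K)"
  unfolding Ind_def by (rule finite_subset[of _ "PiE K (\<lambda>_. V)"]) (auto intro: finite_PiE)

lemma Ind_mem: "z \<in> Ind V S K \<Longrightarrow> k \<in> K \<Longrightarrow> z k \<in> V"
  by (auto simp: Ind_def)

lemma sum_Ind_insert:
  assumes "fvs.subspace S" "finite K" "k \<notin> K" "finite V"
  shows "(\<Sum>z\<in>Ind V S (insert k K). (F z :: real)) =
    (\<Sum>z\<in>Ind V S K. \<Sum>\<xi>\<in>V - ssp S z K. F (z(k := \<xi>)))"
proof -
  have bij: "bij_betw (\<lambda>(z,\<xi>). z(k := \<xi>)) (Sigma (Ind V S K) (\<lambda>z. V - ssp S z K)) (Ind V S (insert k K))"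
  proof (rule bij_betwI[where g = "\<lambda>z. (restrict z K, z k)"])
    show "(\<lambda>(z,\<xi>). z(k := \<xi>)) \<in> (Sigma (Ind V S K) (\<lambda>z. V - ssp S z K)) \<rightarrow> (Ind V S (insert k K))"
    proof (clarify)
      fix z \<xi> assume z: "z \<in> Ind V S K" "\<xi> \<in> V" "\<xi> \<notin> ssp S z K"
      have "indm S (z(k := \<xi>)) K = indm S z K" "ssp S (z(k := \<xi>)) K = ssp S z K"
        using assms by (auto intro!: indm_cong ssp_cong)
      then show "z(k := \<xi>) \<in> Ind V S (insert k K)"
        using z assms by (auto simp: Ind_def indm_insert PiE_iff extensional_def)
    qed
    show "(\<lambda>z. (restrict z K, z k)) \<in> Ind V S (insert k K) \<rightarrow> Sigma (Ind V S K) (\<lambda>z. V - ssp S z K)"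
    proof
      fix z assume z: "z \<in> Ind V S (insert k K)"
      have "indm S (restrict z K) K = indm S z K" "ssp S (restrict z K) K = ssp S z K"
        by (auto intro!: indm_cong ssp_cong)
      then show "(restrict z K, z k) \<in> Sigma (Ind V S K) (\<lambda>z. V - ssp S z K)"
        using z assms by (auto simp: Ind_def indm_insert)
    qed
    show "(restrict ((case p of (z,\<xi>) \<Rightarrow> z(k := \<xi>))) K, (case p of (z,\<xi>) \<Rightarrow> z(k := \<xi>)) k) = p"
      if p: "p \<in> Sigma (Ind V S K) (\<lambda>z. V - ssp S z K)" for p
    proof -
      obtain z \<xi> where pz: "p = (z, \<xi>)" by (cases p)
      have "restrict (z(k := \<xi>)) K = z"
        using p assms by (auto simp: Ind_def PiE_iff extensional_def fun_eq_iff pz)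
      then show ?thesis by (simp add: pz)
    qed
    show "(case (restrict z K, z k) of (z,\<xi>) \<Rightarrow> z(k := \<xi>)) = z" if "z \<in> Ind V S (insert k K)" for z
      using that by (auto simp: Ind_def PiE_iff extensional_def fun_eq_iff)
  qed
  show ?thesis
    using sum.reindex_bij_betw[OF bij, of F] assms by (subst sum.Sigma) (auto simp: finite_Ind split_def)
qed

text \<open>The vectors at \<open>K2\<close> are summed out one at a time; the averaging identity
  turns each of them into a factor that depends only on the dimension reached. So the family on
  \<open>K1\<close> again carries a weight of the same form.\<close>

lemma harm_marginal:
  assumes h: "harm V d n" and S: "fvs.subspace S" "S \<subseteq> V" "card S = 2 ^ j"
    and K1: "finite K1" and K2: "finite K2" "K1 \<inter> K2 = {}"
  shows "(\<Sum>z\<in>Ind V S (K1 \<union> K2). n (ssp S z (K1 \<union> K2)) * F (restrict z K1)) =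
     extc d (j + card K1) (card K2) * (\<Sum>z\<in>Ind V S K1. n (ssp S z K1) * F z)"
  using K2
proof (induction K2)
  case empty
  have "restrict z K1 = z" if "z \<in> Ind V S K1" for z
    using that by (auto simp: Ind_def PiE_restrict)
  then show ?case by (simp add: extc_def)
next
  case (insert k K2)
  define K where "K = K1 \<union> K2"
  have fV: "finite V" and V: "fvs.subspace V" using h by (auto simp: harm_def)
  have fS: "finite S" using fV S finite_subset by auto
  have fK: "finite K" "k \<notin> K" using insert K1 by (auto simp: K_def)
  have "(\<Sum>z\<in>Ind V S (K1 \<union> insert k K2). n (ssp S z (K1 \<union> insert k K2)) * F (restrict z K1))
      = (\<Sum>z\<in>Ind V S (insert k K). n (ssp S z (insert k K)) * F (restrict z K1))"
    by (simp add: K_def)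
  also have "\<dots> = (\<Sum>z\<in>Ind V S K. \<Sum>\<xi>\<in>V - ssp S z K. n (ssp S (z(k := \<xi>)) (insert k K)) * F (restrict (z(k := \<xi>)) K1))"
    using S fK fV by (intro sum_Ind_insert) auto
  also have "\<dots> = (\<Sum>z\<in>Ind V S K. (2 ^ d - 2 ^ (j + card K)) * (n (ssp S z K) * F (restrict z K1)))"
  proof (rule sum.cong[OF refl])
    fix z assume z: "z \<in> Ind V S K"
    have c: "ssp S (z(k := \<xi>)) K = ssp S z K" for \<xi> using fK by (intro ssp_cong) auto
    have r: "restrict (z(k := \<xi>)) K1 = restrict z K1" for \<xi>
      using fK by (auto simp: fun_eq_iff K_def restrict_def)
    have sub: "ssp S z K \<subseteq> V" using z S V by (intro ssp_subset) (auto simp: Ind_def)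
    have "(\<Sum>\<xi>\<in>V - ssp S z K. n (ssp S (z(k := \<xi>)) (insert k K)) * F (restrict (z(k := \<xi>)) K1))
       = (\<Sum>\<xi>\<in>V - ssp S z K. n (sp1 (ssp S z K) \<xi>)) * F (restrict z K1)"
      using S fK by (simp add: ssp_insert_sp1 c r sum_distrib_right)
    also have "(\<Sum>\<xi>\<in>V - ssp S z K. n (sp1 (ssp S z K) \<xi>)) = (2 ^ d - real (card (ssp S z K))) * n (ssp S z K)"
      using h sub subspace_ssp[OF S(1) fK(1)] by (auto simp: harm_def)
    also have "card (ssp S z K) = 2 ^ (j + card K)"
      using card_ssp[OF fK(1) S(1) fS, of z] z S by (auto simp: Ind_def power_add)
    finally show "(\<Sum>\<xi>\<in>V - ssp S z K. n (ssp S (z(k := \<xi>)) (insert k K)) * F (restrict (z(k := \<xi>)) K1)) =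
        (2 ^ d - 2 ^ (j + card K)) * (n (ssp S z K) * F (restrict z K1))"
      by (simp only: mult.assoc of_nat_power of_nat_numeral)
  qed
  also have "\<dots> = (2 ^ d - 2 ^ (j + card K)) * (extc d (j + card K1) (card K2) * (\<Sum>z\<in>Ind V S K1. n (ssp S z K1) * F z))"
  proof -
    have "K1 \<inter> K2 = {}" using insert.prems by blast
    then have "(\<Sum>z\<in>Ind V S K. n (ssp S z K) * F (restrict z K1)) =
        extc d (j + card K1) (card K2) * (\<Sum>z\<in>Ind V S K1. n (ssp S z K1) * F z)"
      unfolding K_def by (rule insert.IH)
    then show ?thesis by (simp only: sum_distrib_left[symmetric])
  qed
  also have "\<dots> = extc d (j + card K1) (card (insert k K2)) * (\<Sum>z\<in>Ind V S K1. n (ssp S z K1) * F z)"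
  proof -
    have "card K = card K1 + card K2" using insert K1 by (simp add: K_def card_Un_disjoint)
    then show ?thesis using insert by (simp add: extc_def add.assoc)
  qed
  finally show ?case .
qed

text \<open>Turns \<open>harm_marginal\<close> into a count of independent families inside
  \<open>W\<close>.\<close>

lemma harm_const:
  assumes "finite W" "fvs.subspace W"
  shows "harm W (fvs.dim W) (\<lambda>_. 1)"
  unfolding harm_def
proof (intro conjI allI impI)
  fix S assume S: "fvs.subspace S" "S \<subseteq> W"
  then have "card S \<le> card W" "finite S" using assms by (auto intro: card_mono finite_subset)
  then have "real (card (W - S)) = real (card W) - real (card S)"
    using S by (simp add: card_Diff_subset of_nat_diff)
  then show "(\<Sum>\<xi>\<in>W - S. 1) = (2 ^ fvs.dim W - real (card S)) * 1"
    using card_subspace[OF assms(2,1)] by simp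
qed (use assms in auto)

lemma sum_Ind_marginal_count:
  assumes W: "finite W" "fvs.subspace W" and S: "fvs.subspace S" "S \<subseteq> W"
    and K: "finite K1" "finite K2" "K1 \<inter> K2 = {}"
  shows "(\<Sum>z\<in>Ind W S (K1 \<union> K2). F (restrict z K1)) =
     extc (fvs.dim W) (fvs.dim S + card K1) (card K2) * (\<Sum>z\<in>Ind W S K1. F z)"
proof -
  have "finite S" using W S finite_subset by auto
  then show ?thesis
    using harm_marginal[OF harm_const[OF W] S card_subspace[OF S(1)] K, of F] by simp
qed

lemma card_Ind:
  assumes W: "finite W" "fvs.subspace W" and S: "fvs.subspace S" "S \<subseteq> W" and K: "finite K"
  shows "real (card (Ind W S K)) = extc (fvs.dim W) (fvs.dim S) (card K)"
proof -
  have e: "Ind W S {} = {\<lambda>_. undefined}" by (auto simp: Ind_def)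
  show ?thesis using sum_Ind_marginal_count[OF W S, of "{}" K "\<lambda>_. 1"] K by (simp add: e)
qed

section \<open>Containment probabilities\<close>

definition Nm :: "('i \<Rightarrow> bit) set pmf \<Rightarrow> ('i \<Rightarrow> bit) set \<Rightarrow> real" where
  "Nm \<mu> S = measure_pmf.prob \<mu> {W. S \<subseteq> W}"

definition pure :: "('i \<Rightarrow> bit) set \<Rightarrow> nat \<Rightarrow> ('i \<Rightarrow> bit) set pmf \<Rightarrow> bool" where
  "pure V d \<mu> \<longleftrightarrow> finite V \<and> fvs.subspace V \<and> (\<forall>W\<in>set_pmf \<mu>. fvs.subspace W \<and> W \<subseteq> V \<and> fvs.dim W = d)"

lemma pure_finite: "pure V d \<mu> \<Longrightarrow> finite (set_pmf \<mu>)"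
  by (rule finite_subset[of _ "Pow V"]) (auto simp: pure_def)

lemma prob_finite_sum:
  assumes "finite (set_pmf \<mu>)"
  shows "measure_pmf.prob \<mu> {W. P W} = (\<Sum>W\<in>set_pmf \<mu>. pmf \<mu> W * of_bool (P W))"
proof -
  have "measure_pmf.prob \<mu> {W. P W} = measure_pmf.prob \<mu> ({W. P W} \<inter> set_pmf \<mu>)"
    by (simp add: measure_Int_set_pmf)
  also have "\<dots> = sum (pmf \<mu>) ({W. P W} \<inter> set_pmf \<mu>)"
    using assms by (intro measure_measure_pmf_finite) auto
  also have "\<dots> = (\<Sum>W\<in>set_pmf \<mu>. pmf \<mu> W * of_bool (P W))"
    using assms by (intro sum.mono_neutral_cong_left) auto
  finally show ?thesis .
qed

lemma Nm_sum: "pure V d \<mu> \<Longrightarrow> Nm \<mu> S = (\<Sum>W\<in>set_pmf \<mu>. pmf \<mu> W * of_bool (S \<subseteq> W))"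
  unfolding Nm_def by (rule prob_finite_sum[OF pure_finite])

lemma Nm_nonneg: "Nm \<mu> S \<ge> 0"
  by (simp add: Nm_def)

lemma Nm_pos_iff: "Nm \<mu> S > 0 \<longleftrightarrow> (\<exists>W\<in>set_pmf \<mu>. S \<subseteq> W)"
proof -
  have "Nm \<mu> S > 0 \<longleftrightarrow> Nm \<mu> S \<noteq> 0" using Nm_nonneg[of \<mu> S] by linarith
  also have "\<dots> \<longleftrightarrow> (\<exists>W\<in>set_pmf \<mu>. S \<subseteq> W)"
    unfolding Nm_def measure_pmf_zero_iff by auto
  finally show ?thesis .
qed

text \<open>Double counting of the pairs of a top space \<open>W\<close> containing \<open>S\<close>
  and a vector of \<open>W - S\<close>.\<close>

lemma harm_Nm:
  assumes p: "pure V d \<mu>"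
  shows "harm V d (Nm \<mu>)"
  unfolding harm_def
proof (intro conjI allI impI)
  fix S assume S: "fvs.subspace S" "S \<subseteq> V"
  have fV: "finite V" using p by (auto simp: pure_def)
  show "Nm \<mu> S \<ge> 0" by (rule Nm_nonneg)
  have "(\<Sum>\<xi>\<in>V - S. Nm \<mu> (sp1 S \<xi>)) = (\<Sum>W\<in>set_pmf \<mu>. \<Sum>\<xi>\<in>V - S. pmf \<mu> W * of_bool (sp1 S \<xi> \<subseteq> W))"
    unfolding Nm_sum[OF p] by (rule sum.swap)
  also have "\<dots> = (\<Sum>W\<in>set_pmf \<mu>. (2 ^ d - real (card S)) * (pmf \<mu> W * of_bool (S \<subseteq> W)))"
  proof (rule sum.cong[OF refl])
    fix W assume "W \<in> set_pmf \<mu>"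
    then have W: "fvs.subspace W" "W \<subseteq> V" "fvs.dim W = d" using p by (auto simp: pure_def)
    have fW: "finite W" using W fV finite_subset by auto
    show "(\<Sum>\<xi>\<in>V - S. pmf \<mu> W * of_bool (sp1 S \<xi> \<subseteq> W)) = (2 ^ d - real (card S)) * (pmf \<mu> W * of_bool (S \<subseteq> W))"
    proof (cases "S \<subseteq> W")
      case True
      have "(\<Sum>\<xi>\<in>V - S. pmf \<mu> W * of_bool (sp1 S \<xi> \<subseteq> W)) = (\<Sum>\<xi>\<in>W - S. pmf \<mu> W)"
        using True W S fV by (intro sum.mono_neutral_cong_right) (auto simp: sp1_subset_iff)
      also have "\<dots> = real (card (W - S)) * pmf \<mu> W" by simp
      also have "real (card (W - S)) = real (card W) - real (card S)"
        using True fW by (simp add: card_Diff_subset finite_subset of_nat_diff card_mono)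
      finally show ?thesis using True card_subspace[OF W(1) fW] W(3) by simp
    next
      case False
      then show ?thesis using W S by (auto simp: sp1_subset_iff)
    qed
  qed
  finally show "(\<Sum>\<xi>\<in>V - S. Nm \<mu> (sp1 S \<xi>)) = (2 ^ d - real (card S)) * Nm \<mu> S"
    unfolding Nm_sum[OF p] by (simp add: sum_distrib_left)
qed (use p in \<open>auto simp: pure_def\<close>)

section \<open>Complete flags and ordered bases\<close>

lemma complete_flags_dim:
  assumes W: "fvs.subspace W" "finite W" and fl: "fl \<in> complete_flags W" and j: "j \<le> fvs.dim W"
  shows "fvs.dim (fl ! j) = j \<and> fvs.subspace (fl ! j) \<and> fl ! j \<subseteq> W"
proof -
  define l where "l = fvs.dim W"
  have len: "length fl = l + 1" and sub: "\<And>u. u \<in> set fl \<Longrightarrow> fvs.subspace u"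
    and srt: "sorted_wrt (\<subset>) fl" and lst: "last fl = W"
    using fl by (auto simp: complete_flags_def l_def)
  have top: "fl ! l = W" using lst len by (metis add_diff_cancel_right' last_conv_nth list.size(3) add_is_0 one_neq_zero)
  have s: "fvs.subspace (fl ! t)" if "t \<le> l" for t using sub len that by (intro sub nth_mem) auto
  have inc: "fl ! t \<subset> fl ! t'" if "t < t'" "t' \<le> l" for t t'
    using sorted_wrt_nth_less[OF srt that(1)] that len by simp
  have W': "fl ! t \<subseteq> W" if "t \<le> l" for t
    using inc[of t l] top that by (cases "t = l") auto
  have f: "finite (fl ! t)" if "t \<le> l" for t using W'[OF that] W(2) finite_subset by blast
  have lt: "fvs.dim (fl ! t) < fvs.dim (fl ! Suc t)" if "Suc t \<le> l" for t
  proof (rule ccontr)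
    assume "\<not> ?thesis"
    then have "fl ! t = fl ! Suc t"
      using that inc[of t "Suc t"] by (intro subspace_eq_of_dim s f) auto
    then show False using inc[of t "Suc t"] that by auto
  qed
  have ge: "t \<le> fvs.dim (fl ! t)" if "t \<le> l" for t
    using that
  proof (induction t)
    case (Suc t) then show ?case using lt[of t] by linarith
  qed simp
  have le: "fvs.dim (fl ! (l - t)) \<le> l - t" if "t \<le> l" for t
    using that
  proof (induction t)
    case 0 
    have "fvs.dim (fl ! l) = l" unfolding top by (simp add: l_def)
    then show ?case by simp
  next
    case (Suc t)
    have "Suc (l - Suc t) = l - t" using Suc by simp
    then have "fvs.dim (fl ! (l - Suc t)) < fvs.dim (fl ! (l - t))" using lt[of "l - Suc t"] by simp
    then show ?case using Suc by linarith
  qed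
  have "fvs.dim (fl ! j) \<le> j" using le[of "l - j"] j by (simp add: l_def)
  then show ?thesis using ge[of j] s[of j] W'[of j] j by (simp add: l_def)
qed

lemma Nm_eq_0:
  assumes p: "pure V d \<mu>" and "\<not> S \<subseteq> V"
  shows "Nm \<mu> S = 0"
proof -
  have "\<not> S \<subseteq> W" if "W \<in> set_pmf \<mu>" for W using that assms by (auto simp: pure_def)
  then have "\<not> Nm \<mu> S > 0" by (simp add: Nm_pos_iff)
  then show ?thesis using Nm_nonneg[of \<mu> S] by simp
qed

definition flag_of :: "nat \<Rightarrow> (nat \<Rightarrow> 'i \<Rightarrow> bit) \<Rightarrow> ('i \<Rightarrow> bit) set list" where
  "flag_of l z = map (\<lambda>j. ssp Z0 z {..<j}) [0..<l + 1]"

lemma flag_of_nth: "j \<le> l \<Longrightarrow> flag_of l z ! j = ssp Z0 z {..<j}"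
  unfolding flag_of_def by (simp del: upt_Suc)

lemma dim_Z0 [simp]: "fvs.dim Z0 = 0"
  using dim_ssp_0[of "{}"] by simp

lemma Z0_subset: "fvs.subspace W \<Longrightarrow> Z0 \<subseteq> W"
  by (auto simp: Z0_def subspace_bit_iff)

lemma ssp_Ind_full:
  assumes W: "fvs.subspace W" "finite W" and S: "fvs.subspace S" "S \<subseteq> W"
    and z: "z \<in> Ind W S K" and K: "finite K" "fvs.dim S + card K = fvs.dim W"
  shows "ssp S z K = W"
proof -
  have fS: "finite S" using S W finite_subset by auto
  have i: "indm S z K" and zW: "\<And>k. k \<in> K \<Longrightarrow> z k \<in> W" using z by (auto simp: Ind_def)
  show ?thesis
  proof (rule subspace_eq_of_dim)
    show "ssp S z K \<subseteq> W" using W S zW by (intro ssp_subset)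
    show "fvs.dim W \<le> fvs.dim (ssp S z K)" using dim_ssp[OF K(1) S(1) fS i] K by simp
  qed (use W S K subspace_ssp in auto)
qed

lemma flag_of_mem:
  assumes W: "fvs.subspace W" "finite W" and z: "z \<in> Ind W Z0 {..<fvs.dim W}"
  shows "flag_of (fvs.dim W) z \<in> complete_flags W"
proof -
  let ?l = "fvs.dim W"
  have i: "indm Z0 z {..<?l}" using z by (auto simp: Ind_def)
  have full: "ssp Z0 z {..<?l} = W"
  proof (rule ssp_Ind_full[OF W subspace_Z0])
    show "Z0 \<subseteq> W" using W by (auto simp: Z0_def subspace_bit_iff)
    show "z \<in> Ind W Z0 {..<?l}" by (rule z)
    show "fvs.dim Z0 + card {..<?l} = ?l" by simp
  qed simp
  have "sorted_wrt (\<subset>) (flag_of ?l z)"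
    unfolding sorted_wrt_iff_nth_less
  proof (intro allI impI)
    fix a b assume ab: "a < b" "b < length (flag_of ?l z)"
    then have b: "b \<le> ?l" by (simp add: flag_of_def)
    have "ssp Z0 z {..<a} \<subseteq> ssp Z0 z {..<b}" using ab by (intro ssp_mono) auto
    moreover have "ssp Z0 z {..<a} \<noteq> ssp Z0 z {..<b}"
    proof
      assume eq: "ssp Z0 z {..<a} = ssp Z0 z {..<b}"
      have "z a \<in> ssp Z0 z {..<b}" using ab by (intro ssp_gen) auto
      moreover have "indm Z0 z (insert a {..<a})" using i ab b by (intro indm_mono[OF i]) auto
      then have "z a \<notin> ssp Z0 z {..<a}" by (simp add: indm_insert)
      ultimately show False using eq by simp
    qed
    ultimately show "flag_of ?l z ! a \<subset> flag_of ?l z ! b" using ab b by (simp add: flag_of_nth psubset_eq)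
  qed
  moreover have "last (flag_of ?l z) = W" using full by (simp add: flag_of_def)
  ultimately show ?thesis using W
    by (auto simp: complete_flags_def flag_of_def subspace_ssp)
qed

text \<open>An ordered basis that induces a given flag picks its \<open>j\<close>-th vector freely
  in one member of the flag minus the previous one. That makes \<open>2 ^ j\<close> choices whatever
  the flag is, so a uniform flag is the flag of a uniform ordered basis.\<close>

lemma flag_fibre:
  assumes W: "fvs.subspace W" "finite W" and fl: "fl \<in> complete_flags W"
  shows "{z \<in> Ind W Z0 {..<fvs.dim W}. flag_of (fvs.dim W) z = fl} =
    PiE {..<fvs.dim W} (\<lambda>j. fl ! Suc j - fl ! j)"
proof -
  let ?l = "fvs.dim W"
  have d: "fvs.dim (fl ! j) = j" "fvs.subspace (fl ! j)" "fl ! j \<subseteq> W" "finite (fl ! j)" if "j \<le> ?l" for j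
    using complete_flags_dim[OF W fl that] W finite_subset by auto
  have len: "length fl = ?l + 1" using fl by (simp add: complete_flags_def)
  have mono: "fl ! j \<subseteq> fl ! Suc j" if "j < ?l" for j
  proof -
    have "sorted_wrt (\<subset>) fl" using fl by (simp add: complete_flags_def)
    from sorted_wrt_nth_less[OF this, of j "Suc j"] show ?thesis using that len by auto
  qed
  show ?thesis
  proof (intro equalityI subsetI)
    fix z assume "z \<in> {z \<in> Ind W Z0 {..<?l}. flag_of ?l z = fl}"
    then have z: "z \<in> Ind W Z0 {..<?l}" and f: "flag_of ?l z = fl" by auto
    have i: "indm Z0 z {..<?l}" using z by (auto simp: Ind_def)
    have "z j \<in> fl ! Suc j - fl ! j" if "j < ?l" for j
    proof -
      have "fl ! Suc j = ssp Z0 z {..<Suc j}" "fl ! j = ssp Z0 z {..<j}"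
        using that by (auto simp: f[symmetric] flag_of_nth)
      moreover have "z j \<in> ssp Z0 z {..<Suc j}" by (intro ssp_gen) auto
      moreover have "indm Z0 z (insert j {..<j})" using that by (intro indm_mono[OF i]) auto
      then have "z j \<notin> ssp Z0 z {..<j}" by (simp add: indm_insert)
      ultimately show ?thesis by simp
    qed
    then show "z \<in> PiE {..<?l} (\<lambda>j. fl ! Suc j - fl ! j)" using z by (auto simp: Ind_def PiE_iff)
  next
    fix z assume z: "z \<in> PiE {..<?l} (\<lambda>j. fl ! Suc j - fl ! j)"
    have zj: "z j \<in> fl ! Suc j" "z j \<notin> fl ! j" if "j < ?l" for j using z that by (auto simp: PiE_iff)
    have main: "indm Z0 z {..<j} \<and> ssp Z0 z {..<j} = fl ! j" if "j \<le> ?l" for j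
      using that
    proof (induction j)
      case 0
      have "Z0 = fl ! 0"
        using d[of 0] W by (intro subspace_eq_of_dim) (auto simp: Z0_def subspace_bit_iff)
      then show ?case by simp
    next
      case (Suc j)
      then have IH: "indm Z0 z {..<j}" "ssp Z0 z {..<j} = fl ! j" by simp_all
      have j: "j < ?l" using Suc by simp
      have "indm Z0 z (insert j {..<j})" using IH zj[OF j] by (simp add: indm_insert)
      then have i: "indm Z0 z {..<Suc j}" by (simp add: lessThan_Suc)
      have "ssp Z0 z {..<Suc j} = fl ! Suc j"
      proof (rule subspace_eq_of_dim)
        have "ssp Z0 z {..<Suc j} = sp1 (fl ! j) (z j)"
          by (simp add: lessThan_Suc ssp_insert_sp1 IH(2))
        also have "\<dots> \<subseteq> fl ! Suc j" using mono[OF j] zj[OF j] d[of "Suc j"] j by (intro sp1_subset) auto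
        finally show "ssp Z0 z {..<Suc j} \<subseteq> fl ! Suc j" .
        show "fvs.dim (fl ! Suc j) \<le> fvs.dim (ssp Z0 z {..<Suc j})"
          using dim_ssp_0[OF _ i] d[of "Suc j"] j by simp
      qed (use d[of "Suc j"] j in \<open>auto simp: subspace_ssp\<close>)
      then show ?case using i by simp
    qed
    have "z \<in> Ind W Z0 {..<?l}"
    proof -
      have "z j \<in> W" if "j < ?l" for j using zj(1)[OF that] d(3)[of "Suc j"] that by auto
      then show ?thesis unfolding Ind_def using z main[of ?l] by (auto simp: PiE_iff)
    qed
    moreover have "flag_of ?l z = fl"
    proof (rule nth_equalityI)
      show lf: "length (flag_of ?l z) = length fl" using len by (simp add: flag_of_def)
      fix t assume "t < length (flag_of ?l z)"
      then have "t \<le> ?l" using lf len by simp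
      then show "flag_of ?l z ! t = fl ! t" using main[of t] by (simp add: flag_of_nth)
    qed
    ultimately show "z \<in> {z \<in> Ind W Z0 {..<?l}. flag_of ?l z = fl}" by simp
  qed
qed

lemma finite_complete_flags:
  assumes W: "fvs.subspace W" "finite W"
  shows "finite (complete_flags W)"
proof (rule finite_subset)
  show "complete_flags W \<subseteq> {xs. set xs \<subseteq> Pow W \<and> length xs = fvs.dim W + 1}"
  proof
    fix fl assume fl: "fl \<in> complete_flags W"
    then have len: "length fl = fvs.dim W + 1" by (simp add: complete_flags_def)
    have "u \<subseteq> W" if us: "u \<in> set fl" for u
    proof -
      obtain t where "t < length fl" "u = fl ! t" using us by (metis in_set_conv_nth)
      then have t: "t \<le> fvs.dim W" "u = fl ! t" using len by auto
      then show ?thesis using complete_flags_dim[OF W fl t(1)] by simp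
    qed
    then show "fl \<in> {xs. set xs \<subseteq> Pow W \<and> length xs = fvs.dim W + 1}" using len by auto
  qed
  show "finite {xs. set xs \<subseteq> Pow W \<and> length xs = fvs.dim W + 1}"
    using W by (intro finite_lists_length_eq) auto
qed

lemma sum_flags:
  assumes W: "fvs.subspace W" "finite W"
  shows "(\<Sum>z\<in>Ind W Z0 {..<fvs.dim W}. F (flag_of (fvs.dim W) z) :: real) =
     (\<Prod>j<fvs.dim W. 2 ^ j) * (\<Sum>fl\<in>complete_flags W. F fl)"
proof -
  let ?l = "fvs.dim W"
  have "(\<Sum>z\<in>Ind W Z0 {..<?l}. F (flag_of ?l z)) =
      (\<Sum>fl\<in>complete_flags W. \<Sum>z\<in>{z \<in> Ind W Z0 {..<?l}. flag_of ?l z = fl}. F (flag_of ?l z))"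
    using W by (intro sum.group[symmetric] finite_Ind finite_complete_flags)
      (auto intro: flag_of_mem)
  also have "\<dots> = (\<Sum>fl\<in>complete_flags W. (\<Prod>j<?l. 2 ^ j) * F fl)"
  proof (rule sum.cong[OF refl])
    fix fl assume fl: "fl \<in> complete_flags W"
    have "(\<Sum>z\<in>{z \<in> Ind W Z0 {..<?l}. flag_of ?l z = fl}. F (flag_of ?l z)) =
        real (card {z \<in> Ind W Z0 {..<?l}. flag_of ?l z = fl}) * F fl"
      by (subst sum.cong[OF refl, of _ _ "\<lambda>_. F fl"]) auto
    also have "card {z \<in> Ind W Z0 {..<?l}. flag_of ?l z = fl} = (\<Prod>j<?l. card (fl ! Suc j - fl ! j))"
      unfolding flag_fibre[OF W fl] by (simp add: card_PiE)
    also have "\<dots> = (\<Prod>j<?l. 2 ^ j)"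
    proof (rule prod.cong[OF refl])
      fix j assume "j \<in> {..<?l}"
      then have j: "j < ?l" by simp
      note d = complete_flags_dim[OF W fl, of j] complete_flags_dim[OF W fl, of "Suc j"]
      have fin: "finite (fl ! j)" "finite (fl ! Suc j)" using d j W finite_subset by auto
      have "length fl = ?l + 1" "sorted_wrt (\<subset>) fl" using fl by (auto simp: complete_flags_def)
      then have "fl ! j \<subseteq> fl ! Suc j" using sorted_wrt_nth_less[of _ fl j "Suc j"] j by auto
      then have "card (fl ! Suc j - fl ! j) = card (fl ! Suc j) - card (fl ! j)"
        using fin by (simp add: card_Diff_subset)
      then show "card (fl ! Suc j - fl ! j) = 2 ^ j" using d j fin by (simp add: card_subspace)
    qed
    finally show "(\<Sum>z\<in>{z \<in> Ind W Z0 {..<?l}. flag_of ?l z = fl}. F (flag_of ?l z)) = (\<Prod>j<?l. 2 ^ j) * F fl"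
      by simp
  qed
  finally show ?thesis by (simp add: sum_distrib_left)
qed

lemma complete_flags_nonempty:
  assumes W: "fvs.subspace W" "finite W"
  shows "complete_flags W \<noteq> {}"
proof -
  have "real (card (Ind W Z0 {..<fvs.dim W})) > 0"
    using card_Ind[OF W(2,1) subspace_Z0 Z0_subset[OF W(1)], of "{..<fvs.dim W}"] extc_pos[of 0 "fvs.dim W" "fvs.dim W"]
    by simp
  then obtain z where "z \<in> Ind W Z0 {..<fvs.dim W}" by (metis card_gt_0_iff of_nat_0_less_iff all_not_in_conv)
  then show ?thesis using flag_of_mem[OF W] by auto
qed

text \<open>A random flag comes from a random top space and a uniform ordered basis of it; the
  factor between flags and bases cancels. Exchanging the sums over top spaces and over bases leaves
  the containment weight of the span.\<close>

lemma prob_random_flag: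
  assumes p: "pure V l \<mu>"
  shows "measure_pmf.prob (random_flag \<mu>) {fl. P fl} =
    (\<Sum>z\<in>Ind V Z0 {..<l}. Nm \<mu> (ssp Z0 z {..<l}) * of_bool (P (flag_of l z))) / extc l 0 l"
proof -
  have fV: "finite V" and V: "fvs.subspace V" using p by (auto simp: pure_def)
  have W: "fvs.subspace W" "finite W" "W \<subseteq> V" "fvs.dim W = l" if "W \<in> set_pmf \<mu>" for W
    using p that finite_subset by (auto simp: pure_def)
  have "measure_pmf.prob (random_flag \<mu>) {fl. P fl} =
      measure_pmf.expectation \<mu> (\<lambda>W. measure_pmf.prob (pmf_of_set (complete_flags W)) {fl. P fl})"
  proof -
    have T: "measure_pmf.prob M {x. Q x} = pmf (map_pmf Q M) True" for M :: "'c pmf" and Q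
      by (simp add: pmf_map vimage_def)
    show ?thesis unfolding random_flag_def T map_bind_pmf pmf_bind ..
  qed
  also have "\<dots> = (\<Sum>W\<in>set_pmf \<mu>. pmf \<mu> W * measure_pmf.prob (pmf_of_set (complete_flags W)) {fl. P fl})"
    by (subst integral_measure_pmf[OF pure_finite[OF p]]) auto
  also have "\<dots> = (\<Sum>W\<in>set_pmf \<mu>. pmf \<mu> W * ((\<Sum>z\<in>Ind W Z0 {..<l}. of_bool (P (flag_of l z))) / extc l 0 l))"
  proof (rule sum.cong[OF refl])
    fix w assume w: "w \<in> set_pmf \<mu>"
    note W = W[OF w]
    have "measure_pmf.prob (pmf_of_set (complete_flags w)) {fl. P fl} =
        real (card (complete_flags w \<inter> {fl. P fl})) / real (card (complete_flags w))"
      using W finite_complete_flags complete_flags_nonempty by (intro measure_pmf_of_set) auto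
    also have "real (card (complete_flags w \<inter> {fl. P fl})) = (\<Sum>fl\<in>complete_flags w. of_bool (P fl))"
      using finite_complete_flags[OF W(1,2)] by (simp add: of_bool_def sum.If_cases Int_def)
    also have "\<dots> = (\<Sum>z\<in>Ind w Z0 {..<l}. of_bool (P (flag_of l z))) / (\<Prod>j<l. 2 ^ j)"
      using sum_flags[OF W(1,2), of "\<lambda>fl. of_bool (P fl)"] W(4) by (simp add: field_simps)
    also have "real (card (complete_flags w)) = extc l 0 l / (\<Prod>j<l. 2 ^ j)"
      using sum_flags[OF W(1,2), of "\<lambda>fl. 1"] W(4) card_Ind[OF W(2,1) subspace_Z0 Z0_subset[OF W(1)], of "{..<l}"]
      by (simp add: field_simps)
    finally show "pmf \<mu> w * measure_pmf.prob (pmf_of_set (complete_flags w)) {fl. P fl} =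
        pmf \<mu> w * ((\<Sum>z\<in>Ind w Z0 {..<l}. of_bool (P (flag_of l z))) / extc l 0 l)"
      by (simp add: prod_zero_iff)
  qed
  also have "\<dots> = (\<Sum>W\<in>set_pmf \<mu>. \<Sum>z\<in>Ind V Z0 {..<l}. pmf \<mu> W * of_bool (ssp Z0 z {..<l} \<subseteq> W) * of_bool (P (flag_of l z))) / extc l 0 l"
  proof -
    have "(\<Sum>z\<in>Ind w Z0 {..<l}. of_bool (P (flag_of l z)) :: real) =
       (\<Sum>z\<in>Ind V Z0 {..<l}. of_bool (ssp Z0 z {..<l} \<subseteq> w) * of_bool (P (flag_of l z)))" if w: "w \<in> set_pmf \<mu>" for w
    proof (rule sum.mono_neutral_cong_left)
      note W = W[OF w]
      show "finite (Ind V Z0 {..<l})" using fV by (simp add: finite_Ind)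
      show "Ind w Z0 {..<l} \<subseteq> Ind V Z0 {..<l}" using W by (auto simp: Ind_def)
      have sub: "ssp Z0 z {..<l} \<subseteq> w \<longleftrightarrow> (\<forall>j<l. z j \<in> w)" for z
      proof
        assume "ssp Z0 z {..<l} \<subseteq> w"
        then show "\<forall>j<l. z j \<in> w" using ssp_gen[OF subspace_Z0, of "{..<l}" _ z] by auto
      next
        assume "\<forall>j<l. z j \<in> w"
        then show "ssp Z0 z {..<l} \<subseteq> w" using W by (intro ssp_subset Z0_subset) auto
      qed
      show "\<forall>z\<in>Ind V Z0 {..<l} - Ind w Z0 {..<l}. of_bool (ssp Z0 z {..<l} \<subseteq> w) * of_bool (P (flag_of l z)) = (0::real)"
        by (auto simp: sub Ind_def PiE_iff)
      show "of_bool (P (flag_of l z)) = (of_bool (ssp Z0 z {..<l} \<subseteq> w) * of_bool (P (flag_of l z)) :: real)"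
        if "z \<in> Ind w Z0 {..<l}" for z using that by (auto simp: sub Ind_def PiE_iff)
    qed
    then show ?thesis by (simp add: sum_divide_distrib sum_distrib_left mult.assoc)
  qed
  also have "\<dots> = (\<Sum>z\<in>Ind V Z0 {..<l}. Nm \<mu> (ssp Z0 z {..<l}) * of_bool (P (flag_of l z))) / extc l 0 l"
    unfolding Nm_sum[OF p] by (subst sum.swap) (simp add: sum_distrib_right)
  finally show ?thesis .
qed

lemma random_flag_support:
  assumes p: "pure V l \<mu>" and fl: "fl \<in> set_pmf (random_flag \<mu>)"
  shows "\<exists>W\<in>set_pmf \<mu>. fl \<in> complete_flags W"
proof -
  obtain W where W: "W \<in> set_pmf \<mu>" "fl \<in> set_pmf (pmf_of_set (complete_flags W))"
    using fl by (auto simp: random_flag_def)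
  have "fvs.subspace W" "finite W" using p W finite_subset by (auto simp: pure_def)
  then have "set_pmf (pmf_of_set (complete_flags W)) = complete_flags W"
    by (intro set_pmf_of_set finite_complete_flags complete_flags_nonempty)
  then show ?thesis using W by auto
qed

text \<open>Ordered bases of a \<open>k\<close>-space, times extensions to an
  \<open>m\<close>-space, times extensions to a top space, divided by the ordered bases of a top
  space. Being positive and dependent on dimensions alone is all that later arguments ask of
  it.\<close>

definition flagc :: "nat \<Rightarrow> nat \<Rightarrow> nat \<Rightarrow> real" where
  "flagc l k m = extc l m (l - m) * extc m k (m - k) * extc k 0 k / extc l 0 l"

lemma flagc_pos: "k \<le> m \<Longrightarrow> m \<le> l \<Longrightarrow> flagc l k m > 0"
  unfolding flagc_def by (intro divide_pos_pos mult_pos_pos extc_pos) auto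

lemma restrict_Ind_ssp: "A \<subseteq> B \<Longrightarrow> ssp S (restrict z B) A = ssp S z A"
  by (intro ssp_cong) auto

text \<open>The event depends only on the first \<open>m\<close> basis vectors, so the others are
  summed out by harmonicity. Then the first \<open>m\<close> must form a basis of \<open>u\<close>
  and the first \<open>k\<close> a basis of \<open>w\<close>, which leaves two counts.\<close>

lemma prob_flag_pair:
  fixes V :: "('a \<Rightarrow> bit) set"
  assumes p: "pure V l \<mu>" and w: "fvs.subspace w" "fvs.dim w = k" and u: "fvs.subspace u" "fvs.dim u = m"
    and wu: "w \<subseteq> u" "u \<subseteq> V" and km: "k \<le> m" "m \<le> l"
  shows "measure_pmf.prob (random_flag \<mu>) {fl. fl ! k = w \<and> fl ! m = u} = flagc l k m * Nm \<mu> u"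
proof -
  have fV: "finite V" and V: "fvs.subspace V" using p by (auto simp: pure_def)
  have fu: "finite u" by (rule finite_subset[OF wu(2) fV])
  have fw: "finite w" by (rule finite_subset[OF wu(1) fu])
  define A where "A = (\<lambda>z. of_bool (ssp Z0 z {..<k} = w \<and> ssp Z0 z {..<m} = u) :: real)"
  have lm: "{..<m} \<union> {m..<l} = {..<l}" "{..<k} \<union> {k..<m} = {..<m}" using km by auto
  have "(\<Sum>z\<in>Ind V Z0 {..<l}. Nm \<mu> (ssp Z0 z {..<l}) * of_bool (flag_of l z ! k = w \<and> flag_of l z ! m = u)) =
      (\<Sum>z\<in>Ind V Z0 ({..<m} \<union> {m..<l}). Nm \<mu> (ssp Z0 z ({..<m} \<union> {m..<l})) * A (restrict z {..<m}))"
    unfolding lm using km by (intro sum.cong refl) (simp add: A_def flag_of_nth restrict_Ind_ssp)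
  also have "\<dots> = extc l (0 + card {..<m}) (card {m..<l}) * (\<Sum>z\<in>Ind V Z0 {..<m}. Nm \<mu> (ssp Z0 z {..<m}) * A z)"
    by (rule harm_marginal[OF harm_Nm[OF p]]) (use Z0_subset[OF V] in auto)
  also have "(\<Sum>z\<in>Ind V Z0 {..<m}. Nm \<mu> (ssp Z0 z {..<m}) * A z) = (\<Sum>z\<in>Ind u Z0 {..<m}. Nm \<mu> u * of_bool (ssp Z0 z {..<k} = w))"
  proof (rule sum.mono_neutral_cong_right)
    show "finite (Ind V Z0 {..<m})" using fV by (simp add: finite_Ind)
    show "Ind u Z0 {..<m} \<subseteq> Ind V Z0 {..<m}" using wu by (auto simp: Ind_def)
    show "\<forall>z\<in>Ind V Z0 {..<m} - Ind u Z0 {..<m}. Nm \<mu> (ssp Z0 z {..<m}) * A z = 0"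
    proof
      fix z assume z: "z \<in> Ind V Z0 {..<m} - Ind u Z0 {..<m}"
      have "ssp Z0 z {..<m} \<noteq> u"
      proof
        assume "ssp Z0 z {..<m} = u"
        then have "z j \<in> u" if "j < m" for j using ssp_gen[OF subspace_Z0, of "{..<m}" j z] that by simp
        then show False using z by (auto simp: Ind_def PiE_iff)
      qed
      then show "Nm \<mu> (ssp Z0 z {..<m}) * A z = 0" by (simp add: A_def)
    qed
    fix z assume z: "z \<in> Ind u Z0 {..<m}"
    then have "ssp Z0 z {..<m} = u" using ssp_Ind_full[OF u(1) fu subspace_Z0 Z0_subset[OF u(1)] z] u by simp
    then show "Nm \<mu> (ssp Z0 z {..<m}) * A z = Nm \<mu> u * of_bool (ssp Z0 z {..<k} = w)" by (simp add: A_def)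
  qed
  also have "\<dots> = Nm \<mu> u * (\<Sum>z\<in>Ind u Z0 ({..<k} \<union> {k..<m}). of_bool (ssp Z0 (restrict z {..<k}) {..<k} = w))"
    unfolding lm by (simp add: sum_distrib_left restrict_Ind_ssp)
  also have "(\<Sum>z\<in>Ind u Z0 ({..<k} \<union> {k..<m}). of_bool (ssp Z0 (restrict z {..<k}) {..<k} = w) :: real) =
      extc (fvs.dim u) (fvs.dim (Z0 :: ('a \<Rightarrow> bit) set) + card {..<k}) (card {k..<m}) * (\<Sum>z\<in>Ind u Z0 {..<k}. of_bool (ssp Z0 z {..<k} = w))"
    by (rule sum_Ind_marginal_count[OF fu u(1) subspace_Z0 Z0_subset[OF u(1)], where F = "\<lambda>z. of_bool (ssp Z0 z {..<k} = w)"]) auto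
  also have "(\<Sum>z\<in>Ind u Z0 {..<k}. of_bool (ssp Z0 z {..<k} = w) :: real) = (\<Sum>z\<in>Ind w Z0 {..<k}. 1)"
  proof (rule sum.mono_neutral_cong_right)
    show "finite (Ind u Z0 {..<k})" using fu by (simp add: finite_Ind)
    show "Ind w Z0 {..<k} \<subseteq> Ind u Z0 {..<k}" using wu by (auto simp: Ind_def)
    show "\<forall>z\<in>Ind u Z0 {..<k} - Ind w Z0 {..<k}. of_bool (ssp Z0 z {..<k} = w) = (0::real)"
    proof
      fix z assume z: "z \<in> Ind u Z0 {..<k} - Ind w Z0 {..<k}"
      have "ssp Z0 z {..<k} \<noteq> w"
      proof
        assume "ssp Z0 z {..<k} = w"
        then have "z j \<in> w" if "j < k" for j using ssp_gen[OF subspace_Z0, of "{..<k}" j z] that by simp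
        then show False using z by (auto simp: Ind_def PiE_iff)
      qed
      then show "of_bool (ssp Z0 z {..<k} = w) = (0::real)" by simp
    qed
    fix z assume z: "z \<in> Ind w Z0 {..<k}"
    then have "ssp Z0 z {..<k} = w" using ssp_Ind_full[OF w(1) fw subspace_Z0 Z0_subset[OF w(1)] z] w by simp
    then show "of_bool (ssp Z0 z {..<k} = w) = (1::real)" by simp
  qed
  also have "(\<Sum>z\<in>Ind w Z0 {..<k}. 1::real) = extc k 0 k"
    using card_Ind[OF fw w(1) subspace_Z0 Z0_subset[OF w(1)], of "{..<k}"] w by simp
  finally have "(\<Sum>z\<in>Ind V Z0 {..<l}. Nm \<mu> (ssp Z0 z {..<l}) * of_bool (flag_of l z ! k = w \<and> flag_of l z ! m = u)) =
     extc l m (l - m) * (Nm \<mu> u * (extc m k (m - k) * extc k 0 k))"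
    using u by simp
  then show ?thesis unfolding prob_random_flag[OF p] flagc_def by simp
qed

lemma prob_flag_nth:
  assumes p: "pure V l \<mu>" and w: "fvs.subspace w" "fvs.dim w = k" "w \<subseteq> V" and k: "k \<le> l"
  shows "measure_pmf.prob (random_flag \<mu>) {fl. fl ! k = w} = flagc l k k * Nm \<mu> w"
  using prob_flag_pair[OF p w(1,2) w(1,2) order.refl w(3) order.refl k] by simp

lemma random_flag_nth:
  assumes p: "pure V l \<mu>" and fl: "fl \<in> set_pmf (random_flag \<mu>)" and k: "k \<le> l"
  shows "fvs.dim (fl ! k) = k" "fvs.subspace (fl ! k)" "fl ! k \<subseteq> V" "\<exists>W\<in>set_pmf \<mu>. fl ! k \<subseteq> W"
proof -
  obtain W where W: "W \<in> set_pmf \<mu>" "fl \<in> complete_flags W" using random_flag_support[OF p fl] by auto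
  have W': "fvs.subspace W" "finite W" "W \<subseteq> V" "fvs.dim W = l" using p W finite_subset by (auto simp: pure_def)
  show "fvs.dim (fl ! k) = k" "fvs.subspace (fl ! k)" "fl ! k \<subseteq> V" "\<exists>W\<in>set_pmf \<mu>. fl ! k \<subseteq> W"
    using complete_flags_dim[OF W'(1,2) W(2), of k] W' W k by auto
qed

lemma pmf_flag_marginal:
  assumes p: "pure V l \<mu>" and k: "k \<le> l"
  shows "pmf (flag_marginal k \<mu>) w =
    (if fvs.subspace w \<and> fvs.dim w = k then flagc l k k * Nm \<mu> w else 0)"
proof -
  have eq: "pmf (flag_marginal k \<mu>) w = measure_pmf.prob (random_flag \<mu>) {fl. fl ! k = w}"
    unfolding flag_marginal_def pmf_map by (simp add: vimage_def)
  show ?thesis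
  proof (cases "fvs.subspace w \<and> fvs.dim w = k \<and> w \<subseteq> V")
    case True
    then show ?thesis using prob_flag_nth[OF p _ _ _ k, of w] eq by simp
  next
    case False
    then have "measure_pmf.prob (random_flag \<mu>) {fl. fl ! k = w} = 0"
      using random_flag_nth[OF p _ k] by (auto simp: measure_pmf_zero_iff)
    moreover have "Nm \<mu> w = 0" if "\<not> w \<subseteq> V"
      using that by (rule Nm_eq_0[OF p])
    ultimately show ?thesis using eq False by auto
  qed
qed

lemma set_flag_marginal:
  assumes p: "pure V l \<mu>" and k: "k \<le> l"
  shows "set_pmf (flag_marginal k \<mu>) = {w. fvs.subspace w \<and> fvs.dim w = k \<and> (\<exists>W\<in>set_pmf \<mu>. w \<subseteq> W)}"
proof -
  have "w \<in> set_pmf (flag_marginal k \<mu>) \<longleftrightarrow> fvs.subspace w \<and> fvs.dim w = k \<and> Nm \<mu> w > 0" for w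
    using flagc_pos[of k k l] k Nm_nonneg[of \<mu> w]
    by (auto simp: set_pmf_eq pmf_flag_marginal[OF p k] zero_less_mult_iff order_less_le)
  then show ?thesis by (auto simp: Nm_pos_iff)
qed

lemma pure_flag_marginal:
  assumes p: "pure V l \<mu>" and k: "k \<le> l"
  shows "pure V k (flag_marginal k \<mu>)"
  using p set_flag_marginal[OF p k] by (auto simp: pure_def)

text \<open>Both weights are, up to constants, the sum of \<open>Nm \<mu>\<close> over the
  \<open>k\<close>-dimensional spaces containing \<open>u\<close>. For this reason links in a
  skeleton have the same edge distribution as links in the whole poset.\<close>

lemma Nm_flag_marginal:
  assumes p: "pure V l \<mu>" and k: "j \<le> k" "k \<le> l"
  shows "\<exists>c>0. \<forall>u. fvs.subspace u \<longrightarrow> fvs.dim u = j \<longrightarrow> Nm (flag_marginal k \<mu>) u = c * Nm \<mu> u"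
proof (intro exI conjI allI impI)
  define c where "c = flagc l k k * (extc l j (k - j) / extc k j (k - j))"
  show "c > 0" unfolding c_def using k by (intro mult_pos_pos divide_pos_pos extc_pos flagc_pos) auto
  fix u :: "('a \<Rightarrow> bit) set" assume u: "fvs.subspace u" "fvs.dim u = j"
  have fV: "finite V" and V: "fvs.subspace V" using p by (auto simp: pure_def)
  have p': "pure V k (flag_marginal k \<mu>)" by (rule pure_flag_marginal[OF p k(2)])
  show "Nm (flag_marginal k \<mu>) u = c * Nm \<mu> u"
  proof (cases "u \<subseteq> V")
    case False
    then have "Nm \<mu> u = 0" "Nm (flag_marginal k \<mu>) u = 0"
      using Nm_eq_0[OF p] Nm_eq_0[OF p'] by auto
    then show ?thesis by simp
  next
    case True
    have fu: "finite u" using True fV finite_subset by auto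
    define K where "K = {..<k - j}"
    define G where "G = {w. fvs.subspace w \<and> fvs.dim w = k \<and> w \<subseteq> V \<and> u \<subseteq> w}"
    have fG: "finite G" using fV by (intro finite_subset[of G "Pow V"]) (auto simp: G_def)
    have e: "Ind V u {} = {\<lambda>_. undefined}" by (auto simp: Ind_def)
    have "extc l j (k - j) * Nm \<mu> u = (\<Sum>z\<in>Ind V u K. Nm \<mu> (ssp u z K))"
      using harm_marginal[OF harm_Nm[OF p] u(1) True card_subspace[OF u(1) fu], of "{}" K "\<lambda>_. 1"] u
      by (simp add: e K_def)
    also have "\<dots> = (\<Sum>w\<in>G. \<Sum>z\<in>{z \<in> Ind V u K. ssp u z K = w}. Nm \<mu> (ssp u z K))"
    proof (intro sum.group[symmetric] fG)
      show "finite (Ind V u K)" using fV by (simp add: finite_Ind K_def)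
      show "(\<lambda>z. ssp u z K) ` Ind V u K \<subseteq> G"
      proof clarify
        fix z assume z: "z \<in> Ind V u K"
        have "fvs.dim (ssp u z K) = k" using dim_ssp[of K u z] z u fu k by (auto simp: K_def Ind_def)
        moreover have "ssp u z K \<subseteq> V" using z True V by (intro ssp_subset) (auto simp: Ind_def)
        ultimately show "ssp u z K \<in> G" using u ssp_base[OF u(1)] by (auto simp: G_def K_def subspace_ssp)
      qed
    qed
    also have "\<dots> = (\<Sum>w\<in>G. extc k j (k - j) * Nm \<mu> w)"
    proof (rule sum.cong[OF refl])
      fix w assume "w \<in> G"
      then have w: "fvs.subspace w" "fvs.dim w = k" "w \<subseteq> V" "u \<subseteq> w" by (auto simp: G_def)
      have fw: "finite w" using w fV finite_subset by auto
      have "{z \<in> Ind V u K. ssp u z K = w} = Ind w u K"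
      proof (intro equalityI subsetI)
        fix z assume z: "z \<in> Ind w u K"
        then have "ssp u z K = w" using ssp_Ind_full[OF w(1) fw u(1) w(4) z] u w k by (simp add: K_def)
        then show "z \<in> {z \<in> Ind V u K. ssp u z K = w}" using z w by (auto simp: Ind_def)
      next
        fix z assume z: "z \<in> {z \<in> Ind V u K. ssp u z K = w}"
        then have "z k' \<in> w" if "k' \<in> K" for k' using ssp_gen[OF u(1), of K k' z] that by (auto simp: K_def)
        then show "z \<in> Ind w u K" using z by (auto simp: Ind_def PiE_iff)
      qed
      then have "(\<Sum>z\<in>{z \<in> Ind V u K. ssp u z K = w}. Nm \<mu> (ssp u z K)) = (\<Sum>z\<in>Ind w u K. Nm \<mu> w)"
        by (intro sum.cong) auto
      also have "\<dots> = extc k j (k - j) * Nm \<mu> w"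
        using card_Ind[OF fw w(1) u(1) w(4), of K] w u by (simp add: K_def)
      finally show "(\<Sum>z\<in>{z \<in> Ind V u K. ssp u z K = w}. Nm \<mu> (ssp u z K)) = extc k j (k - j) * Nm \<mu> w" .
    qed
    finally have *: "extc l j (k - j) * Nm \<mu> u = extc k j (k - j) * (\<Sum>w\<in>G. Nm \<mu> w)"
      by (simp add: sum_distrib_left)
    have pos: "extc k j (k - j) > 0" using k by (intro extc_pos) auto
    have "Nm (flag_marginal k \<mu>) u = (\<Sum>w\<in>set_pmf (flag_marginal k \<mu>). pmf (flag_marginal k \<mu>) w * of_bool (u \<subseteq> w))"
      by (rule Nm_sum[OF p'])
    also have "\<dots> = (\<Sum>w\<in>G. flagc l k k * Nm \<mu> w)"
    proof (rule sum.mono_neutral_cong[OF fG pure_finite[OF p']])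
      show "\<And>w. w \<in> G - set_pmf (flag_marginal k \<mu>) \<Longrightarrow> flagc l k k * Nm \<mu> w = 0"
        by (auto simp: G_def set_pmf_eq pmf_flag_marginal[OF p k(2)])
      show "\<And>w. w \<in> set_pmf (flag_marginal k \<mu>) - G \<Longrightarrow> pmf (flag_marginal k \<mu>) w * of_bool (u \<subseteq> w) = 0"
        using p' by (auto simp: G_def pure_def)
      show "\<And>w. w \<in> set_pmf (flag_marginal k \<mu>) \<inter> G \<Longrightarrow> pmf (flag_marginal k \<mu>) w * of_bool (u \<subseteq> w) = flagc l k k * Nm \<mu> w"
        by (auto simp: G_def pmf_flag_marginal[OF p k(2)])
    qed
    also have "\<dots> = flagc l k k * (\<Sum>w\<in>G. Nm \<mu> w)" by (simp add: sum_distrib_left)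
    also have "\<dots> = c * Nm \<mu> u" using * pos by (simp add: c_def field_simps)
    finally show ?thesis .
  qed
qed

section \<open>Edge weights of links\<close>

text \<open>Unnormalised vertex weight in the link of \<open>S\<close>, set to zero on degenerate
  vectors so that sums may range over the whole ambient space; \<open>n2\<close> is the matching
  weight of an ordered edge.\<close>

definition n1 :: "(('i \<Rightarrow> bit) set \<Rightarrow> real) \<Rightarrow> ('i \<Rightarrow> bit) set \<Rightarrow> ('i \<Rightarrow> bit) \<Rightarrow> real" where
  "n1 n S a = (if a \<in> S then 0 else n (sp1 S a))"

definition n2 :: "(('i \<Rightarrow> bit) set \<Rightarrow> real) \<Rightarrow> ('i \<Rightarrow> bit) set \<Rightarrow> ('i \<Rightarrow> bit) \<Rightarrow> ('i \<Rightarrow> bit) \<Rightarrow> real" where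
  "n2 n S a b = (if a \<in> S then 0 else n1 n (sp1 S a) b)"

lemma sp1_sp1_span: 
  assumes "fvs.subspace w" shows "sp1 (sp1 w v) v' = fvs.span ({v, v'} \<union> w)"
proof -
  have "fvs.span (insert v' (fvs.span (insert v w))) = fvs.span (insert v' (insert v w))"
  proof
    show "fvs.span (insert v' (fvs.span (insert v w))) \<subseteq> fvs.span (insert v' (insert v w))"
      by (intro fvs.span_minimal)
        (auto intro: fvs.span_base fvs.span_mono[THEN subsetD, rotated])
    show "fvs.span (insert v' (insert v w)) \<subseteq> fvs.span (insert v' (fvs.span (insert v w)))"
      by (intro fvs.span_mono) (auto intro: fvs.span_base)
  qed
  then show ?thesis using assms by (simp add: sp1_eq_span insert_commute)
qed

lemma dim_sp1_sp1:
  fixes w :: "('a \<Rightarrow> bit) set"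
  assumes w: "fvs.subspace w" "finite w"
  shows "fvs.dim (sp1 (sp1 w v) v') = fvs.dim w + 2 \<longleftrightarrow> v \<notin> w \<and> v' \<notin> sp1 w v"
proof -
  have triv: "sp1 S a = S" if "fvs.subspace S" "a \<in> S" for S and a :: "'a \<Rightarrow> bit"
    using that by (auto simp: sp1_def subspace_bit_iff)
  have up: "fvs.dim (sp1 S a) \<le> fvs.dim S + 1" if "fvs.subspace S" "finite S" for S and a :: "'a \<Rightarrow> bit"
    using that triv[of S a] dim_sp1[of S a] by (cases "a \<in> S") simp_all
  have s: "fvs.subspace (sp1 w v)" "finite (sp1 w v)" using w by (auto simp: subspace_sp1 finite_sp1)
  show ?thesis
  proof (cases "v \<in> w")
    case True
    then show ?thesis using up[OF w, of v'] triv[OF w(1) True] by simp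
  next
    case False
    then have d: "fvs.dim (sp1 w v) = fvs.dim w + 1" by (rule dim_sp1[OF w])
    show ?thesis
    proof (cases "v' \<in> sp1 w v")
      case True
      then show ?thesis using triv[OF s(1) True] d by simp
    next
      case F2: False
      then show ?thesis using dim_sp1[OF s F2] d False by simp
    qed
  qed
qed

text \<open>This number depends on the dimension only, so choosing a uniform pair over a given span
  contributes a constant factor to the edge distribution.\<close>

lemma card_span_pairs:
  fixes w :: "('a \<Rightarrow> bit) set"
  assumes w: "fvs.subspace w" and u: "fvs.subspace u" "finite u" and wu: "w \<subseteq> u" "fvs.dim u = fvs.dim w + 2"
  shows "real (card {(v, v'). fvs.span ({v, v'} \<union> w) = u}) = extc (fvs.dim w + 2) (fvs.dim w) 2"
proof -
  have fw: "finite w" using wu u finite_subset by auto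
  have eq: "{(v, v'). fvs.span ({v, v'} \<union> w) = u} = Sigma (u - w) (\<lambda>v. u - sp1 w v)"
  proof (intro equalityI subrelI)
    fix v v' assume "(v, v') \<in> {(v, v'). fvs.span ({v, v'} \<union> w) = u}"
    then have sp: "fvs.span ({v, v'} \<union> w) = u" by simp
    then have "v \<in> u" "v' \<in> u" by (auto intro: fvs.span_base)
    moreover have "v \<notin> w \<and> v' \<notin> sp1 w v"
    proof -
      have "fvs.dim (sp1 (sp1 w v) v') = fvs.dim w + 2" by (simp only: sp1_sp1_span[OF w] sp wu(2))
      then show ?thesis using dim_sp1_sp1[OF w fw, of v v'] by blast
    qed
    ultimately show "(v, v') \<in> Sigma (u - w) (\<lambda>v. u - sp1 w v)" by auto
  next
    fix v v' assume "(v, v') \<in> Sigma (u - w) (\<lambda>v. u - sp1 w v)"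
    then have v: "v \<in> u" "v \<notin> w" "v' \<in> u" "v' \<notin> sp1 w v" by auto
    have "sp1 (sp1 w v) v' = u"
    proof (rule subspace_eq_of_dim)
      show "sp1 (sp1 w v) v' \<subseteq> u" using v u wu by (intro sp1_subset) auto
      show "fvs.dim u \<le> fvs.dim (sp1 (sp1 w v) v')" using dim_sp1_sp1[OF w fw, of v v'] v wu by simp
    qed (use u w subspace_sp1 in auto)
    then show "(v, v') \<in> {(v, v'). fvs.span ({v, v'} \<union> w) = u}" by (simp add: sp1_sp1_span[OF w])
  qed
  have cw: "card w = 2 ^ fvs.dim w" using card_subspace[OF w fw] .
  have cu: "card u = 2 ^ (fvs.dim w + 2)" using card_subspace[OF u] wu by simp
  have c1: "real (card (u - sp1 w v)) = 2 ^ (fvs.dim w + 2) - 2 ^ (fvs.dim w + 1)" if v: "v \<in> u - w" for v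
  proof -
    have "sp1 w v \<subseteq> u" using v u wu by (intro sp1_subset) auto
    moreover have "card (sp1 w v) = 2 ^ (fvs.dim w + 1)" using v card_sp1[OF w fw] cw by simp
    ultimately show ?thesis using cu u finite_sp1[OF fw]
      by (simp add: card_Diff_subset of_nat_diff power_add)
  qed
  have "real (card (Sigma (u - w) (\<lambda>v. u - sp1 w v))) = (\<Sum>v\<in>u - w. real (card (u - sp1 w v)))"
    using u by (subst card_SigmaI) auto
  also have "\<dots> = real (card (u - w)) * (2 ^ (fvs.dim w + 2) - 2 ^ (fvs.dim w + 1))"
    by (subst sum.cong[OF refl c1]) auto
  also have "real (card (u - w)) = 2 ^ (fvs.dim w + 2) - 2 ^ fvs.dim w"
    using cw cu wu u fw by (simp add: card_Diff_subset of_nat_diff power_add)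
  finally show ?thesis unfolding eq by (simp add: extc_def numeral_2_eq_2)
qed

text \<open>Conditioning on \<open>w\<close> and the uniform choice of a pair are divisions by
  constants. What remains is the probability that a flag passes through \<open>w\<close> and through
  the span of the pair, which \<open>prob_flag_pair\<close> evaluates; degenerate pairs have weight
  zero on both sides.\<close>

lemma pmf_link_edge:
  assumes p: "pure V l \<mu>" and w: "fvs.subspace w" "w \<subseteq> V" "fvs.dim w + 2 \<le> l" and pos: "Nm \<mu> w > 0"
  shows "\<exists>c>0. \<forall>v v'. pmf (link_edge_pmf \<mu> w) (v, v') = c * n2 (Nm \<mu>) w v v'"
proof (intro exI conjI allI)
  let ?i = "fvs.dim w"
  have fV: "finite V" and V: "fvs.subspace V" using p by (auto simp: pure_def)
  have fw: "finite w" using w fV finite_subset by auto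
  define M where "M = extc (?i + 2) ?i 2"
  define R where "R = measure_pmf.prob (random_flag \<mu>) {fl. fl ! ?i = w}"
  define c where "c = flagc l ?i (?i + 2) / R / M"
  have Mpos: "M > 0" unfolding M_def by (intro extc_pos) auto
  have Rpos: "R > 0" unfolding R_def using prob_flag_nth[OF p w(1) refl w(2)] w pos flagc_pos[of ?i ?i l] by simp
  show "c > 0" unfolding c_def using Mpos Rpos w by (intro divide_pos_pos flagc_pos) auto
  fix v v'
  define U where "U = fvs.span ({v, v'} \<union> w)"
  let ?A = "{fl. fl ! ?i = w}"
  have ne: "set_pmf (random_flag \<mu>) \<inter> ?A \<noteq> {}" using Rpos unfolding R_def
    by (metis measure_pmf_zero_iff order_less_irrefl)
  have val: "pmf (pmf_of_set {(v, v'). fvs.span ({v, v'} \<union> w) = fl ! (?i + 2)}) (v, v') =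
      indicator {fl. fl ! (?i + 2) = U} fl / M"
    if fl: "fl \<in> set_pmf (cond_pmf (random_flag \<mu>) ?A)" for fl
  proof -
    have fl': "fl \<in> set_pmf (random_flag \<mu>)" "fl ! ?i = w" using fl ne by (auto simp: set_cond_pmf)
    define u where "u = fl ! (?i + 2)"
    have u: "fvs.dim u = ?i + 2" "fvs.subspace u" "u \<subseteq> V" unfolding u_def
      using random_flag_nth[OF p fl'(1) w(3)] by auto
    have fu: "finite u" using u fV finite_subset by auto
    have wu: "w \<subseteq> u"
    proof -
      obtain W where W: "W \<in> set_pmf \<mu>" "fl \<in> complete_flags W" using random_flag_support[OF p fl'(1)] by auto
      then have "length fl = l + 1" "sorted_wrt (\<subset>) fl" using p by (auto simp: complete_flags_def pure_def)
      then have "fl ! ?i \<subset> fl ! (?i + 2)" using w by (intro sorted_wrt_nth_less[of "(\<subset>)" fl]) auto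
      then show ?thesis using fl' by (auto simp: u_def)
    qed
    let ?S = "{(v, v'). fvs.span ({v, v'} \<union> w) = u}"
    have cS: "real (card ?S) = M" unfolding M_def by (rule card_span_pairs[OF w(1) u(2) fu wu u(1)])
    then have "card ?S > 0" using Mpos by (simp only: of_nat_0_less_iff[symmetric, where 'a = real])
    then have "finite ?S" "?S \<noteq> {}" by (auto simp only: card_gt_0_iff)
    then have "pmf (pmf_of_set ?S) (v, v') = indicator ?S (v, v') / real (card ?S)" by (rule pmf_of_set[rotated])
    then show ?thesis unfolding cS by (auto simp: indicator_def u_def U_def)
  qed
  have "pmf (link_edge_pmf \<mu> w) (v, v') =
      measure_pmf.expectation (cond_pmf (random_flag \<mu>) ?A) (\<lambda>fl. indicator {fl. fl ! (?i + 2) = U} fl / M)"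
    unfolding link_edge_pmf_def pmf_bind
    by (rule integral_cong_AE) (simp, simp, rule AE_pmfI, rule val)
  also have "\<dots> = measure_pmf.prob (cond_pmf (random_flag \<mu>) ?A) {fl. fl ! (?i + 2) = U} / M"
    by simp
  also have "measure_pmf.prob (cond_pmf (random_flag \<mu>) ?A) {fl. fl ! (?i + 2) = U} =
      measure_pmf.prob (random_flag \<mu>) {fl. fl ! ?i = w \<and> fl ! (?i + 2) = U} / R"
  proof -
    have "measure_pmf.prob (cond_pmf (random_flag \<mu>) ?A) {fl. fl ! (?i + 2) = U} =
        measure_pmf.prob (random_flag \<mu>) (?A \<inter> {fl. fl ! (?i + 2) = U}) / R"
      unfolding R_def cond_pmf.rep_eq[OF ne]
      using Rpos by (intro measure_uniform_measure) (auto simp: R_def measure_pmf.emeasure_eq_measure)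
    then show ?thesis by (simp add: Int_def)
  qed
  also have "measure_pmf.prob (random_flag \<mu>) {fl. fl ! ?i = w \<and> fl ! (?i + 2) = U} =
      flagc l ?i (?i + 2) * n2 (Nm \<mu>) w v v'"
  proof (cases "fvs.dim U = ?i + 2 \<and> U \<subseteq> V")
    case True
    have "w \<subseteq> U" unfolding U_def by (auto intro: fvs.span_base)
    then have "measure_pmf.prob (random_flag \<mu>) {fl. fl ! ?i = w \<and> fl ! (?i + 2) = U} =
      flagc l ?i (?i + 2) * Nm \<mu> U"
      using True w by (intro prob_flag_pair[OF p w(1) refl]) (auto simp: U_def)
    moreover have "n2 (Nm \<mu>) w v v' = Nm \<mu> U"
      using True dim_sp1_sp1[OF w(1) fw, of v v'] by (simp add: n2_def n1_def U_def sp1_sp1_span[OF w(1)])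
    ultimately show ?thesis by simp
  next
    case False
    have "measure_pmf.prob (random_flag \<mu>) {fl. fl ! ?i = w \<and> fl ! (?i + 2) = U} = 0"
      unfolding measure_pmf_zero_iff using False random_flag_nth[OF p _ w(3)] by auto
    moreover have "n2 (Nm \<mu>) w v v' = 0"
    proof (cases "fvs.dim U = ?i + 2")
      case True
      then have "Nm \<mu> U = 0" using False Nm_eq_0[OF p] by auto
      then show ?thesis by (simp add: n2_def n1_def U_def sp1_sp1_span[OF w(1)])
    next
      case False
      then show ?thesis using dim_sp1_sp1[OF w(1) fw, of v v']
        by (auto simp: n2_def n1_def U_def sp1_sp1_span[OF w(1)])
    qed
    ultimately show ?thesis by simp
  qed
  finally show "pmf (link_edge_pmf \<mu> w) (v, v') = c * n2 (Nm \<mu>) w v v'"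
    by (simp add: c_def)
qed

section \<open>The second eigenvalue and mean-zero functions\<close>

text \<open>Functions on an arbitrary index type carry the product topology, so compactness comes
  from Tychonoff's theorem. A zero bound pins a coordinate, which later keeps functions supported on
  the vertices.\<close>

lemma compact_box:
  fixes c :: "'v \<Rightarrow> real"
  shows "compact {f. \<forall>v. f v \<in> {-c v..c v}}"
proof -
  have "compactin (product_topology (\<lambda>i::'v. euclidean :: real topology) UNIV) (PiE UNIV (\<lambda>v. {-c v..c v}))"
    unfolding compactin_PiE by (simp add: compactin_euclidean_iff)
  then have "compact (PiE UNIV (\<lambda>v. {-c v..c v}))"
    by (simp add: euclidean_product_topology compactin_euclidean_iff)
  moreover have "PiE UNIV (\<lambda>v. {-c v..c v}) = {f. \<forall>v. f v \<in> {-c v..c v}}"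
    by (auto simp: PiE_def Pi_def)
  ultimately show ?thesis by simp
qed

text \<open>First-order optimality: for small \<open>t\<close> a nonzero linear term would dominate
  the quadratic one and take a negative value.\<close>

lemma linear_term_zero:
  fixes a c :: real
  assumes "\<And>t. 0 \<le> 2 * t * a + t\<^sup>2 * c"
  shows "a = 0"
proof (rule ccontr)
  assume a: "a \<noteq> 0"
  define C where "C = \<bar>c\<bar> + 1"
  have C: "C > 0" "c < C" by (auto simp: C_def)
  have "0 \<le> 2 * (- a / C) * a + (- a / C)\<^sup>2 * c" by (rule assms)
  also have "\<dots> = (a\<^sup>2 / C\<^sup>2) * (c - 2 * C)"
    using C by (simp add: field_simps power2_eq_square)
  also have "\<dots> < 0" using a C by (intro mult_pos_neg) auto
  finally show False by simp
qed

text \<open>By compactness the Rayleigh quotient attains its maximum on mean-zero functions, and a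
  maximiser is an eigenfunction. This variational route yields the extremal eigenvalue without
  diagonalising the operator.\<close>

lemma extremal_eigenfunction:
  fixes U :: "'v set" and p :: "'v \<Rightarrow> real" and k :: "'v \<Rightarrow> 'v \<Rightarrow> real"
  assumes U: "finite U" "card U \<ge> 2" and p: "\<And>u. u \<in> U \<Longrightarrow> p u > 0"
    and sym: "\<And>u v. u \<in> U \<Longrightarrow> v \<in> U \<Longrightarrow> k u v = k v u"
    and row: "\<And>u. u \<in> U \<Longrightarrow> (\<Sum>v\<in>U. k u v) = p u"
  shows "\<exists>\<beta> f. (\<forall>v. v \<notin> U \<longrightarrow> f v = 0) \<and> (\<exists>v\<in>U. f v \<noteq> 0) \<and> (\<Sum>u\<in>U. p u * f u) = 0 \<and>
    (\<forall>u\<in>U. (\<Sum>v\<in>U. k u v * f v) = \<beta> * p u * f u) \<and>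
    (\<forall>g. (\<Sum>u\<in>U. p u * g u) = 0 \<longrightarrow> (\<Sum>u\<in>U. \<Sum>v\<in>U. k u v * g u * g v) \<le> \<beta> * (\<Sum>u\<in>U. p u * (g u)\<^sup>2))"
proof -
  define P where "P = (\<lambda>g. \<Sum>u\<in>U. p u * (g u)\<^sup>2)"
  define Q where "Q = (\<lambda>g. \<Sum>u\<in>U. \<Sum>v\<in>U. k u v * g u * g v)"
  define m where "m = (\<lambda>g. \<Sum>u\<in>U. p u * g u)"
  \<comment> \<open>On the unit sphere \<open>p v * (g v)\<^sup>2 \<le> 1\<close>, so the bound
    \<open>1 + 1 / p v\<close> encloses it; the bound 0 makes functions vanish outside
    \<open>U\<close>.\<close>
  define c where "c = (\<lambda>v. if v \<in> U then 1 + 1 / p v else 0)"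
  define B where "B = {f. \<forall>v. f v \<in> {-c v..c v}} \<inter> {f. m f = 0} \<inter> {f. P f = 1}"
  have cont: "continuous_on UNIV (\<lambda>f. f v)" for v :: 'v by simp
  have contP: "continuous_on UNIV P" unfolding P_def by (intro continuous_intros cont)
  have contQ: "continuous_on UNIV Q" unfolding Q_def by (intro continuous_intros cont)
  have contm: "continuous_on UNIV m" unfolding m_def by (intro continuous_intros cont)
  have "compact B" unfolding B_def
    by (intro compact_Int_closed compact_box closed_Collect_eq contP contm continuous_intros)
  have pn: "0 \<le> p u" if "u \<in> U" for u using p[OF that] by simp
  have Pnn: "P g \<ge> 0" for g unfolding P_def using pn by (intro sum_nonneg mult_nonneg_nonneg) auto
  have P0: "g u = 0" if "P g = 0" "u \<in> U" for g u
  proof -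
    have "\<forall>u\<in>U. p u * (g u)\<^sup>2 = 0"
      using that(1) U(1) pn unfolding P_def by (subst (asm) sum_nonneg_eq_0_iff) auto
    then show ?thesis using that(2) p by fastforce
  qed
  have Pscale: "P (\<lambda>u. a * g u) = a\<^sup>2 * P g" for a g
    by (simp add: P_def sum_distrib_left power_mult_distrib algebra_simps)
  have Qscale: "Q (\<lambda>u. a * g u) = a\<^sup>2 * Q g" for a g
    by (simp add: Q_def sum_distrib_left power2_eq_square algebra_simps)
  have mscale: "m (\<lambda>u. a * g u) = a * m g" for a g
    by (simp add: m_def sum_distrib_left algebra_simps)
  have norm: "\<exists>g'. g' \<in> B \<and> Q g = P g * Q g'" if g: "m g = 0" "P g \<noteq> 0" for g
  proof -
    define g' where "g' = (\<lambda>u. (1 / sqrt (P g)) * (if u \<in> U then g u else 0))"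
    have Pg: "P g > 0" using g Pnn[of g] by simp
    have r: "P (\<lambda>u. if u \<in> U then g u else 0) = P g" "Q (\<lambda>u. if u \<in> U then g u else 0) = Q g" "m (\<lambda>u. if u \<in> U then g u else 0) = m g"
      by (auto simp: P_def Q_def m_def intro!: sum.cong)
    have P1: "P g' = 1" unfolding g'_def Pscale r using Pg by (simp add: power_divide)
    have m0: "m g' = 0" unfolding g'_def mscale r using g by simp
    have Q': "Q g = P g * Q g'" unfolding g'_def Qscale r using Pg by (simp add: power_divide)
    have "g' v \<in> {-c v..c v}" for v
    proof (cases "v \<in> U")
      case True
      have "p v * (g' v)\<^sup>2 \<le> P g'" unfolding P_def
        using True U(1) pn by (intro member_le_sum) auto
      then have "(g' v)\<^sup>2 \<le> 1 / p v" using P1 p[OF True] by (simp add: field_simps)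
      also have "\<dots> \<le> (1 + 1 / p v)\<^sup>2"
      proof -
        have "a \<le> (1 + a)\<^sup>2" if "0 \<le> a" for a :: real
          using that zero_le_power2[of a] by (simp add: power2_sum)
        then show ?thesis using p[OF True] by simp
      qed
      finally have "\<bar>g' v\<bar> \<le> \<bar>1 + 1 / p v\<bar>" using abs_le_square_iff by blast
      moreover have "\<bar>1 + 1 / p v\<bar> = 1 + 1 / p v" using p[OF True] by simp
      ultimately show ?thesis using True by (auto simp: c_def)
    next
      case False then show ?thesis by (simp add: c_def g'_def)
    qed
    then have "g' \<in> B" using P1 m0 by (simp add: B_def)
    then show ?thesis using Q' by blast
  qed
  have "B \<noteq> {}"
  proof -
    obtain a b where ab: "a \<in> U" "b \<in> U" "a \<noteq> b" using U
      by (metis One_nat_def Suc_1 card_le_Suc0_iff_eq not_less_eq_eq)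
    \<comment> \<open>Two opposite values, scaled by the weights, give a nonzero function of mean
      zero. Here \<open>U\<close> has to have two elements.\<close>
    define g where "g = (\<lambda>u. if u = a then 1 / p a else if u = b then - 1 / p b else 0)"
    have "m g = (\<Sum>u\<in>{a, b}. p u * g u)" unfolding m_def
      using ab U by (intro sum.mono_neutral_right) (auto simp: g_def)
    also have "\<dots> = 0" using ab p[OF ab(1)] p[OF ab(2)] by (simp add: g_def)
    finally have m0: "m g = 0" .
    have "g a \<noteq> 0" using p[OF ab(1)] by (simp add: g_def)
    then have "P g \<noteq> 0" using P0[of g a] ab by auto
    then show ?thesis using norm[OF m0] by auto
  qed
  then obtain f where f: "f \<in> B" "\<And>g. g \<in> B \<Longrightarrow> Q g \<le> Q f"
    using continuous_attains_sup[OF \<open>compact B\<close> _ continuous_on_subset[OF contQ]] by auto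
  define \<beta> where "\<beta> = Q f"
  have mf: "m f = 0" and Pf: "P f = 1" using f(1) by (auto simp: B_def)
  have out: "f v = 0" if "v \<notin> U" for v
  proof -
    have "f v \<in> {-c v..c v}" using f(1) by (auto simp: B_def)
    then show ?thesis using that by (simp add: c_def)
  qed
  have max: "Q g \<le> \<beta> * P g" if mg: "m g = 0" for g
  proof (cases "P g = 0")
    case True
    then have "Q g = 0" using P0[OF True] by (simp add: Q_def)
    then show ?thesis using True by simp
  next
    case False
    then obtain g' where "g' \<in> B" "Q g = P g * Q g'" using norm[OF mg] by blast
    then show ?thesis using f(2)[of g'] Pnn[of g] by (simp add: \<beta>_def mult.commute mult_left_mono)
  qed
  define A where "A = (\<lambda>u. \<Sum>v\<in>U. k u v * f v)"
  \<comment> \<open>The residual of the eigenvalue equation. It has mean zero because the row sums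
    are \<open>p\<close>, so \<open>f + t * h\<close> competes with the maximiser for every
    \<open>t\<close>. The linear coefficient of the resulting inequality is twice
    \<open>P h\<close>, which must therefore vanish.\<close>
  define h where "h = (\<lambda>u. if u \<in> U then \<beta> * f u - A u / p u else 0)"
  have sumA: "(\<Sum>u\<in>U. A u) = 0"
  proof -
    have "(\<Sum>u\<in>U. A u) = (\<Sum>v\<in>U. \<Sum>u\<in>U. k u v * f v)" unfolding A_def by (rule sum.swap)
    also have "\<dots> = (\<Sum>v\<in>U. p v * f v)"
    proof (rule sum.cong[OF refl])
      fix v assume v: "v \<in> U"
      have "(\<Sum>u\<in>U. k u v * f v) = (\<Sum>u\<in>U. k v u) * f v"
        using v sym by (subst sum_distrib_right) (auto intro!: sum.cong)
      then show "(\<Sum>u\<in>U. k u v * f v) = p v * f v" using row[OF v] by simp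
    qed
    finally show ?thesis using mf by (simp add: m_def)
  qed
  have ph: "p u * h u = \<beta> * (p u * f u) - A u" if "u \<in> U" for u
    using p[OF that] that by (simp add: h_def field_simps)
  have mh: "m h = 0"
  proof -
    have "m h = (\<Sum>u\<in>U. \<beta> * (p u * f u) - A u)" unfolding m_def by (intro sum.cong) (auto simp: ph)
    also have "\<dots> = \<beta> * m f - (\<Sum>u\<in>U. A u)" by (simp add: sum_subtractf sum_distrib_left m_def)
    finally show ?thesis using mf sumA by simp
  qed
  have "P h = 0"
  proof (rule linear_term_zero)
    fix t :: real
    define g where "g = (\<lambda>u. f u + t * h u)"
    have "m g = m f + t * m h" by (simp add: m_def g_def sum.distrib sum_distrib_left algebra_simps)
    then have le: "Q g \<le> \<beta> * P g" using mf mh by (intro max) simp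
    define X where "X = (\<Sum>u\<in>U. p u * f u * h u)"
    define Y where "Y = (\<Sum>u\<in>U. A u * h u)"
    have Pg: "P g = P f + 2 * t * X + t\<^sup>2 * P h"
      by (simp add: X_def P_def g_def sum.distrib sum_distrib_left algebra_simps power2_eq_square)
    have Qg: "Q g = Q f + 2 * t * Y + t\<^sup>2 * Q h"
    proof -
      have "Q g = Q f + t * (\<Sum>u\<in>U. \<Sum>v\<in>U. k u v * f u * h v) + t * (\<Sum>u\<in>U. \<Sum>v\<in>U. k u v * h u * f v) + t\<^sup>2 * Q h"
        by (simp add: Q_def g_def sum.distrib sum_distrib_left algebra_simps power2_eq_square)
      moreover have "(\<Sum>u\<in>U. \<Sum>v\<in>U. k u v * f u * h v) = (\<Sum>u\<in>U. A u * h u)"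
      proof -
        have "(\<Sum>u\<in>U. \<Sum>v\<in>U. k u v * f u * h v) = (\<Sum>v\<in>U. \<Sum>u\<in>U. k u v * f u * h v)" by (rule sum.swap)
        also have "\<dots> = (\<Sum>v\<in>U. A v * h v)"
          unfolding A_def using sym by (intro sum.cong refl) (auto simp: sum_distrib_right intro!: sum.cong)
        finally show ?thesis .
      qed
      moreover have "(\<Sum>u\<in>U. \<Sum>v\<in>U. k u v * h u * f v) = (\<Sum>u\<in>U. A u * h u)"
        unfolding A_def sum_distrib_right by (intro sum.cong refl) (simp add: ac_simps)
      ultimately show ?thesis by (simp add: Y_def)
    qed
    have Ph: "P h = \<beta> * X - Y"
    proof -
      have "P h = (\<Sum>u\<in>U. (p u * h u) * h u)" by (simp add: P_def power2_eq_square algebra_simps)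
      also have "\<dots> = (\<Sum>u\<in>U. (\<beta> * (p u * f u) - A u) * h u)" by (intro sum.cong) (auto simp: ph)
      finally show ?thesis by (simp add: X_def Y_def sum_subtractf sum_distrib_left algebra_simps)
    qed
    have "\<beta> * P g - Q g = 2 * t * (\<beta> * X - Y) + t\<^sup>2 * (\<beta> * P h - Q h)"
      unfolding Pg Qg Pf \<beta>_def[symmetric] by (simp add: algebra_simps)
    then have "0 \<le> 2 * t * P h + t\<^sup>2 * (\<beta> * P h - Q h)"
      using le unfolding Ph[symmetric] by linarith
    then show "0 \<le> 2 * t * P h + t\<^sup>2 * (\<beta> * P h - Q h)" .
  qed
  then have eig: "A u = \<beta> * p u * f u" if "u \<in> U" for u
    using P0[of h u] ph[OF that] that by simp
  have nz: "\<exists>v\<in>U. f v \<noteq> 0"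
  proof (rule ccontr)
    assume "\<not> ?thesis"
    then have "P f = 0" by (simp add: P_def)
    then show False using Pf by simp
  qed
  show ?thesis
    using out nz mf eig max unfolding A_def m_def P_def Q_def by blast
qed

lemma size_filter_sum_replicate:
  "finite A \<Longrightarrow> size (filter_mset P (\<Sum>\<theta>\<in>A. replicate_mset (n \<theta>) (g \<theta>))) = (\<Sum>\<theta>\<in>A. if P (g \<theta>) then n \<theta> else 0)"
proof (induction A rule: finite_induct)
  case (insert \<theta> A)
  have "size (filter_mset P (replicate_mset m x)) = (if P x then m else 0)" for m x
    by (induction m) auto
  then show ?case using insert by simp
qed simp

text \<open>Position 1 of the decreasing list is controlled by how many entries exceed, or reach,
  \<open>c\<close>; such counts are sums of eigenspace dimensions.\<close>

lemma second_largest: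
  fixes M :: "real multiset"
  assumes "size M \<ge> 2"
  shows "size (filter_mset (\<lambda>x. x > c) M) \<le> 1 \<Longrightarrow> rev (sorted_list_of_multiset M) ! 1 \<le> c"
    and "size (filter_mset (\<lambda>x. x \<ge> c) M) \<ge> 2 \<Longrightarrow> rev (sorted_list_of_multiset M) ! 1 \<ge> c"
proof -
  define l where "l = rev (sorted_list_of_multiset M)"
  have ml: "mset l = M" by (simp add: l_def)
  have srt: "sorted (rev l)" by (simp add: l_def)
  have "length l \<ge> 2" using assms ml by (metis size_mset)
  then obtain x y zs where l: "l = x # y # zs"
    by (metis One_nat_def Suc_1 Suc_le_length_iff)
  have xy: "x \<ge> y" "\<forall>z\<in>set zs. z \<le> y" using srt by (auto simp: l sorted_append)
  have f: "size (filter_mset P M) = length (filter P l)" for P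
    using ml by (metis mset_filter size_mset)
  show "rev (sorted_list_of_multiset M) ! 1 \<le> c" if "size (filter_mset (\<lambda>x. x > c) M) \<le> 1"
  proof (rule ccontr)
    assume "\<not> ?thesis"
    then have "y > c" by (simp add: l_def[symmetric] l)
    then show False using that xy unfolding f by (simp add: l)
  qed
  show "rev (sorted_list_of_multiset M) ! 1 \<ge> c" if "size (filter_mset (\<lambda>x. x \<ge> c) M) \<ge> 2"
  proof (rule ccontr)
    assume "\<not> ?thesis"
    then have "y < c" by (simp add: l_def[symmetric] l)
    moreover have "filter (\<lambda>x. x \<ge> c) zs = []" using xy \<open>y < c\<close> by (auto simp: filter_empty_conv)
    ultimately show False using that unfolding f by (simp add: l split: if_splits)
  qed
qed

section \<open>Eigenvalues of the random walk on a finite weighted graph\<close>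

locale wgraph =
  fixes U :: "'v set" and E :: "('v \<times> 'v) pmf" and p :: "'v \<Rightarrow> real"
  assumes U: "finite U" "card U \<ge> 2" and supp: "set_pmf E \<subseteq> U \<times> U"
    and sym: "\<And>u v. pmf E (u, v) = pmf E (v, u)"
    and pdef: "p = pmf (map_pmf fst E)"
    and pos: "\<And>v. v \<in> U \<Longrightarrow> p v > 0"
begin

lemma row: "u \<in> U \<Longrightarrow> (\<Sum>v\<in>U. pmf E (u, v)) = p u"
proof -
  have "p u = measure_pmf.prob E (fst -` {u})" by (simp add: pdef pmf_map)
  also have "\<dots> = measure_pmf.prob E ((fst -` {u}) \<inter> set_pmf E)" by (simp add: measure_Int_set_pmf)
  also have "\<dots> = measure_pmf.prob E (((\<lambda>v. (u, v)) ` U) \<inter> set_pmf E)"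
    using supp by (intro arg_cong[of _ _ "measure_pmf.prob E"]) auto
  also have "\<dots> = measure_pmf.prob E ((\<lambda>v. (u, v)) ` U)" by (simp add: measure_Int_set_pmf)
  also have "\<dots> = (\<Sum>x\<in>(\<lambda>v. (u, v)) ` U. pmf E x)"
    using U by (intro measure_measure_pmf_finite) auto
  also have "\<dots> = (\<Sum>v\<in>U. pmf E (u, v))" by (subst sum.reindex) (auto simp: inj_on_def)
  finally show ?thesis by simp
qed

abbreviation ES where "ES \<equiv> eigenspace U E"

lemma ES_iff: "f \<in> ES \<theta> \<longleftrightarrow> (\<forall>v. v \<notin> U \<longrightarrow> f v = 0) \<and> (\<forall>v\<in>U. (\<Sum>u\<in>U. pmf E (v, u) * f u) = \<theta> * p v * f v)"
proof -
  have "walk_op U E f v = \<theta> * f v \<longleftrightarrow> (\<Sum>u\<in>U. pmf E (v, u) * f u) = \<theta> * p v * f v" if "v \<in> U" for v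
  proof -
    have "walk_op U E f v = (\<Sum>u\<in>U. pmf E (v, u) * f u) / p v"
      unfolding walk_op_def pdef by (simp add: sum_divide_distrib)
    then show ?thesis using pos[OF that] by (simp add: divide_eq_eq mult.commute mult.left_commute)
  qed
  then show ?thesis unfolding eigenspace_def by auto
qed

lemma pn: "u \<in> U \<Longrightarrow> 0 \<le> p u"
  using pos[of u] by simp

definition ip where "ip f g = (\<Sum>u\<in>U. p u * f u * g u)"

lemma ip_pos: "\<lbrakk>\<forall>v. v \<notin> U \<longrightarrow> f v = 0; f \<noteq> 0\<rbrakk> \<Longrightarrow> ip f f > 0"
proof -
  assume a: "\<forall>v. v \<notin> U \<longrightarrow> f v = 0" "f \<noteq> 0"
  then obtain u where "f u \<noteq> 0" by (auto simp: fun_eq_iff)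
  then have u: "u \<in> U" "f u \<noteq> 0" using a by auto
  have "0 < p u * (f u)\<^sup>2" using u pos[OF u(1)] by (intro mult_pos_pos) auto
  then have "0 < p u * f u * f u" by (simp add: power2_eq_square mult.assoc)
  also have "\<dots> \<le> ip f f" unfolding ip_def
    using u U(1) pn by (intro member_le_sum[of u U "\<lambda>u. p u * f u * f u"]) (auto simp: mult.assoc)
  finally show ?thesis .
qed

lemma ES_orth: "f \<in> ES \<theta> \<Longrightarrow> g \<in> ES \<eta> \<Longrightarrow> \<theta> \<noteq> \<eta> \<Longrightarrow> ip f g = 0"
proof -
  assume f: "f \<in> ES \<theta>" and g: "g \<in> ES \<eta>" and ne: "\<theta> \<noteq> \<eta>"
  have "\<theta> * ip f g = (\<Sum>v\<in>U. (\<theta> * p v * f v) * g v)" by (simp add: ip_def sum_distrib_left mult.assoc)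
  also have "\<dots> = (\<Sum>v\<in>U. (\<Sum>u\<in>U. pmf E (v, u) * f u) * g v)" using f by (intro sum.cong) (auto simp: ES_iff)
  also have "\<dots> = (\<Sum>v\<in>U. \<Sum>u\<in>U. pmf E (v, u) * f u * g v)" by (simp add: sum_distrib_right)
  also have "\<dots> = (\<Sum>u\<in>U. \<Sum>v\<in>U. pmf E (v, u) * f u * g v)" by (rule sum.swap)
  also have "\<dots> = (\<Sum>u\<in>U. f u * (\<Sum>v\<in>U. pmf E (u, v) * g v))"
  proof (rule sum.cong[OF refl])
    fix u
    show "(\<Sum>v\<in>U. pmf E (v, u) * f u * g v) = f u * (\<Sum>v\<in>U. pmf E (u, v) * g v)"
      unfolding sum_distrib_left by (intro sum.cong refl) (simp add: sym[of _ u])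
  qed
  also have "\<dots> = (\<Sum>u\<in>U. f u * (\<eta> * p u * g u))" using g by (intro sum.cong) (auto simp: ES_iff)
  also have "\<dots> = \<eta> * ip f g" by (simp add: ip_def sum_distrib_left mult.assoc mult.left_commute)
  finally show ?thesis using ne by simp
qed

definition del :: "'v \<Rightarrow> 'v \<Rightarrow> real" where "del u = (\<lambda>v. if v = u then 1 else 0)"

lemma supported_in_span: "\<forall>v. v \<notin> U \<longrightarrow> f v = 0 \<Longrightarrow> f \<in> fvs.span (del ` U)"
proof -
  assume a: "\<forall>v. v \<notin> U \<longrightarrow> f v = 0"
  have "f = (\<Sum>u\<in>U. fscale (f u) (del u))"
  proof
    fix v
    have "(\<Sum>u\<in>U. fscale (f u) (del u)) v = (\<Sum>u\<in>U. if u = v then f u else 0)"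
      by (auto simp: sum_fun_app fscale_def del_def intro!: sum.cong)
    also have "\<dots> = f v" using U a by simp
    finally show "f v = (\<Sum>u\<in>U. fscale (f u) (del u)) v" by simp
  qed
  moreover have "(\<Sum>u\<in>U. fscale (f u) (del u)) \<in> fvs.span (del ` U)"
    by (intro fvs.span_sum fvs.span_scale fvs.span_base) auto
  ultimately show ?thesis by simp
qed

text \<open>Eigenfunctions for different eigenvalues are orthogonal, hence independent, so there are
  no more of them than vertices. Finiteness matters because \<open>abs_spectrum\<close> is a sum
  over the eigenvalues, which over an infinite set would be the empty multiset.\<close>

lemma finite_spectrum: "finite {\<theta>. ES \<theta> \<noteq> {0}}"
proof (rule ccontr)
  assume "infinite {\<theta>. ES \<theta> \<noteq> {0}}"
  then obtain T where T: "finite T" "card T = card U + 1" "T \<subseteq> {\<theta>. ES \<theta> \<noteq> {0}}"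
    by (metis infinite_arbitrarily_large)
  have "\<exists>f. f \<in> ES \<theta> \<and> f \<noteq> 0" if "\<theta> \<in> T" for \<theta>
  proof -
    have "0 \<in> ES \<theta>" by (simp add: ES_iff)
    then show ?thesis using T that by blast
  qed
  then obtain F where F: "\<And>\<theta>. \<theta> \<in> T \<Longrightarrow> F \<theta> \<in> ES \<theta> \<and> F \<theta> \<noteq> 0" by metis
  have Fs: "\<forall>v. v \<notin> U \<longrightarrow> F \<theta> v = 0" if "\<theta> \<in> T" for \<theta> using F[OF that] by (simp add: ES_iff)
  have inj: "inj_on F T"
  proof (rule inj_onI, rule ccontr)
    fix a b assume ab: "a \<in> T" "b \<in> T" "F a = F b" "a \<noteq> b"
    then have "ip (F a) (F b) = 0" using F ES_orth by blast
    then show False using ab ip_pos[OF Fs[OF ab(1)]] F[OF ab(1)] by simp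
  qed
  have "fvs.independent (F ` T)"
  proof (rule fvs.independent_if_scalars_zero)
    show "finite (F ` T)" using T by simp
    fix c g assume z: "(\<Sum>x\<in>F ` T. fscale (c x) x) = 0" and g: "g \<in> F ` T"
    obtain a where a: "a \<in> T" "g = F a" using g by auto
    have "0 = ip (\<Sum>x\<in>F ` T. fscale (c x) x) g" by (simp add: z ip_def)
    also have "\<dots> = (\<Sum>u\<in>U. \<Sum>x\<in>F ` T. p u * (c x * x u) * g u)"
      by (simp add: ip_def sum_fun_app fscale_def sum_distrib_left sum_distrib_right)
    also have "\<dots> = (\<Sum>x\<in>F ` T. \<Sum>u\<in>U. p u * (c x * x u) * g u)" by (rule sum.swap)
    also have "\<dots> = (\<Sum>x\<in>F ` T. c x * ip x g)" by (simp add: ip_def sum_distrib_left algebra_simps)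
    also have "\<dots> = (\<Sum>b\<in>T. c (F b) * ip (F b) (F a))" using inj a by (simp add: sum.reindex)
    also have "\<dots> = (\<Sum>b\<in>T. if b = a then c (F a) * ip (F a) (F a) else 0)"
    proof (rule sum.cong[OF refl])
      fix b assume b: "b \<in> T"
      have "ip (F b) (F a) = 0" if "b \<noteq> a" using ES_orth[of "F b" b "F a" a] F[OF b] F[OF a(1)] that by simp
      then show "c (F b) * ip (F b) (F a) = (if b = a then c (F a) * ip (F a) (F a) else 0)" by simp
    qed
    also have "\<dots> = c g * ip g g" using T a by simp
    finally show "c g = 0" using ip_pos[OF Fs[OF a(1)]] F[OF a(1)] a by simp
  qed
  moreover have "F ` T \<subseteq> fvs.span (del ` U)" using Fs supported_in_span by blast
  ultimately have "card (F ` T) \<le> card (del ` U)"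
    using fvs.independent_span_bound[of "del ` U" "F ` T"] U by auto
  then show False using T card_image[OF inj] card_image_le[OF U(1), of del] by simp
qed

lemma card_le_dim_ES: "A \<subseteq> ES \<theta> \<Longrightarrow> fvs.independent A \<Longrightarrow> card A \<le> fvs.dim (ES \<theta>)"
proof -
  assume A: "A \<subseteq> ES \<theta>" "fvs.independent A"
  obtain B where B: "B \<subseteq> ES \<theta>" "fvs.independent B" "ES \<theta> \<subseteq> fvs.span B" "card B = fvs.dim (ES \<theta>)"
    using fvs.basis_exists by blast
  have "B \<subseteq> fvs.span (del ` U)" using B supported_in_span by (auto simp: ES_iff)
  then have "finite B" using fvs.independent_span_bound[of "del ` U" B] U B by auto
  then show ?thesis using fvs.independent_span_bound[of B A] A B by auto
qed

definition one where "one = (\<lambda>v. if v \<in> U then 1 else (0::real))"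

lemma one_ES: "one \<in> ES 1"
  using row by (simp add: ES_iff one_def)

lemma one_nz: "one \<noteq> 0"
proof -
  obtain u where "u \<in> U" using U by (cases "U = {}") auto
  then have "one u \<noteq> 0 u" by (simp add: one_def)
  then show ?thesis by metis
qed

lemma quad_le: "(\<Sum>u\<in>U. \<Sum>v\<in>U. pmf E (u, v) * g u * g v) \<le> (\<Sum>u\<in>U. p u * (g u)\<^sup>2)"
proof -
  have "(\<Sum>u\<in>U. \<Sum>v\<in>U. pmf E (u, v) * g u * g v) \<le>
      (\<Sum>u\<in>U. \<Sum>v\<in>U. pmf E (u, v) * (g u)\<^sup>2 / 2 + pmf E (u, v) * (g v)\<^sup>2 / 2)"
  proof (intro sum_mono)
    fix u v
    have "0 \<le> pmf E (u, v) * (g u - g v)\<^sup>2" by simp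
    then show "pmf E (u, v) * g u * g v \<le> pmf E (u, v) * (g u)\<^sup>2 / 2 + pmf E (u, v) * (g v)\<^sup>2 / 2"
      by (simp add: power2_eq_square algebra_simps)
  qed
  also have "\<dots> = (\<Sum>u\<in>U. \<Sum>v\<in>U. pmf E (u, v) * (g u)\<^sup>2) / 2 + (\<Sum>u\<in>U. \<Sum>v\<in>U. pmf E (u, v) * (g v)\<^sup>2) / 2"
    by (simp add: sum.distrib sum_divide_distrib)
  also have "(\<Sum>u\<in>U. \<Sum>v\<in>U. pmf E (u, v) * (g v)\<^sup>2) = (\<Sum>v\<in>U. \<Sum>u\<in>U. pmf E (u, v) * (g v)\<^sup>2)" by (rule sum.swap)
  also have "\<dots> = (\<Sum>u\<in>U. p u * (g u)\<^sup>2)"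
  proof (rule sum.cong[OF refl])
    fix v assume v: "v \<in> U"
    have "(\<Sum>u\<in>U. pmf E (u, v) * (g v)\<^sup>2) = (\<Sum>u\<in>U. pmf E (v, u)) * (g v)\<^sup>2"
      unfolding sum_distrib_right by (intro sum.cong refl) (simp add: sym[of _ v])
    then show "(\<Sum>u\<in>U. pmf E (u, v) * (g v)\<^sup>2) = p v * (g v)\<^sup>2" by (simp add: row[OF v])
  qed
  also have "(\<Sum>u\<in>U. \<Sum>v\<in>U. pmf E (u, v) * (g u)\<^sup>2) = (\<Sum>u\<in>U. p u * (g u)\<^sup>2)"
    by (intro sum.cong refl) (simp add: sum_distrib_right[symmetric] row)
  finally show ?thesis by simp
qed

text \<open>The constant function and \<open>f\<close> account for two eigenvalues counted with
  multiplicity. If \<open>\<beta> = 1\<close> they share an eigenspace, where orthogonality makes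
  them independent.\<close>

lemma spectrum_bound:
  assumes Q: "Q 1" "\<And>\<theta>. \<theta> \<ge> \<beta> \<Longrightarrow> Q \<bar>\<theta>\<bar>"
    and f: "f \<in> ES \<beta>" "f \<noteq> 0" "(\<Sum>u\<in>U. p u * f u) = 0"
  shows "size (filter_mset Q (abs_spectrum U E)) \<ge> 2"
proof -
  let ?T = "{\<theta>. ES \<theta> \<noteq> {0}}"
  have sz: "size (filter_mset Q (abs_spectrum U E)) = (\<Sum>\<theta>\<in>?T. if Q \<bar>\<theta>\<bar> then fvs.dim (ES \<theta>) else 0)"
    unfolding abs_spectrum_def by (rule size_filter_sum_replicate[OF finite_spectrum])
  have T: "1 \<in> ?T" "\<beta> \<in> ?T" using one_ES one_nz f by auto
  have ge: "(\<Sum>\<theta>\<in>{1, \<beta>}. if Q \<bar>\<theta>\<bar> then fvs.dim (ES \<theta>) else 0) \<le> (\<Sum>\<theta>\<in>?T. if Q \<bar>\<theta>\<bar> then fvs.dim (ES \<theta>) else 0)"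
    using T finite_spectrum by (intro sum_mono2) auto
  show ?thesis
  proof (cases "\<beta> = 1")
    case True
    have "ip f one = 0" using f(3) by (simp add: ip_def one_def)
    then have ne: "f \<noteq> one" using ip_pos[of one] one_nz by (auto simp: one_def)
    have "f \<notin> fvs.span {one}"
    proof
      assume "f \<in> fvs.span {one}"
      then obtain c where c: "f = fscale c one" by (auto simp: fvs.span_singleton)
      have "ip f one = c * ip one one" by (simp add: ip_def c fscale_def sum_distrib_left algebra_simps)
      then have "c = 0" using \<open>ip f one = 0\<close> ip_pos[of one] one_nz by (auto simp: one_def)
      then show False using c f(2) by (auto simp: fscale_def fun_eq_iff)
    qed
    then have "fvs.independent {f, one}" using one_nz by (intro fvs.independent_insertI) (auto simp: fvs.independent_empty)
    then have "card {f, one} \<le> fvs.dim (ES 1)" using f one_ES True by (intro card_le_dim_ES) auto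
    then have "2 \<le> fvs.dim (ES 1)" using ne by simp
    then show ?thesis using ge Q True unfolding sz by simp
  next
    case False
    have "1 \<le> fvs.dim (ES 1)" using card_le_dim_ES[of "{one}" 1] one_ES one_nz by simp
    moreover have "1 \<le> fvs.dim (ES \<beta>)" using card_le_dim_ES[of "{f}" \<beta>] f by simp
    ultimately show ?thesis using ge Q(1) Q(2)[of \<beta>] False unfolding sz by simp
  qed
qed

lemma extremal:
  obtains \<beta> f where "f \<in> ES \<beta>" "f \<noteq> 0" "(\<Sum>u\<in>U. p u * f u) = 0"
    "\<And>g. (\<Sum>u\<in>U. p u * g u) = 0 \<Longrightarrow> (\<Sum>u\<in>U. \<Sum>v\<in>U. pmf E (u, v) * g u * g v) \<le> \<beta> * (\<Sum>u\<in>U. p u * (g u)\<^sup>2)"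
proof -
  have "\<exists>\<beta> f. (\<forall>v. v \<notin> U \<longrightarrow> f v = 0) \<and> (\<exists>v\<in>U. f v \<noteq> 0) \<and> (\<Sum>u\<in>U. p u * f u) = 0 \<and>
    (\<forall>u\<in>U. (\<Sum>v\<in>U. pmf E (u, v) * f v) = \<beta> * p u * f u) \<and>
    (\<forall>g. (\<Sum>u\<in>U. p u * g u) = 0 \<longrightarrow> (\<Sum>u\<in>U. \<Sum>v\<in>U. pmf E (u, v) * g u * g v) \<le> \<beta> * (\<Sum>u\<in>U. p u * (g u)\<^sup>2))"
    by (rule extremal_eigenfunction[OF U pos sym row])
  then show ?thesis
  proof (elim exE conjE)
    fix \<beta> f
    assume f: "\<forall>v. v \<notin> U \<longrightarrow> f v = 0" "\<exists>v\<in>U. f v \<noteq> 0" "(\<Sum>u\<in>U. p u * f u) = 0"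
      "\<forall>u\<in>U. (\<Sum>v\<in>U. pmf E (u, v) * f v) = \<beta> * p u * f u"
      "\<forall>g. (\<Sum>u\<in>U. p u * g u) = 0 \<longrightarrow> (\<Sum>u\<in>U. \<Sum>v\<in>U. pmf E (u, v) * g u * g v) \<le> \<beta> * (\<Sum>u\<in>U. p u * (g u)\<^sup>2)"
    have "f \<in> ES \<beta>" using f by (simp add: ES_iff)
    moreover have "f \<noteq> 0" using f(2) by auto
    ultimately show thesis using f(3,5) by (intro that[of f \<beta>]) auto
  qed
qed

text \<open>The extremal value \<open>\<beta>\<close> of the Rayleigh quotient is at most 1. So 1
  and \<open>\<bar>\<beta>\<bar>\<close> are two entries of the spectrum that reach
  \<open>\<beta>\<close>, and the second largest entry does too.\<close>

theorem quad_le_graph_lambda: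
  assumes g: "(\<Sum>u\<in>U. p u * g u) = 0"
  shows "(\<Sum>u\<in>U. \<Sum>v\<in>U. pmf E (u, v) * g u * g v) \<le> graph_lambda U E * (\<Sum>u\<in>U. p u * (g u)\<^sup>2)"
proof -
  obtain \<beta> f where f: "f \<in> ES \<beta>" "f \<noteq> 0" "(\<Sum>u\<in>U. p u * f u) = 0"
    "\<And>g. (\<Sum>u\<in>U. p u * g u) = 0 \<Longrightarrow> (\<Sum>u\<in>U. \<Sum>v\<in>U. pmf E (u, v) * g u * g v) \<le> \<beta> * (\<Sum>u\<in>U. p u * (g u)\<^sup>2)"
    by (rule extremal) blast
  have "\<beta> \<le> 1"
  proof -
    have "(\<Sum>u\<in>U. \<Sum>v\<in>U. pmf E (u, v) * f u * f v) = (\<Sum>u\<in>U. f u * (\<Sum>v\<in>U. pmf E (u, v) * f v))"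
      by (simp add: sum_distrib_left algebra_simps)
    also have "\<dots> = (\<Sum>u\<in>U. f u * (\<beta> * p u * f u))" using f(1) by (intro sum.cong) (auto simp: ES_iff)
    also have "\<dots> = \<beta> * ip f f" by (simp add: ip_def sum_distrib_left algebra_simps)
    finally have "\<beta> * ip f f \<le> ip f f" using quad_le[of f] by (simp add: ip_def power2_eq_square mult.assoc)
    moreover have "ip f f > 0" using f by (intro ip_pos) (auto simp: ES_iff)
    ultimately show ?thesis by simp
  qed
  then have "size (filter_mset (\<lambda>x. x \<ge> \<beta>) (abs_spectrum U E)) \<ge> 2"
    using f by (intro spectrum_bound) auto
  moreover have "size (filter_mset (\<lambda>x. True) (abs_spectrum U E)) \<ge> 2"
    using f by (intro spectrum_bound) auto
  ultimately have "graph_lambda U E \<ge> \<beta>" unfolding graph_lambda_def by (intro second_largest) auto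
  moreover have "(\<Sum>u\<in>U. p u * (g u)\<^sup>2) \<ge> 0" using pn by (intro sum_nonneg) auto
  ultimately show ?thesis using f(4)[OF g] by (meson mult_right_mono order_trans)
qed

text \<open>The left side of \<open>contr\<close> is the squared norm of the walk operator applied
  to \<open>g\<close>. Bounding it, and not the quadratic form, controls eigenvalues of either sign.
  Since \<open>\<rho> < 1\<close>, only the eigenvalue 1 can exceed \<open>\<rho>\<close>, and it is
  simple.\<close>

theorem graph_lambda_le:
  assumes \<rho>: "0 \<le> \<rho>" "\<rho> < 1"
    and contr: "\<And>g. (\<Sum>u\<in>U. p u * g u) = 0 \<Longrightarrow>
      (\<Sum>v\<in>U. (\<Sum>u\<in>U. pmf E (v, u) * g u)\<^sup>2 / p v) \<le> \<rho>\<^sup>2 * (\<Sum>u\<in>U. p u * (g u)\<^sup>2)"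
  shows "graph_lambda U E \<le> \<rho>"
proof -
  let ?T = "{\<theta>. ES \<theta> \<noteq> {0}}"
  obtain \<beta> f where f: "f \<in> ES \<beta>" "f \<noteq> 0" "(\<Sum>u\<in>U. p u * f u) = 0"
    by (rule extremal)
  have sz2: "size (filter_mset (\<lambda>x. True) (abs_spectrum U E)) \<ge> 2"
    using f by (intro spectrum_bound) auto
  have small: "\<bar>\<theta>\<bar> \<le> \<rho>" if g: "g \<in> ES \<theta>" "g \<noteq> 0" "(\<Sum>u\<in>U. p u * g u) = 0" for \<theta> g
  proof -
    have pg: "ip g g > 0" using g by (intro ip_pos) (auto simp: ES_iff)
    have "(\<Sum>v\<in>U. (\<Sum>u\<in>U. pmf E (v, u) * g u)\<^sup>2 / p v) = (\<Sum>v\<in>U. (\<theta> * p v * g v)\<^sup>2 / p v)"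
      using g by (intro sum.cong) (auto simp: ES_iff)
    also have "\<dots> = (\<Sum>v\<in>U. \<theta>\<^sup>2 * (p v * g v * g v))"
    proof (rule sum.cong[OF refl])
      fix v assume "v \<in> U"
      then show "(\<theta> * p v * g v)\<^sup>2 / p v = \<theta>\<^sup>2 * (p v * g v * g v)" using pos[of v]
        by (simp add: power2_eq_square field_simps)
    qed
    also have "\<dots> = \<theta>\<^sup>2 * ip g g" by (simp add: ip_def sum_distrib_left)
    finally have "\<theta>\<^sup>2 * ip g g \<le> \<rho>\<^sup>2 * ip g g"
      using contr[OF g(3)] by (simp add: ip_def power2_eq_square mult.assoc)
    then have "\<theta>\<^sup>2 \<le> \<rho>\<^sup>2" using pg by simp
    then show ?thesis using \<rho> by (metis abs_le_square_iff abs_of_nonneg)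
  qed
  have only1: "\<theta> = 1" if th: "\<theta> \<in> ?T" "\<bar>\<theta>\<bar> > \<rho>" for \<theta>
  proof (rule ccontr)
    assume ne: "\<theta> \<noteq> 1"
    have "0 \<in> ES \<theta>" by (simp add: ES_iff)
    then obtain g where g: "g \<in> ES \<theta>" "g \<noteq> 0" using th(1) by blast
    have "ip g one = 0" using ES_orth[OF g(1) one_ES ne] .
    then have "(\<Sum>u\<in>U. p u * g u) = 0" by (simp add: ip_def one_def)
    then show False using small[OF g] that by simp
  qed
  have dim1: "fvs.dim (ES 1) \<le> 1"
  proof -
    \<comment> \<open>Subtracting the projection to the constants leaves a mean-zero eigenfunction
      with eigenvalue 1, which is above \<open>\<rho>\<close>; it must be 0.\<close>
    have "ES 1 \<subseteq> fvs.span {one}"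
    proof
      fix g assume g: "g \<in> ES 1"
      define c where "c = ip g one / ip one one"
      define h where "h = (\<lambda>v. g v - c * one v)"
      have p1: "ip one one > 0" using one_nz by (intro ip_pos) (auto simp: one_def)
      have "h \<in> ES 1" using g one_ES unfolding ES_iff h_def
        by (auto simp: algebra_simps sum_subtractf sum_distrib_left[symmetric])
      moreover have "(\<Sum>u\<in>U. p u * h u) = 0"
      proof -
        have "(\<Sum>u\<in>U. p u * h u) = ip g one - c * ip one one"
          by (simp add: ip_def h_def one_def algebra_simps sum_subtractf sum_distrib_left)
        then show ?thesis using p1 by (simp add: c_def)
      qed
      ultimately have "h = 0" using small[of h 1] \<rho> by auto
      then have "h v = 0" for v by simp
      then have "g = fscale c one" by (auto simp: h_def fscale_def fun_eq_iff)
      then show "g \<in> fvs.span {one}" by (auto simp: fvs.span_singleton)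
    qed
    then show ?thesis using fvs.dim_le_card[of "ES 1" "{one}"] by simp
  qed
  have "size (filter_mset (\<lambda>x. x > \<rho>) (abs_spectrum U E)) = (\<Sum>\<theta>\<in>?T. if \<bar>\<theta>\<bar> > \<rho> then fvs.dim (ES \<theta>) else 0)"
    unfolding abs_spectrum_def by (rule size_filter_sum_replicate[OF finite_spectrum])
  also have "\<dots> \<le> (\<Sum>\<theta>\<in>?T. if \<theta> = 1 then 1 else 0)"
    using only1 dim1 by (intro sum_mono) auto
  also have "\<dots> \<le> 1" using finite_spectrum by simp
  finally show ?thesis unfolding graph_lambda_def using sz2 by (intro second_largest(1)) auto
qed

end

section \<open>Links as weighted graphs\<close>

lemma harm_sub: "harm V d n \<Longrightarrow> S \<subseteq> V \<Longrightarrow> a \<in> V \<Longrightarrow> sp1 S a \<subseteq> V"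
  by (rule sp1_subset) (auto simp: harm_def)

lemma harm_nonneg: "harm V d n \<Longrightarrow> fvs.subspace S \<Longrightarrow> S \<subseteq> V \<Longrightarrow> n S \<ge> 0"
  by (simp add: harm_def)

lemma n1_nonneg: "harm V d n \<Longrightarrow> fvs.subspace S \<Longrightarrow> S \<subseteq> V \<Longrightarrow> a \<in> V \<Longrightarrow> n1 n S a \<ge> 0"
  unfolding n1_def by (simp add: harm_nonneg[OF _ subspace_sp1 harm_sub])

lemma n2_nonneg: "harm V d n \<Longrightarrow> fvs.subspace S \<Longrightarrow> S \<subseteq> V \<Longrightarrow> a \<in> V \<Longrightarrow> b \<in> V \<Longrightarrow> n2 n S a b \<ge> 0"
  unfolding n2_def by (simp add: n1_nonneg[OF _ subspace_sp1 harm_sub])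

lemma sum_n1:
  assumes h: "harm V d n" and S: "fvs.subspace S" "S \<subseteq> V"
  shows "(\<Sum>a\<in>V. n1 n S a) = (2 ^ d - real (card S)) * n S"
proof -
  have "finite V" using h by (simp add: harm_def)
  then have "(\<Sum>a\<in>V. n1 n S a) = (\<Sum>a\<in>V - S. n (sp1 S a))"
    by (intro sum.mono_neutral_cong_right) (auto simp: n1_def)
  then show ?thesis using h S by (simp add: harm_def)
qed

lemma sum_n2:
  assumes h: "harm V d n" and S: "fvs.subspace S" "S \<subseteq> V" and a: "a \<in> V"
  shows "(\<Sum>b\<in>V. n2 n S a b) = (2 ^ d - 2 * real (card S)) * n1 n S a"
proof (cases "a \<in> S")
  case True then show ?thesis by (simp add: n2_def n1_def)
next
  case False
  have fS: "finite S" using h S finite_subset by (auto simp: harm_def)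
  have "sp1 S a \<subseteq> V" using h S a by (intro sp1_subset) (auto simp: harm_def)
  then have "(\<Sum>b\<in>V. n1 n (sp1 S a) b) = (2 ^ d - real (card (sp1 S a))) * n (sp1 S a)"
    using S by (intro sum_n1[OF h] subspace_sp1)
  then show ?thesis using False card_sp1[OF S(1) fS False] by (simp add: n2_def n1_def)
qed

lemma n2_sym:
  assumes S: "fvs.subspace S"
  shows "n2 n S a b = n2 n S b a"
proof -
  have *: "x \<in> S \<Longrightarrow> y \<notin> S \<Longrightarrow> y \<notin> sp1 S x" for x y
    using subspace_add_iff[OF S, of x y] by (auto simp: mem_sp1)
  have "b \<notin> sp1 S a \<longleftrightarrow> a \<notin> sp1 S b" if "a \<notin> S" "b \<notin> S"
    using that by (auto simp: mem_sp1 add.commute)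
  then show ?thesis using sp1_commute[OF S, of a b] *
    by (auto simp: n2_def n1_def mem_sp1)
qed

lemma n1_shift:
  assumes S: "fvs.subspace S" "s \<in> S" shows "n1 n S (a + s) = n1 n S a"
  using sp1_shift[OF S, of a] subspace_add_iff[OF S, of a] by (simp add: n1_def)

lemma n2_shift:
  assumes S: "fvs.subspace S" "s \<in> S" shows "n2 n S (a + s) b = n2 n S a b"
  using sp1_shift[OF S, of a] subspace_add_iff[OF S, of a] by (simp add: n2_def)

text \<open>The weight sees only the span, in which \<open>a\<close>, \<open>b\<close> and
  \<open>a + b\<close> are interchangeable.\<close>

lemma n2_add:
  assumes S: "fvs.subspace S" shows "n2 n S (a + b) a = n2 n S b a"
proof -
  have "n2 n S a (b + a) = n2 n S a b"
  proof (cases "a \<in> S")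
    case False
    have "a \<in> sp1 S a" using S by (simp add: mem_sp1 subspace_bit_iff)
    then show ?thesis using n1_shift[OF subspace_sp1[OF S], of a a n b] False by (simp add: n2_def)
  qed (simp add: n2_def)
  moreover have "n2 n S (a + b) a = n2 n S a (b + a)" using n2_sym[OF S, of n "a + b" a] by (simp add: add.commute)
  moreover have "n2 n S a b = n2 n S b a" by (rule n2_sym[OF S])
  ultimately show ?thesis by simp
qed

text \<open>An upper bound for the second eigenvalue of the link of \<open>S\<close>, as an
  unnormalised Rayleigh quotient: by \<open>sum_n2\<close> the factor
  \<open>2 ^ d - 2 * card S\<close> is the ratio of the edge marginal to the vertex weight. It is
  one-sided, as trickling down and the zero-block estimate require, and makes sense where weights
  vanish.\<close>

definition Exp :: "('i \<Rightarrow> bit) set \<Rightarrow> nat \<Rightarrow> (('i \<Rightarrow> bit) set \<Rightarrow> real) \<Rightarrow> ('i \<Rightarrow> bit) set \<Rightarrow> real \<Rightarrow> bool" where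
  "Exp V d n S lam \<longleftrightarrow> (\<forall>f. (\<Sum>a\<in>V. n1 n S a * f a) = 0 \<longrightarrow>
     (\<Sum>a\<in>V. \<Sum>b\<in>V. n2 n S a b * f a * f b) \<le> lam * (2 ^ d - 2 * real (card S)) * (\<Sum>a\<in>V. n1 n S a * (f a)\<^sup>2))"

lemma n2_zero:
  assumes h: "harm V d n" and S: "fvs.subspace S" "S \<subseteq> V" and ab: "a \<in> V" "b \<in> V" and z: "n1 n S a = 0"
  shows "n2 n S a b = 0"
proof -
  have fV: "finite V" using h by (simp add: harm_def)
  have "(\<Sum>b\<in>V. n2 n S a b) = 0" using sum_n2[OF h S ab(1)] z by simp
  then show ?thesis using ab fV n2_nonneg[OF h S] by (simp add: sum_nonneg_eq_0_iff)
qed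

text \<open>A vertex of positive weight has a neighbour of positive weight, and there are no
  loops.\<close>

lemma link_card:
  assumes h: "harm V d n" and S: "fvs.subspace S" "S \<subseteq> V" and lt: "2 * real (card S) < 2 ^ d"
    and a: "a \<in> V" "n1 n S a > 0"
  shows "card {a \<in> V. n1 n S a > 0} \<ge> 2"
proof -
  have fV: "finite V" using h by (simp add: harm_def)
  have "(\<Sum>b\<in>V. n2 n S a b) > 0" using sum_n2[OF h S a(1)] a lt by simp
  then obtain b where b: "b \<in> V" "n2 n S a b > 0" using sum_nonpos[of V "n2 n S a"] by (meson not_le)
  have "n1 n S b \<noteq> 0" using n2_zero[OF h S b(1) a(1)] b n2_sym[OF S(1), of n a b] by auto
  then have "n1 n S b > 0" using n1_nonneg[OF h S b(1)] by simp
  moreover have "a \<noteq> b"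
  proof
    assume "a = b"
    then have "n2 n S a b = 0" using S by (simp add: n2_def n1_def mem_sp1 subspace_bit_iff)
    then show False using b by simp
  qed
  ultimately have "{a, b} \<subseteq> {a \<in> V. n1 n S a > 0}" "card {a, b} = 2" using a b by auto
  then show ?thesis using fV card_mono[of "{a \<in> V. n1 n S a > 0}" "{a, b}"] by simp
qed

lemma sum_link:
  assumes h: "harm V d n" and S: "fvs.subspace S" "S \<subseteq> V"
  shows "(\<Sum>a\<in>V. n1 n S a * F a) = (\<Sum>a\<in>{a \<in> V. n1 n S a > 0}. n1 n S a * F a)"
    and "a \<in> V \<Longrightarrow> (\<Sum>b\<in>V. n2 n S a b * F b) = (\<Sum>b\<in>{a \<in> V. n1 n S a > 0}. n2 n S a b * F b)"
    and "(\<Sum>a\<in>V. \<Sum>b\<in>V. n2 n S a b * F a * G b) =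
      (\<Sum>a\<in>{a \<in> V. n1 n S a > 0}. \<Sum>b\<in>{a \<in> V. n1 n S a > 0}. n2 n S a b * F a * G b)"
proof -
  have fV: "finite V" using h by (simp add: harm_def)
  have z: "n1 n S a = 0" if "a \<in> V - {a \<in> V. n1 n S a > 0}" for a
    using that n1_nonneg[OF h S, of a] by auto
  show "(\<Sum>a\<in>V. n1 n S a * F a) = (\<Sum>a\<in>{a \<in> V. n1 n S a > 0}. n1 n S a * F a)" for F
    using z fV by (intro sum.mono_neutral_right) auto
  have z2: "n2 n S a b = 0" if "a \<in> V" "b \<in> V - {a \<in> V. n1 n S a > 0}" for a b
    using n2_zero[OF h S, of b a] z[OF that(2)] that n2_sym[OF S(1), of n a b] by auto
  show s2: "(\<Sum>b\<in>V. n2 n S a b * F b) = (\<Sum>b\<in>{a \<in> V. n1 n S a > 0}. n2 n S a b * F b)" if "a \<in> V" for a F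
    using z2[OF that] fV by (intro sum.mono_neutral_right) auto
  have "(\<Sum>a\<in>V. \<Sum>b\<in>V. n2 n S a b * F a * G b) = (\<Sum>a\<in>V. F a * (\<Sum>b\<in>V. n2 n S a b * G b))"
    by (simp add: sum_distrib_left ac_simps)
  also have "\<dots> = (\<Sum>a\<in>{a \<in> V. n1 n S a > 0}. F a * (\<Sum>b\<in>V. n2 n S a b * G b))"
  proof (rule sum.mono_neutral_right)
    show "\<forall>a\<in>V - {a \<in> V. 0 < n1 n S a}. F a * (\<Sum>b\<in>V. n2 n S a b * G b) = 0"
      using z n2_zero[OF h S] by auto
  qed (use fV in auto)
  also have "\<dots> = (\<Sum>a\<in>{a \<in> V. n1 n S a > 0}. F a * (\<Sum>b\<in>{a \<in> V. n1 n S a > 0}. n2 n S a b * G b))"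
    using s2 by (intro sum.cong) auto
  finally show "(\<Sum>a\<in>V. \<Sum>b\<in>V. n2 n S a b * F a * G b) =
      (\<Sum>a\<in>{a \<in> V. n1 n S a > 0}. \<Sum>b\<in>{a \<in> V. n1 n S a > 0}. n2 n S a b * F a * G b)"
    by (simp add: sum_distrib_left ac_simps)
qed

lemma link_wgraph:
  assumes p: "pure V l \<mu>" and w: "fvs.subspace w" "w \<subseteq> V" "fvs.dim w + 2 \<le> l" and pos: "Nm \<mu> w > 0"
  defines "U \<equiv> {v \<in> V. n1 (Nm \<mu>) w v > 0}"
  shows "\<exists>c>0. (\<forall>v v'. pmf (link_edge_pmf \<mu> w) (v, v') = c * n2 (Nm \<mu>) w v v') \<and>
    wgraph U (link_edge_pmf \<mu> w) (pmf (map_pmf fst (link_edge_pmf \<mu> w))) \<and>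
    (\<forall>v\<in>U. pmf (map_pmf fst (link_edge_pmf \<mu> w)) v = c * (2 ^ l - 2 * real (card w)) * n1 (Nm \<mu>) w v)"
proof -
  let ?E = "link_edge_pmf \<mu> w" and ?n = "Nm \<mu>"
  have h: "harm V l ?n" by (rule harm_Nm[OF p])
  have fV: "finite V" using p by (simp add: pure_def)
  have fw: "finite w" using w fV finite_subset by auto
  obtain c where c: "c > 0" "\<And>v v'. pmf ?E (v, v') = c * n2 ?n w v v'"
    using pmf_link_edge[OF p w pos] by blast
  have cw: "real (card w) = 2 ^ fvs.dim w" using card_subspace[OF w(1) fw] by simp
  have "(2::real) ^ (fvs.dim w + 2) \<le> 2 ^ l" using w by (intro power_increasing) auto
  then have lt: "2 * real (card w) < 2 ^ l" "real (card w) < 2 ^ l" proof -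
    have "(4::real) * 2 ^ fvs.dim w \<le> 2 ^ l" using \<open>(2::real) ^ (fvs.dim w + 2) \<le> 2 ^ l\<close> by (simp add: power_add)
    moreover have "(0::real) < 2 ^ fvs.dim w" by simp
    ultimately show "2 * real (card w) < 2 ^ l" "real (card w) < 2 ^ l" unfolding cw by linarith+
  qed
  have supp: "set_pmf ?E \<subseteq> U \<times> U"
  proof
    fix e assume e: "e \<in> set_pmf ?E"
    obtain v v' where vv: "e = (v, v')" by (cases e)
    have ne: "n2 ?n w v v' \<noteq> 0" using e c by (auto simp: set_pmf_eq vv)
    have ss: "fvs.subspace (sp1 (sp1 w v) v')" using w by (simp add: subspace_sp1)
    have "Nm \<mu> (sp1 (sp1 w v) v') \<noteq> 0" using ne by (auto simp: n2_def n1_def split: if_splits)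
    then have "sp1 (sp1 w v) v' \<subseteq> V" using Nm_eq_0[OF p] by blast
    then have v: "v \<in> V" "v' \<in> V"
      using sp1_subset_iff[of V "sp1 w v" v'] sp1_subset_iff[of V w v] w p by (auto simp: subspace_sp1 pure_def)
    have "n1 ?n w v \<noteq> 0" using n2_zero[OF h w(1,2) v] ne by auto
    moreover have "n1 ?n w v' \<noteq> 0" using n2_zero[OF h w(1,2) v(2,1)] ne n2_sym[OF w(1), of ?n v v'] by auto
    ultimately show "e \<in> U \<times> U" using v n1_nonneg[OF h w(1,2)] by (simp add: U_def vv order_less_le)
  qed
  have pm: "pmf (map_pmf fst ?E) v = c * (2 ^ l - 2 * real (card w)) * n1 ?n w v" if v: "v \<in> U" for v
  proof -
    have fU: "finite U" using fV by (simp add: U_def)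
    have "pmf (map_pmf fst ?E) v = measure_pmf.prob ?E (fst -` {v})" by (simp add: pmf_map)
    also have "\<dots> = measure_pmf.prob ?E ((fst -` {v}) \<inter> set_pmf ?E)" by (simp add: measure_Int_set_pmf)
    also have "\<dots> = measure_pmf.prob ?E (((\<lambda>u. (v, u)) ` U) \<inter> set_pmf ?E)"
      using supp by (intro arg_cong[of _ _ "measure_pmf.prob ?E"]) auto
    also have "\<dots> = measure_pmf.prob ?E ((\<lambda>u. (v, u)) ` U)" by (simp add: measure_Int_set_pmf)
    also have "\<dots> = (\<Sum>x\<in>(\<lambda>u. (v, u)) ` U. pmf ?E x)"
      using fU by (intro measure_measure_pmf_finite) auto
    also have "\<dots> = (\<Sum>u\<in>U. c * n2 ?n w v u * 1)" by (subst sum.reindex) (auto simp: inj_on_def c)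
    also have "\<dots> = c * (\<Sum>u\<in>U. n2 ?n w v u * 1)" by (simp add: sum_distrib_left)
    also have "(\<Sum>u\<in>U. n2 ?n w v u * 1) = (\<Sum>u\<in>V. n2 ?n w v u * 1)"
      unfolding U_def using v by (intro sum_link(2)[OF h w(1,2), symmetric]) (auto simp: U_def)
    also have "\<dots> = (2 ^ l - 2 * real (card w)) * n1 ?n w v"
      using sum_n2[OF h w(1,2), of v] v by (simp add: U_def)
    finally show ?thesis by simp
  qed
  have "wgraph U ?E (pmf (map_pmf fst ?E))"
  proof
    show "finite U" using fV by (simp add: U_def)
    show "card U \<ge> 2"
    proof -
      have "(\<Sum>a\<in>V. n1 ?n w a) > 0" using sum_n1[OF h w(1,2)] pos lt by simp
      then obtain a where "a \<in> V" "n1 ?n w a > 0" using sum_nonpos[of V "n1 ?n w"] by (meson not_le)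
      then show ?thesis unfolding U_def by (intro link_card[OF h w(1,2) lt(1)])
    qed
    show "set_pmf ?E \<subseteq> U \<times> U" by (rule supp)
    show "pmf ?E (u, v) = pmf ?E (v, u)" for u v using n2_sym[OF w(1), of ?n u v] c by simp
    show "pmf (map_pmf fst ?E) v > 0" if "v \<in> U" for v
      using pm[OF that] c lt that by (simp add: U_def)
  qed simp
  then show ?thesis using c pm by blast
qed

lemma Exp_of_graph_lambda:
  assumes p: "pure V l \<mu>" and w: "fvs.subspace w" "w \<subseteq> V" "fvs.dim w + 2 \<le> l" and pos: "Nm \<mu> w > 0"
    and gl: "graph_lambda {v \<in> V. n1 (Nm \<mu>) w v > 0} (link_edge_pmf \<mu> w) \<le> lam"
  shows "Exp V l (Nm \<mu>) w lam"
  unfolding Exp_def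
proof (intro allI impI)
  fix f assume f: "(\<Sum>a\<in>V. n1 (Nm \<mu>) w a * f a) = 0"
  let ?n = "Nm \<mu>" and ?E = "link_edge_pmf \<mu> w"
  define U where "U = {v \<in> V. n1 (Nm \<mu>) w v > 0}"
  define D where "D = 2 ^ l - 2 * real (card w)"
  have h: "harm V l ?n" by (rule harm_Nm[OF p])
  obtain c where c: "c > 0" "\<forall>v v'. pmf ?E (v, v') = c * n2 ?n w v v'"
    and wg: "wgraph U ?E (pmf (map_pmf fst ?E))"
    and pm: "\<forall>v\<in>U. pmf (map_pmf fst ?E) v = c * D * n1 ?n w v"
    using link_wgraph[OF p w pos] unfolding U_def D_def by blast
  interpret wgraph U ?E "pmf (map_pmf fst ?E)" by (rule wg)
  have s1: "(\<Sum>u\<in>U. pmf (map_pmf fst ?E) u * F u) = c * D * (\<Sum>a\<in>V. n1 ?n w a * F a)" for F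
    unfolding sum_link(1)[OF h w(1,2)] U_def[symmetric] using pm by (simp add: sum_distrib_left mult.assoc)
  have s2: "(\<Sum>u\<in>U. \<Sum>v\<in>U. pmf ?E (u, v) * f u * f v) = c * (\<Sum>a\<in>V. \<Sum>b\<in>V. n2 ?n w a b * f a * f b)"
    unfolding sum_link(3)[OF h w(1,2)] U_def[symmetric] using c by (simp add: sum_distrib_left mult.assoc)
  have "(\<Sum>u\<in>U. \<Sum>v\<in>U. pmf ?E (u, v) * f u * f v) \<le> graph_lambda U ?E * (\<Sum>u\<in>U. pmf (map_pmf fst ?E) u * (f u)\<^sup>2)"
    using s1[of f] f by (intro quad_le_graph_lambda) simp
  also have "\<dots> \<le> lam * (\<Sum>u\<in>U. pmf (map_pmf fst ?E) u * (f u)\<^sup>2)"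
    using gl by (intro mult_right_mono sum_nonneg) (auto simp: U_def)
  finally have "c * (\<Sum>a\<in>V. \<Sum>b\<in>V. n2 ?n w a b * f a * f b) \<le> c * (lam * D * (\<Sum>a\<in>V. n1 ?n w a * (f a)\<^sup>2))"
    unfolding s1 s2 by (simp add: ac_simps)
  then show "(\<Sum>a\<in>V. \<Sum>b\<in>V. n2 ?n w a b * f a * f b) \<le> lam * (2 ^ l - 2 * real (card w)) * (\<Sum>a\<in>V. n1 ?n w a * (f a)\<^sup>2)"
    using c by (simp add: D_def)
qed

section \<open>Trickling down\<close>

lemma sum_shift:
  fixes F :: "('i \<Rightarrow> bit) \<Rightarrow> real"
  assumes "fvs.subspace V" "z \<in> V"
  shows "(\<Sum>a\<in>V. F (a + z)) = (\<Sum>a\<in>V. F a)"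
proof (rule sum.reindex_bij_witness[of _ "\<lambda>a. a + z" "\<lambda>a. a + z"])
qed (use assms in \<open>auto simp: subspace_bit_iff add.assoc\<close>)

text \<open>Test the quadratic form on an extremal eigenfunction \<open>f\<close> with eigenvalue
  \<open>\<beta>\<close> and add up the bounds in the links of \<open>sp1 S z\<close> over all
  \<open>z\<close>. There \<open>a\<close> and \<open>a + z\<close> are indistinguishable, so
  \<open>f\<close> may be replaced by the average \<open>hh\<close> of both values; its total
  squared norm is \<open>(D1 * N + Q) / 2\<close> where that of \<open>f\<close> would be
  \<open>D1 * N\<close>. This gives a quadratic inequality in \<open>\<beta>\<close> whose roots are
  1 and \<open>lam / (2 * (1 - lam))\<close>; the assumption \<open>con\<close> keeps
  \<open>\<beta>\<close> below 1.\<close>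

lemma trickling_down:
  assumes h: "harm V d n" and S: "fvs.subspace S" "S \<subseteq> V" and lt: "4 * real (card S) < 2 ^ d"
    and lam: "0 \<le> lam" "lam < 1"
    and up: "\<And>z. z \<in> V \<Longrightarrow> n1 n S z > 0 \<Longrightarrow> Exp V d n (sp1 S z) lam"
    and con: "Exp V d n S lam0" "lam0 < 1"
  shows "Exp V d n S (lam / (2 * (1 - lam)))"
proof (cases "\<exists>a\<in>V. n1 n S a > 0")
  case False
  then have z: "n1 n S a = 0" if "a \<in> V" for a using n1_nonneg[OF h S that] that by force
  then have "n2 n S a b = 0" if "a \<in> V" "b \<in> V" for a b using n2_zero[OF h S that] that by auto
  then show ?thesis using z by (simp add: Exp_def)
next
  case True
  define U where "U = {a \<in> V. n1 n S a > 0}"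
  define D1 where "D1 = 2 ^ d - 2 * real (card S)"
  define D2 where "D2 = 2 ^ d - 4 * real (card S)"
  have D: "D1 > 0" "D2 > 0" using lt by (auto simp: D1_def D2_def)
  have fV: "finite V" and V: "fvs.subspace V" using h by (auto simp: harm_def)
  have fS: "finite S" using S fV finite_subset by auto
  obtain a0 where a0: "a0 \<in> V" "n1 n S a0 > 0" using True by auto
  have fU: "finite U" using fV by (simp add: U_def)
  have cU: "card U \<ge> 2" unfolding U_def using lt a0 by (intro link_card[OF h S _ a0]) simp
  have "\<exists>\<beta> f. (\<forall>v. v \<notin> U \<longrightarrow> f v = 0) \<and> (\<exists>v\<in>U. f v \<noteq> 0) \<and> (\<Sum>u\<in>U. D1 * n1 n S u * f u) = 0 \<and>
    (\<forall>u\<in>U. (\<Sum>v\<in>U. n2 n S u v * f v) = \<beta> * (D1 * n1 n S u) * f u) \<and>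
    (\<forall>g. (\<Sum>u\<in>U. D1 * n1 n S u * g u) = 0 \<longrightarrow> (\<Sum>u\<in>U. \<Sum>v\<in>U. n2 n S u v * g u * g v) \<le> \<beta> * (\<Sum>u\<in>U. D1 * n1 n S u * (g u)\<^sup>2))"
  proof (rule extremal_eigenfunction[OF fU cU])
    show "0 < D1 * n1 n S u" if "u \<in> U" for u using that D by (simp add: U_def)
    show "n2 n S u v = n2 n S v u" for u v by (rule n2_sym[OF S(1)])
    show "(\<Sum>v\<in>U. n2 n S u v) = D1 * n1 n S u" if "u \<in> U" for u
      using sum_link(2)[OF h S, of u "\<lambda>_. 1"] sum_n2[OF h S, of u] that by (simp add: U_def D1_def)
  qed
  then obtain \<beta> f where ff: "(\<forall>v. v \<notin> U \<longrightarrow> f v = 0) \<and> (\<exists>v\<in>U. f v \<noteq> 0) \<and> (\<Sum>u\<in>U. D1 * n1 n S u * f u) = 0 \<and>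
    (\<forall>u\<in>U. (\<Sum>v\<in>U. n2 n S u v * f v) = \<beta> * (D1 * n1 n S u) * f u) \<and>
    (\<forall>g. (\<Sum>u\<in>U. D1 * n1 n S u * g u) = 0 \<longrightarrow> (\<Sum>u\<in>U. \<Sum>v\<in>U. n2 n S u v * g u * g v) \<le> \<beta> * (\<Sum>u\<in>U. D1 * n1 n S u * (g u)\<^sup>2))"
    by (elim exE) (rule that)
  have fnz: "\<exists>v\<in>U. f v \<noteq> 0" using ff by (elim conjE)
  have fm: "(\<Sum>u\<in>U. D1 * n1 n S u * f u) = 0" using ff by (elim conjE)
  have fe: "\<forall>u\<in>U. (\<Sum>v\<in>U. n2 n S u v * f v) = \<beta> * (D1 * n1 n S u) * f u" using ff by (elim conjE)
  have fx: "\<forall>g. (\<Sum>u\<in>U. D1 * n1 n S u * g u) = 0 \<longrightarrow> (\<Sum>u\<in>U. \<Sum>v\<in>U. n2 n S u v * g u * g v) \<le> \<beta> * (\<Sum>u\<in>U. D1 * n1 n S u * (g u)\<^sup>2)"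
    using ff by (elim conjE)
  define N where "N = (\<Sum>a\<in>V. n1 n S a * (f a)\<^sup>2)"
  define Q where "Q = (\<Sum>a\<in>V. \<Sum>b\<in>V. n2 n S a b * f a * f b)"
  have eig: "(\<Sum>b\<in>V. n2 n S a b * f b) = \<beta> * D1 * n1 n S a * f a" if a: "a \<in> V" for a
  proof (cases "a \<in> U")
    case True
    then show ?thesis using fe sum_link(2)[OF h S a, of f] by (simp add: U_def)
  next
    case False
    then have "n1 n S a = 0" using n1_nonneg[OF h S a] a by (simp add: U_def)
    then show ?thesis using n2_zero[OF h S a] by simp
  qed
  have Qb: "Q = \<beta> * D1 * N"
  proof -
    have "Q = (\<Sum>a\<in>V. f a * (\<Sum>b\<in>V. n2 n S a b * f b))" by (simp add: Q_def sum_distrib_left ac_simps)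
    also have "\<dots> = (\<Sum>a\<in>V. \<beta> * D1 * (n1 n S a * (f a)\<^sup>2))"
      using eig by (intro sum.cong) (auto simp: power2_eq_square)
    finally show ?thesis by (simp add: N_def sum_distrib_left)
  qed
  have Npos: "N > 0"
  proof -
    obtain v where v: "v \<in> U" "f v \<noteq> 0" using fnz by auto
    have "0 < n1 n S v * (f v)\<^sup>2" using v by (simp add: U_def)
    also have "\<dots> \<le> N" unfolding N_def
      using v fV n1_nonneg[OF h S] by (intro member_le_sum) (auto simp: U_def)
    finally show ?thesis .
  qed
  have fmV: "(\<Sum>a\<in>V. n1 n S a * f a) = 0"
    using fm D by (simp add: sum_link(1)[OF h S] U_def[symmetric] mult.assoc sum_distrib_left[symmetric])
  have b1: "\<beta> < 1"
  proof -
    have "Q \<le> lam0 * D1 * N" using con(1) fmV unfolding Exp_def Q_def D1_def N_def by blast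
    then have "\<beta> * (D1 * N) \<le> lam0 * (D1 * N)" by (simp add: Qb ac_simps)
    then have "\<beta> \<le> lam0" using D Npos by simp
    then show ?thesis using con by simp
  qed
  \<comment> \<open>Weight of the ordered triangle \<open>z\<close>, \<open>a\<close>,
    \<open>b\<close> in the link of \<open>S\<close>, symmetric in all three vectors.\<close>
  define t where "t = (\<lambda>z a b. if z \<in> S then 0 else n2 n (sp1 S z) a b)"
  have t_sym23: "t z a b = t z b a" for z a b using n2_sym[OF subspace_sp1[OF S(1)], of n z a b] by (simp add: t_def)
  have t_alt: "t z a b = (if z \<in> S \<or> a \<in> sp1 S z then 0 else n1 n (sp1 (sp1 S z) a) b)" for z a b
    by (simp add: t_def n2_def)
  have t_sym12: "t z a b = t a z b" for z a b
  proof -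
    have "z \<in> S \<or> a \<in> sp1 S z \<longleftrightarrow> a \<in> S \<or> z \<in> sp1 S a"
      using subspace_add_iff[OF S(1), of a z] subspace_add_iff[OF S(1), of z a] by (auto simp: mem_sp1 add.commute)
    then show ?thesis using sp1_commute[OF S(1), of z a] by (simp add: t_alt)
  qed
  have sub1: "sp1 S z \<subseteq> V" "fvs.subspace (sp1 S z)" if "z \<in> V" for z using harm_sub[OF h S(2) that] subspace_sp1[OF S(1)] by auto
  have t_row: "(\<Sum>b\<in>V. t z a b) = D2 * n2 n S z a" if "z \<in> V" "a \<in> V" for z a
  proof (cases "z \<in> S")
    case True then show ?thesis by (simp add: t_def n2_def)
  next
    case False
    then show ?thesis using sum_n2[OF h sub1(2,1)[OF that(1)] that(2)] card_sp1[OF S(1) fS False]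
      by (simp add: t_def D2_def n2_def)
  qed
  have t_sum: "(\<Sum>z\<in>V. t z a b) = D2 * n2 n S a b" if "a \<in> V" "b \<in> V" for a b
  proof -
    have "(\<Sum>z\<in>V. t z a b) = (\<Sum>z\<in>V. t a b z)"
      by (intro sum.cong refl) (rule trans[OF t_sym12 t_sym23])
    then show ?thesis using t_row[OF that] by simp
  qed
  have t_nonneg: "t z a b \<ge> 0" if "z \<in> V" "a \<in> V" "b \<in> V" for z a b
    using n2_nonneg[OF h sub1(2,1)[OF that(1)] that(2,3)] by (simp add: t_def)
  have t_shift: "t z (a + z) b = t z a b" for z a b
  proof (cases "z \<in> S")
    case False
    have "z \<in> sp1 S z" using S by (simp add: mem_sp1 subspace_bit_iff)
    then show ?thesis using n2_shift[OF subspace_sp1[OF S(1)], of z z n a b] False by (simp add: t_def)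
  qed (simp add: t_def)
  have n2z_shift: "n2 n S z (a + z) = n2 n S z a" for z a
    using n2_add[OF S(1), of n z a] n2_sym[OF S(1), of n z "a + z"] n2_sym[OF S(1), of n a z] by (simp add: add.commute)
  define hh where "hh = (\<lambda>z a. (f a + f (a + z)) / 2)"
  define F where "F = (\<lambda>z. \<Sum>a\<in>V. \<Sum>b\<in>V. t z a b * f a * f b)"
  define H where "H = (\<lambda>z. \<Sum>a\<in>V. n2 n S z a * (hh z a)\<^sup>2)"
  have D2Q: "D2 * Q = (\<Sum>z\<in>V. F z)"
  proof -
    have "(\<Sum>z\<in>V. F z) = (\<Sum>a\<in>V. \<Sum>z\<in>V. \<Sum>b\<in>V. t z a b * f a * f b)" unfolding F_def by (rule sum.swap)
    also have "\<dots> = (\<Sum>a\<in>V. \<Sum>b\<in>V. \<Sum>z\<in>V. t z a b * f a * f b)" by (rule sum.cong[OF refl], rule sum.swap)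
    also have "\<dots> = (\<Sum>a\<in>V. \<Sum>b\<in>V. (\<Sum>z\<in>V. t z a b) * f a * f b)" by (simp add: sum_distrib_right)
    also have "\<dots> = (\<Sum>a\<in>V. \<Sum>b\<in>V. D2 * (n2 n S a b * f a * f b))"
      by (intro sum.cong refl) (simp add: t_sum)
    finally show ?thesis by (simp add: Q_def sum_distrib_left)
  qed
  \<comment> \<open>Averaging leaves the form unchanged, because the triangle weight is invariant
    under adding \<open>z\<close> to \<open>a\<close> or to \<open>b\<close>.\<close>
  have Fh: "(\<Sum>a\<in>V. \<Sum>b\<in>V. t z a b * hh z a * hh z b) = F z" if z: "z \<in> V" for z
  proof -
    have X: "(\<Sum>a\<in>V. t z a b * f (a + z)) = (\<Sum>a\<in>V. t z a b * f a)" for b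
      using sum_shift[OF V z, of "\<lambda>a. t z a b * f a"] by (simp add: t_shift)
    have X': "(\<Sum>b\<in>V. t z a b * f (b + z)) = (\<Sum>b\<in>V. t z a b * f b)" for a
      using X[of a] unfolding t_sym23[of z _ a] .
    have inner: "(\<Sum>b\<in>V. t z a b * hh z b) = (\<Sum>b\<in>V. t z a b * f b)" for a
    proof -
      have "(\<Sum>b\<in>V. t z a b * hh z b) = ((\<Sum>b\<in>V. t z a b * f b) + (\<Sum>b\<in>V. t z a b * f (b + z))) / 2"
        by (simp add: hh_def sum.distrib[symmetric] sum_divide_distrib algebra_simps)
      then show ?thesis using X' by simp
    qed
    have inner': "(\<Sum>a\<in>V. t z a b * hh z a) = (\<Sum>a\<in>V. t z a b * f a)" for b
      using inner[of b] unfolding t_sym23[of z b] .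
    have "(\<Sum>a\<in>V. \<Sum>b\<in>V. t z a b * hh z a * hh z b) = (\<Sum>a\<in>V. hh z a * (\<Sum>b\<in>V. t z a b * hh z b))"
      by (simp add: sum_distrib_left ac_simps)
    also have "\<dots> = (\<Sum>a\<in>V. \<Sum>b\<in>V. hh z a * (t z a b * f b))" by (simp add: inner sum_distrib_left)
    also have "\<dots> = (\<Sum>b\<in>V. \<Sum>a\<in>V. hh z a * (t z a b * f b))" by (rule sum.swap)
    also have "\<dots> = (\<Sum>b\<in>V. f b * (\<Sum>a\<in>V. t z a b * hh z a))" by (simp add: sum_distrib_left ac_simps)
    also have "\<dots> = (\<Sum>b\<in>V. \<Sum>a\<in>V. t z a b * f a * f b)"
      unfolding inner' sum_distrib_left by (intro sum.cong refl) (simp add: ac_simps)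
    also have "\<dots> = F z" unfolding F_def by (rule sum.swap)
    finally show ?thesis .
  qed
  have Fle: "F z \<le> D2 * ((1 - lam) * \<beta>\<^sup>2 * D1 * (n1 n S z * (f z)\<^sup>2) + lam * H z)" if z: "z \<in> V" for z
  proof (cases "z \<in> U")
    case False
    then have n0: "n1 n S z = 0" using n1_nonneg[OF h S z] z by (simp add: U_def)
    then have n20: "n2 n S z a = 0" if "a \<in> V" for a using n2_zero[OF h S z that] by simp
    have "t z a b = 0" if "a \<in> V" "b \<in> V" for a b
      using t_row[OF z that(1)] n20[OF that(1)] fV that t_nonneg[OF z that(1)] by (simp add: sum_nonneg_eq_0_iff)
    then show ?thesis using n0 n20 by (simp add: F_def H_def)
  next
    case True
    then have zS: "z \<notin> S" by (auto simp: U_def n1_def)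
    \<comment> \<open>By the eigenvalue equation at \<open>z\<close> this is the local mean of
      \<open>hh\<close>; the bound in the link of \<open>sp1 S z\<close> is applied to the deviation
      from it.\<close>
    define m where "m = \<beta> * f z"
    define g where "g = (\<lambda>a. hh z a - m)"
    have nn: "n1 n (sp1 S z) a = n2 n S z a" for a using zS by (simp add: n2_def)
    have tt: "n2 n (sp1 S z) a b = t z a b" for a b using zS by (simp add: t_def)
    have row: "(\<Sum>a\<in>V. n2 n S z a) = D1 * n1 n S z" using sum_n2[OF h S z] by (simp add: D1_def)
    have M: "(\<Sum>a\<in>V. n2 n S z a * hh z a) = m * (D1 * n1 n S z)"
    proof -
      have "(\<Sum>a\<in>V. n2 n S z a * f (a + z)) = (\<Sum>a\<in>V. n2 n S z a * f a)"
        using sum_shift[OF V z, of "\<lambda>a. n2 n S z a * f a"] by (simp add: n2z_shift)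
      then have "(\<Sum>a\<in>V. n2 n S z a * hh z a) = (\<Sum>a\<in>V. n2 n S z a * f a)"
        by (simp add: hh_def sum.distrib algebra_simps sum_divide_distrib[symmetric] add_divide_distrib)
      then show ?thesis using eig[OF z] by (simp add: m_def)
    qed
    have "(\<Sum>a\<in>V. n1 n (sp1 S z) a * g a) = 0"
      using M row by (simp add: nn g_def right_diff_distrib sum_subtractf sum_distrib_right[symmetric])
    moreover have "2 ^ d - 2 * real (card (sp1 S z)) = D2" using card_sp1[OF S(1) fS zS] by (simp add: D2_def)
    ultimately have E: "(\<Sum>a\<in>V. \<Sum>b\<in>V. t z a b * g a * g b) \<le> lam * D2 * (\<Sum>a\<in>V. n2 n S z a * (g a)\<^sup>2)"
      using up[OF z] True unfolding Exp_def U_def by (simp add: nn tt)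
    have e1: "(\<Sum>a\<in>V. \<Sum>b\<in>V. t z a b * g a * g b) = F z - D2 * m\<^sup>2 * (D1 * n1 n S z)"
    proof -
      have "(\<Sum>a\<in>V. \<Sum>b\<in>V. t z a b * g a * g b) =
         (\<Sum>a\<in>V. \<Sum>b\<in>V. t z a b * hh z a * hh z b) - m * (\<Sum>a\<in>V. \<Sum>b\<in>V. t z a b * hh z a)
         - m * (\<Sum>a\<in>V. \<Sum>b\<in>V. t z a b * hh z b) + m\<^sup>2 * (\<Sum>a\<in>V. \<Sum>b\<in>V. t z a b)"
        by (simp add: g_def algebra_simps sum.distrib sum_subtractf sum_distrib_left power2_eq_square)
      also have "(\<Sum>a\<in>V. \<Sum>b\<in>V. t z a b * hh z b) = (\<Sum>b\<in>V. \<Sum>a\<in>V. t z a b * hh z b)" by (rule sum.swap)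
      also have "\<dots> = (\<Sum>a\<in>V. \<Sum>b\<in>V. t z a b * hh z a)"
        by (intro sum.cong refl) (subst t_sym23, rule refl)
      also have "(\<Sum>a\<in>V. \<Sum>b\<in>V. t z a b * hh z a) = D2 * (m * (D1 * n1 n S z))"
        using t_row[OF z] by (simp add: sum_distrib_right[symmetric] M[symmetric] sum_distrib_left mult.assoc)
      also have "(\<Sum>a\<in>V. \<Sum>b\<in>V. t z a b) = D2 * (D1 * n1 n S z)"
        using t_row[OF z] row by (simp add: sum_distrib_left[symmetric])
      finally show ?thesis using Fh[OF z] by (simp add: algebra_simps power2_eq_square)
    qed
    have e2: "(\<Sum>a\<in>V. n2 n S z a * (g a)\<^sup>2) = H z - m\<^sup>2 * (D1 * n1 n S z)"
    proof -
      have "(\<Sum>a\<in>V. n2 n S z a * (g a)\<^sup>2) = H z - 2 * m * (\<Sum>a\<in>V. n2 n S z a * hh z a) + m\<^sup>2 * (\<Sum>a\<in>V. n2 n S z a)"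
        by (simp add: g_def H_def algebra_simps sum.distrib sum_subtractf sum_distrib_left power2_eq_square)
      then show ?thesis using M row by (simp add: algebra_simps power2_eq_square)
    qed
    show ?thesis using E unfolding e1 e2 by (simp add: m_def algebra_simps power2_eq_square)
  qed
  \<comment> \<open>After expanding the square, the cross term joins \<open>a\<close> and
    \<open>a + z\<close> over the edges \<open>z\<close>, \<open>a\<close>. These pairs span the
    same planes, so the cross term is the edge form \<open>Q\<close> again.\<close>
  have sumH: "(\<Sum>z\<in>V. H z) = (D1 * N + Q) / 2"
  proof -
    have Hz: "H z = ((\<Sum>a\<in>V. n2 n S z a * (f a)\<^sup>2) + (\<Sum>a\<in>V. n2 n S z a * f a * f (a + z))) / 2" if z: "z \<in> V" for z
    proof -
      have "(\<Sum>a\<in>V. n2 n S z a * (f (a + z))\<^sup>2) = (\<Sum>a\<in>V. n2 n S z a * (f a)\<^sup>2)"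
        using sum_shift[OF V z, of "\<lambda>a. n2 n S z a * (f a)\<^sup>2"] by (simp add: n2z_shift)
      moreover have "H z = (\<Sum>a\<in>V. n2 n S z a * (f a)\<^sup>2) / 4 + (\<Sum>a\<in>V. n2 n S z a * f a * f (a + z)) / 2
          + (\<Sum>a\<in>V. n2 n S z a * (f (a + z))\<^sup>2) / 4"
        by (simp add: H_def hh_def sum_divide_distrib sum.distrib[symmetric] power2_eq_square field_simps)
      ultimately show ?thesis by (simp add: field_simps)
    qed
    have A: "(\<Sum>z\<in>V. \<Sum>a\<in>V. n2 n S z a * (f a)\<^sup>2) = D1 * N"
    proof -
      have "(\<Sum>z\<in>V. \<Sum>a\<in>V. n2 n S z a * (f a)\<^sup>2) = (\<Sum>a\<in>V. \<Sum>z\<in>V. n2 n S z a * (f a)\<^sup>2)" by (rule sum.swap)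
      also have "\<dots> = (\<Sum>a\<in>V. (\<Sum>z\<in>V. n2 n S a z) * (f a)\<^sup>2)"
        by (intro sum.cong refl) (subst sum_distrib_right, intro sum.cong refl, subst n2_sym[OF S(1)], rule refl)
      also have "\<dots> = D1 * N" using sum_n2[OF h S] by (simp add: N_def D1_def sum_distrib_left mult.assoc)
      finally show ?thesis .
    qed
    have B: "(\<Sum>z\<in>V. \<Sum>a\<in>V. n2 n S z a * f a * f (a + z)) = Q"
    proof -
      have "(\<Sum>z\<in>V. \<Sum>a\<in>V. n2 n S z a * f a * f (a + z)) = (\<Sum>a\<in>V. \<Sum>z\<in>V. n2 n S z a * f a * f (a + z))" by (rule sum.swap)
      also have "\<dots> = (\<Sum>a\<in>V. \<Sum>b\<in>V. n2 n S a b * f a * f b)"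
      proof (rule sum.cong[OF refl])
        fix a assume a: "a \<in> V"
        have "(\<Sum>z\<in>V. n2 n S z a * f a * f (a + z)) = (\<Sum>b\<in>V. n2 n S (b + a) a * f a * f (a + (b + a)))"
          by (rule sum_shift[OF V a, symmetric])
        also have "\<dots> = (\<Sum>b\<in>V. n2 n S a b * f a * f b)"
        proof (rule sum.cong[OF refl])
          fix b
          have "n2 n S (b + a) a = n2 n S a b" using n2_add[OF S(1), of n a b] n2_sym[OF S(1), of n a b] by (simp add: add.commute)
          moreover have "a + (b + a) = b" by (simp add: add.commute[of b a])
          ultimately show "n2 n S (b + a) a * f a * f (a + (b + a)) = n2 n S a b * f a * f b" by simp
        qed
        finally show "(\<Sum>z\<in>V. n2 n S z a * f a * f (a + z)) = (\<Sum>b\<in>V. n2 n S a b * f a * f b)" .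
      qed
      finally show ?thesis by (simp add: Q_def)
    qed
    show ?thesis using A B by (simp add: Hz sum.distrib sum_divide_distrib[symmetric])
  qed
  have "D2 * Q \<le> D2 * ((1 - lam) * \<beta>\<^sup>2 * D1 * N + lam * ((D1 * N + Q) / 2))"
  proof -
    have "D2 * Q \<le> (\<Sum>z\<in>V. D2 * ((1 - lam) * \<beta>\<^sup>2 * D1 * (n1 n S z * (f z)\<^sup>2) + lam * H z))"
      unfolding D2Q by (intro sum_mono Fle)
    also have "\<dots> = D2 * ((1 - lam) * \<beta>\<^sup>2 * D1 * N + lam * (\<Sum>z\<in>V. H z))"
      unfolding N_def sum_distrib_left sum.distrib[symmetric] ..
    finally show ?thesis by (simp add: sumH)
  qed
  then have "Q \<le> (1 - lam) * \<beta>\<^sup>2 * D1 * N + lam * ((D1 * N + Q) / 2)" using D by simp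
  then have "\<beta> * (D1 * N) \<le> ((1 - lam) * \<beta>\<^sup>2 + lam * (1 + \<beta>) / 2) * (D1 * N)"
    by (simp add: Qb algebra_simps add_divide_distrib)
  then have "\<beta> \<le> (1 - lam) * \<beta>\<^sup>2 + lam * (1 + \<beta>) / 2" using D Npos by simp
  then have "0 \<le> (\<beta> - 1) * ((1 - lam) * \<beta> - lam / 2)" by (simp add: field_simps power2_eq_square)
  then have "(1 - lam) * \<beta> - lam / 2 \<le> 0" using b1 by (simp add: zero_le_mult_iff)
  then have bb: "\<beta> \<le> lam / (2 * (1 - lam))" using lam by (simp add: field_simps)
  show ?thesis unfolding Exp_def
  proof (intro allI impI)
    fix g assume g: "(\<Sum>a\<in>V. n1 n S a * g a) = 0"
    have "(\<Sum>u\<in>U. D1 * n1 n S u * g u) = D1 * (\<Sum>a\<in>V. n1 n S a * g a)"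
      unfolding sum_link(1)[OF h S] U_def[symmetric] by (simp add: sum_distrib_left mult.assoc)
    then have "(\<Sum>u\<in>U. \<Sum>v\<in>U. n2 n S u v * g u * g v) \<le> \<beta> * (\<Sum>u\<in>U. D1 * n1 n S u * (g u)\<^sup>2)"
      using fx g by simp
    then have "(\<Sum>a\<in>V. \<Sum>b\<in>V. n2 n S a b * g a * g b) \<le> \<beta> * (D1 * (\<Sum>a\<in>V. n1 n S a * (g a)\<^sup>2))"
      unfolding sum_link(1)[OF h S] sum_link(3)[OF h S] U_def[symmetric] by (simp add: sum_distrib_left mult.assoc)
    also have "\<dots> \<le> (lam / (2 * (1 - lam))) * (D1 * (\<Sum>a\<in>V. n1 n S a * (g a)\<^sup>2))"
      using bb D n1_nonneg[OF h S] by (intro mult_right_mono mult_nonneg_nonneg sum_nonneg) auto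
    finally show "(\<Sum>a\<in>V. \<Sum>b\<in>V. n2 n S a b * g a * g b)
      \<le> lam / (2 * (1 - lam)) * (2 ^ d - 2 * real (card S)) * (\<Sum>a\<in>V. n1 n S a * (g a)\<^sup>2)"
      by (simp add: D1_def mult.assoc)
  qed
qed

lemma Exp_mono:
  assumes h: "harm V d n" and S: "fvs.subspace S" "S \<subseteq> V" and lt: "2 * real (card S) \<le> 2 ^ d"
    and E: "Exp V d n S lam" and le: "lam \<le> lam'"
  shows "Exp V d n S lam'"
  unfolding Exp_def
proof (intro allI impI)
  fix f assume "(\<Sum>a\<in>V. n1 n S a * f a) = 0"
  then have "(\<Sum>a\<in>V. \<Sum>b\<in>V. n2 n S a b * f a * f b) \<le> lam * (2 ^ d - 2 * real (card S)) * (\<Sum>a\<in>V. n1 n S a * (f a)\<^sup>2)"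
    using E by (simp add: Exp_def)
  also have "\<dots> \<le> lam' * (2 ^ d - 2 * real (card S)) * (\<Sum>a\<in>V. n1 n S a * (f a)\<^sup>2)"
    using le lt n1_nonneg[OF h S] by (intro mult_right_mono sum_nonneg mult_nonneg_nonneg) auto
  finally show "(\<Sum>a\<in>V. \<Sum>b\<in>V. n2 n S a b * f a * f b) \<le> lam' * (2 ^ d - 2 * real (card S)) * (\<Sum>a\<in>V. n1 n S a * (f a)\<^sup>2)" .
qed

text \<open>Induction on the codimension, starting at 2. For \<open>lam \<le> 1 / 4\<close> one
  trickling step multiplies the bound by at most 2 / 3, as \<open>2 * (1 - lam) \<ge> 3 / 2\<close>.
  The crude bound \<open>e < 1\<close> supplies the connectedness that each step asks for.\<close>

lemma Exp_iterate:
  assumes h: "harm V d n" and e: "0 \<le> e" "e \<le> 1 / 4"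
    and all: "\<And>S. fvs.subspace S \<Longrightarrow> S \<subseteq> V \<Longrightarrow> n S > 0 \<Longrightarrow> fvs.dim S + 2 \<le> d \<Longrightarrow> Exp V d n S e"
    and S: "fvs.subspace S" "S \<subseteq> V" "n S > 0" "fvs.dim S + 2 + k = d"
  shows "Exp V d n S ((2 / 3) ^ k * e)"
  using S
proof (induction k arbitrary: S)
  case 0
  have "Exp V d n S e" by (rule all) (use 0 in auto)
  then show ?case by simp
next
  case (Suc k)
  note S = Suc.prems
  have fV: "finite V" and V: "fvs.subspace V" using h by (auto simp: harm_def)
  have fS: "finite S" using S fV finite_subset by auto
  define l where "l = (2 / 3) ^ k * e"
  have l: "0 \<le> l" "l \<le> 1 / 4"
  proof -
    show "0 \<le> l" using e by (simp add: l_def)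
    have "(2 / 3 :: real) ^ k \<le> 1" by (intro power_le_one) auto
    then have "l \<le> 1 * e" unfolding l_def using e by (intro mult_right_mono) auto
    then show "l \<le> 1 / 4" using e by simp
  qed
  have cS: "real (card S) = 2 ^ fvs.dim S" using card_subspace[OF S(1) fS] by simp
  have "(2::real) ^ (fvs.dim S + 3) \<le> 2 ^ d" using S by (intro power_increasing) auto
  then have c: "8 * real (card S) \<le> 2 ^ d" by (simp add: cS power_add)
  have cp: "real (card S) > 0" by (simp add: cS)
  have "Exp V d n S (l / (2 * (1 - l)))"
  proof (rule trickling_down[OF h S(1,2)])
    show "4 * real (card S) < 2 ^ d" using c cp by linarith
    show "0 \<le> l" "l < 1" using l by auto
    show "Exp V d n S e" using S by (intro all) auto
    show "e < 1" using e by simp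
    fix z assume z: "z \<in> V" "n1 n S z > 0"
    then have zS: "z \<notin> S" by (auto simp: n1_def)
    show "Exp V d n (sp1 S z) l" unfolding l_def
    proof (rule Suc.IH)
      show "n (sp1 S z) > 0" using z zS by (simp add: n1_def)
      show "fvs.dim (sp1 S z) + 2 + k = d" using dim_sp1[OF S(1) fS zS] S by simp
      show "sp1 S z \<subseteq> V" using S z V by (intro sp1_subset)
    qed (use S in \<open>simp add: subspace_sp1\<close>)
  qed
  then show ?case
  proof (rule Exp_mono[OF h S(1,2), rotated])
    show "2 * real (card S) \<le> 2 ^ d" using c cp by linarith
    have "l / (2 * (1 - l)) \<le> l / (3 / 2)" using l by (intro divide_left_mono) auto
    then show "l / (2 * (1 - l)) \<le> (2 / 3) ^ Suc k * e" by (simp add: l_def)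
  qed
qed

section \<open>Outer products\<close>

definition outer :: "('i \<Rightarrow> bit) \<Rightarrow> ('j \<Rightarrow> bit) \<Rightarrow> 'i \<times> 'j \<Rightarrow> bit" where
  "outer x y = (\<lambda>(i, j). x i * y j)"

lemma outer_add_left: "outer (a + b) y = outer a y + outer b y"
  by (auto simp: outer_def fun_eq_iff algebra_simps)

lemma outer_add_right: "outer x (a + b) = outer x a + outer x b"
  by (auto simp: outer_def fun_eq_iff algebra_simps)

lemma outer_zero [simp]: "outer 0 y = 0" "outer x 0 = 0"
  by (auto simp: outer_def fun_eq_iff)

lemma outer_sum_left: "outer (sum x C) y = (\<Sum>w\<in>C. outer (x w) y)"
  by (rule ext, clarify) (simp only: outer_def prod.case sum_fun_app sum_distrib_right)

text \<open>A largest subspace that contains \<open>L\<close> but not \<open>v0\<close> has index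
  two in \<open>V\<close>; the functional is the indicator of its complement.\<close>

lemma separating_functional:
  fixes V :: "('i \<Rightarrow> bit) set"
  assumes V: "fvs.subspace V" "finite V" and L: "fvs.subspace L" "L \<subseteq> V" and v0: "v0 \<in> V" "v0 \<notin> L"
  shows "\<exists>\<phi> :: ('i \<Rightarrow> bit) \<Rightarrow> bit. (\<forall>a\<in>V. \<forall>b\<in>V. \<phi> (a + b) = \<phi> a + \<phi> b) \<and> (\<forall>a\<in>L. \<phi> a = 0) \<and> \<phi> v0 = 1"
proof -
  define A where "A = {H. fvs.subspace H \<and> L \<subseteq> H \<and> H \<subseteq> V \<and> v0 \<notin> H}"
  have "finite A" using V by (intro finite_subset[of A "Pow V"]) (auto simp: A_def)
  moreover have "L \<in> A" using L v0 by (auto simp: A_def)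
  ultimately have "Max (card ` A) \<in> card ` A" by (intro Max_in) auto
  then obtain H where H: "H \<in> A" "card H = Max (card ` A)" by auto
  then have max: "card H' \<le> card H" if "H' \<in> A" for H' using Max_ge[of "card ` A"] \<open>finite A\<close> that by auto
  have Hs: "fvs.subspace H" "L \<subseteq> H" "H \<subseteq> V" "v0 \<notin> H" using H by (auto simp: A_def)
  have fH: "finite H" using Hs V finite_subset by auto
  have dich: "v + v0 \<in> H" if v: "v \<in> V" "v \<notin> H" for v
  proof (rule ccontr)
    assume n: "v + v0 \<notin> H"
    then have "sp1 H v \<in> A"
      using Hs v V sp1_subset[OF V(1) Hs(3) v(1)] by (auto simp: A_def subspace_sp1 mem_sp1 add.commute)
    then have "card (sp1 H v) \<le> card H" by (rule max)
    moreover have "card H > 0" using Hs fH by (auto simp: card_gt_0_iff subspace_bit_iff)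
    ultimately show False using card_sp1[OF Hs(1) fH v(2)] by simp
  qed
  define \<phi> :: "('i \<Rightarrow> bit) \<Rightarrow> bit" where "\<phi> v = (if v \<in> H then 0 else 1)" for v
  have "\<phi> (a + b) = \<phi> a + \<phi> b" if ab: "a \<in> V" "b \<in> V" for a b
  proof (cases "a \<in> H")
    case True
    then show ?thesis using subspace_add_iff[OF Hs(1) True, of b] by (simp add: \<phi>_def add.commute)
  next
    case a: False
    show ?thesis
    proof (cases "b \<in> H")
      case True
      then show ?thesis using subspace_add_iff[OF Hs(1) True, of a] by (simp add: \<phi>_def)
    next
      case b: False
      have "(a + v0) + (b + v0) \<in> H" using dich[OF ab(1) a] dich[OF ab(2) b] Hs(1) unfolding subspace_bit_iff by blast
      moreover have "(a + v0) + (b + v0) = a + b" by (simp add: add.assoc add.left_commute[of v0 b])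
      ultimately show ?thesis using a b by (simp add: \<phi>_def)
    qed
  qed
  then show ?thesis using Hs by (intro exI[of _ \<phi>]) (auto simp: \<phi>_def)
qed

lemma functional_zero:
  assumes V: "fvs.subspace V" and \<phi>: "\<forall>a\<in>V. \<forall>b\<in>V. \<phi> (a + b) = \<phi> a + (\<phi> b :: bit)"
  shows "\<phi> (0 :: 'i \<Rightarrow> bit) = 0"
proof -
  have "(0 :: 'i \<Rightarrow> bit) \<in> V" using V by (simp add: subspace_bit_iff)
  then have "\<phi> (0 + 0) = \<phi> 0 + \<phi> 0" using \<phi> by blast
  then show ?thesis by (cases "\<phi> 0") auto
qed

lemma functional_sum:
  assumes V: "fvs.subspace V" and \<phi>: "\<forall>a\<in>V. \<forall>b\<in>V. \<phi> (a + b) = \<phi> a + (\<phi> b :: bit)"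
    and C: "finite C" and z: "\<And>k. k \<in> C \<Longrightarrow> z k \<in> (V :: ('i \<Rightarrow> bit) set)"
  shows "\<phi> (sum z C) = (\<Sum>k\<in>C. \<phi> (z k))"
  using C z
proof (induction C)
  case empty
  show ?case unfolding sum.empty by (rule functional_zero[OF V \<phi>])
next
  case (insert k C)
  have "sum z C \<in> V" "z k \<in> V" using V insert.prems by (auto intro: subspace_sum_mem)
  then have "\<phi> (z k + sum z C) = \<phi> (z k) + \<phi> (sum z C)" using \<phi> by blast
  moreover have "\<phi> (sum z C) = (\<Sum>k\<in>C. \<phi> (z k))" by (rule insert.IH) (use insert.prems in auto)
  ultimately show ?case unfolding sum.insert[OF insert.hyps] by (simp only:)
qed

text \<open>A dual functional of \<open>y'\<close> reads off \<open>x'\<close> from the rows of the common sum.\<close>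

lemma outer_sum_expand:
  fixes x x' y y' :: "'k \<Rightarrow> 'i \<Rightarrow> bit"
  assumes V: "fvs.subspace V" "finite V" and B: "finite B"
    and y: "\<And>k. k \<in> B \<Longrightarrow> y k \<in> V" and y': "\<And>k. k \<in> B \<Longrightarrow> y' k \<in> V" "indm Z0 y' B"
    and eq: "(\<Sum>k\<in>B. outer (x k) (y k)) = (\<Sum>k\<in>B. outer (x' k) (y' k))" and w: "w \<in> B"
  shows "\<exists>D\<subseteq>B. x' w = sum x D \<and> (\<forall>u\<in>B. y u = y' u \<longrightarrow> (u \<in> D \<longleftrightarrow> u = w))"
proof -
  let ?L = "ssp Z0 y' (B - {w})"
  have "indm Z0 y' (insert w (B - {w}))" using y'(2) w by (simp add: insert_absorb)
  then have "y' w \<notin> ?L" using B by (subst (asm) indm_insert) auto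
  moreover have "?L \<subseteq> V" using V y' by (intro ssp_subset Z0_subset) auto
  ultimately obtain \<phi> where \<phi>: "\<forall>a\<in>V. \<forall>b\<in>V. \<phi> (a + b) = \<phi> a + (\<phi> b :: bit)" "\<forall>a\<in>?L. \<phi> a = 0" "\<phi> (y' w) = 1"
    using separating_functional[OF V subspace_ssp[OF subspace_Z0], of "B - {w}" y' "y' w"] B y' w by auto
  have d: "\<phi> (y' k) = (if k = w then 1 else 0)" if "k \<in> B" for k
  proof (cases "k = w")
    case False
    then have "y' k \<in> ?L" using that B by (intro ssp_gen) auto
    then show ?thesis using \<phi> False by auto
  qed (use \<phi> in simp)
  define sc where "sc c v = (if c = (1::bit) then v else (0 :: 'i \<Rightarrow> bit))" for c v
  have scV: "sc c v \<in> V" if "v \<in> V" for c v using that V by (auto simp: sc_def subspace_bit_iff)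
  have phisc: "\<phi> (sc c v) = c * \<phi> v" if "v \<in> V" for c v
  proof -
    have "\<phi> 0 = 0" by (rule functional_zero[OF V(1) \<phi>(1)])
    then show ?thesis by (cases c) (auto simp: sc_def)
  qed
  have rowsum: "\<phi> (\<Sum>k\<in>B. sc (c k) (z k)) = (\<Sum>k\<in>B. c k * \<phi> (z k))" if "\<And>k. k \<in> B \<Longrightarrow> z k \<in> V" for c z
  proof -
    have "\<phi> (\<Sum>k\<in>B. sc (c k) (z k)) = (\<Sum>k\<in>B. \<phi> (sc (c k) (z k)))"
      by (rule functional_sum[OF V(1) \<phi>(1) B]) (rule scV[OF that])
    also have "\<dots> = (\<Sum>k\<in>B. c k * \<phi> (z k))" by (rule sum.cong[OF refl], rule phisc[OF that])
    finally show ?thesis .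
  qed
  have row: "(\<Sum>k\<in>B. sc (a k i) (b k)) = (\<lambda>j. (\<Sum>k\<in>B. outer (a k) (b k)) (i, j))" for a b :: "'k \<Rightarrow> 'i \<Rightarrow> bit" and i
  proof
    fix j
    have "sc c v j = c * v j" for c v by (cases c) (auto simp: sc_def)
    then show "(\<Sum>k\<in>B. sc (a k i) (b k)) j = (\<Sum>k\<in>B. outer (a k) (b k)) (i, j)"
      by (simp add: sum_fun_app outer_def)
  qed
  define D where "D = {k \<in> B. \<phi> (y k) = 1}"
  have "x' w = sum x D"
  proof
    fix i
    have "x' w i = (\<Sum>k\<in>B. x' k i * \<phi> (y' k))"
    proof -
      have "(\<Sum>k\<in>B. x' k i * \<phi> (y' k)) = (\<Sum>k\<in>B. if k = w then x' k i else 0)"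
        by (intro sum.cong refl) (simp add: d)
      then show ?thesis using B w by simp
    qed
    also have "\<dots> = \<phi> (\<Sum>k\<in>B. sc (x' k i) (y' k))" using rowsum[of y'] y' by simp
    also have "\<dots> = \<phi> (\<Sum>k\<in>B. sc (x k i) (y k))" unfolding row eq ..
    also have "\<dots> = (\<Sum>k\<in>B. x k i * \<phi> (y k))" using rowsum[of y] y by simp
    also have "\<dots> = (\<Sum>k\<in>B. if \<phi> (y k) = 1 then x k i else 0)"
    proof (rule sum.cong[OF refl])
      fix k assume "k \<in> B"
      then show "x k i * \<phi> (y k) = (if \<phi> (y k) = 1 then x k i else 0)" by (cases "\<phi> (y k)") auto
    qed
    also have "\<dots> = (\<Sum>k\<in>D. x k i)" unfolding D_def by (rule sum.inter_filter[OF B, symmetric])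
    finally show "x' w i = sum x D i" by (simp add: sum_fun_app)
  qed
  moreover have "u \<in> D \<longleftrightarrow> u = w" if "u \<in> B" "y u = y' u" for u
    using d[OF that(1)] that by (auto simp: D_def)
  moreover have "D \<subseteq> B" by (auto simp: D_def)
  ultimately show ?thesis by blast
qed

text \<open>The expansion of every \<open>x' w\<close> in terms of \<open>x\<close> also holds with
  the roles exchanged, so a sum of tensors with independent right factors determines the span of the
  left factors.\<close>

lemma outer_sum_span:
  fixes x x' y y' :: "'k \<Rightarrow> 'i \<Rightarrow> bit"
  assumes V: "fvs.subspace V" "finite V" and B: "finite B"
    and y: "\<And>k. k \<in> B \<Longrightarrow> y k \<in> V" "indm Z0 y B" and y': "\<And>k. k \<in> B \<Longrightarrow> y' k \<in> V" "indm Z0 y' B"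
    and eq: "(\<Sum>k\<in>B. outer (x k) (y k)) = (\<Sum>k\<in>B. outer (x' k) (y' k))"
  shows "ssp Z0 x B = ssp Z0 x' B"
proof -
  have sub: "ssp Z0 b B \<subseteq> ssp Z0 a B"
    if ab: "\<And>w. w \<in> B \<Longrightarrow> \<exists>D\<subseteq>B. b w = sum a D" for a b :: "'k \<Rightarrow> 'i \<Rightarrow> bit"
  proof (rule ssp_subset)
    show "fvs.subspace (ssp Z0 a B)" using B by (simp add: subspace_ssp)
    show "Z0 \<subseteq> ssp Z0 a B" by (rule ssp_base) simp
    show "b k \<in> ssp Z0 a B" if "k \<in> B" for k using ab[OF that] ssp_sum[OF subspace_Z0, of _ B a] by auto
  qed
  show ?thesis
  proof
    show "ssp Z0 x' B \<subseteq> ssp Z0 x B"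
      using outer_sum_expand[OF V B y(1) y' eq] by (intro sub) blast
    show "ssp Z0 x B \<subseteq> ssp Z0 x' B"
      using outer_sum_expand[OF V B y'(1) y eq[symmetric]] by (intro sub) blast
  qed
qed

text \<open>Since \<open>y u = y' u\<close>, the expansion of \<open>x' u\<close> contains
  \<open>x u\<close> and those of the other vectors avoid it. So the coset of \<open>x u\<close>
  modulo the other vectors is determined. This serves the second of the two steps at
  \<open>u\<close>, where the partner vector is already known.\<close>

lemma outer_sum_affine:
  fixes x x' y y' :: "'k \<Rightarrow> 'i \<Rightarrow> bit"
  assumes V: "fvs.subspace V" "finite V" and B: "finite B"
    and y: "\<And>k. k \<in> B \<Longrightarrow> y k \<in> V" "indm Z0 y B" and y': "\<And>k. k \<in> B \<Longrightarrow> y' k \<in> V" "indm Z0 y' B"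
    and eq: "(\<Sum>k\<in>B. outer (x k) (y k)) = (\<Sum>k\<in>B. outer (x' k) (y' k))"
    and u: "u \<in> B" "y u = y' u"
  shows "(\<lambda>C. x u + sum x C) ` Pow (B - {u}) = (\<lambda>C. x' u + sum x' C) ` Pow (B - {u})"
proof -
  have sub: "(\<lambda>C. b u + sum b C) ` Pow (B - {u}) \<subseteq> (\<lambda>C. a u + sum a C) ` Pow (B - {u})"
    if ab: "\<And>w. w \<in> B \<Longrightarrow> \<exists>D\<subseteq>B. b w = sum a D \<and> (u \<in> D \<longleftrightarrow> u = w)" for a b :: "'k \<Rightarrow> 'i \<Rightarrow> bit"
  proof clarify
    fix C assume C: "C \<subseteq> B - {u}"
    obtain D0 where D0: "D0 \<subseteq> B" "b u = sum a D0" "u \<in> D0" using ab[OF u(1)] by auto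
    have "b w \<in> ssp Z0 a (B - {u})" if "w \<in> C" for w
    proof -
      have "w \<in> B" "w \<noteq> u" using that C by auto
      then obtain D where D: "D \<subseteq> B" "b w = sum a D" "u \<notin> D" using ab[of w] by auto
      then show ?thesis using ssp_sum[OF subspace_Z0, of D "B - {u}" a] by auto
    qed
    then have "sum b C \<in> ssp Z0 a (B - {u})" using B by (intro subspace_sum_mem) (auto simp: subspace_ssp)
    moreover have "sum a (D0 - {u}) \<in> ssp Z0 a (B - {u})" using D0 by (intro ssp_sum) auto
    ultimately have "sum a (D0 - {u}) + sum b C \<in> ssp Z0 a (B - {u})"
      using subspace_ssp[OF subspace_Z0, of "B - {u}" a] B unfolding subspace_bit_iff by blast
    then obtain C' where C': "C' \<subseteq> B - {u}" "sum a (D0 - {u}) + sum b C = sum a C'" by (auto simp: ssp_def)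
    have "finite D0" using D0 B finite_subset by auto
    then have "b u = a u + sum a (D0 - {u})" unfolding D0(2) using D0(3) by (rule sum.remove)
    then have "b u + sum b C = a u + sum a C'" using C'(2) by (simp add: add.assoc)
    then show "b u + sum b C \<in> (\<lambda>C. a u + sum a C) ` Pow (B - {u})" using C' by auto
  qed
  show ?thesis
  proof
    show "(\<lambda>C. x' u + sum x' C) ` Pow (B - {u}) \<subseteq> (\<lambda>C. x u + sum x C) ` Pow (B - {u})"
    proof (rule sub)
      fix w assume "w \<in> B"
      then show "\<exists>D\<subseteq>B. x' w = sum x D \<and> (u \<in> D \<longleftrightarrow> u = w)"
        using outer_sum_expand[OF V B y(1) y' eq] u by blast
    qed
    show "(\<lambda>C. x u + sum x C) ` Pow (B - {u}) \<subseteq> (\<lambda>C. x' u + sum x' C) ` Pow (B - {u})"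
    proof (rule sub)
      fix w assume "w \<in> B"
      then show "\<exists>D\<subseteq>B. x w = sum x' D \<and> (u \<in> D \<longleftrightarrow> u = w)"
        using outer_sum_expand[OF V B y'(1) y eq[symmetric]] u by metis
    qed
  qed
qed

section \<open>Transvections of a rank decomposition\<close>

text \<open>Together with \<open>opy\<close> a pair of dual row and column operations on a rank
  decomposition. Both are involutions when \<open>u \<notin> C\<close>.\<close>

definition opx :: "'k \<Rightarrow> 'k set \<Rightarrow> ('k \<Rightarrow> 'i \<Rightarrow> bit) \<Rightarrow> 'k \<Rightarrow> 'i \<Rightarrow> bit" where
  "opx u C x = x(u := x u + sum x C)"

definition opy :: "'k \<Rightarrow> 'k set \<Rightarrow> ('k \<Rightarrow> 'i \<Rightarrow> bit) \<Rightarrow> 'k \<Rightarrow> 'i \<Rightarrow> bit" where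
  "opy u C y = (\<lambda>w. if w \<in> C then y w + y u else y w)"

lemma opx_opx: "u \<notin> C \<Longrightarrow> opx u C (opx u C x) = x"
proof -
  assume "u \<notin> C"
  then have "sum (x(u := x u + sum x C)) C = sum x C" by (intro sum.cong) auto
  then show ?thesis by (auto simp: opx_def fun_eq_iff add.assoc)
qed

lemma opy_opy: "u \<notin> C \<Longrightarrow> opy u C (opy u C y) = y"
  by (auto simp: opy_def add.assoc)

lemma ssp_opx:
  assumes J: "finite J" "u \<in> J" "C \<subseteq> J" "u \<notin> C"
  shows "ssp Z0 (opx u C x) J = ssp Z0 x J"
proof -
  have sub: "ssp Z0 (opx u C x) J \<subseteq> ssp Z0 x J" for x :: "'a \<Rightarrow> 'b \<Rightarrow> bit"
  proof (rule ssp_subset)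
    show s: "fvs.subspace (ssp Z0 x J)" using J by (simp add: subspace_ssp)
    show "Z0 \<subseteq> ssp Z0 x J" by (rule ssp_base) simp
    fix k assume k: "k \<in> J"
    have "x k \<in> ssp Z0 x J" using J k by (intro ssp_gen) auto
    moreover have "x u + sum x C \<in> ssp Z0 x J"
      using s ssp_gen[OF subspace_Z0 J(1,2), of x] ssp_sum[OF subspace_Z0 J(3), of x] unfolding subspace_bit_iff by blast
    ultimately show "opx u C x k \<in> ssp Z0 x J" by (simp add: opx_def)
  qed
  show ?thesis using sub[of x] sub[of "opx u C x"] opx_opx[OF J(4), of x] by auto
qed

lemma ssp_opy:
  assumes J: "finite J" "u \<in> J" "C \<subseteq> J" "u \<notin> C"
  shows "ssp Z0 (opy u C y) J = ssp Z0 y J"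
proof -
  have sub: "ssp Z0 (opy u C x) J \<subseteq> ssp Z0 x J" for x :: "'a \<Rightarrow> 'b \<Rightarrow> bit"
  proof (rule ssp_subset)
    show s: "fvs.subspace (ssp Z0 x J)" using J by (simp add: subspace_ssp)
    show "Z0 \<subseteq> ssp Z0 x J" by (rule ssp_base) simp
    fix k assume k: "k \<in> J"
    have "x k \<in> ssp Z0 x J" "x u \<in> ssp Z0 x J" using J k by (auto intro: ssp_gen)
    then have "x k + x u \<in> ssp Z0 x J" using s unfolding subspace_bit_iff by blast
    then show "opy u C x k \<in> ssp Z0 x J" using \<open>x k \<in> ssp Z0 x J\<close> by (simp add: opy_def)
  qed
  show ?thesis using sub[of y] sub[of "opy u C y"] opy_opy[OF J(4), of y] by auto
qed

text \<open>Independence depends only on the size of the span, so operations that keep the span keep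
  it.\<close>

lemma indm_iff_card:
  assumes "finite K"
  shows "indm Z0 z K \<longleftrightarrow> card (ssp Z0 z K) = 2 ^ card K"
proof
  assume "indm Z0 z K"
  then show "card (ssp Z0 z K) = 2 ^ card K" using card_ssp[OF assms, of Z0 z] by simp
next
  assume c: "card (ssp Z0 z K) = 2 ^ card K"
  have im: "ssp Z0 z K = (\<lambda>C. sum z C) ` Pow K" by (auto simp: ssp_def Z0_def)
  have "inj_on (\<lambda>C. sum z C) (Pow K)"
    using c assms unfolding im by (intro eq_card_imp_inj_on) (auto simp: card_Pow)
  then have "C = {}" if "C \<subseteq> K" "sum z C = 0" for C using that by (auto simp: inj_on_def)
  then show "indm Z0 z K" by (auto simp: indm_def)
qed

lemma Ind_opx:
  assumes V: "fvs.subspace V" and J: "finite J" "u \<in> J" "C \<subseteq> J" "u \<notin> C" and x: "x \<in> Ind V Z0 J"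
  shows "opx u C x \<in> Ind V Z0 J"
proof -
  have "opx u C x k \<in> V" if "k \<in> J" for k
  proof -
    have "sum x C \<in> V" using V x J by (intro subspace_sum_mem) (auto simp: Ind_def)
    moreover have "x u \<in> V" "x k \<in> V" using x that J by (auto simp: Ind_def)
    ultimately show ?thesis using V by (simp add: opx_def subspace_bit_iff)
  qed
  moreover have "opx u C x k = undefined" if "k \<notin> J" for k
    using that x J by (auto simp: opx_def Ind_def PiE_iff extensional_def)
  moreover have "indm Z0 (opx u C x) J"
    using x unfolding indm_iff_card[OF J(1)] ssp_opx[OF J] Ind_def by simp
  ultimately show ?thesis by (auto simp: Ind_def PiE_iff extensional_def)
qed

lemma Ind_opy:
  assumes V: "fvs.subspace V" and J: "finite J" "u \<in> J" "C \<subseteq> J" "u \<notin> C" and x: "x \<in> Ind V Z0 J"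
  shows "opy u C x \<in> Ind V Z0 J"
proof -
  have "opy u C x k \<in> V" if "k \<in> J" for k
  proof -
    have "x u \<in> V" "x k \<in> V" using x that J by (auto simp: Ind_def)
    then show ?thesis using V by (simp add: opy_def subspace_bit_iff)
  qed
  moreover have "opy u C x k = undefined" if "k \<notin> J" for k
    using that x J by (auto simp: opy_def Ind_def PiE_iff extensional_def)
  moreover have "indm Z0 (opy u C x) J"
    using x unfolding indm_iff_card[OF J(1)] ssp_opy[OF J] Ind_def by simp
  ultimately show ?thesis by (auto simp: Ind_def PiE_iff extensional_def)
qed

text \<open>The change at \<open>u\<close> and the total change along \<open>C\<close> are both
  \<open>outer (sum x C) (y u)\<close> and cancel in characteristic two.\<close>

lemma outer_sum_op:
  assumes D: "finite D" "u \<in> D" "C \<subseteq> D" "u \<notin> C"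
  shows "(\<Sum>k\<in>D. outer (opx u C x k) (opy u C y k)) = (\<Sum>k\<in>D. outer (x k) (y k))"
proof -
  have fC: "finite C" using D finite_subset by auto
  have split: "(\<Sum>k\<in>D. G k) = G u + (\<Sum>k\<in>C. G k) + (\<Sum>k\<in>D - insert u C. G k)" for G :: "'a \<Rightarrow> 'b \<times> 'c \<Rightarrow> bit"
  proof -
    have "(\<Sum>k\<in>D. G k) = (\<Sum>k\<in>D - insert u C. G k) + (\<Sum>k\<in>insert u C. G k)"
      using D by (intro sum.subset_diff) auto
    then show ?thesis using D fC by (simp add: ac_simps)
  qed
  have "(\<Sum>k\<in>C. outer (opx u C x k) (opy u C y k)) = (\<Sum>k\<in>C. outer (x k) (y k) + outer (x k) (y u))"
    using D by (intro sum.cong) (auto simp: opx_def opy_def outer_add_right)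
  also have "\<dots> = (\<Sum>k\<in>C. outer (x k) (y k)) + outer (sum x C) (y u)"
    by (simp add: sum.distrib outer_sum_left)
  finally have c: "(\<Sum>k\<in>C. outer (opx u C x k) (opy u C y k)) = (\<Sum>k\<in>C. outer (x k) (y k)) + outer (sum x C) (y u)" .
  have u: "outer (opx u C x u) (opy u C y u) = outer (x u) (y u) + outer (sum x C) (y u)"
    using D by (simp add: opx_def opy_def outer_add_left)
  have o: "(\<Sum>k\<in>D - insert u C. outer (opx u C x k) (opy u C y k)) = (\<Sum>k\<in>D - insert u C. outer (x k) (y k))"
    by (intro sum.cong) (auto simp: opx_def opy_def)
  show ?thesis unfolding split c u o by (simp add: ac_simps)
qed

lemma outer_sum_op':
  assumes D: "finite D" "u \<in> D" "C \<subseteq> D" "u \<notin> C"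
  shows "(\<Sum>k\<in>D. outer (opy u C x k) (opx u C y k)) = (\<Sum>k\<in>D. outer (x k) (y k))"
proof -
  define tr where "tr M = (\<lambda>(i, j). M (j, i))" for M :: "'c \<times> 'b \<Rightarrow> bit"
  have t: "(\<Sum>k\<in>D. outer (a k) (b k)) = tr (\<Sum>k\<in>D. outer (b k) (a k))" for a b
    by (rule ext, clarify) (simp only: tr_def prod.case sum_fun_app outer_def mult.commute)
  show ?thesis unfolding t outer_sum_op[OF D] ..
qed

section \<open>Conditional second moments\<close>

text \<open>Conditional expectation of \<open>f\<close> given a key, for an unnormalised finite
  measure; \<open>Nk\<close> is the squared norm of this conditional expectation. On a fibre of
  weight zero the numerator vanishes as well, and the quotient is 0.\<close>

locale finite_weighted =
  fixes Om :: "'o set" and W f :: "'o \<Rightarrow> real"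
  assumes fin: "finite Om" and Wn: "\<And>\<omega>. \<omega> \<in> Om \<Longrightarrow> W \<omega> \<ge> 0"
begin

definition fib :: "('o \<Rightarrow> 'k) \<Rightarrow> 'k \<Rightarrow> 'o set" where "fib key k = {\<omega> \<in> Om. key \<omega> = k}"
definition den :: "('o \<Rightarrow> 'k) \<Rightarrow> 'k \<Rightarrow> real" where "den key k = (\<Sum>\<omega>\<in>fib key k. W \<omega>)"
definition num :: "('o \<Rightarrow> 'k) \<Rightarrow> 'k \<Rightarrow> real" where "num key k = (\<Sum>\<omega>\<in>fib key k. W \<omega> * f \<omega>)"
definition cexp :: "('o \<Rightarrow> 'k) \<Rightarrow> 'k \<Rightarrow> real" where "cexp key k = num key k / den key k"
definition Nk :: "('o \<Rightarrow> 'k) \<Rightarrow> real" where "Nk key = (\<Sum>k\<in>key ` Om. (num key k)\<^sup>2 / den key k)"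

lemma sum_fib: "(\<Sum>\<omega>\<in>Om. G \<omega>) = (\<Sum>k\<in>key ` Om. \<Sum>\<omega>\<in>fib key k. G \<omega>)"
  unfolding fib_def using fin by (intro sum.group[symmetric]) auto

lemma num_eq_0: "den key k = 0 \<Longrightarrow> num key k = 0"
proof -
  assume "den key k = 0"
  moreover have "finite (fib key k)" using fin by (simp add: fib_def)
  ultimately have "\<forall>\<omega>\<in>fib key k. W \<omega> = 0"
    using Wn unfolding den_def by (subst (asm) sum_nonneg_eq_0_iff) (auto simp: fib_def)
  then show ?thesis by (simp add: num_def)
qed

lemma Nk_alt1: "(\<Sum>\<omega>\<in>Om. W \<omega> * f \<omega> * cexp key (key \<omega>)) = Nk key"
  unfolding Nk_def sum_fib[of _ key]
proof (rule sum.cong[OF refl])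
  fix k
  have "(\<Sum>\<omega>\<in>fib key k. W \<omega> * f \<omega> * cexp key (key \<omega>)) = num key k * cexp key k"
    unfolding num_def sum_distrib_right by (intro sum.cong) (auto simp: fib_def)
  then show "(\<Sum>\<omega>\<in>fib key k. W \<omega> * f \<omega> * cexp key (key \<omega>)) = (num key k)\<^sup>2 / den key k"
    by (simp add: cexp_def power2_eq_square)
qed

lemma Nk_alt2: "(\<Sum>\<omega>\<in>Om. W \<omega> * (cexp key (key \<omega>))\<^sup>2) = Nk key"
  unfolding Nk_def sum_fib[of _ key]
proof (rule sum.cong[OF refl])
  fix k
  have "(\<Sum>\<omega>\<in>fib key k. W \<omega> * (cexp key (key \<omega>))\<^sup>2) = den key k * (cexp key k)\<^sup>2"
    unfolding den_def sum_distrib_right by (intro sum.cong) (auto simp: fib_def)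
  then show "(\<Sum>\<omega>\<in>fib key k. W \<omega> * (cexp key (key \<omega>))\<^sup>2) = (num key k)\<^sup>2 / den key k"
    by (cases "den key k = 0") (auto simp: cexp_def power2_eq_square)
qed

lemma sum_cexp: "(\<Sum>\<omega>\<in>fib key k. W \<omega> * cexp key (key \<omega>)) = num key k"
proof -
  have "(\<Sum>\<omega>\<in>fib key k. W \<omega> * cexp key (key \<omega>)) = den key k * cexp key k"
    unfolding den_def sum_distrib_right by (intro sum.cong) (auto simp: fib_def)
  then show ?thesis using num_eq_0[of key k] by (cases "den key k = 0") (auto simp: cexp_def)
qed

lemma tower:
  assumes r: "\<And>\<omega>. \<omega> \<in> Om \<Longrightarrow> key \<omega> = r (key' \<omega>)"
  shows "(\<Sum>\<omega>\<in>Om. W \<omega> * cexp key' (key' \<omega>) * G (key \<omega>)) = (\<Sum>\<omega>\<in>Om. W \<omega> * f \<omega> * G (key \<omega>))"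
  unfolding sum_fib[of _ key']
proof (rule sum.cong[OF refl])
  fix k
  have k: "key \<omega> = r k" if "\<omega> \<in> fib key' k" for \<omega> using that r by (auto simp: fib_def)
  have "(\<Sum>\<omega>\<in>fib key' k. W \<omega> * cexp key' (key' \<omega>) * G (key \<omega>)) = num key' k * G (r k)"
    unfolding sum_cexp[symmetric] sum_distrib_right by (intro sum.cong refl) (simp add: k)
  also have "\<dots> = (\<Sum>\<omega>\<in>fib key' k. W \<omega> * f \<omega> * G (key \<omega>))"
    unfolding num_def sum_distrib_right by (intro sum.cong refl) (simp add: k)
  finally show "(\<Sum>\<omega>\<in>fib key' k. W \<omega> * cexp key' (key' \<omega>) * G (key \<omega>)) = (\<Sum>\<omega>\<in>fib key' k. W \<omega> * f \<omega> * G (key \<omega>))" .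
qed

text \<open>Refining the key adds a martingale difference: it has mean zero on the coarse fibres,
  and its squared norm and its product with \<open>f\<close> both equal the growth of
  \<open>Nk\<close>.\<close>

lemma increment:
  assumes r: "\<And>\<omega>. \<omega> \<in> Om \<Longrightarrow> key \<omega> = r (key' \<omega>)"
  defines "g \<equiv> (\<lambda>\<omega>. cexp key' (key' \<omega>) - cexp key (key \<omega>))"
  shows "(\<Sum>\<omega>\<in>Om. W \<omega> * f \<omega> * g \<omega>) = Nk key' - Nk key"
    and "(\<Sum>\<omega>\<in>Om. W \<omega> * (g \<omega>)\<^sup>2) = Nk key' - Nk key"
    and "(\<Sum>\<omega>\<in>fib key k. W \<omega> * g \<omega>) = 0"
proof -
  show "(\<Sum>\<omega>\<in>Om. W \<omega> * f \<omega> * g \<omega>) = Nk key' - Nk key"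
    unfolding g_def Nk_alt1[symmetric] by (simp add: right_diff_distrib sum_subtractf)
  have c: "(\<Sum>\<omega>\<in>Om. W \<omega> * cexp key' (key' \<omega>) * cexp key (key \<omega>)) = Nk key"
    using tower[where key = key and r = r and key' = key' and G = "cexp key", OF r] Nk_alt1[of key] by simp
  have "(\<Sum>\<omega>\<in>Om. W \<omega> * (g \<omega>)\<^sup>2) = (\<Sum>\<omega>\<in>Om. W \<omega> * (cexp key' (key' \<omega>))\<^sup>2)
      - 2 * (\<Sum>\<omega>\<in>Om. W \<omega> * cexp key' (key' \<omega>) * cexp key (key \<omega>)) + (\<Sum>\<omega>\<in>Om. W \<omega> * (cexp key (key \<omega>))\<^sup>2)"
    by (simp add: g_def power2_eq_square algebra_simps sum.distrib sum_subtractf sum_distrib_left)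
  then show "(\<Sum>\<omega>\<in>Om. W \<omega> * (g \<omega>)\<^sup>2) = Nk key' - Nk key"
    unfolding c Nk_alt2 by simp
  have "(\<Sum>\<omega>\<in>fib key k. W \<omega> * cexp key' (key' \<omega>)) = (\<Sum>\<omega>\<in>Om. W \<omega> * cexp key' (key' \<omega>) * of_bool (key \<omega> = k))"
    using fin unfolding fib_def by (intro sum.mono_neutral_cong_left) auto
  also have "\<dots> = (\<Sum>\<omega>\<in>Om. W \<omega> * f \<omega> * of_bool (key \<omega> = k))" by (rule tower[where key = key and r = r and key' = key' and G = "\<lambda>k'. of_bool (k' = k)", OF r])
  also have "\<dots> = num key k"
    using fin unfolding num_def fib_def by (intro sum.mono_neutral_cong_right) auto
  finally show "(\<Sum>\<omega>\<in>fib key k. W \<omega> * g \<omega>) = 0"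
    unfolding g_def by (simp add: right_diff_distrib sum_subtractf sum_cexp)
qed

lemma Nk_mono:
  assumes r: "\<And>\<omega>. \<omega> \<in> Om \<Longrightarrow> key \<omega> = r (key' \<omega>)"
  shows "Nk key \<le> Nk key'"
proof -
  have "0 \<le> (\<Sum>\<omega>\<in>Om. W \<omega> * (cexp key' (key' \<omega>) - cexp key (key \<omega>))\<^sup>2)" using Wn by (intro sum_nonneg) auto
  then show ?thesis using increment(2)[where key = key and r = r and key' = key', OF r] by simp
qed

text \<open>For the martingale difference itself the correlation bound reads
  \<open>X * X \<le> \<delta> * P * X\<close>, where \<open>X\<close> is the growth of
  \<open>Nk\<close>; hence \<open>X \<le> \<delta> * P\<close>.\<close>

lemma Nk_step:
  assumes r: "\<And>\<omega>. \<omega> \<in> Om \<Longrightarrow> key \<omega> = r (key' \<omega>)" and \<delta>: "\<delta> \<ge> 0"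
    and contr: "\<And>G. (\<And>k. (\<Sum>\<omega>\<in>fib key k. W \<omega> * G (key' \<omega>)) = 0) \<Longrightarrow>
      (\<Sum>\<omega>\<in>Om. W \<omega> * f \<omega> * G (key' \<omega>))\<^sup>2 \<le> \<delta> * (\<Sum>\<omega>\<in>Om. W \<omega> * (f \<omega>)\<^sup>2) * (\<Sum>\<omega>\<in>Om. W \<omega> * (G (key' \<omega>))\<^sup>2)"
  shows "Nk key' \<le> Nk key + \<delta> * (\<Sum>\<omega>\<in>Om. W \<omega> * (f \<omega>)\<^sup>2)"
proof -
  define G where "G = (\<lambda>k'. cexp key' k' - cexp key (r k'))"
  define P where "P = (\<Sum>\<omega>\<in>Om. W \<omega> * (f \<omega>)\<^sup>2)"
  define X where "X = Nk key' - Nk key"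
  have G: "G (key' \<omega>) = cexp key' (key' \<omega>) - cexp key (key \<omega>)" if "\<omega> \<in> Om" for \<omega> using r[OF that] by (simp add: G_def)
  have "(\<Sum>\<omega>\<in>fib key k. W \<omega> * G (key' \<omega>)) = 0" for k
  proof -
    have "(\<Sum>\<omega>\<in>fib key k. W \<omega> * G (key' \<omega>)) = (\<Sum>\<omega>\<in>fib key k. W \<omega> * (cexp key' (key' \<omega>) - cexp key (key \<omega>)))"
      by (intro sum.cong refl) (simp add: G fib_def)
    then show ?thesis using increment(3)[where key = key and r = r and key' = key', OF r] by simp
  qed
  then have "(\<Sum>\<omega>\<in>Om. W \<omega> * f \<omega> * G (key' \<omega>))\<^sup>2 \<le> \<delta> * P * (\<Sum>\<omega>\<in>Om. W \<omega> * (G (key' \<omega>))\<^sup>2)"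
    unfolding P_def by (rule contr)
  moreover have "(\<Sum>\<omega>\<in>Om. W \<omega> * f \<omega> * G (key' \<omega>)) = X"
    using increment(1)[where key = key and r = r and key' = key', OF r] by (simp add: X_def G)
  moreover have "(\<Sum>\<omega>\<in>Om. W \<omega> * (G (key' \<omega>))\<^sup>2) = X"
    using increment(2)[where key = key and r = r and key' = key', OF r] by (simp add: X_def G)
  ultimately have le: "X * X \<le> \<delta> * P * X" by (simp add: power2_eq_square)
  have "X \<ge> 0" using Nk_mono[where key = key and r = r and key' = key', OF r] by (simp add: X_def)
  moreover have "\<delta> * P \<ge> 0" using \<delta> Wn unfolding P_def by (intro mult_nonneg_nonneg sum_nonneg) auto
  ultimately have "X \<le> \<delta> * P" using le by (cases "X = 0") auto
  then show ?thesis by (simp add: X_def P_def)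
qed

end

section \<open>Marginals of a harmonic weight\<close>

lemma marg1:
  assumes h: "harm V d n" and S: "fvs.subspace S" "S \<subseteq> V" "card S = 2 ^ j" and B: "finite B" "u \<in> B"
  shows "(\<Sum>z\<in>Ind V S B. n (ssp S z B) * Ph (z u)) = extc d (j + 1) (card B - 1) * (\<Sum>a\<in>V. n1 n S a * Ph a)"
proof -
  have fV: "finite V" using h by (simp add: harm_def)
  have e: "Ind V S {} = {\<lambda>_. undefined}" by (auto simp: Ind_def)
  have BB: "{u} \<union> (B - {u}) = B" using B by auto
  have "(\<Sum>z\<in>Ind V S ({u} \<union> (B - {u})). n (ssp S z ({u} \<union> (B - {u}))) * Ph (restrict z {u} u)) =
      extc d (j + card {u}) (card (B - {u})) * (\<Sum>z\<in>Ind V S {u}. n (ssp S z {u}) * Ph (z u))"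
    by (rule harm_marginal[OF h S, where F = "\<lambda>z. Ph (z u)"]) (use B in auto)
  then have 1: "(\<Sum>z\<in>Ind V S B. n (ssp S z B) * Ph (z u)) = extc d (j + 1) (card B - 1) * (\<Sum>z\<in>Ind V S {u}. n (ssp S z {u}) * Ph (z u))"
    unfolding BB using B by simp
  have "(\<Sum>z\<in>Ind V S {u}. n (ssp S z {u}) * Ph (z u)) = (\<Sum>a\<in>V - S. n (sp1 S a) * Ph a)"
    using sum_Ind_insert[OF S(1), of "{}" u V "\<lambda>z. n (ssp S z {u}) * Ph (z u)"] fV
    by (simp add: e ssp_single_sp1)
  also have "\<dots> = (\<Sum>a\<in>V. n1 n S a * Ph a)"
    using fV by (intro sum.mono_neutral_cong_left) (auto simp: n1_def)
  finally show ?thesis using 1 by simp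
qed

text \<open>Two vectors of a harmonically weighted independent family modulo \<open>S\<close> are
  distributed like an edge of the link of \<open>S\<close>, and one of them like a vertex
  (\<open>marg1\<close>). This is how the expansion of \<open>Y\<close> will be brought in.\<close>

lemma marg2:
  assumes h: "harm V d n" and S: "fvs.subspace S" "S \<subseteq> V" "card S = 2 ^ j" and B: "finite B" "u \<in> B" "w \<in> B" "u \<noteq> w"
  shows "(\<Sum>z\<in>Ind V S B. n (ssp S z B) * Ph (z u) (z w)) = extc d (j + 2) (card B - 2) * (\<Sum>a\<in>V. \<Sum>b\<in>V. n2 n S a b * Ph a b)"
proof -
  have fV: "finite V" using h by (simp add: harm_def)
  have e: "Ind V S {} = {\<lambda>_. undefined}" by (auto simp: Ind_def)
  have BB: "{w, u} \<union> (B - {w, u}) = B" using B by auto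
  have "card (B - {w, u}) = card B - 2" using B by (simp add: card_Diff_subset)
  moreover have "(\<Sum>z\<in>Ind V S ({w, u} \<union> (B - {w, u})). n (ssp S z ({w, u} \<union> (B - {w, u}))) * Ph (restrict z {w, u} u) (restrict z {w, u} w)) =
      extc d (j + card {w, u}) (card (B - {w, u})) * (\<Sum>z\<in>Ind V S {w, u}. n (ssp S z {w, u}) * Ph (z u) (z w))"
    by (rule harm_marginal[OF h S, where F = "\<lambda>z. Ph (z u) (z w)"]) (use B in auto)
  ultimately have 1: "(\<Sum>z\<in>Ind V S B. n (ssp S z B) * Ph (z u) (z w)) = extc d (j + 2) (card B - 2) * (\<Sum>z\<in>Ind V S {w, u}. n (ssp S z {w, u}) * Ph (z u) (z w))"
    unfolding BB using B by simp
  have "(\<Sum>z\<in>Ind V S {w, u}. n (ssp S z {w, u}) * Ph (z u) (z w)) =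
      (\<Sum>z\<in>Ind V S {u}. \<Sum>b\<in>V - ssp S z {u}. n (ssp S (z(w := b)) {w, u}) * Ph (z u) b)"
    using sum_Ind_insert[OF S(1), of "{u}" w V "\<lambda>z. n (ssp S z {w, u}) * Ph (z u) (z w)"] fV B by simp
  also have "\<dots> = (\<Sum>a\<in>V - S. \<Sum>b\<in>V - sp1 S a. n (sp1 (sp1 S a) b) * Ph a b)"
  proof -
    have "ssp S (z(w := b)) {w, u} = sp1 (sp1 S (z u)) b" for z b
      using ssp_insert_sp1[OF S(1), of "{u}" "z(w := b)" w] B by (simp add: ssp_single_sp1)
    then show ?thesis
      using sum_Ind_insert[OF S(1), of "{}" u V "\<lambda>z. \<Sum>b\<in>V - ssp S z {u}. n (ssp S (z(w := b)) {w, u}) * Ph (z u) b"] fV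
      by (simp add: e ssp_single_sp1)
  qed
  also have "\<dots> = (\<Sum>a\<in>V. \<Sum>b\<in>V. n2 n S a b * Ph a b)"
  proof (rule sum.mono_neutral_cong_left[OF fV])
    show "\<forall>a\<in>V - (V - S). (\<Sum>b\<in>V. n2 n S a b * Ph a b) = 0" by (auto simp: n2_def)
    fix a assume "a \<in> V - S"
    then show "(\<Sum>b\<in>V - sp1 S a. n (sp1 (sp1 S a) b) * Ph a b) = (\<Sum>b\<in>V. n2 n S a b * Ph a b)"
      by (intro sum.mono_neutral_cong_left[OF fV]) (auto simp: n2_def n1_def)
  qed auto
  finally show ?thesis using 1 by simp
qed

lemma extc_Suc: "extc d j (Suc k) = (2 ^ d - 2 ^ j) * extc d (Suc j) k"
  unfolding extc_def by (subst prod.lessThan_Suc_shift) simp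

section \<open>Revealing a rank decomposition one vector at a time\<close>

type_synonym ('k, 'i) state = "('k \<Rightarrow> 'i \<Rightarrow> bit) \<times> ('k \<Rightarrow> 'i \<Rightarrow> bit)"

text \<open>
  In the application the index \<open>u\<close> is a vector of \<open>\<bbbF>\<^sub>2\<^sup>L\<close>; \<open>blk u\<close> and \<open>cls u\<close> are its first \<open>i\<close> and \<open>i + 1\<close>
  coordinates. The conditioning determines the sum over each block except the zero block, where the
  vectors remain free.
\<close>

locale core =
  fixes V :: "('i \<Rightarrow> bit) set" and d :: nat and n :: "('i \<Rightarrow> bit) set \<Rightarrow> real"
    and J :: "'k set" and cls :: "'k \<Rightarrow> 'c" and blk :: "'k \<Rightarrow> 'b" and z0 :: 'b
    and Om :: "('k, 'i) state set" and F :: "('k, 'i) state \<Rightarrow> real" and eps :: real and m0 :: nat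
  assumes h: "harm V d n" and J: "finite J" "card J \<le> d"
    and Om: "Om \<subseteq> Ind V Z0 J \<times> Ind V Z0 J"
    and cls: "\<And>u w. u \<in> J \<Longrightarrow> w \<in> J \<Longrightarrow> cls u = cls w \<Longrightarrow> blk u = blk w"
    and op: "\<And>x y u C. (x, y) \<in> Om \<Longrightarrow> u \<in> J \<Longrightarrow> C \<subseteq> J \<Longrightarrow> u \<notin> C \<Longrightarrow> (\<And>w. w \<in> C \<Longrightarrow> blk w = blk u) \<Longrightarrow>
      (opx u C x, opy u C y) \<in> Om \<and> (opy u C x, opx u C y) \<in> Om"
    and Fop: "\<And>x y u C. (x, y) \<in> Om \<Longrightarrow> u \<in> J \<Longrightarrow> C \<subseteq> J \<Longrightarrow> u \<notin> C \<Longrightarrow> (\<And>w. w \<in> C \<Longrightarrow> cls w = cls u) \<Longrightarrow>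
      F (opx u C x, opy u C y) = F (x, y) \<and> F (opy u C x, opx u C y) = F (x, y)"
    and blkdet: "\<And>x y x' y' a. (x, y) \<in> Om \<Longrightarrow> (x', y') \<in> Om \<Longrightarrow> a \<noteq> z0 \<Longrightarrow>
      (\<Sum>k\<in>{k \<in> J. blk k = a}. outer (x k) (y k)) = (\<Sum>k\<in>{k \<in> J. blk k = a}. outer (x' k) (y' k))"
    and zfree: "\<And>x y x'. (x, y) \<in> Om \<Longrightarrow> x' \<in> Ind V Z0 J \<Longrightarrow> (\<And>k. k \<in> J \<Longrightarrow> blk k \<noteq> z0 \<Longrightarrow> x' k = x k) \<Longrightarrow> (x', y) \<in> Om"
    and zfree': "\<And>x y y'. (x, y) \<in> Om \<Longrightarrow> y' \<in> Ind V Z0 J \<Longrightarrow> (\<And>k. k \<in> J \<Longrightarrow> blk k \<noteq> z0 \<Longrightarrow> y' k = y k) \<Longrightarrow> (x, y') \<in> Om"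
    and eps: "eps \<ge> 0" and m0: "m0 + 2 \<le> d"
    and exp: "\<And>S. fvs.subspace S \<Longrightarrow> S \<subseteq> V \<Longrightarrow> n S > 0 \<Longrightarrow> fvs.dim S \<le> m0 \<Longrightarrow> Exp V d n S eps"
begin

lemma fV: "finite V" and V: "fvs.subspace V" using h by (auto simp: harm_def)

lemma fOm: "finite Om"
  using finite_subset[OF Om] finite_Ind[OF fV J(1)] by auto

definition W :: "('k, 'i) state \<Rightarrow> real" where
  "W \<omega> = n (ssp Z0 (fst \<omega>) J) * n (ssp Z0 (snd \<omega>) J)"

lemma n_ssp_nonneg: "x \<in> Ind V S K \<Longrightarrow> fvs.subspace S \<Longrightarrow> S \<subseteq> V \<Longrightarrow> finite K \<Longrightarrow> n (ssp S x K) \<ge> 0"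
  by (intro harm_nonneg[OF h] subspace_ssp ssp_subset V) (auto simp: Ind_def)

lemma Wn: "\<omega> \<in> Om \<Longrightarrow> W \<omega> \<ge> 0"
  unfolding W_def using Om J V
  by (intro mult_nonneg_nonneg n_ssp_nonneg) (auto simp: Z0_subset[OF V, THEN subsetD])

definition Phi :: "'k \<Rightarrow> 'k set \<Rightarrow> ('k, 'i) state \<Rightarrow> ('k, 'i) state" where
  "Phi u C \<omega> = (opx u C (fst \<omega>), opy u C (snd \<omega>))"

text \<open>Transvections inside a block preserve the conditioning, and the weight depends only on
  spans, which they preserve too.\<close>

lemma sum_Phi:
  assumes u: "u \<in> J" "C \<subseteq> J" "u \<notin> C" "\<And>w. w \<in> C \<Longrightarrow> blk w = blk u"
  shows "(\<Sum>\<omega>\<in>Om. W \<omega> * G (Phi u C \<omega>)) = (\<Sum>\<omega>\<in>Om. W \<omega> * G \<omega>)"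
proof (rule sum.reindex_bij_witness[of _ "Phi u C" "Phi u C"])
  fix \<omega> assume \<omega>: "\<omega> \<in> Om"
  show PP: "Phi u C (Phi u C \<omega>) = \<omega>" using u by (simp add: Phi_def opx_opx opy_opy)
  show "Phi u C \<omega> \<in> Om" using op[of "fst \<omega>" "snd \<omega>" u C] \<omega> u by (simp add: Phi_def)
  show "W (Phi u C \<omega>) * G (Phi u C \<omega>) = W \<omega> * G (Phi u C \<omega>)"
    by (simp add: W_def Phi_def ssp_opx[OF J(1) u(1,2,3)] ssp_opy[OF J(1) u(1,2,3)])
  show "Phi u C (Phi u C \<omega>) = \<omega>" by (rule PP)
  show "Phi u C \<omega> \<in> Om" by fact
qed

lemma sum_fibre_const:
  assumes 0: "\<And>k. (\<Sum>\<omega>\<in>{\<omega> \<in> Om. key \<omega> = k}. W \<omega> * g \<omega>) = 0"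
    and G: "\<And>\<omega> \<omega>'. \<omega> \<in> Om \<Longrightarrow> \<omega>' \<in> Om \<Longrightarrow> key \<omega> = key \<omega>' \<Longrightarrow> G \<omega> = G \<omega>'"
  shows "(\<Sum>\<omega>\<in>Om. W \<omega> * (g \<omega> * G \<omega>)) = 0"
proof -
  have "(\<Sum>\<omega>\<in>Om. W \<omega> * (g \<omega> * G \<omega>)) = (\<Sum>k\<in>key ` Om. \<Sum>\<omega>\<in>{\<omega> \<in> Om. key \<omega> = k}. W \<omega> * (g \<omega> * G \<omega>))"
    using fOm by (intro sum.group[symmetric]) auto
  also have "\<dots> = (\<Sum>k\<in>key ` Om. 0)"
  proof (rule sum.cong[OF refl])
    fix k assume "k \<in> key ` Om"
    then obtain \<omega>0 where \<omega>0: "\<omega>0 \<in> Om" "key \<omega>0 = k" by auto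
    have "(\<Sum>\<omega>\<in>{\<omega> \<in> Om. key \<omega> = k}. W \<omega> * (g \<omega> * G \<omega>)) = (\<Sum>\<omega>\<in>{\<omega> \<in> Om. key \<omega> = k}. W \<omega> * g \<omega>) * G \<omega>0"
      unfolding sum_distrib_right
    proof (rule sum.cong[OF refl])
      fix \<omega> assume "\<omega> \<in> {\<omega> \<in> Om. key \<omega> = k}"
      then have "G \<omega> = G \<omega>0" using \<omega>0 by (intro G) auto
      then show "W \<omega> * (g \<omega> * G \<omega>) = W \<omega> * g \<omega> * G \<omega>0" by simp
    qed
    then show "(\<Sum>\<omega>\<in>{\<omega> \<in> Om. key \<omega> = k}. W \<omega> * (g \<omega> * G \<omega>)) = 0" using 0 by simp
  qed
  finally show ?thesis by simp
qed

definition mrg :: "'k set \<Rightarrow> ('k \<Rightarrow> 'i \<Rightarrow> bit) \<Rightarrow> ('k \<Rightarrow> 'i \<Rightarrow> bit) \<Rightarrow> 'k \<Rightarrow> 'i \<Rightarrow> bit" where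
  "mrg B xo z = (\<lambda>k. if k \<in> B then z k else xo k)"

text \<open>Vectors of the zero block are subject to independence alone. Given all the others, they
  range over the independent families modulo the span of these.\<close>

lemma sum_zero_block:
  assumes B: "B \<subseteq> {k \<in> J. blk k = z0}"
  shows "(\<Sum>\<omega>\<in>Om. Ps \<omega>) = (\<Sum>p\<in>(\<lambda>\<omega>. (restrict (fst \<omega>) (J - B), snd \<omega>)) ` Om.
     \<Sum>z\<in>Ind V (ssp Z0 (fst p) (J - B)) B. (Ps (mrg B (fst p) z, snd p) :: real))"
proof -
  define pr where "pr = (\<lambda>\<omega>::('k, 'i) state. (restrict (fst \<omega>) (J - B), snd \<omega>))"
  have B1: "B \<subseteq> J" using B by auto
  then have BJ: "B \<subseteq> J" "finite B" "finite (J - B)" "J - B \<union> B = J" "(J - B) \<inter> B = {}"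
    using finite_subset[OF B1 J(1)] J(1) by auto
  have "(\<Sum>\<omega>\<in>Om. Ps \<omega>) = (\<Sum>p\<in>pr ` Om. \<Sum>\<omega>\<in>{\<omega> \<in> Om. pr \<omega> = p}. Ps \<omega>)"
    using fOm by (intro sum.group[symmetric]) auto
  also have "\<dots> = (\<Sum>p\<in>pr ` Om. \<Sum>z\<in>Ind V (ssp Z0 (fst p) (J - B)) B. Ps (mrg B (fst p) z, snd p))"
  proof (rule sum.cong[OF refl])
    fix p assume "p \<in> pr ` Om"
    then obtain x y where xy: "(x, y) \<in> Om" "p = pr (x, y)" by auto
    define xo where "xo = restrict x (J - B)"
    have p: "p = (xo, y)" using xy by (simp add: pr_def xo_def)
    have x: "x \<in> Ind V Z0 J" using xy Om by auto
    have inJ: "x' \<in> Ind V Z0 J \<longleftrightarrow> restrict x' B \<in> Ind V (ssp Z0 xo (J - B)) B \<and> x' \<in> extensional J"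
      if r: "restrict x' (J - B) = xo" for x'
    proof -
      have eq: "x' k = x k" if "k \<in> J - B" for k using fun_cong[OF r, of k] that by (simp add: xo_def)
      have s: "ssp Z0 x' (J - B) = ssp Z0 xo (J - B)" using eq by (intro ssp_cong) (simp add: xo_def)
      have i1: "indm Z0 x' (J - B)" using x eq indm_cong[of "J - B" x' x Z0] indm_mono[of Z0 x J "J - B"] by (auto simp: Ind_def)
      have v1: "\<forall>k\<in>J - B. x' k \<in> V" using x eq by (auto simp: Ind_def)
      have "indm Z0 x' J \<longleftrightarrow> indm Z0 x' (J - B) \<and> indm (ssp Z0 x' (J - B)) x' B"
        using indm_union[OF subspace_Z0 BJ(3,2) BJ(5), of x'] BJ(4) by simp
      also have "\<dots> \<longleftrightarrow> indm (ssp Z0 xo (J - B)) (restrict x' B) B"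
        using i1 s indm_cong[of B x' "restrict x' B" "ssp Z0 xo (J - B)"] by simp
      finally show ?thesis using v1 BJ by (auto simp: Ind_def PiE_iff)
    qed
    show "(\<Sum>\<omega>\<in>{\<omega> \<in> Om. pr \<omega> = p}. Ps \<omega>) = (\<Sum>z\<in>Ind V (ssp Z0 (fst p) (J - B)) B. Ps (mrg B (fst p) z, snd p))"
    proof (rule sum.reindex_bij_witness[of _ "\<lambda>z. (mrg B xo z, y)" "\<lambda>\<omega>. restrict (fst \<omega>) B"])
      fix \<omega> assume "\<omega> \<in> {\<omega> \<in> Om. pr \<omega> = p}"
      then have \<omega>: "\<omega> \<in> Om" "restrict (fst \<omega>) (J - B) = xo" "snd \<omega> = y" by (auto simp: pr_def p)
      have f: "fst \<omega> \<in> Ind V Z0 J" using \<omega> Om by auto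
      have "mrg B xo (restrict (fst \<omega>) B) k = fst \<omega> k" for k
        using f \<omega>(2) BJ by (auto simp: mrg_def Ind_def PiE_iff extensional_def dest: fun_cong[of _ _ k])
      then have m: "mrg B xo (restrict (fst \<omega>) B) = fst \<omega>" by auto
      show "(mrg B xo (restrict (fst \<omega>) B), y) = \<omega>" using m \<omega> by (simp add: prod_eq_iff)
      show "restrict (fst \<omega>) B \<in> Ind V (ssp Z0 (fst p) (J - B)) B" using inJ[OF \<omega>(2)] f by (simp add: p)
      show "Ps (mrg B (fst p) (restrict (fst \<omega>) B), snd p) = Ps \<omega>" using m \<omega> by (simp add: p) (metis prod.collapse)
    next
      fix z assume "z \<in> Ind V (ssp Z0 (fst p) (J - B)) B"
      then have z: "z \<in> Ind V (ssp Z0 xo (J - B)) B" by (simp add: p)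
      have rB: "restrict (mrg B xo z) B = z" using z by (auto simp: mrg_def Ind_def PiE_iff extensional_def fun_eq_iff)
      have rA: "restrict (mrg B xo z) (J - B) = xo" by (auto simp: mrg_def xo_def fun_eq_iff)
      have "mrg B xo z \<in> extensional J" using BJ by (auto simp: mrg_def xo_def extensional_def)
      then have mI: "mrg B xo z \<in> Ind V Z0 J" using inJ[OF rA] z rB by simp
      have "(mrg B xo z, y) \<in> Om"
        by (rule zfree[OF xy(1) mI]) (use B in \<open>auto simp: mrg_def xo_def\<close>)
      then show "(mrg B xo z, y) \<in> {\<omega> \<in> Om. pr \<omega> = p}" using rA by (simp add: pr_def p)
      show "restrict (fst (mrg B xo z, y)) B = z" using rB by simp
    qed
  qed
  finally show ?thesis unfolding pr_def .
qed

text \<open>The unrevealed vectors of a nonzero block are not known one by one, but the block sum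
  determines the span of the whole block. So the space spanned by everything except the unrevealed
  zero block is a function of the revealed part.\<close>

lemma span_determined:
  assumes T: "T \<subseteq> J" and xy: "(x, y) \<in> Om" "(x', y') \<in> Om" and eq: "restrict x T = restrict x' T"
  defines "R \<equiv> J - {k \<in> J - T. blk k = z0}"
  shows "ssp Z0 x R = ssp Z0 x' R"
proof -
  have fR: "finite R" using J by (simp add: R_def)
  have sub: "ssp Z0 a R \<subseteq> ssp Z0 a' R" if "(a, b) \<in> Om" "(a', b') \<in> Om" "restrict a T = restrict a' T" for a b a' b'
  proof (rule ssp_subset)
    show "fvs.subspace (ssp Z0 a' R)" using fR by (simp add: subspace_ssp)
    show "Z0 \<subseteq> ssp Z0 a' R" by (rule ssp_base) simp
    fix k assume k: "k \<in> R"
    show "a k \<in> ssp Z0 a' R"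
    proof (cases "k \<in> T")
      case True
      then have "a k = a' k" using fun_cong[OF that(3), of k] by simp
      then show ?thesis using ssp_gen[OF subspace_Z0 fR k, of a'] by simp
    next
      case False
      then have kb: "blk k \<noteq> z0" "k \<in> J" using k by (auto simp: R_def)
      define B where "B = {k' \<in> J. blk k' = blk k}"
      have B: "finite B" "B \<subseteq> J" "k \<in> B" using J kb by (auto simp: B_def)
      have "ssp Z0 a B = ssp Z0 a' B"
      proof (rule outer_sum_span[OF V fV B(1)])
        have i: "a \<in> Ind V Z0 J" "b \<in> Ind V Z0 J" "a' \<in> Ind V Z0 J" "b' \<in> Ind V Z0 J" using that Om by auto
        show "b k' \<in> V" "b' k' \<in> V" if "k' \<in> B" for k' using that i B by (auto simp: Ind_def)
        show "indm Z0 b B" "indm Z0 b' B" using i B by (auto simp: Ind_def intro: indm_mono)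
        show "(\<Sum>k\<in>B. outer (a k) (b k)) = (\<Sum>k\<in>B. outer (a' k) (b' k))"
          unfolding B_def by (rule blkdet[OF that(1,2) kb(1)])
      qed
      then have "a k \<in> ssp Z0 a' B" using ssp_gen[OF subspace_Z0 B(1,3), of a] by simp
      moreover have "ssp Z0 a' B \<subseteq> ssp Z0 a' R" using kb by (intro ssp_mono) (auto simp: B_def R_def)
      ultimately show ?thesis by auto
    qed
  qed
  show ?thesis using sub[OF xy eq] sub[OF xy(2,1) eq[symmetric]] by auto
qed

text \<open>All assumptions are symmetric under transposing the matrices, so the estimate for
  revealing \<open>x u\<close> also yields the one for \<open>y u\<close>.\<close>

lemma core_swap:
  "core V d n J cls blk z0 (prod.swap ` Om) (\<lambda>\<omega>. F (prod.swap \<omega>)) eps m0"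
proof
  show "harm V d n" by (rule h)
  show "finite J" "card J \<le> d" by (rule J)+
  show "prod.swap ` Om \<subseteq> Ind V Z0 J \<times> Ind V Z0 J" using Om by auto
  show "eps \<ge> 0" "m0 + 2 \<le> d" by (rule eps m0)+
  show "\<And>u w. u \<in> J \<Longrightarrow> w \<in> J \<Longrightarrow> cls u = cls w \<Longrightarrow> blk u = blk w" by (rule cls)
  show "\<And>S. fvs.subspace S \<Longrightarrow> S \<subseteq> V \<Longrightarrow> n S > 0 \<Longrightarrow> fvs.dim S \<le> m0 \<Longrightarrow> Exp V d n S eps" by (rule exp)
  have sw: "(x, y) \<in> prod.swap ` Om \<longleftrightarrow> (y, x) \<in> Om" for x y by force
  fix x y u C
  show "(opx u C x, opy u C y) \<in> prod.swap ` Om \<and> (opy u C x, opx u C y) \<in> prod.swap ` Om"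
    if "(x, y) \<in> prod.swap ` Om" "u \<in> J" "C \<subseteq> J" "u \<notin> C" "\<And>w. w \<in> C \<Longrightarrow> blk w = blk u"
    using op[of y x u C] that unfolding sw by blast
  show "F (prod.swap (opx u C x, opy u C y)) = F (prod.swap (x, y)) \<and> F (prod.swap (opy u C x, opx u C y)) = F (prod.swap (x, y))"
    if "(x, y) \<in> prod.swap ` Om" "u \<in> J" "C \<subseteq> J" "u \<notin> C" "\<And>w. w \<in> C \<Longrightarrow> cls w = cls u"
    using Fop[of y x u C] that unfolding sw by simp
next
  have sw: "(x, y) \<in> prod.swap ` Om \<longleftrightarrow> (y, x) \<in> Om" for x y by force
  fix x y x' y' a
  assume "(x, y) \<in> prod.swap ` Om" "(x', y') \<in> prod.swap ` Om" "a \<noteq> z0"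
  then have e: "(\<Sum>k\<in>{k \<in> J. blk k = a}. outer (y k) (x k)) = (\<Sum>k\<in>{k \<in> J. blk k = a}. outer (y' k) (x' k))"
    unfolding sw by (rule blkdet)
  define tr where "tr M = (\<lambda>(i, j). M (j, i))" for M :: "'i \<times> 'i \<Rightarrow> bit"
  have t: "(\<Sum>k\<in>D. outer (a k) (b k)) = tr (\<Sum>k\<in>D. outer (b k) (a k))" for a b :: "'k \<Rightarrow> 'i \<Rightarrow> bit" and D
    by (rule ext, clarify) (simp only: tr_def prod.case sum_fun_app outer_def mult.commute)
  show "(\<Sum>k\<in>{k \<in> J. blk k = a}. outer (x k) (y k)) = (\<Sum>k\<in>{k \<in> J. blk k = a}. outer (x' k) (y' k))"
    unfolding t[of x] t[of x'] e ..
next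
  have sw: "(x, y) \<in> prod.swap ` Om \<longleftrightarrow> (y, x) \<in> Om" for x y by force
  show "(x', y) \<in> prod.swap ` Om"
    if "(x, y) \<in> prod.swap ` Om" "x' \<in> Ind V Z0 J" "\<And>k. k \<in> J \<Longrightarrow> blk k \<noteq> z0 \<Longrightarrow> x' k = x k" for x y x'
    using that unfolding sw by (rule zfree')
  show "(x, y') \<in> prod.swap ` Om"
    if "(x, y) \<in> prod.swap ` Om" "y' \<in> Ind V Z0 J" "\<And>k. k \<in> J \<Longrightarrow> blk k \<noteq> z0 \<Longrightarrow> y' k = y k" for x y y'
    using that unfolding sw by (rule zfree)
qed

text \<open>
  Revealing \<open>x u\<close>, when \<open>x\<close> is known on \<open>T\<close> and \<open>y\<close> on \<open>T'\<close>: the transvections \<open>Phi u C\<close> inside the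
  class of \<open>u\<close> do not affect \<open>F\<close>, and two different ones make the vectors at \<open>u\<close> almost uncorrelated.
\<close>

lemma xstep:
  fixes hh :: "('k \<Rightarrow> 'i \<Rightarrow> bit) \<Rightarrow> ('k \<Rightarrow> 'i \<Rightarrow> bit) \<Rightarrow> ('i \<Rightarrow> bit) \<Rightarrow> real"
  assumes T: "T \<subseteq> J" and u: "u \<in> J" "u \<notin> T" and T': "T' = T \<or> T' = insert u T"
    and dm: "blk u = z0 \<Longrightarrow> card {k \<in> J. blk k \<noteq> z0} + card {k \<in> T. blk k = z0} \<le> m0"
  defines "key \<equiv> (\<lambda>\<omega>. (restrict (fst \<omega>) T, restrict (snd \<omega>) T'))"
  defines "g \<equiv> (\<lambda>\<omega>. hh (restrict (fst \<omega>) T) (restrict (snd \<omega>) T') (fst \<omega> u))"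
  assumes mean: "\<And>k. (\<Sum>\<omega>\<in>{\<omega> \<in> Om. key \<omega> = k}. W \<omega> * g \<omega>) = 0"
  shows "(\<Sum>\<omega>\<in>Om. W \<omega> * F \<omega> * g \<omega>)\<^sup>2 \<le>
     (1 / 2 ^ card {w \<in> J - T - {u}. cls w = cls u} + (if blk u = z0 then eps else 0)) *
     (\<Sum>\<omega>\<in>Om. W \<omega> * (F \<omega>)\<^sup>2) * (\<Sum>\<omega>\<in>Om. W \<omega> * (g \<omega>)\<^sup>2)"
proof -
  define hv where "hv = (\<lambda>\<omega>::('k,'i) state. hh (restrict (fst \<omega>) T) (restrict (snd \<omega>) T'))"
  have g: "g \<omega> = hv \<omega> (fst \<omega> u)" for \<omega> by (simp add: g_def hv_def)
  define B where "B = {w \<in> J - T. blk w = blk u}"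
  have uB: "u \<in> B" using u by (simp add: B_def)
  have fB: "finite B" and BJ: "B \<subseteq> J" and BT: "B \<inter> T = {}" using J by (auto simp: B_def)
  have TT': "T \<subseteq> T'" "T' \<subseteq> insert u T" using T' by auto
  define N where "N = (\<Sum>\<omega>\<in>Om. W \<omega> * (g \<omega>)\<^sup>2)"
  have Nn: "N \<ge> 0" unfolding N_def using Wn by (intro sum_nonneg) auto
  \<comment> \<open>Correlation of the value of \<open>hv\<close> at \<open>x u\<close> with its
    value at the subset sum over \<open>C\<close>.\<close>
  define sg where "sg = (\<lambda>C. \<Sum>\<omega>\<in>Om. W \<omega> * (g \<omega> * hv \<omega> (sum (fst \<omega>) C)))"
  have sgu: "sg {u} = N" by (simp add: sg_def N_def g power2_eq_square)
  have keyinv: "hv (Phi v C \<omega>) = hv \<omega>" if "v \<notin> T" "C \<inter> T' = {}" for v C \<omega>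
  proof -
    have "restrict (fst (Phi v C \<omega>)) T = restrict (fst \<omega>) T" using that by (auto simp: Phi_def opx_def fun_eq_iff restrict_def)
    moreover have "restrict (snd (Phi v C \<omega>)) T' = restrict (snd \<omega>) T'" using that by (auto simp: Phi_def opy_def fun_eq_iff restrict_def)
    ultimately show ?thesis by (simp add: hv_def)
  qed
  have fstP: "fst (Phi v C \<omega>) w = (if w = v then fst \<omega> v + sum (fst \<omega>) C else fst \<omega> w)" for v C \<omega> w
    by (simp add: Phi_def opx_def)
  \<comment> \<open>A transvection at \<open>w\<close> carries the sum over \<open>{u, w}\<close> to
    the sum over \<open>C\<close>, so all these correlations agree. If \<open>u \<notin> C\<close>,
    it alters \<open>y u\<close>, which then must not be revealed yet.\<close>
  have sg_pair: "sg C = sg {u, w}"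
    if C: "C \<subseteq> B" "w \<in> C" "w \<noteq> u" "u \<notin> C \<Longrightarrow> T' = T" for C w
  proof -
    define D where "D = (if u \<in> C then C - {u, w} else insert u (C - {w}))"
    have fC: "finite C" using C fB finite_subset by auto
    have D: "D \<subseteq> B" "w \<notin> D" "D \<inter> T' = {}" using C uB BT T' TT' by (auto simp: D_def)
    have sumC: "sum x C = x u + (x w + sum x D)" for x :: "'k \<Rightarrow> 'i \<Rightarrow> bit"
    proof (cases "u \<in> C")
      case True
      have e1: "sum x C = x u + sum x (C - {u})" using fC True by (rule sum.remove)
      have e2: "sum x (C - {u}) = x w + sum x (C - {u} - {w})" using fC C by (intro sum.remove) auto
      have DD: "D = C - {u} - {w}" using True by (auto simp: D_def)
      show ?thesis unfolding e1 e2 DD ..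
    next
      case False
      have e1: "sum x C = x w + sum x (C - {w})" using fC C(2) by (rule sum.remove)
      have "sum x (insert u (C - {w})) = x u + sum x (C - {w})" using False fC by (intro sum.insert) auto
      then have e2: "sum x D = x u + sum x (C - {w})" using False unfolding D_def by simp
      show ?thesis by (simp only: e1 e2 add.left_commute[of "x w" "x u"] vadd_self_left)
    qed
    have "sg {u, w} = (\<Sum>\<omega>\<in>Om. W \<omega> * (g (Phi w D \<omega>) * hv (Phi w D \<omega>) (sum (fst (Phi w D \<omega>)) {u, w})))"
    proof -
      have 1: "w \<in> J" "D \<subseteq> J" using C D BJ by auto
      have 2: "blk w' = blk w" if "w' \<in> D" for w'
      proof -
        have "w' \<in> B" "w \<in> B" using that D C by auto
        then show ?thesis by (simp add: B_def)
      qed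
      show ?thesis unfolding sg_def
        by (rule sum_Phi[symmetric, where G = "\<lambda>\<omega>. g \<omega> * hv \<omega> (sum (fst \<omega>) {u, w})"]) (use 1 2 D in auto)
    qed
    also have "\<dots> = sg C"
      unfolding sg_def
    proof (rule sum.cong[OF refl])
      fix \<omega>
      have hvi: "hv (Phi w D \<omega>) = hv \<omega>" using C D BT by (intro keyinv) auto
      have gi: "g (Phi w D \<omega>) = g \<omega>" unfolding g hvi using C by (simp add: fstP)
      have "sum (fst (Phi w D \<omega>)) {u, w} = fst \<omega> u + (fst \<omega> w + sum (fst \<omega>) D)"
        using C by (simp add: fstP)
      then show "W \<omega> * (g (Phi w D \<omega>) * hv (Phi w D \<omega>) (sum (fst (Phi w D \<omega>)) {u, w})) = W \<omega> * (g \<omega> * hv \<omega> (sum (fst \<omega>) C))"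
        unfolding hvi gi sumC by simp
    qed
    finally show ?thesis by simp
  qed
  have small: "sg {u, w} \<le> (if blk u = z0 then eps else 0) * N" if w: "w \<in> B" "w \<noteq> u" for w
  proof (cases "blk u = z0")
    case False
    \<comment> \<open>The index sets whose subset sums, taken together, are fixed by the revealed
      part: the nonzero elements of a span if \<open>y u\<close> is unknown, the coset through
      \<open>x u\<close> if it is known.\<close>
    define CC where "CC = (if T' = T then Pow B - {{}} else {C \<in> Pow B. u \<in> C})"
    have fCC: "finite CC" using fB by (simp add: CC_def)
    have uCC: "{u} \<in> CC" "{u, w} \<in> CC" using uB w by (auto simp: CC_def)
    have CCB: "C \<subseteq> B" if "C \<in> CC" for C using that by (auto simp: CC_def split: if_splits)
    have injx: "inj_on (\<lambda>C. sum x C) (Pow B)" if "x \<in> Ind V Z0 J" for x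
    proof -
      have "indm Z0 x B" using that BJ by (auto simp: Ind_def intro: indm_mono)
      then show ?thesis using indm_inj[OF fB subspace_Z0, of x] by (auto simp: inj_on_def vadd_eq_0_iff)
    qed
    have det: "(\<lambda>C. sum x C) ` CC = (\<lambda>C. sum x' C) ` CC"
      if o: "(x, y) \<in> Om" "(x', y') \<in> Om" and k: "key (x, y) = key (x', y')" for x y x' y'
    proof -
      have i: "x \<in> Ind V Z0 J" "y \<in> Ind V Z0 J" "x' \<in> Ind V Z0 J" "y' \<in> Ind V Z0 J" using o Om by auto
      have xT: "x t = x' t" if "t \<in> T" for t using k that unfolding key_def by (auto dest: fun_cong[of _ _ t])
      have yT: "y t = y' t" if "t \<in> T'" for t using k that unfolding key_def by (auto dest: fun_cong[of _ _ t])
      define A where "A = {k \<in> J. blk k = blk u}"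
      have fA: "finite A" using J by (simp add: A_def)
      have "(\<Sum>k\<in>A. outer (x k) (y k)) = (\<Sum>k\<in>A. outer (x' k) (y' k))"
        unfolding A_def by (rule blkdet[OF o False])
      moreover have "(\<Sum>k\<in>A. G k) = (\<Sum>k\<in>A \<inter> T. G k) + (\<Sum>k\<in>B. G k)" for G :: "'k \<Rightarrow> 'i \<times> 'i \<Rightarrow> bit"
      proof -
        have "A - T = B" by (auto simp: A_def B_def)
        then show ?thesis using sum.Int_Diff[OF fA, of G T] by simp
      qed
      moreover have "(\<Sum>k\<in>A \<inter> T. outer (x k) (y k)) = (\<Sum>k\<in>A \<inter> T. outer (x' k) (y' k))"
        using xT yT TT' by (intro sum.cong refl) auto
      ultimately have eqB: "(\<Sum>k\<in>B. outer (x k) (y k)) = (\<Sum>k\<in>B. outer (x' k) (y' k))" by simp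
      have yv: "y k \<in> V" "y' k \<in> V" if "k \<in> B" for k using i that BJ by (auto simp: Ind_def)
      have yi: "indm Z0 y B" "indm Z0 y' B" "indm Z0 x B" "indm Z0 x' B" using i BJ by (auto simp: Ind_def intro: indm_mono)
      show ?thesis
      proof (cases "T' = T")
        case True
        have *: "(\<lambda>C. sum a C) ` CC = ssp Z0 a B - Z0" if "indm Z0 a B" for a :: "'k \<Rightarrow> 'i \<Rightarrow> bit"
        proof -
          have im: "ssp Z0 a B = (\<lambda>C. sum a C) ` Pow B" by (auto simp: ssp_def Z0_def)
          have inj: "inj_on (\<lambda>C. sum a C) (Pow B)"
            using indm_inj[OF fB subspace_Z0 that] by (auto simp: inj_on_def vadd_eq_0_iff)
          have "(\<lambda>C. sum a C) ` (Pow B - {{}}) = (\<lambda>C. sum a C) ` Pow B - (\<lambda>C. sum a C) ` {{}}"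
            by (rule inj_on_image_set_diff[OF inj]) auto
          then show ?thesis unfolding im CC_def using True by (simp add: Z0_def)
        qed
        show ?thesis using *[OF yi(3)] *[OF yi(4)] outer_sum_span[OF V fV fB yv(1) yi(1) yv(2) yi(2) eqB] by simp
      next
        case F: False
        have *: "(\<lambda>C. sum a C) ` CC = (\<lambda>C. a u + sum a C) ` Pow (B - {u})" for a :: "'k \<Rightarrow> 'i \<Rightarrow> bit"
        proof -
          have "CC = insert u ` Pow (B - {u})"
          proof (intro equalityI subsetI)
            fix C assume "C \<in> CC"
            then have "C \<subseteq> B" "u \<in> C" using F by (auto simp: CC_def)
            then show "C \<in> insert u ` Pow (B - {u})" by (intro image_eqI[of _ _ "C - {u}"]) auto
          qed (use F uB in \<open>auto simp: CC_def\<close>)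
          moreover have "sum a (insert u C) = a u + sum a C" if "C \<subseteq> B - {u}" for C
            using that fB finite_subset[of C B] by (subst sum.insert) auto
          ultimately show ?thesis by (auto simp: image_image)
        qed
        have "y u = y' u" using F T' by (intro yT) auto
        then show ?thesis unfolding * using outer_sum_affine[OF V fV fB yv(1) yi(1) yv(2) yi(2) eqB uB] by blast
      qed
    qed
    \<comment> \<open>As a function of the key, the sum over \<open>CC\<close> is orthogonal to the
      conditionally mean-zero \<open>g\<close>. Its term at \<open>{u}\<close> is
      \<open>N \<ge> 0\<close> and all others equal \<open>sg {u, w}\<close>, which therefore cannot
      be positive.\<close>
    have "(\<Sum>\<omega>\<in>Om. W \<omega> * (g \<omega> * (\<Sum>C\<in>CC. hv \<omega> (sum (fst \<omega>) C)))) = 0"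
    proof (rule sum_fibre_const[where key = key and g = g and G = "\<lambda>\<omega>. \<Sum>C\<in>CC. hv \<omega> (sum (fst \<omega>) C)"])
      show "(\<Sum>\<omega>\<in>{\<omega> \<in> Om. key \<omega> = k}. W \<omega> * g \<omega>) = 0" for k by (rule mean)
      fix \<omega> \<omega>' assume o: "\<omega> \<in> Om" "\<omega>' \<in> Om" "key \<omega> = key \<omega>'"
      have ii: "fst \<omega> \<in> Ind V Z0 J" "fst \<omega>' \<in> Ind V Z0 J" using o Om by auto
      have re: "(\<Sum>C\<in>CC. hv \<omega> (sum x C)) = (\<Sum>\<xi>\<in>(\<lambda>C. sum x C) ` CC. hv \<omega> \<xi>)" if "x \<in> Ind V Z0 J" for \<omega> x
        using inj_on_subset[OF injx[OF that], of CC] CCB by (subst sum.reindex) auto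
      have "hv \<omega> = hv \<omega>'" using o(3) by (simp add: hv_def key_def)
      moreover have "(\<lambda>C. sum (fst \<omega>) C) ` CC = (\<lambda>C. sum (fst \<omega>') C) ` CC"
        using o by (intro det[of "fst \<omega>" "snd \<omega>" "fst \<omega>'" "snd \<omega>'"]) auto
      ultimately show "(\<Sum>C\<in>CC. hv \<omega> (sum (fst \<omega>) C)) = (\<Sum>C\<in>CC. hv \<omega>' (sum (fst \<omega>') C))"
        unfolding re[OF ii(1)] re[OF ii(2)] by simp
    qed
    moreover have "(\<Sum>\<omega>\<in>Om. W \<omega> * (g \<omega> * (\<Sum>C\<in>CC. hv \<omega> (sum (fst \<omega>) C)))) = (\<Sum>C\<in>CC. sg C)"
      unfolding sg_def by (subst sum.swap) (simp add: sum_distrib_left)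
    ultimately have "0 = (\<Sum>C\<in>CC. sg C)" by simp
    also have "\<dots> = sg {u} + (\<Sum>C\<in>CC - {{u}}. sg C)" using fCC uCC by (intro sum.remove) auto
    also have "(\<Sum>C\<in>CC - {{u}}. sg C) = (\<Sum>C\<in>CC - {{u}}. sg {u, w})"
    proof (rule sum.cong[OF refl])
      fix C assume C: "C \<in> CC - {{u}}"
      then have CB: "C \<subseteq> B" "C \<noteq> {}" "C \<noteq> {u}" "u \<notin> C \<Longrightarrow> T' = T" by (auto simp: CC_def split: if_splits)
      then obtain w' where w': "w' \<in> C" "w' \<noteq> u" by auto
      have "sg C = sg {u, w'}" using CB w' by (intro sg_pair) auto
      also have "\<dots> = sg {u, w}"
      proof (cases "w' = w")
        case False
        have "sg {u, w, w'} = sg {u, w'}" using w' w CB uB by (intro sg_pair) auto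
        moreover have "sg {u, w, w'} = sg {u, w}" using w' w CB uB by (intro sg_pair) auto
        ultimately show ?thesis by simp
      qed simp
      finally show "sg C = sg {u, w}" .
    qed
    also have "\<dots> = real (card (CC - {{u}})) * sg {u, w}" by simp
    finally have "real (card (CC - {{u}})) * sg {u, w} = - N" using sgu by simp
    moreover have "{u, w} \<in> CC - {{u}}" using uCC w by auto
    then have "card (CC - {{u}}) > 0" using fCC by (auto simp: card_gt_0_iff)
    ultimately have "sg {u, w} \<le> 0"
    proof -
      assume e: "real (card (CC - {{u}})) * sg {u, w} = - N" and c: "card (CC - {{u}}) > 0"
      show ?thesis
      proof (rule ccontr)
        assume "\<not> ?thesis"
        then have "real (card (CC - {{u}})) * sg {u, w} > 0" using c by (intro mult_pos_pos) auto
        then show False using e Nn by linarith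
      qed
    qed
    then show ?thesis using False by simp
  next
    case True
    \<comment> \<open>In the zero block the tensor sum is free. Given \<open>y\<close> and all
      \<open>x\<close> outside \<open>B\<close>, an independent family modulo \<open>S p\<close>
      remains, and pairs from it are edges of the link of \<open>S p\<close>.\<close>
    define R where "R = J - B"
    have BB: "B \<subseteq> {k \<in> J. blk k = z0}" using True by (auto simp: B_def)
    have R: "R = J - {k \<in> J - T. blk k = z0}" using True by (auto simp: R_def B_def)
    have fR: "finite R" using J by (simp add: R_def)
    have TR: "T \<subseteq> R" using T BT by (auto simp: R_def)
    define P where "P = (\<lambda>\<omega>::('k,'i) state. (restrict (fst \<omega>) R, snd \<omega>)) ` Om"
    have fP: "finite P" using fOm by (simp add: P_def)
    have fib: "(\<Sum>\<omega>\<in>Om. Ps \<omega>) = (\<Sum>p\<in>P. \<Sum>z\<in>Ind V (ssp Z0 (fst p) R) B. (Ps (mrg B (fst p) z, snd p) :: real))" for Ps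
      unfolding P_def R_def by (rule sum_zero_block[OF BB])
    define m where "m = card B"
    define j where "j = card R"
    have jm: "j + m \<le> d"
      using J BJ fB by (simp add: j_def m_def R_def card_Diff_subset card_mono)
    have m2: "m \<ge> 2"
    proof -
      have "card {u, w} \<le> card B" using uB w fB by (intro card_mono) auto
      then show ?thesis using w by (simp add: m_def)
    qed
    define S where "S = (\<lambda>p::('k,'i) state. ssp Z0 (fst p) R)"
    have fib2: "(\<Sum>\<omega>\<in>Om. Ps \<omega>) = (\<Sum>p\<in>P. \<Sum>z\<in>Ind V (S p) B. (Ps (mrg B (fst p) z, snd p) :: real))" for Ps
      unfolding fib S_def ..
    define H where "H = (\<lambda>p::('k,'i) state. hh (restrict (fst p) T) (restrict (snd p) T'))"
    define ny where "ny = (\<lambda>p::('k,'i) state. n (ssp Z0 (snd p) J))"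
    have Pf: "\<exists>x. (x, snd p) \<in> Om \<and> fst p = restrict x R \<and> S p = ssp Z0 x R" if "p \<in> P" for p
      using that unfolding P_def S_def by (auto intro!: ssp_cong)
    have SS: "fvs.subspace (S p)" "S p \<subseteq> V" "card (S p) = 2 ^ j" "fvs.dim (S p) = j" "ny p \<ge> 0" if p: "p \<in> P" for p
    proof -
      obtain x where x: "(x, snd p) \<in> Om" "S p = ssp Z0 x R" using Pf[OF p] by auto
      have xi: "x \<in> Ind V Z0 J" "snd p \<in> Ind V Z0 J" using x Om by auto
      have ir: "indm Z0 x R" using xi by (auto simp: Ind_def R_def intro: indm_mono)
      show "fvs.subspace (S p)" unfolding x(2) using fR by (simp add: subspace_ssp)
      show "S p \<subseteq> V" unfolding x(2) using xi V by (intro ssp_subset Z0_subset) (auto simp: Ind_def R_def)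
      show "card (S p) = 2 ^ j" unfolding x(2) using card_ssp[OF fR subspace_Z0 _ ir] by (simp add: j_def)
      show "fvs.dim (S p) = j" unfolding x(2) using dim_ssp_0[OF fR ir] by (simp add: j_def)
      show "ny p \<ge> 0" unfolding ny_def using xi J V by (intro n_ssp_nonneg) (auto simp: Z0_subset[OF V, THEN subsetD])
    qed
    have Wm: "W (mrg B (fst p) z, snd p) = n (ssp (S p) z B) * ny p" for p z
    proof -
      have "ssp Z0 (mrg B (fst p) z) J = ssp (ssp Z0 (mrg B (fst p) z) R) (mrg B (fst p) z) B"
        using ssp_union[OF subspace_Z0 fR fB, of "mrg B (fst p) z"] BJ by (simp add: R_def Un_absorb2)
      also have "ssp Z0 (mrg B (fst p) z) R = S p" unfolding S_def by (intro ssp_cong) (auto simp: mrg_def R_def)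
      also have "ssp (S p) (mrg B (fst p) z) B = ssp (S p) z B" by (intro ssp_cong) (auto simp: mrg_def)
      finally show ?thesis by (simp add: W_def ny_def)
    qed
    have km: "restrict (mrg B (fst p) z) T = restrict (fst p) T" for p :: "('k,'i) state" and z
      using BT by (auto simp: mrg_def fun_eq_iff restrict_def)
    have hvm: "hv (mrg B (fst p) z, snd p) = H p" for p z by (simp add: hv_def H_def km)
    have gm: "g (mrg B (fst p) z, snd p) = H p (z u)" for p z unfolding g hvm using uB by (simp add: mrg_def)
    have mw: "mrg B xo z k = z k" if "k \<in> B" for xo z k using that by (simp add: mrg_def)
    define e1 where "e1 = extc d (j + 1) (m - 1)"
    define e2 where "e2 = extc d (j + 2) (m - 2)"
    have e1pos: "e1 > 0" unfolding e1_def using jm m2 by (intro extc_pos) auto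
    have e2pos: "e2 > 0" unfolding e2_def using jm m2 by (intro extc_pos) auto
    have e12: "e1 = (2 ^ d - 2 ^ (j + 1)) * e2"
    proof -
      have "m - 1 = Suc (m - 2)" using m2 by simp
      then show ?thesis unfolding e1_def e2_def by (simp add: extc_Suc)
    qed
    \<comment> \<open>Mean zero is given only on fibres of the key. It passes to every single
      \<open>p\<close> because \<open>S p\<close> and \<open>H p\<close> are functions of the key,
      so all \<open>p\<close> over one key share the same link average \<open>c\<close>.\<close>
    have meanH: "(\<Sum>a\<in>V. n1 n (S p) a * H p a) = 0" if p: "p \<in> P" and pos: "ny p > 0" for p
    proof -
      define k where "k = (restrict (fst p) T, restrict (snd p) T')"
      define c where "c = (\<Sum>a\<in>V. n1 n (S p) a * H p a)"
      have "0 = (\<Sum>\<omega>\<in>{\<omega> \<in> Om. key \<omega> = k}. W \<omega> * g \<omega>)" using mean by simp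
      also have "\<dots> = (\<Sum>\<omega>\<in>Om. of_bool (key \<omega> = k) * (W \<omega> * g \<omega>))"
        using fOm by (intro sum.mono_neutral_cong_left) auto
      also have "\<dots> = (\<Sum>q\<in>P. \<Sum>z\<in>Ind V (S q) B. of_bool (key (mrg B (fst q) z, snd q) = k) * (W (mrg B (fst q) z, snd q) * g (mrg B (fst q) z, snd q)))"
        unfolding fib S_def ..
      also have "\<dots> = (\<Sum>q\<in>P. of_bool ((restrict (fst q) T, restrict (snd q) T') = k) * ny q * e1 * c)"
      proof (rule sum.cong[OF refl])
        fix q assume q: "q \<in> P"
        show "(\<Sum>z\<in>Ind V (S q) B. of_bool (key (mrg B (fst q) z, snd q) = k) * (W (mrg B (fst q) z, snd q) * g (mrg B (fst q) z, snd q)))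
           = of_bool ((restrict (fst q) T, restrict (snd q) T') = k) * ny q * e1 * c"
        proof (cases "(restrict (fst q) T, restrict (snd q) T') = k")
          case kq: True
          obtain x where x: "(x, snd p) \<in> Om" "fst p = restrict x R" "S p = ssp Z0 x R" using Pf[OF p] by auto
          obtain x' where x': "(x', snd q) \<in> Om" "fst q = restrict x' R" "S q = ssp Z0 x' R" using Pf[OF q] by auto
          have "restrict x T = restrict (fst p) T" "restrict x' T = restrict (fst q) T"
            using TR x x' by (auto simp: fun_eq_iff restrict_def)
          then have "restrict x T = restrict x' T" using kq by (simp add: k_def)
          then have "S q = S p" unfolding x(3) x'(3) R using span_determined[OF T x(1) x'(1)] by simp
          moreover have "H q = H p" using kq by (simp add: H_def k_def)
          ultimately have "(\<Sum>z\<in>Ind V (S q) B. n (ssp (S q) z B) * H q (z u)) = e1 * c"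
            unfolding e1_def c_def m_def using marg1[OF h SS(1,2,3)[OF p] fB uB] by simp
          moreover have "(\<Sum>z\<in>Ind V (S q) B. of_bool (key (mrg B (fst q) z, snd q) = k) * (W (mrg B (fst q) z, snd q) * g (mrg B (fst q) z, snd q)))
            = (\<Sum>z\<in>Ind V (S q) B. ny q * (n (ssp (S q) z B) * H q (z u)))"
            using kq by (intro sum.cong refl) (simp add: key_def km Wm gm)
          ultimately show ?thesis using kq by (simp add: sum_distrib_left[symmetric])
        next
          case False
          then show ?thesis by (simp add: key_def km)
        qed
      qed
      also have "\<dots> = (\<Sum>q\<in>P. of_bool ((restrict (fst q) T, restrict (snd q) T') = k) * ny q) * (e1 * c)"
        by (simp add: sum_distrib_right mult.assoc)
      finally have z: "(\<Sum>q\<in>P. of_bool ((restrict (fst q) T, restrict (snd q) T') = k) * ny q) * (e1 * c) = 0" by simp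
      have "0 < of_bool ((restrict (fst p) T, restrict (snd p) T') = k) * ny p" using pos by (simp add: k_def)
      also have "\<dots> \<le> (\<Sum>q\<in>P. of_bool ((restrict (fst q) T, restrict (snd q) T') = k) * ny q)"
        using p fP SS(5) by (intro member_le_sum) auto
      finally show ?thesis using z e1pos by (simp add: c_def)
    qed
    have bound: "e2 * (\<Sum>a\<in>V. \<Sum>b\<in>V. n2 n (S p) a b * (H p a * H p (a + b))) \<le> eps * (e1 * (\<Sum>a\<in>V. n1 n (S p) a * (H p a)\<^sup>2))"
      if p: "p \<in> P" and pos: "ny p > 0" for p
    proof -
      note S = SS(1,2)[OF p]
      \<comment> \<open>The edges \<open>a\<close>, \<open>b\<close> and \<open>a\<close>,
        \<open>a + b\<close> have equal weight, so \<open>a + b\<close> may be replaced by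
        \<open>b\<close>.\<close>
      have sub: "(\<Sum>b\<in>V. n2 n (S p) a b * (H p a * H p (a + b))) = (\<Sum>b\<in>V. n2 n (S p) a b * H p a * H p b)" if a: "a \<in> V" for a
      proof -
        have "n2 n (S p) a (b + a) = n2 n (S p) a b" for b
          using n2_add[OF S(1), of n a b] n2_sym[OF S(1), of n a "b + a"] n2_sym[OF S(1), of n a b] by (simp add: add.commute)
        then have "(\<Sum>b\<in>V. n2 n (S p) a b * H p a * H p b) = (\<Sum>b\<in>V. n2 n (S p) a b * H p a * H p (b + a))"
          using sum_shift[OF V a, of "\<lambda>b. n2 n (S p) a b * H p a * H p b"] by simp
        then show ?thesis by (simp add: add.commute[of _ a] mult.assoc)
      qed
      have E: "Exp V d n (S p) eps"
      proof (cases "n (S p) > 0")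
        case pos: True
        have "card R = card {k \<in> J. blk k \<noteq> z0} + card {k \<in> T. blk k = z0}"
        proof -
          have "R = {k \<in> J. blk k \<noteq> z0} \<union> {k \<in> T. blk k = z0}" using T by (auto simp: R)
          moreover have "finite {k \<in> T. blk k = z0}" using T J finite_subset[of T J] by auto
          ultimately show ?thesis using J by (simp add: card_Un_disjoint disjoint_iff)
        qed
        then have "fvs.dim (S p) \<le> m0" using dm[OF True] SS(4)[OF p] by (simp add: j_def)
        then show ?thesis using exp[OF S pos] by simp
      next
        case False
        then have "n (S p) = 0" using harm_nonneg[OF h S] by simp
        then have "(\<Sum>a\<in>V. n1 n (S p) a) = 0" using sum_n1[OF h S] by simp
        then have z1: "n1 n (S p) a = 0" if "a \<in> V" for a
          using n1_nonneg[OF h S] fV that by (simp add: sum_nonneg_eq_0_iff)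
        then have "n2 n (S p) a b = 0" if "a \<in> V" "b \<in> V" for a b using n2_zero[OF h S that] that by simp
        then show ?thesis using z1 by (simp add: Exp_def)
      qed
      have "(\<Sum>a\<in>V. \<Sum>b\<in>V. n2 n (S p) a b * (H p a * H p (a + b))) = (\<Sum>a\<in>V. \<Sum>b\<in>V. n2 n (S p) a b * H p a * H p b)"
        by (rule sum.cong[OF refl], rule sub)
      also have "\<dots> \<le> eps * (2 ^ d - 2 * real (card (S p))) * (\<Sum>a\<in>V. n1 n (S p) a * (H p a)\<^sup>2)"
        using E meanH[OF p pos] unfolding Exp_def by blast
      also have "2 ^ d - 2 * real (card (S p)) = 2 ^ d - 2 ^ (j + 1)" using SS(3)[OF p] by simp
      finally have *: "(\<Sum>a\<in>V. \<Sum>b\<in>V. n2 n (S p) a b * (H p a * H p (a + b))) \<le>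
          eps * (2 ^ d - 2 ^ (j + 1)) * (\<Sum>a\<in>V. n1 n (S p) a * (H p a)\<^sup>2)" .
      have "e2 * (\<Sum>a\<in>V. \<Sum>b\<in>V. n2 n (S p) a b * (H p a * H p (a + b))) \<le>
          e2 * (eps * (2 ^ d - 2 ^ (j + 1)) * (\<Sum>a\<in>V. n1 n (S p) a * (H p a)\<^sup>2))"
        by (rule mult_left_mono[OF *]) (rule less_imp_le[OF e2pos])
      also have "\<dots> = eps * (e1 * (\<Sum>a\<in>V. n1 n (S p) a * (H p a)\<^sup>2))" unfolding e12 by (simp only: ac_simps)
      finally show ?thesis .
    qed
    have "sg {u, w} = (\<Sum>p\<in>P. \<Sum>z\<in>Ind V (S p) B. ny p * (n (ssp (S p) z B) * (H p (z u) * H p (z u + z w))))"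
      unfolding sg_def fib2
    proof (intro sum.cong refl)
      fix p :: "('k,'i) state" and z
      have "sum (mrg B (fst p) z) {u, w} = z u + z w" using w uB by (simp add: mw)
      then show "W (mrg B (fst p) z, snd p) * (g (mrg B (fst p) z, snd p) * hv (mrg B (fst p) z, snd p) (sum (fst (mrg B (fst p) z, snd p)) {u, w})) =
           ny p * (n (ssp (S p) z B) * (H p (z u) * H p (z u + z w)))"
        unfolding fst_conv Wm gm hvm by (simp only: ac_simps)
    qed
    also have "\<dots> = (\<Sum>p\<in>P. ny p * (e2 * (\<Sum>a\<in>V. \<Sum>b\<in>V. n2 n (S p) a b * (H p a * H p (a + b)))))"
    proof (rule sum.cong[OF refl])
      fix p assume p: "p \<in> P"
      show "(\<Sum>z\<in>Ind V (S p) B. ny p * (n (ssp (S p) z B) * (H p (z u) * H p (z u + z w)))) =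
        ny p * (e2 * (\<Sum>a\<in>V. \<Sum>b\<in>V. n2 n (S p) a b * (H p a * H p (a + b))))"
        unfolding sum_distrib_left[symmetric] e2_def m_def
        using marg2[OF h SS(1,2,3)[OF p] fB uB w(1) w(2)[symmetric], of "\<lambda>a b. H p a * H p (a + b)"] by simp
    qed
    also have "\<dots> \<le> (\<Sum>p\<in>P. ny p * (eps * (e1 * (\<Sum>a\<in>V. n1 n (S p) a * (H p a)\<^sup>2))))"
    proof (rule sum_mono)
      fix p assume p: "p \<in> P"
      show "ny p * (e2 * (\<Sum>a\<in>V. \<Sum>b\<in>V. n2 n (S p) a b * (H p a * H p (a + b)))) \<le>
        ny p * (eps * (e1 * (\<Sum>a\<in>V. n1 n (S p) a * (H p a)\<^sup>2)))"
      proof (cases "ny p > 0")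
        case True
        then show ?thesis by (intro mult_left_mono bound[OF p True]) simp
      next
        case False
        then have "ny p = 0" using SS(5)[OF p] by simp
        then show ?thesis by simp
      qed
    qed
    also have "\<dots> = eps * (\<Sum>p\<in>P. ny p * (\<Sum>z\<in>Ind V (S p) B. n (ssp (S p) z B) * (H p (z u))\<^sup>2))"
      unfolding sum_distrib_left[of eps]
    proof (rule sum.cong[OF refl])
      fix p assume p: "p \<in> P"
      show "ny p * (eps * (e1 * (\<Sum>a\<in>V. n1 n (S p) a * (H p a)\<^sup>2))) = eps * (ny p * (\<Sum>z\<in>Ind V (S p) B. n (ssp (S p) z B) * (H p (z u))\<^sup>2))"
        unfolding e1_def m_def using marg1[OF h SS(1,2,3)[OF p] fB uB, of "\<lambda>a. (H p a)\<^sup>2"] by simp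
    qed
    also have "(\<Sum>p\<in>P. ny p * (\<Sum>z\<in>Ind V (S p) B. n (ssp (S p) z B) * (H p (z u))\<^sup>2)) = N"
      unfolding N_def fib2 sum_distrib_left
      by (intro sum.cong refl) (simp only: Wm gm ac_simps)
    finally show ?thesis using True by simp
  qed
  define dl where "dl = (if blk u = z0 then eps else 0)"
  have dl: "dl \<ge> 0" using eps by (simp add: dl_def)
  define Q where "Q = {w \<in> J - T - {u}. cls w = cls u}"
  have fQ: "finite Q" using J by (simp add: Q_def)
  have QB: "Q \<subseteq> B - {u}" 
  proof
    fix w assume "w \<in> Q"
    then have w: "w \<in> J" "w \<notin> T" "w \<noteq> u" "cls w = cls u" by (auto simp: Q_def)
    then have "blk w = blk u" using cls[OF w(1) u(1)] by simp
    then show "w \<in> B - {u}" using w by (simp add: B_def)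
  qed
  \<comment> \<open>Summing \<open>g\<close> over the transvections at \<open>u\<close> within its
    class: \<open>F\<close> is invariant, so the correlation with \<open>F\<close> is multiplied by
    the number of terms, while the terms are almost orthogonal and the squared norm grows much more
    slowly.\<close>
  define A where "A = (\<lambda>\<omega>. \<Sum>C\<in>Pow Q. g (Phi u C \<omega>))"
  have Qok: "C \<subseteq> J" "u \<notin> C" "C \<inter> T' = {}" "\<And>w. w \<in> C \<Longrightarrow> blk w = blk u" "\<And>w. w \<in> C \<Longrightarrow> cls w = cls u" if "C \<subseteq> Q" for C
  proof -
    have CB: "C \<subseteq> B - {u}" using that QB by blast
    show "C \<subseteq> J" "u \<notin> C" "C \<inter> T' = {}" using CB BJ BT TT' by blast+
    show "blk w = blk u" if "w \<in> C" for w using that CB by (auto simp: B_def)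
    show "cls w = cls u" if w: "w \<in> C" for w using w \<open>C \<subseteq> Q\<close> by (auto simp: Q_def)
  qed
  have gPhi: "g (Phi u C \<omega>) = hv \<omega> (fst \<omega> u + sum (fst \<omega>) C)" if "C \<subseteq> Q" for C \<omega>
    unfolding g keyinv[OF u(2) Qok(3)[OF that]] by (simp add: fstP)
  have FA: "(\<Sum>\<omega>\<in>Om. W \<omega> * F \<omega> * A \<omega>) = 2 ^ card Q * (\<Sum>\<omega>\<in>Om. W \<omega> * F \<omega> * g \<omega>)"
  proof -
    have "(\<Sum>\<omega>\<in>Om. W \<omega> * F \<omega> * A \<omega>) = (\<Sum>C\<in>Pow Q. \<Sum>\<omega>\<in>Om. W \<omega> * F \<omega> * g (Phi u C \<omega>))"
      unfolding A_def by (subst sum.swap) (simp add: sum_distrib_left)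
    also have "\<dots> = (\<Sum>C\<in>Pow Q. \<Sum>\<omega>\<in>Om. W \<omega> * F \<omega> * g \<omega>)"
    proof (rule sum.cong[OF refl])
      fix C assume "C \<in> Pow Q"
      then have C: "C \<subseteq> Q" by simp
      have "(\<Sum>\<omega>\<in>Om. W \<omega> * F \<omega> * g (Phi u C \<omega>)) = (\<Sum>\<omega>\<in>Om. W \<omega> * (F (Phi u C \<omega>) * g (Phi u C \<omega>)))"
      proof (rule sum.cong[OF refl])
        fix \<omega> assume "\<omega> \<in> Om"
        then have "F (Phi u C \<omega>) = F \<omega>" using Fop[of "fst \<omega>" "snd \<omega>" u C] u Qok[OF C] by (simp add: Phi_def)
        then show "W \<omega> * F \<omega> * g (Phi u C \<omega>) = W \<omega> * (F (Phi u C \<omega>) * g (Phi u C \<omega>))" by simp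
      qed
      also have "\<dots> = (\<Sum>\<omega>\<in>Om. W \<omega> * (F \<omega> * g \<omega>))"
        using u Qok[OF C] by (intro sum_Phi[where G = "\<lambda>\<omega>. F \<omega> * g \<omega>"]) auto
      finally show "(\<Sum>\<omega>\<in>Om. W \<omega> * F \<omega> * g (Phi u C \<omega>)) = (\<Sum>\<omega>\<in>Om. W \<omega> * F \<omega> * g \<omega>)" by (simp add: mult.assoc)
    qed
    finally show ?thesis using fQ by (simp add: card_Pow)
  qed
  \<comment> \<open>Applying \<open>Phi u C\<close> under the sum turns the product into
    \<open>sg\<close> of \<open>u\<close> together with the symmetric difference of \<open>C\<close>
    and \<open>C'\<close>, so off-diagonal terms fall under \<open>small\<close>.\<close>
  have cross: "(\<Sum>\<omega>\<in>Om. W \<omega> * (g (Phi u C \<omega>) * g (Phi u C' \<omega>))) \<le> (if C = C' then N else dl * N)"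
    if C: "C \<subseteq> Q" "C' \<subseteq> Q" for C C'
  proof -
    have fC: "finite C" "finite C'" using C fQ finite_subset by auto
    let ?D = "sym_diff C C'"
    have D: "?D \<subseteq> Q" using C by auto
    have uD: "u \<notin> ?D" using Qok(2)[OF D] .
    have "(\<Sum>\<omega>\<in>Om. W \<omega> * (g (Phi u C \<omega>) * g (Phi u C' \<omega>))) = (\<Sum>\<omega>\<in>Om. W \<omega> * (g (Phi u C (Phi u C \<omega>)) * g (Phi u C' (Phi u C \<omega>))))"
      using u Qok[OF C(1)] by (intro sum_Phi[symmetric, where G = "\<lambda>\<omega>. g (Phi u C \<omega>) * g (Phi u C' \<omega>)"]) auto
    also have "\<dots> = sg (insert u ?D)"
      unfolding sg_def
    proof (rule sum.cong[OF refl])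
      fix \<omega>
      have PP: "Phi u C (Phi u C \<omega>) = \<omega>" using Qok[OF C(1)] by (simp add: Phi_def opx_opx opy_opy)
      have s: "sum (fst (Phi u C \<omega>)) C' = sum (fst \<omega>) C'" using Qok(2)[OF C(2)] by (intro sum.cong) (auto simp: fstP)
      have "g (Phi u C' (Phi u C \<omega>)) = hv \<omega> (fst \<omega> u + sum (fst \<omega>) C + sum (fst \<omega>) C')"
        unfolding gPhi[OF C(2)] keyinv[OF u(2) Qok(3)[OF C(1)]] s by (simp add: fstP)
      also have "fst \<omega> u + sum (fst \<omega>) C + sum (fst \<omega>) C' = sum (fst \<omega>) (insert u ?D)"
        using sum_sym_diff[OF fC, of "fst \<omega>"] fC uD by (subst sum.insert) (auto simp: add.assoc)
      finally show "W \<omega> * (g (Phi u C (Phi u C \<omega>)) * g (Phi u C' (Phi u C \<omega>))) = W \<omega> * (g \<omega> * hv \<omega> (sum (fst \<omega>) (insert u ?D)))"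
        by (simp add: PP)
    qed
    finally have e: "(\<Sum>\<omega>\<in>Om. W \<omega> * (g (Phi u C \<omega>) * g (Phi u C' \<omega>))) = sg (insert u ?D)" .
    show ?thesis
    proof (cases "C = C'")
      case True
      then show ?thesis using e sgu by simp
    next
      case False
      then obtain w where w: "w \<in> ?D" by auto
      have wB: "w \<in> B" "w \<noteq> u" using w D QB by auto
      have "sg (insert u ?D) = sg {u, w}" using w wB D QB uB by (intro sg_pair) auto
      then show ?thesis using e small[OF wB] False by (simp add: dl_def)
    qed
  qed
  define q where "q = (2::real) ^ card Q"
  have qpos: "q > 0" by (simp add: q_def)
  have A2: "(\<Sum>\<omega>\<in>Om. W \<omega> * (A \<omega>)\<^sup>2) \<le> q\<^sup>2 * ((1 / q + dl) * N)"
  proof -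
    have "(\<Sum>\<omega>\<in>Om. W \<omega> * (A \<omega>)\<^sup>2) = (\<Sum>\<omega>\<in>Om. \<Sum>C\<in>Pow Q. \<Sum>C'\<in>Pow Q. W \<omega> * (g (Phi u C \<omega>) * g (Phi u C' \<omega>)))"
      unfolding A_def power2_eq_square sum_product by (simp add: sum_distrib_left)
    also have "\<dots> = (\<Sum>C\<in>Pow Q. \<Sum>\<omega>\<in>Om. \<Sum>C'\<in>Pow Q. W \<omega> * (g (Phi u C \<omega>) * g (Phi u C' \<omega>)))" by (rule sum.swap)
    also have "\<dots> = (\<Sum>C\<in>Pow Q. \<Sum>C'\<in>Pow Q. \<Sum>\<omega>\<in>Om. W \<omega> * (g (Phi u C \<omega>) * g (Phi u C' \<omega>)))"
      by (rule sum.cong[OF refl], rule sum.swap)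
    also have "\<dots> \<le> (\<Sum>C\<in>Pow Q. \<Sum>C'\<in>Pow Q. (if C = C' then N else 0) + dl * N)"
    proof (intro sum_mono)
      fix C C' assume "C \<in> Pow Q" "C' \<in> Pow Q"
      then show "(\<Sum>\<omega>\<in>Om. W \<omega> * (g (Phi u C \<omega>) * g (Phi u C' \<omega>))) \<le> (if C = C' then N else 0) + dl * N"
        using cross[of C C'] dl Nn by (auto split: if_splits intro: order_trans)
    qed
    also have "\<dots> = q * (N + q * (dl * N))"
      using fQ by (simp add: sum.distrib card_Pow q_def)
    also have "\<dots> = q\<^sup>2 * ((1 / q + dl) * N)" using qpos by (simp add: power2_eq_square field_simps)
    finally show ?thesis .
  qed
  have CS: "(\<Sum>\<omega>\<in>Om. W \<omega> * F \<omega> * A \<omega>)\<^sup>2 \<le> (\<Sum>\<omega>\<in>Om. W \<omega> * (F \<omega>)\<^sup>2) * (\<Sum>\<omega>\<in>Om. W \<omega> * (A \<omega>)\<^sup>2)"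
  proof -
    have "(\<Sum>\<omega>\<in>Om. (sqrt (W \<omega>) * F \<omega>) * (sqrt (W \<omega>) * A \<omega>))\<^sup>2 \<le>
        (\<Sum>\<omega>\<in>Om. (sqrt (W \<omega>) * F \<omega>)\<^sup>2) * (\<Sum>\<omega>\<in>Om. (sqrt (W \<omega>) * A \<omega>)\<^sup>2)"
      by (rule Cauchy_Schwarz_ineq_sum)
    moreover have "(sqrt (W \<omega>) * F \<omega>) * (sqrt (W \<omega>) * A \<omega>) = W \<omega> * F \<omega> * A \<omega>" if "\<omega> \<in> Om" for \<omega>
    proof -
      have "sqrt (W \<omega>) * sqrt (W \<omega>) = W \<omega>" using Wn[OF that] by simp
      then show ?thesis by (metis mult.assoc mult.left_commute)
    qed
    moreover have "(sqrt (W \<omega>) * X)\<^sup>2 = W \<omega> * X\<^sup>2" if "\<omega> \<in> Om" for \<omega> X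
      using Wn[OF that] by (simp add: power_mult_distrib)
    ultimately show ?thesis by simp
  qed
  let ?FF = "\<Sum>\<omega>\<in>Om. W \<omega> * (F \<omega>)\<^sup>2"
  let ?FG = "\<Sum>\<omega>\<in>Om. W \<omega> * F \<omega> * g \<omega>"
  have FFn: "?FF \<ge> 0" using Wn by (intro sum_nonneg) auto
  have "(q * ?FG)\<^sup>2 \<le> ?FF * (\<Sum>\<omega>\<in>Om. W \<omega> * (A \<omega>)\<^sup>2)" using CS unfolding FA q_def .
  also have "\<dots> \<le> ?FF * (q\<^sup>2 * ((1 / q + dl) * N))" by (rule mult_left_mono[OF A2 FFn])
  finally have "q\<^sup>2 * ?FG\<^sup>2 \<le> q\<^sup>2 * ((1 / q + dl) * ?FF * N)" by (simp add: power_mult_distrib ac_simps)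
  then have "?FG\<^sup>2 \<le> (1 / q + dl) * ?FF * N" using qpos by simp
  then show ?thesis unfolding q_def dl_def N_def Q_def .
qed

end

section \<open>Total cost of revealing both vectors at every index of a set\<close>

context core
begin

sublocale fw: finite_weighted Om W F
  by unfold_locales (auto simp: fOm Wn)

definition rkey :: "'k set \<Rightarrow> 'k set \<Rightarrow> ('k, 'i) state \<Rightarrow> ('k, 'i) state" where
  "rkey T T' \<omega> = (restrict (fst \<omega>) T, restrict (snd \<omega>) T')"

lemma reveal_x:
  assumes T: "T \<subseteq> J" and u: "u \<in> J" "u \<notin> T"
    and dm: "blk u = z0 \<Longrightarrow> card {k \<in> J. blk k \<noteq> z0} + card {k \<in> T. blk k = z0} \<le> m0"
  shows "fw.Nk (rkey (insert u T) T) \<le> fw.Nk (rkey T T) +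
    (1 / 2 ^ card {w \<in> J - T - {u}. cls w = cls u} + (if blk u = z0 then eps else 0)) * (\<Sum>\<omega>\<in>Om. W \<omega> * (F \<omega>)\<^sup>2)"
proof (rule fw.Nk_step[where r = "\<lambda>k. (restrict (fst k) T, snd k)"])
  show "rkey T T \<omega> = (restrict (fst (rkey (insert u T) T \<omega>)) T, snd (rkey (insert u T) T \<omega>))" for \<omega>
    by (auto simp: rkey_def restrict_def fun_eq_iff)
  show "0 \<le> 1 / 2 ^ card {w \<in> J - T - {u}. cls w = cls u} + (if blk u = z0 then eps else 0)" using eps by simp
  fix G :: "('k, 'i) state \<Rightarrow> real"
  assume G: "(\<Sum>\<omega>\<in>fw.fib (rkey T T) k. W \<omega> * G (rkey (insert u T) T \<omega>)) = 0" for k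
  define hh where "hh = (\<lambda>kx ky \<xi>. G (kx(u := \<xi>), ky))"
  have e: "G (rkey (insert u T) T \<omega>) = hh (restrict (fst \<omega>) T) (restrict (snd \<omega>) T) (fst \<omega> u)" for \<omega>
  proof -
    have "restrict (fst \<omega>) (insert u T) = (restrict (fst \<omega>) T)(u := fst \<omega> u)"
      using u by (auto simp: restrict_def fun_eq_iff)
    then show ?thesis by (simp add: hh_def rkey_def)
  qed
  show "(\<Sum>\<omega>\<in>Om. W \<omega> * F \<omega> * G (rkey (insert u T) T \<omega>))\<^sup>2 \<le>
     (1 / 2 ^ card {w \<in> J - T - {u}. cls w = cls u} + (if blk u = z0 then eps else 0)) *
     (\<Sum>\<omega>\<in>Om. W \<omega> * (F \<omega>)\<^sup>2) * (\<Sum>\<omega>\<in>Om. W \<omega> * (G (rkey (insert u T) T \<omega>))\<^sup>2)"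
    unfolding e
  proof (rule xstep[OF T u])
    show "T = T \<or> T = insert u T" by simp
    show "(\<Sum>\<omega>\<in>{\<omega> \<in> Om. (restrict (fst \<omega>) T, restrict (snd \<omega>) T) = k}. W \<omega> * hh (restrict (fst \<omega>) T) (restrict (snd \<omega>) T) (fst \<omega> u)) = 0" for k
      using G[of k] unfolding fw.fib_def rkey_def[of T T] e .
  qed (rule dm)
qed

text \<open>In the transposed setting a left vector is revealed whose right partner is already
  known, which is the case \<open>T' = insert u T\<close> of \<open>xstep\<close>.\<close>

lemma reveal_y:
  assumes T: "T \<subseteq> J" and u: "u \<in> J" "u \<notin> T"
    and dm: "blk u = z0 \<Longrightarrow> card {k \<in> J. blk k \<noteq> z0} + card {k \<in> T. blk k = z0} \<le> m0"
  shows "fw.Nk (rkey (insert u T) (insert u T)) \<le> fw.Nk (rkey (insert u T) T) +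
    (1 / 2 ^ card {w \<in> J - T - {u}. cls w = cls u} + (if blk u = z0 then eps else 0)) * (\<Sum>\<omega>\<in>Om. W \<omega> * (F \<omega>)\<^sup>2)"
proof (rule fw.Nk_step[where r = "\<lambda>k. (fst k, restrict (snd k) T)"])
  interpret sw: core V d n J cls blk z0 "prod.swap ` Om" "\<lambda>\<omega>. F (prod.swap \<omega>)" eps m0 by (rule core_swap)
  show "rkey (insert u T) T \<omega> = (fst (rkey (insert u T) (insert u T) \<omega>), restrict (snd (rkey (insert u T) (insert u T) \<omega>)) T)" for \<omega>
    by (auto simp: rkey_def restrict_def fun_eq_iff)
  show "0 \<le> 1 / 2 ^ card {w \<in> J - T - {u}. cls w = cls u} + (if blk u = z0 then eps else 0)" using eps by simp
  fix G :: "('k, 'i) state \<Rightarrow> real"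
  assume G: "(\<Sum>\<omega>\<in>fw.fib (rkey (insert u T) T) k. W \<omega> * G (rkey (insert u T) (insert u T) \<omega>)) = 0" for k
  define hh where "hh = (\<lambda>ky kx \<xi>. G (kx, ky(u := \<xi>)))"
  have Wsw: "sw.W (prod.swap \<omega>) = W \<omega>" for \<omega> by (simp add: sw.W_def W_def)
  have sumsw: "(\<Sum>\<omega>\<in>prod.swap ` Om. P \<omega>) = (\<Sum>\<omega>\<in>Om. P (prod.swap \<omega>))" for P :: "('k, 'i) state \<Rightarrow> real"
    by (subst sum.reindex) (auto simp: inj_on_def)
  have e: "hh (restrict (fst (prod.swap \<omega>)) T) (restrict (snd (prod.swap \<omega>)) (insert u T)) (fst (prod.swap \<omega>) u) = G (rkey (insert u T) (insert u T) \<omega>)" for \<omega>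
  proof -
    have "restrict (snd \<omega>) (insert u T) = (restrict (snd \<omega>) T)(u := snd \<omega> u)"
      using u by (auto simp: restrict_def fun_eq_iff)
    then show ?thesis by (simp add: hh_def rkey_def)
  qed
  have "(\<Sum>\<omega>\<in>prod.swap ` Om. sw.W \<omega> * F (prod.swap \<omega>) * hh (restrict (fst \<omega>) T) (restrict (snd \<omega>) (insert u T)) (fst \<omega> u))\<^sup>2 \<le>
     (1 / 2 ^ card {w \<in> J - T - {u}. cls w = cls u} + (if blk u = z0 then eps else 0)) *
     (\<Sum>\<omega>\<in>prod.swap ` Om. sw.W \<omega> * (F (prod.swap \<omega>))\<^sup>2) *
     (\<Sum>\<omega>\<in>prod.swap ` Om. sw.W \<omega> * (hh (restrict (fst \<omega>) T) (restrict (snd \<omega>) (insert u T)) (fst \<omega> u))\<^sup>2)"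
  proof (rule sw.xstep[OF T u])
    show "insert u T = T \<or> insert u T = insert u T" by simp
    fix k :: "('k, 'i) state"
    have "(\<Sum>\<omega>\<in>{\<omega> \<in> prod.swap ` Om. (restrict (fst \<omega>) T, restrict (snd \<omega>) (insert u T)) = k}. sw.W \<omega> * hh (restrict (fst \<omega>) T) (restrict (snd \<omega>) (insert u T)) (fst \<omega> u)) =
       (\<Sum>\<omega>\<in>prod.swap ` Om. of_bool ((restrict (fst \<omega>) T, restrict (snd \<omega>) (insert u T)) = k) * (sw.W \<omega> * hh (restrict (fst \<omega>) T) (restrict (snd \<omega>) (insert u T)) (fst \<omega> u)))"
      using fOm by (intro sum.mono_neutral_cong_left) auto
    also have "\<dots> = (\<Sum>\<omega>\<in>Om. of_bool (rkey (insert u T) T \<omega> = prod.swap k) * (W \<omega> * G (rkey (insert u T) (insert u T) \<omega>)))"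
    proof -
      have e2: "((restrict (fst (prod.swap \<omega>)) T, restrict (snd (prod.swap \<omega>)) (insert u T)) = k) \<longleftrightarrow> rkey (insert u T) T \<omega> = prod.swap k" for \<omega>
        by (cases k) (auto simp: rkey_def)
      show ?thesis unfolding sumsw e Wsw e2 ..
    qed
    also have "\<dots> = (\<Sum>\<omega>\<in>fw.fib (rkey (insert u T) T) (prod.swap k). W \<omega> * G (rkey (insert u T) (insert u T) \<omega>))"
      unfolding fw.fib_def using fOm by (intro sum.mono_neutral_cong_right) auto
    also have "\<dots> = 0" by (rule G)
    finally show "(\<Sum>\<omega>\<in>{\<omega> \<in> prod.swap ` Om. (restrict (fst \<omega>) T, restrict (snd \<omega>) (insert u T)) = k}. sw.W \<omega> * hh (restrict (fst \<omega>) T) (restrict (snd \<omega>) (insert u T)) (fst \<omega> u)) = 0" .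
  qed (rule dm)
  then show "(\<Sum>\<omega>\<in>Om. W \<omega> * F \<omega> * G (rkey (insert u T) (insert u T) \<omega>))\<^sup>2 \<le>
     (1 / 2 ^ card {w \<in> J - T - {u}. cls w = cls u} + (if blk u = z0 then eps else 0)) *
     (\<Sum>\<omega>\<in>Om. W \<omega> * (F \<omega>)\<^sup>2) * (\<Sum>\<omega>\<in>Om. W \<omega> * (G (rkey (insert u T) (insert u T) \<omega>))\<^sup>2)"
    unfolding sumsw e Wsw by simp
qed

text \<open>The sum over classes of 1 / 2 to the number of unrevealed members is a potential.
  Revealing \<open>u\<close> raises the term of its class from \<open>1 / 2 ^ Suc k\<close> to
  \<open>1 / 2 ^ k\<close>; the two steps at \<open>u\<close> cost \<open>2 / 2 ^ k\<close>, four
  times this increase. Indices of the zero block pay \<open>2 * eps\<close> on top.\<close>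

lemma reveal:
  assumes m: "(\<Sum>\<omega>\<in>Om. W \<omega> * F \<omega>) = 0" and T: "T \<subseteq> J"
    and dm: "card {k \<in> J. blk k \<noteq> z0} + card {k \<in> T. blk k = z0} \<le> m0 + 1"
  shows "fw.Nk (rkey T T) \<le> (4 * (\<Sum>c\<in>cls ` J. 1 / 2 ^ card {w \<in> J - T. cls w = c}) + 2 * real (card {k \<in> T. blk k = z0}) * eps)
      * (\<Sum>\<omega>\<in>Om. W \<omega> * (F \<omega>)\<^sup>2)"
proof -
  have "finite T" using T J finite_subset by auto
  define P where "P = (\<Sum>\<omega>\<in>Om. W \<omega> * (F \<omega>)\<^sup>2)"
  have Pn: "P \<ge> 0" unfolding P_def using Wn by (intro sum_nonneg) auto
  define Sm where "Sm T = (\<Sum>c\<in>cls ` J. 1 / 2 ^ card {w \<in> J - T. cls w = c} :: real)" for T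
  show ?thesis
    using \<open>finite T\<close> T dm unfolding P_def[symmetric] Sm_def[symmetric]
  proof (induction T)
    case empty
    have k: "rkey {} {} \<omega> = (\<lambda>_. undefined, \<lambda>_. undefined)" for \<omega> by (auto simp: rkey_def restrict_def)
    have "fw.num (rkey {} {}) c = 0" for c
    proof (cases "c = (\<lambda>_. undefined, \<lambda>_. undefined)")
      case True
      then have "fw.fib (rkey {} {}) c = Om" by (auto simp: fw.fib_def k)
      then show ?thesis using m by (simp add: fw.num_def)
    next
      case False
      then have "fw.fib (rkey {} {}) c = {}" by (auto simp: fw.fib_def k)
      then show ?thesis by (simp add: fw.num_def)
    qed
    then have "fw.Nk (rkey {} {}) = 0" by (simp add: fw.Nk_def)
    moreover have "Sm {} \<ge> 0" unfolding Sm_def by (intro sum_nonneg) auto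
    ultimately show ?case using Pn by simp
  next
    case (insert u T)
    have T: "T \<subseteq> J" and u: "u \<in> J" "u \<notin> T" using insert by auto
    have fT: "finite {k \<in> T. blk k = z0}" using insert by auto
    have cz: "card {k \<in> insert u T. blk k = z0} = card {k \<in> T. blk k = z0} + (if blk u = z0 then 1 else 0)"
    proof (cases "blk u = z0")
      case True
      then have "{k \<in> insert u T. blk k = z0} = insert u {k \<in> T. blk k = z0}" by auto
      then show ?thesis using True fT u by simp
    next
      case False
      then have "{k \<in> insert u T. blk k = z0} = {k \<in> T. blk k = z0}" by auto
      then show ?thesis using False by simp
    qed
    define dl where "dl = (if blk u = z0 then eps else 0)"
    define k where "k = card {w \<in> J - T - {u}. cls w = cls u}"
    have dm: "card {k \<in> J. blk k \<noteq> z0} + card {k \<in> T. blk k = z0} \<le> m0" if "blk u = z0"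
      using insert.prems cz that by simp
    have IH: "fw.Nk (rkey T T) \<le> (4 * Sm T + 2 * real (card {k \<in> T. blk k = z0}) * eps) * P"
      using insert.IH T insert.prems cz by simp
    have "fw.Nk (rkey (insert u T) (insert u T)) \<le> fw.Nk (rkey T T) + (1 / 2 ^ k + dl) * P + (1 / 2 ^ k + dl) * P"
      using reveal_x[OF T u dm] reveal_y[OF T u dm] unfolding k_def dl_def P_def by linarith
    also have "\<dots> \<le> (4 * Sm T + 2 * real (card {k \<in> T. blk k = z0}) * eps) * P + (2 / 2 ^ k + 2 * dl) * P"
      using IH by (simp add: algebra_simps)
    also have "\<dots> = (4 * (Sm T + 1 / 2 ^ Suc k) + 2 * (real (card {k \<in> T. blk k = z0}) * eps + dl)) * P"
      by (simp add: field_simps)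
    also have "real (card {k \<in> T. blk k = z0}) * eps + dl = real (card {k \<in> insert u T. blk k = z0}) * eps"
      unfolding cz dl_def by (simp add: algebra_simps)
    also have "Sm T + 1 / 2 ^ Suc k = Sm (insert u T)"
    proof -
      have fc: "finite (cls ` J)" "cls u \<in> cls ` J" using J u by auto
      have o: "{w \<in> J - insert u T. cls w = c} = {w \<in> J - T. cls w = c}" if "c \<noteq> cls u" for c using that by auto
      have "Sm (insert u T) = 1 / 2 ^ card {w \<in> J - insert u T. cls w = cls u} + (\<Sum>c\<in>cls ` J - {cls u}. 1 / 2 ^ card {w \<in> J - insert u T. cls w = c})"
        unfolding Sm_def by (rule sum.remove[OF fc])
      also have "(\<Sum>c\<in>cls ` J - {cls u}. 1 / 2 ^ card {w \<in> J - insert u T. cls w = c} :: real) = (\<Sum>c\<in>cls ` J - {cls u}. 1 / 2 ^ card {w \<in> J - T. cls w = c})"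
      proof (rule sum.cong[OF refl])
        fix c assume "c \<in> cls ` J - {cls u}"
        then have "c \<noteq> cls u" by simp
        from o[OF this] show "1 / 2 ^ card {w \<in> J - insert u T. cls w = c} = (1 / 2 ^ card {w \<in> J - T. cls w = c} :: real)" by (simp only:)
      qed
      also have "{w \<in> J - insert u T. cls w = cls u} = {w \<in> J - T - {u}. cls w = cls u}" by auto
      finally have 1: "Sm (insert u T) = 1 / 2 ^ k + (\<Sum>c\<in>cls ` J - {cls u}. 1 / 2 ^ card {w \<in> J - T. cls w = c})" by (simp add: k_def)
      have 2: "Sm T = 1 / 2 ^ card {w \<in> J - T. cls w = cls u} + (\<Sum>c\<in>cls ` J - {cls u}. 1 / 2 ^ card {w \<in> J - T. cls w = c})"
        unfolding Sm_def by (rule sum.remove[OF fc])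
      have "{w \<in> J - T. cls w = cls u} = insert u {w \<in> J - T - {u}. cls w = cls u}" using u by auto
      moreover have "finite {w \<in> J - T - {u}. cls w = cls u}" using J by auto
      ultimately have "card {w \<in> J - T. cls w = cls u} = Suc k" by (simp add: k_def)
      then show ?thesis using 1 2 by (simp add: field_simps)
    qed
    finally show ?case by (simp add: mult.assoc)
  qed
qed

end

section \<open>The link of a space of encodings\<close>

lemma outer_sum_cong_out:
  assumes "u \<notin> D" "C \<inter> D = {}"
  shows "(\<Sum>k\<in>D. outer (opx u C x k) (opy u C y k)) = (\<Sum>k\<in>D. outer (x k) (y k))"
    and "(\<Sum>k\<in>D. outer (opy u C x k) (opx u C y k)) = (\<Sum>k\<in>D. outer (x k) (y k))"
proof -
  have "opx u C a k = a k" "opy u C a k = a k" if "k \<in> D" for a :: "'a \<Rightarrow> 'z \<Rightarrow> bit" and k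
    using that assms by (auto simp: opx_def opy_def)
  note e = this
  have x: "opx u C x k = x k" "opy u C x k = x k" if "k \<in> D" for k using that assms by (auto simp: opx_def opy_def)
  have y: "opx u C y k = y k" "opy u C y k = y k" if "k \<in> D" for k using that assms by (auto simp: opx_def opy_def)
  show "(\<Sum>k\<in>D. outer (opx u C x k) (opy u C y k)) = (\<Sum>k\<in>D. outer (x k) (y k))"
    by (intro sum.cong refl) (simp only: x y)
  show "(\<Sum>k\<in>D. outer (opy u C x k) (opx u C y k)) = (\<Sum>k\<in>D. outer (x k) (y k))"
    by (intro sum.cong refl) (simp only: x y)
qed

text \<open>\<open>vv L t (x, y)\<close> is the encoding of the \<open>t\<close>-th unit vector for \<open>s u = x u \<otimes> y u\<close>.\<close>

definition Dt :: "nat \<Rightarrow> nat \<Rightarrow> (nat \<Rightarrow> bit) set" where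
  "Dt L t = {u \<in> F2 {..<L} - {0}. u t = 1}"

definition vv :: "nat \<Rightarrow> nat \<Rightarrow> (nat \<Rightarrow> bit, 'i) state \<Rightarrow> 'i \<times> 'i \<Rightarrow> bit" where
  "vv L t \<omega> = (\<Sum>u\<in>Dt L t. outer (fst \<omega> u) (snd \<omega> u))"

definition Omb :: "('i \<Rightarrow> bit) set \<Rightarrow> nat \<Rightarrow> nat \<Rightarrow> (nat \<Rightarrow> 'i \<times> 'i \<Rightarrow> bit) \<Rightarrow> (nat \<Rightarrow> bit, 'i) state set" where
  "Omb V L i b = {\<omega> \<in> Ind V Z0 (F2 {..<L} - {0}) \<times> Ind V Z0 (F2 {..<L} - {0}). \<forall>t<i. vv L t \<omega> = b t}"

text \<open>Coordinates are replaced by zeros and not dropped, so that blocks and classes of all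
  sizes are labelled by vectors of one type and the zero block has label 0.\<close>

definition trunc :: "nat \<Rightarrow> (nat \<Rightarrow> bit) \<Rightarrow> nat \<Rightarrow> bit" where
  "trunc m u = (\<lambda>t. if t < m then u t else 0)"

lemma vv_op:
  assumes u: "u \<in> F2 {..<L} - {0}" and C: "C \<subseteq> F2 {..<L} - {0}" "u \<notin> C" and eq: "\<And>w. w \<in> C \<Longrightarrow> w t = u t"
  shows "vv L t (opx u C x, opy u C y) = vv L t (x, y) \<and> vv L t (opy u C x, opx u C y) = vv L t (x, y)"
proof (cases "u t = 1")
  case True
  have "finite (Dt L t)" by (simp add: Dt_def finite_F2)
  moreover have "u \<in> Dt L t" "C \<subseteq> Dt L t" using u C eq True by (auto simp: Dt_def)
  ultimately show ?thesis using outer_sum_op[of "Dt L t" u C x y] outer_sum_op'[of "Dt L t" u C x y] C(2)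
    by (simp add: vv_def)
next
  case False
  have "w t \<noteq> 1" if "w \<in> C" for w unfolding eq[OF that] by (rule False)
  then have "u \<notin> Dt L t" "C \<inter> Dt L t = {}" using False unfolding Dt_def by blast+
  then show ?thesis using outer_sum_cong_out[of u "Dt L t" C x y] by (simp add: vv_def)
qed

text \<open>Summing the encodings of the unit vectors in \<open>Z\<close> counts each index as often
  as it has ones on \<open>Z\<close>, so only indices of odd parity survive. Prescribed encodings
  thus prescribe every parity sum on the first \<open>i\<close> coordinates.\<close>

lemma vv_multi:
  assumes Z: "finite Z" "Z \<subseteq> {..<i}" and eq: "\<And>t. t < i \<Longrightarrow> vv L t \<omega> = vv L t \<omega>'"
  shows "(\<Sum>u\<in>{u \<in> F2 {..<L} - {0}. (\<Sum>t\<in>Z. u t) = 1}. outer (fst \<omega> u) (snd \<omega> u)) =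
    (\<Sum>u\<in>{u \<in> F2 {..<L} - {0}. (\<Sum>t\<in>Z. u t) = 1}. outer (fst \<omega>' u) (snd \<omega>' u))"
proof -
  let ?J = "F2 {..<L} - {0}"
  have fJ: "finite ?J" by (simp add: finite_F2)
  have main: "(\<Sum>u\<in>{u \<in> ?J. (\<Sum>t\<in>Z. u t) = 1}. M u) = (\<Sum>t\<in>Z. \<Sum>u\<in>Dt L t. M u)" for M :: "(nat \<Rightarrow> bit) \<Rightarrow> 'a \<times> 'a \<Rightarrow> bit"
  proof -
    have sc: "(\<Sum>t\<in>Z. if c t = 1 then m else 0) = (if (\<Sum>t\<in>Z. c t) = (1::bit) then m else 0)" for c :: "nat \<Rightarrow> bit" and m :: "'a \<times> 'a \<Rightarrow> bit"
      using Z(1)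
    proof (induction Z)
      case (insert t Z)
      show ?case unfolding sum.insert[OF insert.hyps] insert.IH
        by (cases "c t"; cases "\<Sum>t\<in>Z. c t") (simp_all only: if_True if_False vadd_self add_0_left add_0_right
            bit.distinct add_0 refl one_add_one bit_2_eq_0 simp_thms)
    qed simp
    have "(\<Sum>t\<in>Z. \<Sum>u\<in>Dt L t. M u) = (\<Sum>t\<in>Z. \<Sum>u\<in>?J. if u t = 1 then M u else 0)"
      unfolding Dt_def by (intro sum.cong refl sum.inter_filter[OF fJ])
    also have "\<dots> = (\<Sum>u\<in>?J. \<Sum>t\<in>Z. if u t = 1 then M u else 0)" by (rule sum.swap)
    also have "\<dots> = (\<Sum>u\<in>?J. if (\<Sum>t\<in>Z. u t) = 1 then M u else 0)" unfolding sc ..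
    also have "\<dots> = (\<Sum>u\<in>{u \<in> ?J. (\<Sum>t\<in>Z. u t) = 1}. M u)" by (rule sum.inter_filter[OF fJ, symmetric])
    finally show ?thesis by (rule sym)
  qed
  show ?thesis unfolding main
  proof (rule sum.cong[OF refl])
    fix t assume "t \<in> Z"
    then have "t < i" using Z by auto
    from eq[OF this] show "(\<Sum>u\<in>Dt L t. outer (fst \<omega> u) (snd \<omega> u)) = (\<Sum>u\<in>Dt L t. outer (fst \<omega>' u) (snd \<omega>' u))"
      unfolding vv_def .
  qed
qed

lemma bit_index_less: "(\<And>t. t \<ge> i \<Longrightarrow> a t = (0::bit)) \<Longrightarrow> a t = 1 \<Longrightarrow> t < (i::nat)"
  by (rule ccontr) (metis not_less zero_neq_one)

text \<open>Some linear functional is 1 on the nonzero vector \<open>a\<close> and 0 on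
  \<open>c\<close>. One coordinate suffices unless the support of \<open>a\<close> lies in that of
  \<open>c\<close>; then one coordinate from \<open>a\<close> and one from the difference of the
  supports do.\<close>

lemma trunc_separate:
  fixes i :: nat
  assumes "a \<noteq> 0" "c \<noteq> a" "\<And>t. t \<ge> i \<Longrightarrow> a t = (0::bit)" "\<And>t. t \<ge> i \<Longrightarrow> c t = (0::bit)"
  shows "\<exists>Z. finite Z \<and> Z \<subseteq> {..<i} \<and> (\<Sum>t\<in>Z. a t) = 1 \<and> (\<Sum>t\<in>Z. c t) = 0"
proof (cases "\<exists>t. a t = 1 \<and> c t = 0")
  case True
  then obtain t where t: "a t = 1" "c t = 0" by auto
  then have "t < i" using bit_index_less[of i a t, OF assms(3)] by simp
  then show ?thesis using t by (intro exI[of _ "{t}"]) auto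
next
  case False
  obtain t where t: "a t = 1" using assms(1) by (auto simp: fun_eq_iff)
  have F: "c s = 1" if "a s = 1" for s using False that bit_not_zero_iff[of "c s"] by blast
  have ct: "c t = 1" by (rule F[OF t])
  obtain t' where t': "c t' \<noteq> a t'" using assms(2) by (auto simp: fun_eq_iff)
  have at': "a t' = 0" using F[of t'] t' bit_not_zero_iff[of "a t'"] by metis
  moreover have "c t' = 1" using at' t' bit_not_zero_iff[of "c t'"] by metis
  ultimately have at': "a t' = 0" "c t' = 1" by auto
  have "t < i" "t' < i" using bit_index_less[of i a t, OF assms(3) t] bit_index_less[of i c t', OF assms(4) at'(2)] by auto
  moreover have "t \<noteq> t'" using t at' by auto
  ultimately show ?thesis using t ct at' by (intro exI[of _ "{t, t'}"]) auto
qed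

lemma ssp_Int_0:
  assumes K: "finite K" "indm Z0 x K" and AB: "A \<subseteq> K" "B \<subseteq> K" "A \<inter> B = {}" and v: "v \<in> ssp Z0 x A" "v \<in> ssp Z0 x B"
  shows "v = 0"
proof -
  obtain C D where CD: "C \<subseteq> A" "D \<subseteq> B" "v = sum x C" "v = sum x D" using v by (auto simp: ssp_def Z0_def)
  have "sum x C + sum x D \<in> Z0" unfolding CD(3)[symmetric] CD(4)[symmetric] by simp
  then have "C = D" by (intro indm_inj[OF K(1) subspace_Z0 K(2)]) (use CD AB in auto)
  then have "C = {}" using CD AB by auto
  then show ?thesis using CD by simp
qed

text \<open>Parity sums are prescribed directly, block sums are not. Each parity sum determines the
  span of its \<open>x\<close>-vectors. A vector \<open>x' k\<close> of block \<open>c\<close> lies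
  in all such spans for parities that are 1 on \<open>c\<close>, hence, by independence and
  \<open>trunc_separate\<close>, in the span of block \<open>c\<close> alone. Split one parity set
  into block \<open>a\<close> and the rest: the two differences of tensor sums agree, while their
  columns lie in spans that meet only in 0.\<close>

lemma Omb_blkdet:
  assumes V: "fvs.subspace V" "finite V" and o: "\<omega> \<in> Omb V L i b" "\<omega>' \<in> Omb V L i b" and a: "a \<noteq> 0"
  shows "(\<Sum>k\<in>{k \<in> F2 {..<L} - {0}. trunc i k = a}. outer (fst \<omega> k) (snd \<omega> k)) =
         (\<Sum>k\<in>{k \<in> F2 {..<L} - {0}. trunc i k = a}. outer (fst \<omega>' k) (snd \<omega>' k))"
proof -
  define J where "J = F2 {..<L} - {0}"
  have fJ: "finite J" by (simp add: J_def finite_F2)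
  obtain x y x' y' where w: "\<omega> = (x, y)" "\<omega>' = (x', y')" by (cases \<omega>, cases \<omega>')
  have I: "x \<in> Ind V Z0 J" "y \<in> Ind V Z0 J" "x' \<in> Ind V Z0 J" "y' \<in> Ind V Z0 J" using o by (auto simp: Omb_def w J_def)
  have eqt: "vv L t \<omega> = vv L t \<omega>'" if "t < i" for t using o that by (auto simp: Omb_def)
  define D where "D Z = {u \<in> J. (\<Sum>t\<in>Z. u t) = 1}" for Z
  have DJ: "D Z \<subseteq> J" "finite (D Z)" for Z using fJ by (auto simp: D_def)
  define Bl where "Bl a = {k \<in> J. trunc i k = a}" for a
  have BJ: "Bl a \<subseteq> J" "finite (Bl a)" for a using fJ by (auto simp: Bl_def)
  have eqD: "(\<Sum>u\<in>D Z. outer (x u) (y u)) = (\<Sum>u\<in>D Z. outer (x' u) (y' u))" if "finite Z" "Z \<subseteq> {..<i}" for Z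
    using vv_multi[OF that eqt] by (simp add: D_def J_def w)
  have tr: "(\<Sum>t\<in>Z. k t) = (\<Sum>t\<in>Z. trunc i k t)" if "Z \<subseteq> {..<i}" for Z k
    using that by (intro sum.cong) (auto simp: trunc_def)
  have indx: "indm Z0 x K" "indm Z0 y K" "indm Z0 y' K" if "K \<subseteq> J" for K using I that by (auto simp: Ind_def intro: indm_mono)
  have spD: "ssp Z0 x (D Z) = ssp Z0 x' (D Z)" if "finite Z" "Z \<subseteq> {..<i}" for Z
  proof (rule outer_sum_span[OF V DJ(2)])
    show "y k \<in> V" "y' k \<in> V" if "k \<in> D Z" for k using that DJ(1)[of Z] I by (auto simp: Ind_def)
    show "indm Z0 y (D Z)" "indm Z0 y' (D Z)" using indx DJ by auto
  qed (rule eqD[OF that])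
  have mem: "x' k \<in> ssp Z0 x (Bl c)" if k: "k \<in> J" "trunc i k = c" "c \<noteq> 0" for k c
  proof -
    have c0: "c t = 0" if "t \<ge> i" for t using k(2) that by (auto simp: trunc_def)
    have in1: "x' k \<in> ssp Z0 x (D Z)" if Z: "finite Z" "Z \<subseteq> {..<i}" "(\<Sum>t\<in>Z. c t) = 1" for Z
    proof -
      have "k \<in> D Z" using k tr[OF Z(2), of k] Z(3) by (simp add: D_def)
      then show ?thesis using spD[OF Z(1,2)] ssp_gen[OF subspace_Z0 DJ(2), of k Z x'] by simp
    qed
    obtain t0 where t0: "c t0 = 1" using k(3) by (auto simp: fun_eq_iff)
    then have "t0 < i" using bit_index_less[of i c t0, OF c0] by simp
    then have "x' k \<in> ssp Z0 x (D {t0})" using t0 by (intro in1) auto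
    then obtain C where C: "C \<subseteq> D {t0}" "x' k = sum x C" by (auto simp: ssp_def Z0_def)
    have "C \<subseteq> Bl c"
    proof
      fix u assume u: "u \<in> C"
      then have uJ: "u \<in> J" using C DJ by auto
      show "u \<in> Bl c"
      proof (rule ccontr)
        assume "u \<notin> Bl c"
        then have ne: "trunc i u \<noteq> c" using uJ by (simp add: Bl_def)
        have u0: "trunc i u t = 0" if "t \<ge> i" for t using that by (simp add: trunc_def)
        have "\<exists>Z. finite Z \<and> Z \<subseteq> {..<i} \<and> (\<Sum>t\<in>Z. c t) = 1 \<and> (\<Sum>t\<in>Z. trunc i u t) = 0"
          by (rule trunc_separate[OF k(3) ne c0 u0])
        then obtain Z where Z: "finite Z" "Z \<subseteq> {..<i}" "(\<Sum>t\<in>Z. c t) = 1" "(\<Sum>t\<in>Z. trunc i u t) = 0"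
          by (elim exE conjE)
        obtain C' where C': "C' \<subseteq> D Z" "x' k = sum x C'" using in1[OF Z(1,2,3)] by (auto simp: ssp_def Z0_def)
        have "sum x C + sum x C' \<in> Z0" unfolding C(2)[symmetric] C'(2)[symmetric] by simp
        then have "C = C'" using C C' DJ by (intro indm_inj[OF fJ subspace_Z0 indx(1)[OF order.refl]]) auto
        then have "u \<in> D Z" using u C' by auto
        then show False using Z tr[OF Z(2), of u] by (simp add: D_def)
      qed
    qed
    then show ?thesis using C(2) ssp_sum[OF subspace_Z0, of C "Bl c" x] by simp
  qed
  show ?thesis
  proof (cases "Bl a = {}")
    case True
    then show ?thesis unfolding Bl_def J_def by (simp only: sum.empty)
  next
    case False
    then obtain k0 where k0: "k0 \<in> J" "trunc i k0 = a" by (auto simp: Bl_def)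
    have a0: "a t = 0" if "t \<ge> i" for t using k0(2) that by (auto simp: trunc_def)
    obtain t0 where t0: "a t0 = 1" using a by (auto simp: fun_eq_iff)
    then have t0i: "t0 < i" using bit_index_less[of i a t0, OF a0] by simp
    define R where "R = D {t0} - Bl a"
    have BD: "Bl a \<subseteq> D {t0}" using t0 t0i by (auto simp: Bl_def D_def trunc_def fun_eq_iff)
    have RJ: "R \<subseteq> J" "finite R" "R \<inter> Bl a = {}" using DJ by (auto simp: R_def)
    have split: "(\<Sum>u\<in>D {t0}. M u) = (\<Sum>u\<in>Bl a. M u) + (\<Sum>u\<in>R. M u)" for M :: "(nat \<Rightarrow> bit) \<Rightarrow> 'a \<times> 'a \<Rightarrow> bit"
      using sum.subset_diff[OF BD DJ(2), of M] by (simp add: R_def add.commute)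
    define dM where "dM K = (\<Sum>u\<in>K. outer (x u) (y u)) + (\<Sum>u\<in>K. outer (x' u) (y' u))" for K
    have dD: "dM (Bl a) = dM R"
    proof -
      have "dM (D {t0}) = 0" unfolding dM_def vadd_eq_0_iff using t0i by (intro eqD) auto
      moreover have "dM (D {t0}) = dM (Bl a) + dM R" unfolding dM_def split by (simp only: ac_simps)
      ultimately have "dM (Bl a) + dM R = 0" by simp
      then show ?thesis by (simp add: vadd_eq_0_iff)
    qed
    have col: "(\<lambda>r. dM K (r, j)) \<in> ssp Z0 x K'" if K: "K \<subseteq> K'" "finite K'" "\<And>k. k \<in> K \<Longrightarrow> x' k \<in> ssp Z0 x K'" for K K' j
    proof -
      define sc where "sc c v = (if c = (1::bit) then v else (0 :: 'a \<Rightarrow> bit))" for c v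
      have scr: "sc c v r = c * v r" for c v r by (cases c) (auto simp: sc_def)
      have "(\<lambda>r. dM K (r, j)) = (\<Sum>u\<in>K. sc (y u j) (x u)) + (\<Sum>u\<in>K. sc (y' u j) (x' u))"
      proof
        fix r
        show "dM K (r, j) = ((\<Sum>u\<in>K. sc (y u j) (x u)) + (\<Sum>u\<in>K. sc (y' u j) (x' u))) r"
          unfolding dM_def plus_fun_apply sum_fun_app scr outer_def prod.case by (simp only: mult.commute)
      qed
      moreover have s: "fvs.subspace (ssp Z0 x K')" using K by (simp add: subspace_ssp)
      have z: "sc c v \<in> ssp Z0 x K'" if "v \<in> ssp Z0 x K'" for c v using that s by (auto simp: sc_def subspace_bit_iff)
      have "(\<Sum>u\<in>K. sc (y u j) (x u)) \<in> ssp Z0 x K'"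
        using K by (intro subspace_sum_mem[OF s] z ssp_gen) auto
      moreover have "(\<Sum>u\<in>K. sc (y' u j) (x' u)) \<in> ssp Z0 x K'"
        using K by (intro subspace_sum_mem[OF s] z) auto
      ultimately show ?thesis using s unfolding subspace_bit_iff by metis
    qed
    have "dM (Bl a) = 0"
    proof (rule ext, clarify)
      fix r j
      have "(\<lambda>r. dM (Bl a) (r, j)) = 0"
      proof (rule ssp_Int_0[OF fJ indx(1)[OF order.refl] BJ(1) RJ(1)])
        show "Bl a \<inter> R = {}" using RJ by auto
        show "(\<lambda>r. dM (Bl a) (r, j)) \<in> ssp Z0 x (Bl a)"
          using mem a by (intro col BJ(2)) (auto simp: Bl_def)
        show "(\<lambda>r. dM (Bl a) (r, j)) \<in> ssp Z0 x R"
          unfolding dD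
        proof (rule col[OF order.refl RJ(2)])
          fix k assume k: "k \<in> R"
          define c where "c = trunc i k"
          have kJ: "k \<in> J" "k t0 = 1" "c \<noteq> a" using k by (auto simp: R_def D_def Bl_def c_def)
          have "c t0 = 1" using kJ t0i by (simp add: c_def trunc_def)
          then have "c \<noteq> 0" by auto
          then have "x' k \<in> ssp Z0 x (Bl c)" using kJ by (intro mem) (auto simp: c_def)
          moreover have "Bl c \<subseteq> R"
          proof
            fix u assume "u \<in> Bl c"
            then have u: "u \<in> J" "trunc i u = c" by (auto simp: Bl_def)
            have "u t0 = trunc i u t0" using t0i by (simp add: trunc_def)
            then have "u t0 = 1" using u \<open>c t0 = 1\<close> by simp
            then show "u \<in> R" using u kJ by (auto simp: R_def D_def Bl_def)
          qed
          then have "ssp Z0 x (Bl c) \<subseteq> ssp Z0 x R" by (rule ssp_mono)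
          ultimately show "x' k \<in> ssp Z0 x R" by auto
        qed
      qed
      then show "dM (Bl a) (r, j) = 0 (r, j)" by (metis zero_fun_apply)
    qed
    then have "(\<Sum>u\<in>Bl a. outer (x u) (y u)) = (\<Sum>u\<in>Bl a. outer (x' u) (y' u))"
      unfolding dM_def vadd_eq_0_iff .
    then show ?thesis unfolding Bl_def J_def w fst_conv snd_conv .
  qed
qed

lemma card_F2_ivl: "card (F2 {a..<L}) = 2 ^ (L - a)"
  by (simp add: card_F2)

text \<open>The left side is the squared norm of the expectation of \<open>f\<close> given the
  second endpoint, and the indices \<open>T\<close> on which that endpoint depends are revealed.
  With \<open>q = 2 ^ (L - i - 2)\<close>, \<open>T\<close> contains \<open>2 * q\<close> of the
  \<open>4 * q - 1\<close> indices in the zero block. It leaves \<open>q\<close> indices in each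
  class, except \<open>q - 1\<close> in the class of 0, because 0 is not an index; this accounts for
  the summand 1 next to \<open>2 ^ (i + 1)\<close>.\<close>

lemma Omb_core_bound:
  fixes nn :: "('i \<Rightarrow> bit) set \<Rightarrow> real" and f :: "('i \<times> 'i \<Rightarrow> bit) \<Rightarrow> real" and b :: "nat \<Rightarrow> 'i \<times> 'i \<Rightarrow> bit"
  assumes h: "harm V (2 ^ L) nn" and i: "i + 2 \<le> L" and eps: "eps \<ge> 0"
    and exp: "\<And>S. fvs.subspace S \<Longrightarrow> S \<subseteq> V \<Longrightarrow> nn S > 0 \<Longrightarrow> fvs.dim S \<le> 2 ^ L - 2 * 2 ^ (L - i - 2) - 1 \<Longrightarrow> Exp V (2 ^ L) nn S eps"
  defines "J \<equiv> F2 {..<L} - {0}"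
  defines "Om \<equiv> Omb V L i b"
  defines "Wt \<equiv> (\<lambda>\<omega>. nn (ssp Z0 (fst \<omega>) J) * nn (ssp Z0 (snd \<omega>) J))"
  assumes m: "(\<Sum>\<omega>\<in>Om. Wt \<omega> * f (vv L i \<omega>)) = 0"
  shows "(\<Sum>v\<in>vv L (i + 1) ` Om. (\<Sum>\<omega>\<in>{\<omega> \<in> Om. vv L (i + 1) \<omega> = v}. Wt \<omega> * f (vv L i \<omega>))\<^sup>2 / (\<Sum>\<omega>\<in>{\<omega> \<in> Om. vv L (i + 1) \<omega> = v}. Wt \<omega>))
    \<le> (4 * (2 ^ (i + 1) + 1) / 2 ^ (2 ^ (L - i - 2)) + 4 * 2 ^ (L - i - 2) * eps) * (\<Sum>\<omega>\<in>Om. Wt \<omega> * (f (vv L i \<omega>))\<^sup>2)"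
proof -
  define q :: nat where "q = 2 ^ (L - i - 2)"
  have V: "fvs.subspace V" "finite V" using h by (auto simp: harm_def)
  have fJ: "finite J" by (simp add: J_def finite_F2)
  have cF: "card (F2 {..<L}) = 2 ^ L" by (simp add: card_F2)
  have cJ: "card J = 2 ^ L - 1" using cF by (simp add: J_def F2_def card_Diff_singleton)
  have p4: "(2::nat) ^ (L - i) = 4 * q"
  proof -
    have "L - i = (L - i - 2) + 2" using i by simp
    then have "(2::nat) ^ (L - i) = 2 ^ (L - i - 2) * 2 ^ 2" by (metis power_add)
    then show ?thesis by (simp add: q_def)
  qed
  have q1: "q \<ge> 1" by (simp add: q_def)
  have d4: "4 * q \<le> 2 ^ L" unfolding p4[symmetric] by (intro power_increasing) auto
  \<comment> \<open>The dimension reached just before the last zero-block vector: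
    \<open>2 ^ L - 4 * q\<close> indices outside the zero block and \<open>2 * q - 1\<close> inside
    it.\<close>
  define m0 where "m0 = 2 ^ L - 2 * q - 1"
  interpret core V "2 ^ L" nn J "trunc (i + 1)" "trunc i" 0 Om "\<lambda>\<omega>. f (vv L i \<omega>)" eps m0
  proof
    show "harm V (2 ^ L) nn" "finite J" "card J \<le> 2 ^ L" "0 \<le> eps" using h fJ cJ eps by auto
    show "Om \<subseteq> Ind V Z0 J \<times> Ind V Z0 J" by (auto simp: Om_def Omb_def J_def)
    show "m0 + 2 \<le> 2 ^ L" using d4 q1 by (simp add: m0_def)
    show "trunc i u = trunc i w" if "trunc (i + 1) u = trunc (i + 1) w" for u w
    proof
      fix t show "trunc i u t = trunc i w t" using fun_cong[OF that, of t] by (simp add: trunc_def split: if_splits)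
    qed
    show "Exp V (2 ^ L) nn S eps" if "fvs.subspace S" "S \<subseteq> V" "0 < nn S" "fvs.dim S \<le> m0" for S
      using that by (intro exp) (auto simp: m0_def q_def)
    fix x y u C assume xy: "(x, y) \<in> Om" and u: "u \<in> J" "C \<subseteq> J" "u \<notin> C"
    show "(opx u C x, opy u C y) \<in> Om \<and> (opy u C x, opx u C y) \<in> Om" if w: "\<And>w. w \<in> C \<Longrightarrow> trunc i w = trunc i u"
    proof -
      have "vv L t (opx u C x, opy u C y) = vv L t (x, y) \<and> vv L t (opy u C x, opx u C y) = vv L t (x, y)" if "t < i" for t
      proof (rule vv_op)
        show "w t = u t" if "w \<in> C" for w using fun_cong[OF w[OF that], of t] \<open>t < i\<close> by (simp add: trunc_def)
      qed (use u in \<open>auto simp: J_def\<close>)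
      moreover have "x \<in> Ind V Z0 J" "y \<in> Ind V Z0 J" using xy by (auto simp: Om_def Omb_def J_def)
      ultimately show ?thesis using xy Ind_opx[OF V(1) fJ u] Ind_opy[OF V(1) fJ u]
        unfolding Om_def Omb_def J_def by simp
    qed
    show "f (vv L i (opx u C x, opy u C y)) = f (vv L i (x, y)) \<and> f (vv L i (opy u C x, opx u C y)) = f (vv L i (x, y))"
      if w: "\<And>w. w \<in> C \<Longrightarrow> trunc (i + 1) w = trunc (i + 1) u"
    proof -
      have "vv L i (opx u C x, opy u C y) = vv L i (x, y) \<and> vv L i (opy u C x, opx u C y) = vv L i (x, y)"
      proof (rule vv_op)
        show "w i = u i" if "w \<in> C" for w using fun_cong[OF w[OF that], of i] by (simp add: trunc_def)
      qed (use u in \<open>auto simp: J_def\<close>)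
      then show ?thesis by simp
    qed
  next
    fix x y x' y' a assume "(x, y) \<in> Om" "(x', y') \<in> Om" "a \<noteq> (0 :: nat \<Rightarrow> bit)"
    then show "(\<Sum>k\<in>{k \<in> J. trunc i k = a}. outer (x k) (y k)) = (\<Sum>k\<in>{k \<in> J. trunc i k = a}. outer (x' k) (y' k))"
      using Omb_blkdet[OF V, of "(x, y)" L i b "(x', y')" a] unfolding Om_def J_def fst_conv snd_conv by blast
  next
    have nz: "trunc i k \<noteq> 0" if "k \<in> Dt L t" "t < i" for k t
    proof
      assume "trunc i k = 0"
      then have "trunc i k t = 0" by simp
      then show False using that by (simp add: Dt_def trunc_def)
    qed
    have DJ: "Dt L t \<subseteq> J" for t by (auto simp: Dt_def J_def)
    show "(x', y) \<in> Om" if o: "(x, y) \<in> Om" "x' \<in> Ind V Z0 J" "\<And>k. k \<in> J \<Longrightarrow> trunc i k \<noteq> 0 \<Longrightarrow> x' k = x k" for x y x'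
    proof -
      have "vv L t (x', y) = vv L t (x, y)" if "t < i" for t
        unfolding vv_def fst_conv snd_conv
      proof (rule sum.cong[OF refl])
        fix k assume "k \<in> Dt L t"
        then have "x' k = x k" using nz[of k t] that DJ by (intro o(3)) auto
        then show "outer (x' k) (y k) = outer (x k) (y k)" by (simp only:)
      qed
      then show ?thesis using o unfolding Om_def Omb_def J_def by simp
    qed
    show "(x, y') \<in> Om" if o: "(x, y) \<in> Om" "y' \<in> Ind V Z0 J" "\<And>k. k \<in> J \<Longrightarrow> trunc i k \<noteq> 0 \<Longrightarrow> y' k = y k" for x y y'
    proof -
      have "vv L t (x, y') = vv L t (x, y)" if "t < i" for t
        unfolding vv_def fst_conv snd_conv
      proof (rule sum.cong[OF refl])
        fix k assume "k \<in> Dt L t"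
        then have "y' k = y k" using nz[of k t] that DJ by (intro o(3)) auto
        then show "outer (x k) (y' k) = outer (x k) (y k)" by (simp only:)
      qed
      then show ?thesis using o unfolding Om_def Omb_def J_def by simp
    qed
  qed
  have WW: "core.W nn J \<omega> = Wt \<omega>" for \<omega> by (simp add: Wt_def W_def)
  define T where "T = Dt L (i + 1)"
  have TJ: "T \<subseteq> J" by (auto simp: T_def Dt_def J_def)
  have z0iff: "trunc i k = 0 \<longleftrightarrow> (\<forall>t<i. k t = 0)" for k by (auto simp: trunc_def fun_eq_iff)
  have B0: "{k \<in> J. trunc i k = 0} = F2 {i..<L} - {0}"
    using i by (auto simp: z0iff J_def F2_def)
  have cB0: "card {k \<in> J. trunc i k = 0} = 4 * q - 1"
    unfolding B0 using card_F2_ivl[of i L] p4 by (simp add: F2_def card_Diff_singleton)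
  have cT: "card {k \<in> T. trunc i k = 0} = 2 * q"
  proof -
    have "{k \<in> T. trunc i k = 0} = F2 {i..<L} - F2 ({i..<L} - {i + 1})"
    proof (intro equalityI subsetI)
      fix k assume k: "k \<in> {k \<in> T. trunc i k = 0}"
      then have "k \<in> F2 {i..<L}" "k (i + 1) = 1" by (auto simp: T_def Dt_def z0iff F2_def)
      then show "k \<in> F2 {i..<L} - F2 ({i..<L} - {i + 1})" by (auto simp: F2_def)
    next
      fix k assume k: "k \<in> F2 {i..<L} - F2 ({i..<L} - {i + 1})"
      then have k1: "k \<in> F2 {i..<L}" by simp
      have "k (i + 1) = 1"
      proof (rule ccontr)
        assume "k (i + 1) \<noteq> 1"
        then have "k \<in> F2 ({i..<L} - {i + 1})" using k1 by (auto simp: F2_def)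
        then show False using k by simp
      qed
      moreover have "k \<noteq> 0" using calculation by auto
      ultimately show "k \<in> {k \<in> T. trunc i k = 0}" using k1 by (auto simp: T_def Dt_def z0iff F2_def)
    qed
    moreover have "F2 ({i..<L} - {i + 1}) \<subseteq> F2 {i..<L}" by (auto simp: F2_def)
    moreover have "card (F2 ({i..<L} - {i + 1})) = 2 * q"
    proof -
      have "card ({i..<L} - {i + 1}) = L - i - 1" using i by (subst card_Diff_singleton) auto
      then have "card (F2 ({i..<L} - {i + 1})) = 2 ^ (L - i - 1)" by (simp add: card_F2)
      also have "L - i - 1 = Suc (L - i - 2)" using i by simp
      finally show ?thesis by (simp add: q_def)
    qed
    ultimately show ?thesis using card_F2_ivl[of i L] p4
      by (simp add: card_Diff_subset finite_F2)
  qed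
  have cnz: "card {k \<in> J. trunc i k \<noteq> 0} = 2 ^ L - 4 * q"
  proof -
    have "{k \<in> J. trunc i k \<noteq> 0} = J - {k \<in> J. trunc i k = 0}" by auto
    then have "card {k \<in> J. trunc i k \<noteq> 0} = card J - card {k \<in> J. trunc i k = 0}"
      using fJ by (simp add: card_Diff_subset)
    then show ?thesis using cJ cB0 q1 d4 by simp
  qed
  have classes: "(\<Sum>c\<in>trunc (i + 1) ` J. 1 / 2 ^ card {w \<in> J - T. trunc (i + 1) w = c} :: real) \<le> (2 ^ (i + 1) + 1) / 2 ^ q"
  proof -
    have sub: "trunc (i + 1) ` J \<subseteq> F2 {..<i + 1}" by (auto simp: trunc_def F2_def)
    have cc: "card {w \<in> J - T. trunc (i + 1) w = c} = (if c = 0 then q - 1 else q)" if c: "c \<in> F2 {..<i + 1}" for c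
    proof -
      have e1: "{w \<in> J - T. trunc (i + 1) w = c} = (\<lambda>v. v + c) ` F2 {i + 2..<L} - {0}"
      proof (intro equalityI subsetI)
        fix w assume w: "w \<in> {w \<in> J - T. trunc (i + 1) w = c}"
        have wi: "w (i + 1) = 0" using w by (auto simp: T_def Dt_def J_def)
        have wc: "w t = c t" if "t < i + 1" for t using w that by (auto simp: trunc_def)
        have "w + c \<in> F2 {i + 2..<L}"
          unfolding F2_def
        proof (clarify)
          fix t assume t: "t \<notin> {i + 2..<L}"
          consider "t < i + 1" | "t = i + 1" | "t \<ge> L" "t > i + 1" using t by force
          then show "(w + c) t = 0"
          proof cases
            case 1 then show ?thesis using wc[of t] by (simp only: plus_fun_apply) (cases "c t"; simp)
          next
            case 2 then show ?thesis using wi c by (auto simp: F2_def)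
          next
            case 3 then show ?thesis using w c by (auto simp: F2_def J_def)
          qed
        qed
        moreover have "w = (w + c) + c" by (simp only: add.assoc vadd_self add_0_right)
        ultimately have "w \<in> (\<lambda>v. v + c) ` F2 {i + 2..<L}" by (intro image_eqI)
        moreover have "w \<noteq> 0" using w unfolding J_def by blast
        ultimately show "w \<in> (\<lambda>v. v + c) ` F2 {i + 2..<L} - {0}" by blast
      next
        fix w assume w: "w \<in> (\<lambda>v. v + c) ` F2 {i + 2..<L} - {0}"
        then obtain v where v: "v \<in> F2 {i + 2..<L}" "w = v + c" "w \<noteq> 0" by auto
        have "w \<in> F2 {..<L}" using v c i by (auto simp: F2_def)
        moreover have "w (i + 1) = 0" using v c by (auto simp: F2_def)
        moreover have "trunc (i + 1) w = c" using v c by (auto simp: F2_def trunc_def fun_eq_iff)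
        ultimately show "w \<in> {w \<in> J - T. trunc (i + 1) w = c}" using v by (auto simp: J_def T_def Dt_def)
      qed
      have e2: "card ((\<lambda>v. v + c) ` F2 {i + 2..<L}) = q"
        using card_F2_ivl[of "i + 2" L] by (subst card_image) (auto simp: inj_on_def q_def)
      have e3: "finite ((\<lambda>v. v + c) ` F2 {i + 2..<L})" by (simp add: finite_F2)
      have e4: "0 \<in> (\<lambda>v. v + c) ` F2 {i + 2..<L} \<longleftrightarrow> c = 0"
      proof
        assume "0 \<in> (\<lambda>v. v + c) ` F2 {i + 2..<L}"
        then obtain v where v: "v \<in> F2 {i + 2..<L}" "v + c = 0" unfolding image_iff by metis
        then have "v = c" by (simp add: vadd_eq_0_iff)
        then have "c t = 0" for t using v c by (cases "t < i + 1") (auto simp: F2_def)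
        then show "c = 0" by auto
      next
        assume "c = 0"
        then show "0 \<in> (\<lambda>v. v + c) ` F2 {i + 2..<L}" by (auto simp: F2_def image_iff)
      qed
      show ?thesis unfolding e1 card_Diff_singleton_if e2 e4 by simp
    qed
    have "(\<Sum>c\<in>trunc (i + 1) ` J. 1 / 2 ^ card {w \<in> J - T. trunc (i + 1) w = c} :: real) \<le> (\<Sum>c\<in>F2 {..<i + 1}. 1 / 2 ^ card {w \<in> J - T. trunc (i + 1) w = c})"
      using sub by (intro sum_mono2) (auto simp: finite_F2)
    also have "\<dots> = (\<Sum>c\<in>F2 {..<i + 1}. 1 / 2 ^ q + (if c = 0 then 1 / 2 ^ q else 0))"
    proof (rule sum.cong[OF refl])
      fix c assume c: "c \<in> F2 {..<i + 1}"
      obtain q' where q': "q = Suc q'" using q1 by (cases q) auto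
      show "1 / 2 ^ card {w \<in> J - T. trunc (i + 1) w = c} = 1 / 2 ^ q + (if c = 0 then 1 / 2 ^ q else (0::real))"
        unfolding cc[OF c] q' by simp
    qed
    also have "\<dots> = 2 ^ (i + 1) / 2 ^ q + 1 / 2 ^ q"
    proof -
      have "(0 :: nat \<Rightarrow> bit) \<in> F2 {..<i + 1}" by (simp add: F2_def)
      then show ?thesis by (simp add: sum.distrib finite_F2 card_F2)
    qed
    finally show ?thesis by (simp add: add_divide_distrib)
  qed
  have dm: "card {k \<in> J. trunc i k \<noteq> 0} + card {k \<in> T. trunc i k = 0} \<le> m0 + 1"
    unfolding cnz cT m0_def using d4 q1 by simp
  have m': "(\<Sum>\<omega>\<in>Om. core.W nn J \<omega> * f (vv L i \<omega>)) = 0" unfolding WW by (rule m)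
  have FFn: "0 \<le> (\<Sum>\<omega>\<in>Om. Wt \<omega> * (f (vv L i \<omega>))\<^sup>2)"
    using Wn unfolding WW by (intro sum_nonneg mult_nonneg_nonneg) auto
  \<comment> \<open>The second endpoint is a function of the revealed vectors, so conditioning on it
    captures no more of \<open>f\<close>.\<close>
  have "fw.Nk (vv L (i + 1)) \<le> fw.Nk (rkey T T)"
  proof (rule fw.Nk_mono[where r = "\<lambda>k. \<Sum>u\<in>T. outer (fst k u) (snd k u)"])
    show "vv L (i + 1) \<omega> = (\<Sum>u\<in>T. outer (fst (rkey T T \<omega>) u) (snd (rkey T T \<omega>) u))" for \<omega>
      unfolding vv_def T_def[symmetric] by (intro sum.cong refl) (simp add: rkey_def)
  qed
  also have "\<dots> \<le> (4 * (\<Sum>c\<in>trunc (i + 1) ` J. 1 / 2 ^ card {w \<in> J - T. trunc (i + 1) w = c}) + 2 * real (card {k \<in> T. trunc i k = 0}) * eps)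
      * (\<Sum>\<omega>\<in>Om. core.W nn J \<omega> * (f (vv L i \<omega>))\<^sup>2)"
    by (rule reveal[OF m' TJ dm])
  also have "\<dots> \<le> (4 * ((2 ^ (i + 1) + 1) / 2 ^ q) + 2 * real (2 * q) * eps) * (\<Sum>\<omega>\<in>Om. Wt \<omega> * (f (vv L i \<omega>))\<^sup>2)"
    unfolding WW cT by (intro mult_right_mono add_right_mono mult_left_mono classes FFn) auto
  finally show ?thesis unfolding fw.Nk_def fw.num_def fw.den_def fw.fib_def WW by (simp add: q_def)
qed

section \<open>Measured posets determined by their top spaces\<close>

text \<open>A measured poset with full support is recovered from its distribution on top faces
  (\<open>gen_of_poset\<close>), so skeletons and the construction can be described by distributions
  alone.\<close>

definition gen :: "('i \<Rightarrow> bit) set pmf \<Rightarrow> ('i \<Rightarrow> bit) set set" where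
  "gen \<mu> = {u. fvs.subspace u \<and> (\<exists>W\<in>set_pmf \<mu>. u \<subseteq> W)}"

lemma exists_Ind:
  fixes W :: "('i \<Rightarrow> bit) set"
  assumes W: "fvs.subspace W" "finite W" and S: "fvs.subspace S" "S \<subseteq> W" and K: "finite K" "fvs.dim S + card K \<le> fvs.dim W"
  shows "\<exists>z. z \<in> Ind W S K"
proof -
  have "real (card (Ind W S K)) > 0" unfolding card_Ind[OF W(2,1) S K(1)] by (rule extc_pos[OF K(2)])
  then have "Ind W S K \<noteq> {}" by auto
  then show ?thesis by blast
qed

lemma exists_intermediate:
  fixes W :: "('i \<Rightarrow> bit) set"
  assumes W: "fvs.subspace W" "finite W" and S: "fvs.subspace S" "S \<subseteq> W" and k: "fvs.dim S \<le> k" "k \<le> fvs.dim W"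
  shows "\<exists>u. fvs.subspace u \<and> S \<subseteq> u \<and> u \<subseteq> W \<and> fvs.dim u = k"
proof -
  obtain z :: "nat \<Rightarrow> _" where z: "z \<in> Ind W S {..<k - fvs.dim S}"
    using exists_Ind[OF W S, of "{..<k - fvs.dim S}"] k by auto
  have fS: "finite S" using S W finite_subset by auto
  have "ssp S z {..<k - fvs.dim S} \<subseteq> W" using z S W by (intro ssp_subset) (auto simp: Ind_def)
  moreover have "fvs.dim (ssp S z {..<k - fvs.dim S}) = k"
    using dim_ssp[of "{..<k - fvs.dim S}" S z] z S fS k by (auto simp: Ind_def)
  ultimately show ?thesis using S(1) by (intro exI[of _ "ssp S z {..<k - fvs.dim S}"] conjI subspace_ssp ssp_base) auto
qed

text \<open>By finiteness every face lies below a maximal one, which has dimension \<open>l\<close>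
  and so belongs to the support.\<close>

lemma gen_of_poset:
  assumes V: "fvs.subspace V" "finite V" and g: "grassmann_poset V l Y" and s: "set_pmf \<mu> = faces Y l"
  shows "pure V l \<mu>" and "Y = gen \<mu>"
proof -
  have Y: "fvs.subspace w" "w \<subseteq> V" if "w \<in> Y" for w using g that by (auto simp: grassmann_poset_def)
  have down: "u \<in> Y" if "w \<in> Y" "fvs.subspace u" "u \<subseteq> w" for u w using g that unfolding grassmann_poset_def by blast
  have mx: "fvs.dim w = l" if "w \<in> Y" "\<And>u. u \<in> Y \<Longrightarrow> w \<subseteq> u \<Longrightarrow> u = w" for w
  proof -
    have "\<forall>w\<in>Y. (\<forall>u\<in>Y. w \<subseteq> u \<longrightarrow> u = w) \<longrightarrow> fvs.dim w = l" using g unfolding grassmann_poset_def by (elim conjE)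
    from bspec[OF this that(1)] show ?thesis by (rule mp) (intro ballI impI that(2))
  qed
  show "pure V l \<mu>" unfolding pure_def s faces_def using V Y by auto
  have fY: "finite Y" using Y(2) V(2) by (intro finite_subset[of Y "Pow V"]) auto
  show "Y = gen \<mu>"
  proof (intro equalityI subsetI)
    fix w assume w: "w \<in> Y"
    obtain M where M: "M \<in> Y" "w \<subseteq> M" "\<And>u. u \<in> Y \<Longrightarrow> M \<subseteq> u \<Longrightarrow> u = M"
      using finite_has_maximal2[OF fY w] by metis
    then have "M \<in> faces Y l" using mx[of M] by (auto simp: faces_def)
    then show "w \<in> gen \<mu>" using Y[OF w] M s by (auto simp: gen_def)
  next
    fix w assume "w \<in> gen \<mu>"
    then show "w \<in> Y" using down s by (auto simp: gen_def faces_def)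
  qed
qed

lemma poset_gen:
  assumes p: "pure V l \<mu>"
  shows "grassmann_poset V l (gen \<mu>)" and "set_pmf \<mu> = faces (gen \<mu>) l"
proof -
  have V: "finite V" using p by (simp add: pure_def)
  have W: "fvs.subspace W" "finite W" "W \<subseteq> V" "fvs.dim W = l" if "W \<in> set_pmf \<mu>" for W
    using p that finite_subset by (auto simp: pure_def)
  have in_gen: "W \<in> gen \<mu>" if "W \<in> set_pmf \<mu>" for W using W(1)[OF that] that by (auto simp: gen_def)
  show "grassmann_poset V l (gen \<mu>)"
    unfolding grassmann_poset_def
  proof (intro conjI ballI allI impI)
    fix w assume w: "w \<in> gen \<mu>"
    then obtain M where M: "M \<in> set_pmf \<mu>" "w \<subseteq> M" "fvs.subspace w" by (auto simp: gen_def)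
    show "fvs.subspace w" "w \<subseteq> V" using M W(3)[OF M(1)] by auto
    show "u \<in> gen \<mu>" if "fvs.subspace u \<and> u \<subseteq> w" for u using that M by (auto simp: gen_def)
    show "fvs.dim w = l" if "\<forall>u\<in>gen \<mu>. w \<subseteq> u \<longrightarrow> u = w"
    proof -
      have "M = w" using bspec[OF that in_gen[OF M(1)]] M(2) by (rule mp)
      then show ?thesis using W(4)[OF M(1)] by simp
    qed
  qed
  show "set_pmf \<mu> = faces (gen \<mu>) l"
  proof (intro equalityI subsetI)
    fix w assume "w \<in> faces (gen \<mu>) l"
    then obtain M where M: "M \<in> set_pmf \<mu>" "w \<subseteq> M" "fvs.subspace w" "fvs.dim w = l" by (auto simp: gen_def faces_def)
    then have "w = M" using W[OF M(1)] by (intro subspace_eq_of_dim) auto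
    then show "w \<in> set_pmf \<mu>" using M by simp
  qed (use in_gen W in \<open>auto simp: faces_def\<close>)
qed

text \<open>A face of dimension at most \<open>k\<close> lies in a \<open>k\<close>-dimensional face
  below a top face, and the support of the marginal consists of exactly those faces.\<close>

lemma skeleton_gen:
  assumes p: "pure V l \<mu>" and k: "k \<le> l"
  shows "skeleton k (gen \<mu>, \<mu>) = (gen (flag_marginal k \<mu>), flag_marginal k \<mu>)"
proof -
  have W: "fvs.subspace W" "finite W" "fvs.dim W = l" if "W \<in> set_pmf \<mu>" for W
    using p that finite_subset by (auto simp: pure_def)
  have "{w \<in> gen \<mu>. fvs.dim w \<le> k} = gen (flag_marginal k \<mu>)"
  proof (intro equalityI subsetI)
    fix w assume "w \<in> {w \<in> gen \<mu>. fvs.dim w \<le> k}"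
    then obtain M where M: "M \<in> set_pmf \<mu>" "w \<subseteq> M" "fvs.subspace w" "fvs.dim w \<le> k" by (auto simp: gen_def)
    obtain u where u: "fvs.subspace u" "w \<subseteq> u" "u \<subseteq> M" "fvs.dim u = k"
      using exists_intermediate[OF W(1,2)[OF M(1)] M(3,2,4)] W(3)[OF M(1)] k by auto
    then show "w \<in> gen (flag_marginal k \<mu>)" unfolding gen_def set_flag_marginal[OF p k] using M by blast
  next
    fix w assume "w \<in> gen (flag_marginal k \<mu>)"
    then obtain u M where u: "fvs.subspace w" "w \<subseteq> u" "fvs.subspace u" "fvs.dim u = k" "M \<in> set_pmf \<mu>" "u \<subseteq> M"
      unfolding gen_def set_flag_marginal[OF p k] by blast
    have "finite u" using u W(2)[OF u(5)] finite_subset by auto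
    then have "fvs.dim w \<le> k" using dim_mono_subspace[OF u(1,3) _ u(2)] u by simp
    then show "w \<in> {w \<in> gen \<mu>. fvs.dim w \<le> k}" using u by (auto simp: gen_def)
  qed
  then show ?thesis by (simp add: skeleton_def)
qed

lemma link_verts_gen:
  assumes p: "pure V l \<mu>" and w: "fvs.subspace w" "w \<subseteq> V"
  shows "link_verts (gen \<mu>) w = {v \<in> V. n1 (Nm \<mu>) w v > 0}"
proof -
  have fw: "finite w" using p w finite_subset by (auto simp: pure_def)
  have "v \<in> link_verts (gen \<mu>) w \<longleftrightarrow> v \<in> V \<and> n1 (Nm \<mu>) w v > 0" for v
  proof (cases "v \<in> w")
    case True
    then have "insert v w = w" by auto
    then have "fvs.span (insert v w) = w" using w by (simp add: fvs.span_eq_iff)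
    then show ?thesis using True unfolding link_verts_def faces_def n1_def mem_Collect_eq by simp
  next
    case False
    have s: "fvs.span (insert v w) = sp1 w v" using w by (simp add: sp1_eq_span)
    have sub: "fvs.subspace (sp1 w v)" using w by (simp add: subspace_sp1)
    have vm: "v \<in> sp1 w v" using w(1) by (simp add: mem_sp1 fvs.subspace_0)
    have "v \<in> V" if "sp1 w v \<subseteq> W" "W \<in> set_pmf \<mu>" for W using that vm p by (auto simp: pure_def)
    moreover have "fvs.dim (sp1 w v) = fvs.dim w + 1" using False fw w by (intro dim_sp1)
    ultimately show ?thesis using False sub unfolding link_verts_def faces_def s gen_def n1_def mem_Collect_eq by (auto simp: Nm_pos_iff)
  qed
  then show ?thesis by blast
qed

section \<open>Sums of rank-one matrices\<close>

lemma outer_sum_row: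
  assumes "finite K"
  shows "(\<lambda>j. (\<Sum>k\<in>K. outer (x k) (y k)) (i, j)) = sum y {k \<in> K. x k i = 1}"
proof
  fix j
  have "(\<Sum>k\<in>K. outer (x k) (y k)) (i, j) = (\<Sum>k\<in>K. if x k i = 1 then y k j else 0)"
    unfolding sum_fun_app outer_def by (intro sum.cong refl) auto
  also have "\<dots> = sum y {k \<in> K. x k i = 1} j" using assms unfolding sum_fun_app by (simp only: sum.inter_filter)
  finally show "(\<Sum>k\<in>K. outer (x k) (y k)) (i, j) = sum y {k \<in> K. x k i = 1} j" .
qed

lemma row_space_outer_sum_subset:
  assumes "finite K"
  shows "row_space (\<Sum>k\<in>K. outer (x k) (y k)) \<subseteq> ssp Z0 y K"
  unfolding row_space_def outer_sum_row[OF assms]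
  by (intro fvs.span_minimal subspace_ssp assms subspace_Z0) (auto intro: ssp_sum)

text \<open>The rows are subset sums of \<open>y\<close>. If they did not span some
  \<open>y k0\<close>, a functional that vanishes on the rows and not on \<open>y k0\<close> would
  produce a nontrivial relation among the \<open>x k\<close>.\<close>

lemma row_space_outer_sum:
  assumes K: "finite K" and x: "indm Z0 x K"
  shows "row_space (\<Sum>k\<in>K. outer (x k) (y k)) = ssp Z0 y K"
proof
  let ?V = "ssp Z0 y K" and ?R = "row_space (\<Sum>k\<in>K. outer (x k) (y k))"
  have V: "fvs.subspace ?V" "finite ?V" using K by (simp_all add: subspace_ssp finite_ssp)
  show RV: "?R \<subseteq> ?V" by (rule row_space_outer_sum_subset[OF K])
  have R: "fvs.subspace ?R" by (simp add: row_space_def)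
  show "?V \<subseteq> ?R"
  proof (rule ssp_subset[OF R Z0_subset[OF R]])
    fix k0 assume k0: "k0 \<in> K"
    show "y k0 \<in> ?R"
    proof (rule ccontr)
      assume n: "y k0 \<notin> ?R"
      have yV: "y k \<in> ?V" if "k \<in> K" for k using that K by (intro ssp_gen) auto
      obtain \<phi> :: "(nat \<Rightarrow> bit) \<Rightarrow> bit" where \<phi>: "\<forall>a\<in>?V. \<forall>b\<in>?V. \<phi> (a + b) = \<phi> a + \<phi> b" "\<forall>a\<in>?R. \<phi> a = 0" "\<phi> (y k0) = 1"
        using separating_functional[OF V R RV yV[OF k0] n] by blast
      have "sum x {k \<in> K. \<phi> (y k) = 1} = 0"
      proof
        fix i
        have "sum y {k \<in> K. x k i = 1} \<in> ?R" unfolding row_space_def outer_sum_row[OF K, symmetric]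
          by (intro fvs.span_base) blast
        then have "0 = \<phi> (sum y {k \<in> K. x k i = 1})" using \<phi> by simp
        also have "\<dots> = (\<Sum>k\<in>{k \<in> K. x k i = 1}. \<phi> (y k))"
          using K yV by (intro functional_sum[OF V(1) \<phi>(1)]) auto
        also have "\<dots> = (\<Sum>k\<in>K. if x k i = 1 then \<phi> (y k) else 0)" using K by (simp add: sum.inter_filter)
        also have "\<dots> = (\<Sum>k\<in>K. if \<phi> (y k) = 1 then x k i else 0)" by (intro sum.cong refl) auto
        also have "\<dots> = sum x {k \<in> K. \<phi> (y k) = 1} i" using K unfolding sum_fun_app by (simp only: sum.inter_filter)
        finally show "sum x {k \<in> K. \<phi> (y k) = 1} i = 0 i" by simp
      qed
      moreover have "{k \<in> K. \<phi> (y k) = 1} \<noteq> {}" using k0 \<phi> by auto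
      ultimately show False using x unfolding indm_def by (metis (no_types, lifting) Z0_simps(3) mem_Collect_eq subsetI)
    qed
  qed
qed

lemma col_space_outer_sum_swap:
  "col_space (\<Sum>k\<in>K. outer (x k) (y k)) = row_space (\<Sum>k\<in>K. outer (y k) (x k))"
proof -
  have "(\<Sum>k\<in>K. outer (x k) (y k)) (i, j) = (\<Sum>k\<in>K. outer (y k) (x k)) (j, i)" for i j
    unfolding sum_fun_app outer_def by (intro sum.cong refl) (simp only: prod.case mult.commute)
  then show ?thesis unfolding col_space_def row_space_def by simp
qed

lemma mrank_outer:
  assumes "x \<noteq> 0" "y \<noteq> 0"
  shows "mrank (outer x y) = 1"
proof -
  have "row_space (outer x y) = ssp Z0 (\<lambda>_. y) {()}"
    using row_space_outer_sum[of "{()}" "\<lambda>_. x" "\<lambda>_. y"] assms by (simp add: indm_single)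
  then show ?thesis using dim_ssp_0[of "{()}" "\<lambda>_. y"] assms by (simp add: mrank_def indm_single)
qed

text \<open>The only nonzero scalar is 1, so the factors of a nonzero rank-one matrix are unique and
  not just unique up to scaling.\<close>

lemma outer_eqD:
  fixes x x' :: "'i \<Rightarrow> bit" and y y' :: "'j \<Rightarrow> bit"
  assumes "outer x y = outer x' y'" "x \<noteq> 0" "y \<noteq> 0"
  shows "x = x' \<and> y = y'"
proof -
  have e: "x i * y j = x' i * y' j" for i j using fun_cong[OF assms(1), of "(i, j)"] by (simp add: outer_def)
  obtain i0 where "x i0 \<noteq> 0" using assms(2) by (auto simp: fun_eq_iff)
  then have i0: "x i0 = 1" by simp
  obtain j0 where "y j0 \<noteq> 0" using assms(3) by (auto simp: fun_eq_iff)
  then have j0: "y j0 = 1" by simp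
  have p: "x' i0 = 1" "y' j0 = 1" using e[of i0 j0] i0 j0 by (cases "x' i0"; cases "y' j0"; simp)+
  have "x i = x' i" for i using e[of i j0] unfolding j0 p mult_1_right .
  moreover have "y j = y' j" for j using e[of i0 j] unfolding i0 p mult_1_left .
  ultimately show ?thesis by blast
qed

text \<open>The row space has two elements, so each row is 0 or its one nonzero vector.\<close>

lemma rank_one_outer:
  assumes M: "M \<in> F2 ({..<n} \<times> {..<n})" and r: "mrank M = 1"
  shows "\<exists>x y. x \<in> F2 {..<n} \<and> y \<in> F2 {..<n} \<and> x \<noteq> 0 \<and> y \<noteq> 0 \<and> M = outer x y"
proof -
  define row where "row = (\<lambda>i j. M (i, j))"
  have rn: "row i \<in> F2 {..<n}" "i \<notin> {..<n} \<Longrightarrow> row i = 0" for i using M by (auto simp: row_def F2_def fun_eq_iff)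
  have R: "fvs.subspace (row_space M)" "row_space M \<subseteq> F2 {..<n}"
  proof -
    show "fvs.subspace (row_space M)" by (simp add: row_space_def)
    show "row_space M \<subseteq> F2 {..<n}"
      unfolding row_space_def using rn by (intro fvs.span_minimal subspace_F2) (auto simp: row_def)
  qed
  have fR: "finite (row_space M)" using R finite_F2[of "{..<n}"] finite_subset by blast
  have c2: "card (row_space M) = 2" using card_subspace[OF R(1) fR] r by (simp add: mrank_def)
  have z: "0 \<in> row_space M" using R(1) by (rule fvs.subspace_0)
  have "card (row_space M - {0}) = 1" using c2 z by (simp add: card_Diff_singleton)
  then obtain y where y: "row_space M - {0} = {y}" by (rule card_1_singletonE)
  have y0: "y \<in> row_space M" "y \<noteq> 0" using y by auto
  have rows: "row i = 0 \<or> row i = y" for i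
  proof -
    have "row i \<in> row_space M" unfolding row_space_def row_def by (intro fvs.span_base) blast
    then show ?thesis using y by blast
  qed
  define x :: "nat \<Rightarrow> bit" where "x = (\<lambda>i. if row i = y then 1 else 0)"
  have "M = outer x y"
  proof
    fix p :: "nat \<times> nat"
    obtain i j where p: "p = (i, j)" by (cases p)
    have "M p = row i j" by (simp add: p row_def)
    also have "\<dots> = x i * y j" using rows[of i] y0 by (auto simp: x_def)
    finally show "M p = outer x y p" by (simp add: p outer_def)
  qed
  moreover have "x \<in> F2 {..<n}" using rn(2) y0 by (auto simp: F2_def x_def)
  moreover have "x \<noteq> 0"
  proof
    assume "x = 0"
    then have "x i \<noteq> 1" for i by simp
    then have "row i \<noteq> y" for i unfolding x_def by (metis (mono_tags))
    then have "row i = 0" for i using rows[of i] by blast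
    then have "range (\<lambda>i j. M (i, j)) \<subseteq> {0}" by (auto simp: row_def)
    then have "row_space M \<subseteq> fvs.span {0}" unfolding row_space_def by (rule fvs.span_mono)
    then show False using y0 by auto
  qed
  ultimately show ?thesis using y0 R by blast
qed

abbreviation Jset :: "nat \<Rightarrow> (nat \<Rightarrow> bit) set" where "Jset L \<equiv> F2 {..<L} - {0}"

definition mk :: "nat \<Rightarrow> (nat \<Rightarrow> bit, 'i) state \<Rightarrow> (nat \<Rightarrow> bit) \<Rightarrow> 'i \<times> 'i \<Rightarrow> bit" where
  "mk L \<omega> = restrict (\<lambda>u. outer (fst \<omega> u) (snd \<omega> u)) (Jset L)"

lemma finite_Jset [simp]: "finite (Jset L)" by (simp add: finite_F2)

lemma card_Jset: "card (Jset L) = 2 ^ L - 1"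
proof -
  have "0 \<in> F2 {..<L}" by (simp add: F2_def)
  then show ?thesis by (simp add: card_Diff_singleton card_F2)
qed

lemma Ind_nonzero: "x \<in> Ind V Z0 K \<Longrightarrow> k \<in> K \<Longrightarrow> x k \<noteq> 0"
  using indm_mono[of Z0 x K "{k}"] by (auto simp: Ind_def indm_single)

lemma inj_mk: "inj_on (mk L) (Ind V Z0 (Jset L) \<times> Ind V' Z0 (Jset L))"
proof (rule inj_onI)
  fix \<omega> \<omega>' assume o: "\<omega> \<in> Ind V Z0 (Jset L) \<times> Ind V' Z0 (Jset L)" "\<omega>' \<in> Ind V Z0 (Jset L) \<times> Ind V' Z0 (Jset L)" and e: "mk L \<omega> = mk L \<omega>'"
  obtain x y x' y' where w: "\<omega> = (x, y)" "\<omega>' = (x', y')" by (cases \<omega>, cases \<omega>')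
  have xy: "x \<in> Ind V Z0 (Jset L)" "y \<in> Ind V' Z0 (Jset L)" "x' \<in> Ind V Z0 (Jset L)" "y' \<in> Ind V' Z0 (Jset L)" using o w by auto
  have "x u = x' u \<and> y u = y' u" if u: "u \<in> Jset L" for u
  proof (rule outer_eqD)
    show "outer (x u) (y u) = outer (x' u) (y' u)" using fun_cong[OF e, of u] u unfolding mk_def w fst_conv snd_conv by (simp only: restrict_apply' u)
  qed (rule Ind_nonzero[OF xy(1) u] Ind_nonzero[OF xy(2) u])+
  moreover have "x u = undefined" "x' u = undefined" "y u = undefined" "y' u = undefined" if "u \<notin> Jset L" for u
    using xy that by (auto simp: Ind_def PiE_def extensional_def)
  ultimately have "x u = x' u" "y u = y' u" for u by (cases "u \<in> Jset L"; metis)+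
  then have "x = x'" "y = y'" by blast+
  then show "\<omega> = \<omega>'" using w by simp
qed

lemma msum_mk: "msum L (mk L \<omega>) = (\<Sum>u\<in>Jset L. outer (fst \<omega> u) (snd \<omega> u))"
  unfolding msum_def mk_def by (rule sum.cong[OF refl]) (simp only: restrict_apply')

text \<open>A family on \<open>K\<close> has at most \<open>2 ^ card K\<close> subset sums; if they
  cover a space of that size, they are all distinct and fill it exactly.\<close>

lemma indm_of_subset:
  assumes K: "finite K" and w: "fvs.subspace w" "fvs.dim w = card K" "w \<subseteq> ssp Z0 z K"
  shows "indm Z0 z K" and "ssp Z0 z K = w"
proof -
  have f: "finite (ssp Z0 z K)" using K by (simp add: finite_ssp)
  then have fw: "finite w" using w finite_subset by blast
  have "card (ssp Z0 z K) \<le> 2 ^ card K"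
  proof -
    have "ssp Z0 z K \<subseteq> sum z ` Pow K" by (auto simp: ssp_def)
    then have "card (ssp Z0 z K) \<le> card (sum z ` Pow K)" using K by (intro card_mono) auto
    also have "\<dots> \<le> card (Pow K)" using K by (intro card_image_le) auto
    finally show ?thesis using K by (simp add: card_Pow)
  qed
  moreover have "2 ^ card K \<le> card (ssp Z0 z K)"
    using card_mono[OF f w(3)] card_subspace[OF w(1) fw] w(2) by simp
  ultimately have c: "card (ssp Z0 z K) = 2 ^ card K" by simp
  then show "indm Z0 z K" by (simp add: indm_iff_card[OF K])
  show "ssp Z0 z K = w" using card_subspace[OF w(1) fw] w c f by (intro card_subset_eq[symmetric]) auto
qed

lemma outer_mem_F2: "x \<in> F2 I \<Longrightarrow> y \<in> F2 I' \<Longrightarrow> outer x y \<in> F2 (I \<times> I')"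
  by (auto simp: F2_def outer_def)

text \<open>The matrix \<open>msum L s\<close> is a sum of \<open>2 ^ L - 1\<close> rank-one
  matrices and its row and column spaces have that dimension, which forces both families of factors
  to be independent. Left factors lie in the column space \<open>w2\<close>, right factors in the
  row space \<open>w1\<close>.\<close>

lemma admissible_fibre:
  assumes w: "w1 \<in> faces Y (2 ^ L - 1)" "w2 \<in> faces Y (2 ^ L - 1)"
    and sub: "fvs.subspace w1" "fvs.subspace w2" "w1 \<subseteq> F2 {..<n}" "w2 \<subseteq> F2 {..<n}"
  shows "{s \<in> admissible n L Y. row_space (msum L s) = w1 \<and> col_space (msum L s) = w2} =
    mk L ` (Ind w2 Z0 (Jset L) \<times> Ind w1 Z0 (Jset L))"
proof (intro equalityI subsetI)
  have dm: "fvs.dim w1 = card (Jset L)" "fvs.dim w2 = card (Jset L)" using w by (auto simp: faces_def card_Jset)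
  fix s assume s: "s \<in> {s \<in> admissible n L Y. row_space (msum L s) = w1 \<and> col_space (msum L s) = w2}"
  have "\<exists>p. fst p \<in> F2 {..<n} \<and> snd p \<in> F2 {..<n} \<and> s u = outer (fst p) (snd p)" if "u \<in> Jset L" for u
  proof -
    have "s u \<in> F2 ({..<n} \<times> {..<n})" "mrank (s u) = 1" using s that by (auto simp: admissible_def)
    then show ?thesis using rank_one_outer by (metis fst_conv snd_conv)
  qed
  then obtain p where p: "\<And>u. u \<in> Jset L \<Longrightarrow> fst (p u) \<in> F2 {..<n} \<and> snd (p u) \<in> F2 {..<n} \<and> s u = outer (fst (p u)) (snd (p u))" by metis
  define x y where "x = restrict (\<lambda>u. fst (p u)) (Jset L)" and "y = restrict (\<lambda>u. snd (p u)) (Jset L)"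
  have se: "s = mk L (x, y)"
  proof
    fix u show "s u = mk L (x, y) u"
    proof (cases "u \<in> Jset L")
      case True then show ?thesis using p[OF True] by (simp only: mk_def x_def y_def restrict_apply' fst_conv snd_conv)
    next
      case False then show ?thesis using s by (auto simp: mk_def admissible_def PiE_def extensional_def)
    qed
  qed
  have ms: "msum L s = (\<Sum>u\<in>Jset L. outer (x u) (y u))" unfolding se msum_mk by simp
  have r: "row_space (msum L s) = w1" "col_space (msum L s) = w2" using s by auto
  have "w1 \<subseteq> ssp Z0 y (Jset L)" using row_space_outer_sum_subset[OF finite_Jset[of L], of x y] unfolding ms[symmetric] r .
  note 1 = indm_of_subset[OF finite_Jset sub(1) dm(1) this]
  have "w2 \<subseteq> ssp Z0 x (Jset L)" using row_space_outer_sum_subset[OF finite_Jset[of L], of y x] unfolding col_space_outer_sum_swap[symmetric] ms[symmetric] r .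
  note 2 = indm_of_subset[OF finite_Jset sub(2) dm(2) this]
  have "x u \<in> w2" "y u \<in> w1" if "u \<in> Jset L" for u
    using ssp_gen[OF subspace_Z0 finite_Jset that, of x] ssp_gen[OF subspace_Z0 finite_Jset that, of y] 1(2) 2(2) by auto
  then have "(x, y) \<in> Ind w2 Z0 (Jset L) \<times> Ind w1 Z0 (Jset L)"
    using 1(1) 2(1) by (auto simp: Ind_def x_def y_def)
  then show "s \<in> mk L ` (Ind w2 Z0 (Jset L) \<times> Ind w1 Z0 (Jset L))" using se by blast
next
  have dm: "fvs.dim w1 = card (Jset L)" "fvs.dim w2 = card (Jset L)" using w by (auto simp: faces_def card_Jset)
  have fw: "finite w1" "finite w2" using sub finite_F2[of "{..<n}"] finite_subset by blast+
  fix s assume "s \<in> mk L ` (Ind w2 Z0 (Jset L) \<times> Ind w1 Z0 (Jset L))"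
  then obtain x y where xy: "x \<in> Ind w2 Z0 (Jset L)" "y \<in> Ind w1 Z0 (Jset L)" "s = mk L (x, y)" by auto
  have ms: "msum L s = (\<Sum>u\<in>Jset L. outer (x u) (y u))" unfolding xy msum_mk by simp
  have ii: "indm Z0 x (Jset L)" "indm Z0 y (Jset L)" using xy by (auto simp: Ind_def)
  have r1: "row_space (msum L s) = w1"
    unfolding ms row_space_outer_sum[OF finite_Jset ii(1)]
    by (rule ssp_Ind_full[OF sub(1) fw(1) subspace_Z0 Z0_subset[OF sub(1)] xy(2) finite_Jset]) (simp add: dm)
  have r2: "col_space (msum L s) = w2"
    unfolding ms col_space_outer_sum_swap row_space_outer_sum[OF finite_Jset ii(2)]
    by (rule ssp_Ind_full[OF sub(2) fw(2) subspace_Z0 Z0_subset[OF sub(2)] xy(1) finite_Jset]) (simp add: dm)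
  have su: "s u = outer (x u) (y u)" if "u \<in> Jset L" for u unfolding xy mk_def using that by (simp only: restrict_apply' fst_conv snd_conv)
  have "s \<in> Jset L \<rightarrow>\<^sub>E F2 ({..<n} \<times> {..<n})"
  proof (rule PiE_I)
    fix u assume u: "u \<in> Jset L"
    show "s u \<in> F2 ({..<n} \<times> {..<n})" unfolding su[OF u]
      using Ind_mem[OF xy(1) u] Ind_mem[OF xy(2) u] sub by (intro outer_mem_F2) auto
  qed (auto simp: xy mk_def)
  moreover have "mrank (s u) = 1" if "u \<in> Jset L" for u
    unfolding su[OF that] using Ind_nonzero[OF xy(1) that] Ind_nonzero[OF xy(2) that] by (rule mrank_outer)
  moreover have "mrank (msum L s) = 2 ^ L - 1" unfolding mrank_def r1 dm card_Jset ..
  ultimately show "s \<in> {s \<in> admissible n L Y. row_space (msum L s) = w1 \<and> col_space (msum L s) = w2}"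
    using w r1 r2 by (simp add: admissible_def)
qed

section \<open>Hadamard encodings\<close>

definition dot :: "nat \<Rightarrow> (nat \<Rightarrow> bit) \<Rightarrow> (nat \<Rightarrow> bit) \<Rightarrow> bit" where
  "dot L z u = (\<Sum>i<L. z i * u i)"

lemma dot_add: "dot L (a + b) u = dot L a u + dot L b u"
  unfolding dot_def sum.distrib[symmetric] by (rule sum.cong[OF refl]) (simp only: plus_fun_apply distrib_right)

lemma dot_commute: "dot L a b = dot L b a"
  unfolding dot_def by (rule sum.cong[OF refl]) (rule mult.commute)

definition unitv :: "nat \<Rightarrow> nat \<Rightarrow> bit" where "unitv t = (\<lambda>j. if j = t then 1 else 0)"

lemma unitv_mem: "t < L \<Longrightarrow> unitv t \<in> Jset L"
proof -
  assume t: "t < L"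
  have "unitv t t \<noteq> 0 t" by (simp add: unitv_def)
  then have "unitv t \<noteq> 0" by metis
  then show ?thesis using t by (auto simp: F2_def unitv_def)
qed

lemma dot_unitv: "t < L \<Longrightarrow> dot L (unitv t) u = u t"
proof -
  assume t: "t < L"
  have "dot L (unitv t) u = (\<Sum>i<L. if i = t then u i else 0)"
    unfolding dot_def by (rule sum.cong[OF refl]) (simp add: unitv_def)
  then show ?thesis using t by simp
qed

lemma dot_zero: "dot L 0 u = 0" by (simp add: dot_def)

lemma dot_nondegenerate:
  assumes u: "u \<in> F2 {..<L}" and z: "\<And>z. z \<in> F2 {..<L} \<Longrightarrow> dot L z u = 0"
  shows "u = 0"
proof
  fix t show "u t = 0 t"
  proof (cases "t < L")
    case True
    then show ?thesis using z[of "unitv t"] unitv_mem[OF True] by (simp add: dot_unitv)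
  qed (use u in \<open>auto simp: F2_def\<close>)
qed

text \<open>The Hadamard encoding of \<open>z\<close> for \<open>s u = x u \<otimes> y u\<close>: a
  coefficient in the two-element field merely selects summands.\<close>

definition hz :: "nat \<Rightarrow> (nat \<Rightarrow> bit) \<Rightarrow> (nat \<Rightarrow> bit, 'i) state \<Rightarrow> 'i \<times> 'i \<Rightarrow> bit" where
  "hz L z \<omega> = (\<Sum>u\<in>{u \<in> Jset L. dot L z u = 1}. outer (fst \<omega> u) (snd \<omega> u))"

lemma fscale_bit: "fscale c (f :: 'i \<Rightarrow> bit) = (if c = 1 then f else 0)"
  by (auto simp: fscale_def fun_eq_iff)

lemma hz_fscale: "hz L z \<omega> = (\<Sum>u\<in>Jset L. fscale (dot L z u) (outer (fst \<omega> u) (snd \<omega> u)))"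
  unfolding hz_def fscale_bit by (rule sum.inter_filter[OF finite_Jset])

lemma hadamard_mk: "hadamard L (mk L \<omega>) z = hz L z \<omega>"
  unfolding hadamard_def hz_fscale dot_def mk_def by (rule sum.cong[OF refl]) (simp only: restrict_apply')

lemma hz_add: "hz L (a + b) \<omega> = hz L a \<omega> + hz L b \<omega>"
  unfolding hz_fscale dot_add fvs.scale_left_distrib sum.distrib ..

lemma hz_zero: "hz L 0 \<omega> = 0"
  unfolding hz_def by (simp add: dot_zero)

lemma hz_sum: "hz L (sum z C) \<omega> = (\<Sum>k\<in>C. hz L (z k) \<omega>)"
  by (induction C rule: infinite_finite_induct) (simp_all only: sum.infinite sum.empty sum.insert hz_add hz_zero if_True if_False not_False_eq_True)

lemma vv_hz: "t < L \<Longrightarrow> vv L t \<omega> = hz L (unitv t) \<omega>"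
  unfolding vv_def hz_def Dt_def by (simp only: dot_unitv)

definition Omg :: "('i \<Rightarrow> bit) set \<Rightarrow> nat \<Rightarrow> (nat \<Rightarrow> bit, 'i) state set" where
  "Omg V L = Ind V Z0 (Jset L) \<times> Ind V Z0 (Jset L)"

lemma outer_sum_indm_nonzero:
  fixes x :: "'k \<Rightarrow> 'i \<Rightarrow> bit" and y :: "'k \<Rightarrow> 'j \<Rightarrow> bit"
  assumes K: "finite K" "K \<noteq> {}" and x: "indm Z0 x K" and y: "indm Z0 y K"
  shows "(\<Sum>k\<in>K. outer (x k) (y k)) \<noteq> 0"
proof
  assume e: "(\<Sum>k\<in>K. outer (x k) (y k)) = 0"
  obtain k0 where k0: "k0 \<in> K" using K by blast
  have "x k0 \<noteq> 0" using x k0 indm_mono[of Z0 x K "{k0}"] by (auto simp: indm_single)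
  then obtain i where i: "x k0 i \<noteq> 0" by (auto simp: fun_eq_iff)
  have "sum y {k \<in> K. x k i = 1} = 0"
  proof
    fix j
    have "0 = (\<Sum>k\<in>K. outer (x k) (y k)) (i, j)" using e by simp
    also have "\<dots> = (\<Sum>k\<in>K. if x k i = 1 then y k j else 0)"
      unfolding sum_fun_app outer_def by (intro sum.cong refl) auto
    also have "\<dots> = sum y {k \<in> K. x k i = 1} j" using K unfolding sum_fun_app by (simp only: sum.inter_filter)
    finally show "sum y {k \<in> K. x k i = 1} j = 0 j" by simp
  qed
  moreover have "k0 \<in> {k \<in> K. x k i = 1}" using k0 i by auto
  then have "{k \<in> K. x k i = 1} \<noteq> {}" by blast
  moreover have "{k \<in> K. x k i = 1} \<subseteq> K" by blast
  ultimately show False using y unfolding indm_def by (metis Z0_simps(3))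
qed

text \<open>A nonzero \<open>z\<close> pairs to 1 with some index, and a nonempty sum of tensors of
  two independent families is nonzero. This is the injectivity of the encoding.\<close>

lemma hz_eq_0D:
  assumes o: "\<omega> \<in> Omg V L" and z: "z \<in> F2 {..<L}" and e: "hz L z \<omega> = 0"
  shows "z = 0"
proof -
  let ?K = "{u \<in> Jset L. dot L z u = 1}"
  have "?K = {}"
  proof (rule ccontr)
    assume ne: "?K \<noteq> {}"
    have K: "finite ?K" by (rule finite_subset[OF _ finite_Jset[of L]]) blast
    have KJ: "?K \<subseteq> Jset L" by blast
    have ii: "indm Z0 (fst \<omega>) (Jset L)" "indm Z0 (snd \<omega>) (Jset L)"
      using o unfolding Omg_def Ind_def mem_Times_iff mem_Collect_eq by blast+
    have "indm Z0 (fst \<omega>) ?K" "indm Z0 (snd \<omega>) ?K"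
      by (rule indm_mono[OF ii(1) KJ], rule indm_mono[OF ii(2) KJ])
    from outer_sum_indm_nonzero[OF K ne this] e show False unfolding hz_def by (rule notE)
  qed
  then have "dot L u z = 0" if "u \<in> F2 {..<L}" for u
    using that dot_commute[of L u z] dot_zero[of L z] by (cases "u = 0") auto
  then show ?thesis using z by (intro dot_nondegenerate)
qed

lemma hz_inj:
  assumes o: "\<omega> \<in> Omg V L" and z: "z \<in> F2 {..<L}" "z' \<in> F2 {..<L}" and e: "hz L z \<omega> = hz L z' \<omega>"
  shows "z = z'"
proof -
  have "hz L (z + z') \<omega> = 0" unfolding hz_add e by (rule vadd_self)
  moreover have "z + z' \<in> F2 {..<L}" using z subspace_F2[of "{..<L}"] unfolding subspace_bit_iff by blast
  ultimately have "z + z' = 0" using hz_eq_0D[OF o] by blast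
  then show ?thesis by (simp only: vadd_eq_0_iff)
qed

lemma indm_hz:
  assumes o: "\<omega> \<in> Omg V L" and z: "\<And>k. k \<in> K \<Longrightarrow> z k \<in> F2 {..<L}"
  shows "indm Z0 (\<lambda>k. hz L (z k) \<omega>) K \<longleftrightarrow> indm Z0 z K"
proof -
  have "(\<Sum>k\<in>C. hz L (z k) \<omega>) = 0 \<longleftrightarrow> sum z C = 0" if C: "C \<subseteq> K" for C
  proof
    have "sum z C \<in> F2 {..<L}" using C z by (intro subspace_sum_mem subspace_F2) auto
    then show "sum z C = 0" if "(\<Sum>k\<in>C. hz L (z k) \<omega>) = 0" using hz_eq_0D[OF o] that unfolding hz_sum[symmetric] by blast
  qed (simp only: hz_sum[symmetric] hz_zero)
  then show ?thesis unfolding indm_def Z0_simps by blast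
qed

definition himg :: "nat \<Rightarrow> (nat \<Rightarrow> bit, 'i) state \<Rightarrow> ('i \<times> 'i \<Rightarrow> bit) set" where
  "himg L \<omega> = (\<lambda>z. hz L z \<omega>) ` F2 {..<L}"

lemma hadamard_image_mk: "hadamard_image L (mk L \<omega>) = himg L \<omega>"
  unfolding hadamard_image_def himg_def hadamard_mk ..

lemma himg_subspace:
  assumes o: "\<omega> \<in> Omg V L"
  shows "fvs.subspace (himg L \<omega>)" "finite (himg L \<omega>)" "fvs.dim (himg L \<omega>) = L"
proof -
  show s: "fvs.subspace (himg L \<omega>)"
    unfolding subspace_bit_iff
  proof (intro conjI ballI)
    have "0 \<in> F2 {..<L}" by (simp add: F2_def)
    then show "0 \<in> himg L \<omega>" unfolding himg_def using hz_zero[of L \<omega>] by (metis image_eqI)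
    fix a b assume "a \<in> himg L \<omega>" "b \<in> himg L \<omega>"
    then obtain z z' where z: "z \<in> F2 {..<L}" "z' \<in> F2 {..<L}" "a = hz L z \<omega>" "b = hz L z' \<omega>" unfolding himg_def by blast
    have "a + b = hz L (z + z') \<omega>" unfolding hz_add z ..
    moreover have "z + z' \<in> F2 {..<L}" using z subspace_F2[of "{..<L}"] unfolding subspace_bit_iff by blast
    ultimately show "a + b \<in> himg L \<omega>" unfolding himg_def by (rule image_eqI)
  qed
  show f: "finite (himg L \<omega>)" by (simp add: himg_def finite_F2)
  have "inj_on (\<lambda>z. hz L z \<omega>) (F2 {..<L})" using hz_inj[OF o] by (auto intro: inj_onI)
  then have "card (himg L \<omega>) = 2 ^ L" unfolding himg_def by (simp add: card_image card_F2)
  then show "fvs.dim (himg L \<omega>) = L" using card_subspace[OF s f] by simp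
qed

lemma hz_mem:
  assumes "\<omega> \<in> Omg (F2 I) L"
  shows "hz L z \<omega> \<in> F2 (I \<times> I)"
  unfolding hz_def using assms
  by (intro subspace_sum_mem subspace_F2 outer_mem_F2) (auto simp: Omg_def Ind_def PiE_def Pi_def)

lemma himg_sub: "\<omega> \<in> Omg (F2 I) L \<Longrightarrow> himg L \<omega> \<subseteq> F2 (I \<times> I)"
  unfolding himg_def using hz_mem by blast

text \<open>
  Extend \<open>z\<close> to a basis of \<open>\<bbbF>\<^sub>2\<^sup>L\<close>: permuting the indices by the matrix with rows \<open>z t\<close> turns the encoding of
  \<open>z t\<close> into that of the \<open>t\<close>-th unit vector, without changing the weight of \<open>(x, y)\<close>.
\<close>

lemma dot_perm:
  assumes z: "z \<in> Ind (F2 {..<L}) Z0 {..<m}"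
  shows "\<exists>M. bij_betw M (Jset L) (Jset L) \<and> (\<forall>u t. t < m \<longrightarrow> M u t = dot L (z t) u)"
proof -
  let ?F = "F2 {..<L}"
  have F: "fvs.subspace ?F" "finite ?F" by (simp_all add: subspace_F2 finite_F2)
  have dF: "fvs.dim ?F = L" using card_subspace[OF F] by (simp add: card_F2)
  let ?S = "ssp Z0 z {..<m}"
  have iz: "indm Z0 z {..<m}" using z by (simp add: Ind_def)
  have S: "fvs.subspace ?S" "?S \<subseteq> ?F" "fvs.dim ?S = m"
  proof -
    show "fvs.subspace ?S" by (intro subspace_ssp) auto
    show "?S \<subseteq> ?F" by (rule ssp_subset[OF F(1) Z0_subset[OF F(1)] Ind_mem[OF z]])
    show "fvs.dim ?S = m" using dim_ssp_0[OF _ iz] by simp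
  qed
  have mL: "m \<le> L" using dim_mono_subspace[OF S(1) F(1,2) S(2)] S(3) dF by simp
  obtain z2 where z2: "z2 \<in> Ind ?F ?S {m..<L}" using exists_Ind[OF F S(1,2), of "{m..<L}"] S(3) dF mL by auto
  define zz where "zz = (\<lambda>t. if t < m then z t else z2 t)"
  have zF: "zz t \<in> ?F" if "t < L" for t using that Ind_mem[OF z] Ind_mem[OF z2] by (auto simp: zz_def)
  have "indm Z0 zz ({..<m} \<union> {m..<L})"
  proof -
    have 1: "indm Z0 zz {..<m}" using iz indm_cong[of "{..<m}" zz z Z0] by (simp add: zz_def)
    have 2: "ssp Z0 zz {..<m} = ?S" by (rule ssp_cong) (simp add: zz_def)
    have 3: "indm ?S zz {m..<L}" using z2 indm_cong[of "{m..<L}" zz z2 ?S] by (simp add: zz_def Ind_def)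
    have 4: "{..<m} \<inter> {m..<L} = {}" by auto
    show ?thesis using indm_union[OF subspace_Z0 finite_lessThan finite_atLeastLessThan 4, of zz] 1 3 unfolding 2 by blast
  qed
  moreover have "{..<m} \<union> {m..<L} = {..<L}" using mL by auto
  ultimately have izz: "indm Z0 zz {..<L}" by simp
  have full: "ssp Z0 zz {..<L} = ?F"
    using dim_ssp_0[OF _ izz] F dF zF by (intro subspace_eq_of_dim subspace_ssp ssp_subset Z0_subset) auto
  define M where "M = (\<lambda>u t. if t < L then dot L (zz t) u else 0)"
  have Mt: "M u t = dot L (z t) u" if "t < m" for u t using that mL by (simp add: M_def zz_def)
  have MF: "M u \<in> ?F" for u by (auto simp: M_def F2_def)
  have Madd: "M (a + b) = M a + M b" for a b
  proof
    fix t show "M (a + b) t = (M a + M b) t"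
      using dot_add[of L a b "zz t"] unfolding M_def plus_fun_apply dot_commute[of L "zz t"] by (cases "t < L") auto
  qed
  have M0: "u = 0" if u: "u \<in> ?F" and e: "M u = 0" for u
  proof (rule dot_nondegenerate[OF u])
    fix v assume "v \<in> ?F"
    then obtain C where C: "C \<subseteq> {..<L}" "v = sum zz C" unfolding full[symmetric] ssp_def Z0_def by auto
    have d0: "dot L (zz t) u = 0" if "t < L" for t using fun_cong[OF e, of t] that by (simp add: M_def)
    have "dot L (sum zz C) u = 0" if "C \<subseteq> {..<L}" "finite C" for C using that(2,1)
    proof (induction C)
      case empty show ?case by (simp only: sum.empty dot_zero)
    next
      case (insert t C)
      then have "dot L (zz t) u = 0" "dot L (sum zz C) u = 0" using d0 by auto
      then show ?case unfolding sum.insert[OF insert(1,2)] dot_add by (simp only: add_0_left)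
    qed
    then show "dot L v u = 0" using C finite_subset[OF C(1)] by auto
  qed
  have inj: "inj_on M ?F"
  proof (rule inj_onI)
    fix a b assume ab: "a \<in> ?F" "b \<in> ?F" "M a = M b"
    have "M (a + b) = 0" unfolding Madd ab(3) by (rule vadd_self)
    moreover have "a + b \<in> ?F" using ab F(1) unfolding subspace_bit_iff by blast
    ultimately have "a + b = 0" using M0 by blast
    then show "a = b" by (simp only: vadd_eq_0_iff)
  qed
  have sub: "M ` Jset L \<subseteq> Jset L"
  proof (rule image_subsetI)
    fix u assume u: "u \<in> Jset L"
    have "M u \<noteq> 0" using M0[of u] u by blast
    then show "M u \<in> Jset L" using MF[of u] by blast
  qed
  have "inj_on M (Jset L)" using inj by (rule inj_on_subset) auto
  moreover have "M ` Jset L = Jset L" using sub calculation by (intro endo_inj_surj finite_Jset)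
  ultimately show ?thesis using Mt unfolding bij_betw_def by blast
qed

lemma finite_Omg: "finite V \<Longrightarrow> finite (Omg V L)"
  unfolding Omg_def by (intro finite_SigmaI finite_Ind finite_Jset)

definition reidx :: "nat \<Rightarrow> ((nat \<Rightarrow> bit) \<Rightarrow> nat \<Rightarrow> bit) \<Rightarrow> (nat \<Rightarrow> bit, 'i) state \<Rightarrow> (nat \<Rightarrow> bit, 'i) state" where
  "reidx L M \<omega> = (restrict (fst \<omega> \<circ> M) (Jset L), restrict (snd \<omega> \<circ> M) (Jset L))"

lemma ssp_reidx:
  assumes "bij_betw M (Jset L) (Jset L)"
  shows "ssp Z0 (restrict (x \<circ> M) (Jset L)) (Jset L) = ssp Z0 x (Jset L)"
proof -
  have "restrict (x \<circ> M) (Jset L) ` Jset L = x ` (M ` Jset L)" by (auto simp: image_def)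
  also have "M ` Jset L = Jset L" using assms by (simp add: bij_betw_def)
  finally show ?thesis by (simp only: ssp_eq_span[OF subspace_Z0 finite_Jset])
qed

lemma reidx_bij:
  assumes M: "bij_betw M (Jset L) (Jset L)" and V: "finite V"
  shows "bij_betw (reidx L M) (Omg V L) (Omg V L)"
proof -
  have Mi: "M u \<in> Jset L" if "u \<in> Jset L" for u using M that by (auto simp: bij_betw_def)
  have c: "restrict (x \<circ> M) (Jset L) \<in> Ind V Z0 (Jset L)" if x: "x \<in> Ind V Z0 (Jset L)" for x :: "_ \<Rightarrow> 'a \<Rightarrow> bit"
  proof -
    have "indm Z0 (restrict (x \<circ> M) (Jset L)) (Jset L)"
      using x unfolding indm_iff_card[OF finite_Jset] ssp_reidx[OF M] Ind_def mem_Collect_eq by (elim conjE)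
    moreover have "restrict (x \<circ> M) (Jset L) u \<in> V" if "u \<in> Jset L" for u
      using Ind_mem[OF x Mi[OF that]] that by (simp only: restrict_apply' comp_apply)
    ultimately show ?thesis unfolding Ind_def by (auto simp del: Diff_iff)
  qed
  have inj1: "x = x'" if x: "x \<in> Ind V Z0 (Jset L)" "x' \<in> Ind V Z0 (Jset L)" and e: "restrict (x \<circ> M) (Jset L) = restrict (x' \<circ> M) (Jset L)" for x x' :: "_ \<Rightarrow> 'a \<Rightarrow> bit"
  proof
    fix u show "x u = x' u"
    proof (cases "u \<in> Jset L")
      case True
      then obtain u' where u': "u' \<in> Jset L" "u = M u'" using M unfolding bij_betw_def by blast
      show ?thesis using fun_cong[OF e, of u'] unfolding u'(2) by (simp only: restrict_apply' u'(1) comp_apply)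
    next
      case False
      then show ?thesis using x by (auto simp: Ind_def PiE_def extensional_def simp del: Diff_iff)
    qed
  qed
  have inj: "inj_on (reidx L M) (Omg V L)"
    using inj1 by (auto simp: inj_on_def reidx_def Omg_def simp del: Diff_iff)
  have sub: "reidx L M ` Omg V L \<subseteq> Omg V L"
  proof (rule image_subsetI)
    fix \<omega> :: "(nat \<Rightarrow> bit, 'a) state" assume "\<omega> \<in> Omg V L"
    then have "fst \<omega> \<in> Ind V Z0 (Jset L)" "snd \<omega> \<in> Ind V Z0 (Jset L)" unfolding Omg_def mem_Times_iff by blast+
    then show "reidx L M \<omega> \<in> Omg V L" unfolding reidx_def Omg_def by (intro SigmaI c)
  qed
  have "reidx L M ` Omg V L = Omg V L" using sub inj by (intro endo_inj_surj finite_Omg V)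
  then show ?thesis using inj by (simp add: bij_betw_def)
qed

lemma hz_reidx:
  assumes M: "bij_betw M (Jset L) (Jset L)" and Mt: "\<And>u. M u t = dot L z u"
  shows "hz L z (reidx L M \<omega>) = vv L t \<omega>"
proof -
  have "bij_betw M {u \<in> Jset L. dot L z u = 1} (Dt L t)"
  proof -
    have "M ` {u \<in> Jset L. dot L z u = 1} = Dt L t"
    proof -
      have "{u \<in> Jset L. dot L z u = 1} = {u \<in> Jset L. M u t = 1}" using Mt by simp
      moreover have "M ` {u \<in> Jset L. M u t = 1} = {u \<in> M ` Jset L. u t = 1}" by blast
      moreover have "M ` Jset L = Jset L" using M by (simp add: bij_betw_def)
      ultimately show ?thesis by (simp only: Dt_def)
    qed
    moreover have "inj_on M {u \<in> Jset L. dot L z u = 1}" using M unfolding bij_betw_def by (elim conjE inj_on_subset) blast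
    ultimately show ?thesis by (simp add: bij_betw_def)
  qed
  from sum.reindex_bij_betw[OF this, of "\<lambda>u. outer (fst \<omega> u) (snd \<omega> u)"]
  have "vv L t \<omega> = (\<Sum>u\<in>{u \<in> Jset L. dot L z u = 1}. outer (fst \<omega> (M u)) (snd \<omega> (M u)))" by (simp only: vv_def)
  also have "\<dots> = hz L z (reidx L M \<omega>)" unfolding hz_def reidx_def fst_conv snd_conv
    by (rule sum.cong[OF refl]) (simp only: mem_Collect_eq restrict_apply' comp_apply)
  finally show ?thesis by (rule sym)
qed

section \<open>The distribution of the construction\<close>

locale sp_setup =
  fixes n L :: nat and \<mu> :: "(nat \<Rightarrow> bit) set pmf"
  assumes p: "pure (F2 {..<n}) (2 ^ L) \<mu>"
begin

abbreviation V :: "(nat \<Rightarrow> bit) set" where "V \<equiv> F2 {..<n}"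
abbreviation V2 :: "(nat \<times> nat \<Rightarrow> bit) set" where "V2 \<equiv> F2 ({..<n} \<times> {..<n})"
abbreviation J :: "(nat \<Rightarrow> bit) set" where "J \<equiv> Jset L"
abbreviation \<nu> :: "(nat \<times> nat \<Rightarrow> bit) set pmf" where "\<nu> \<equiv> SP_dist n L (gen \<mu>, \<mu>)"
abbreviation \<kappa>0 :: "(nat \<Rightarrow> bit) set pmf" where "\<kappa>0 \<equiv> flag_marginal (2 ^ L - 1) \<mu>"

definition Wt :: "(nat \<Rightarrow> bit, nat) state \<Rightarrow> real" where
  "Wt \<omega> = Nm \<mu> (ssp Z0 (fst \<omega>) J) * Nm \<mu> (ssp Z0 (snd \<omega>) J)"

lemma V: "fvs.subspace V" "finite V" by (simp_all add: subspace_F2 finite_F2)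

lemma fOmg: "finite (Omg V L)" by (intro finite_Omg V)

lemma Wt_nonneg: "Wt \<omega> \<ge> 0" by (simp add: Wt_def Nm_nonneg)

lemma Wt_pos_iff: "Wt \<omega> > 0 \<longleftrightarrow> Nm \<mu> (ssp Z0 (fst \<omega>) J) > 0 \<and> Nm \<mu> (ssp Z0 (snd \<omega>) J) > 0"
  unfolding Wt_def using Nm_nonneg[of \<mu>] by (smt (verit) mult_eq_0_iff mult_pos_pos)

lemma k0: "set_pmf \<kappa>0 = {w. fvs.subspace w \<and> fvs.dim w = 2 ^ L - 1 \<and> Nm \<mu> w > 0}"
  unfolding set_flag_marginal[OF p diff_le_self] Nm_pos_iff ..

lemma k0_sub: "w \<in> set_pmf \<kappa>0 \<Longrightarrow> fvs.subspace w \<and> w \<subseteq> V \<and> finite w \<and> fvs.dim w = 2 ^ L - 1"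
  using pure_flag_marginal[OF p diff_le_self[of "2 ^ L" 1]] V(2) finite_subset unfolding pure_def by blast

lemma faces_k0: "faces (gen \<mu>) (2 ^ L - 1) = set_pmf \<kappa>0"
  unfolding k0 faces_def gen_def Nm_pos_iff by blast

lemma k0_pmf: "w \<in> set_pmf \<kappa>0 \<Longrightarrow> pmf \<kappa>0 w = flagc (2 ^ L) (2 ^ L - 1) (2 ^ L - 1) * Nm \<mu> w"
  using k0_sub[of w] by (simp add: pmf_flag_marginal[OF p diff_le_self])

lemma fin_k0: "finite (set_pmf \<kappa>0)"
  by (rule pure_finite[OF pure_flag_marginal[OF p diff_le_self]])

lemma Ind_ssp_k0:
  assumes x: "x \<in> Ind V Z0 J" and pos: "Nm \<mu> (ssp Z0 x J) > 0"
  shows "ssp Z0 x J \<in> set_pmf \<kappa>0"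
proof -
  have "indm Z0 x J" using x by (simp add: Ind_def)
  then have "fvs.dim (ssp Z0 x J) = card J" by (rule dim_ssp_0[OF finite_Jset])
  then show ?thesis unfolding k0 card_Jset using pos subspace_ssp[OF subspace_Z0 finite_Jset] by blast
qed

lemma Ind_fibre:
  assumes w: "w \<in> set_pmf \<kappa>0"
  shows "{x \<in> {x \<in> Ind V Z0 J. Nm \<mu> (ssp Z0 x J) > 0}. ssp Z0 x J = w} = Ind w Z0 J"
proof (intro equalityI subsetI)
  fix x assume x: "x \<in> {x \<in> {x \<in> Ind V Z0 J. Nm \<mu> (ssp Z0 x J) > 0}. ssp Z0 x J = w}"
  have "x u \<in> w" if "u \<in> J" for u using ssp_gen[OF subspace_Z0 finite_Jset that, of x] x by blast
  then show "x \<in> Ind w Z0 J" using x unfolding Ind_def PiE_def Pi_def by blast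
next
  fix x assume x: "x \<in> Ind w Z0 J"
  note w' = k0_sub[OF w]
  have "ssp Z0 x J = w" using w' by (intro ssp_Ind_full[OF _ _ subspace_Z0 Z0_subset x finite_Jset]) (auto simp: card_Jset simp del: Diff_iff)
  moreover have "x \<in> Ind V Z0 J" using x w' unfolding Ind_def PiE_def Pi_def by blast
  moreover have "Nm \<mu> w > 0" using w unfolding k0 by blast
  ultimately show "x \<in> {x \<in> {x \<in> Ind V Z0 J. Nm \<mu> (ssp Z0 x J) > 0}. ssp Z0 x J = w}" by simp
qed

text \<open>Choosing a face and then an ordered basis of it amounts to choosing an independent
  family weighted by its span.\<close>

lemma sum_k0:
  "(\<Sum>w\<in>set_pmf \<kappa>0. Nm \<mu> w * (\<Sum>x\<in>Ind w Z0 J. G x)) = (\<Sum>x\<in>Ind V Z0 J. Nm \<mu> (ssp Z0 x J) * G x)"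
proof -
  let ?X = "{x \<in> Ind V Z0 J. Nm \<mu> (ssp Z0 x J) > 0}"
  have fI: "finite (Ind V Z0 J)" by (intro finite_Ind V finite_Jset)
  then have fX: "finite ?X" by simp
  have "(\<Sum>w\<in>set_pmf \<kappa>0. Nm \<mu> w * (\<Sum>x\<in>Ind w Z0 J. G x)) =
      (\<Sum>w\<in>set_pmf \<kappa>0. \<Sum>x\<in>{x \<in> ?X. ssp Z0 x J = w}. Nm \<mu> (ssp Z0 x J) * G x)"
  proof (rule sum.cong[OF refl])
    fix w assume w: "w \<in> set_pmf \<kappa>0"
    have "Nm \<mu> w * (\<Sum>x\<in>Ind w Z0 J. G x) = (\<Sum>x\<in>{x \<in> ?X. ssp Z0 x J = w}. Nm \<mu> w * G x)"
      unfolding Ind_fibre[OF w] by (rule sum_distrib_left)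
    also have "\<dots> = (\<Sum>x\<in>{x \<in> ?X. ssp Z0 x J = w}. Nm \<mu> (ssp Z0 x J) * G x)" by (rule sum.cong[OF refl]) simp
    finally show "Nm \<mu> w * (\<Sum>x\<in>Ind w Z0 J. G x) = (\<Sum>x\<in>{x \<in> ?X. ssp Z0 x J = w}. Nm \<mu> (ssp Z0 x J) * G x)" .
  qed
  also have "\<dots> = (\<Sum>x\<in>?X. Nm \<mu> (ssp Z0 x J) * G x)"
    using Ind_ssp_k0 by (intro sum.group fX fin_k0) blast
  also have "\<dots> = (\<Sum>x\<in>Ind V Z0 J. Nm \<mu> (ssp Z0 x J) * G x)"
  proof (rule sum.mono_neutral_left[OF fI])
    show "\<forall>x\<in>Ind V Z0 J - ?X. Nm \<mu> (ssp Z0 x J) * G x = 0"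
    proof
      fix x assume "x \<in> Ind V Z0 J - ?X"
      then have "\<not> Nm \<mu> (ssp Z0 x J) > 0" by blast
      then show "Nm \<mu> (ssp Z0 x J) * G x = 0" using Nm_nonneg[of \<mu> "ssp Z0 x J"] by simp
    qed
  qed blast
  finally show ?thesis .
qed

lemma admissible_fibre_k0:
  assumes w: "w1 \<in> set_pmf \<kappa>0" "w2 \<in> set_pmf \<kappa>0"
  shows "{s \<in> admissible n L (gen \<mu>). row_space (msum L s) = w1 \<and> col_space (msum L s) = w2} =
    mk L ` (Ind w2 Z0 J \<times> Ind w1 Z0 J)"
proof -
  have f: "w1 \<in> faces (gen \<mu>) (2 ^ L - 1)" "w2 \<in> faces (gen \<mu>) (2 ^ L - 1)" unfolding faces_k0 by (fact w)+
  have "fvs.subspace w1" "fvs.subspace w2" "w1 \<subseteq> V" "w2 \<subseteq> V" using k0_sub[OF w(1)] k0_sub[OF w(2)] by blast+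
  from admissible_fibre[OF f this] show ?thesis .
qed

lemma prob_fibre:
  assumes w: "w1 \<in> set_pmf \<kappa>0" "w2 \<in> set_pmf \<kappa>0"
  shows "measure_pmf.prob (pmf_of_set {s \<in> admissible n L (gen \<mu>). row_space (msum L s) = w1 \<and> col_space (msum L s) = w2}) {s. P (hadamard_image L s)} =
    (\<Sum>x\<in>Ind w2 Z0 J. \<Sum>y\<in>Ind w1 Z0 J. of_bool (P (himg L (x, y)))) / (extc (2 ^ L - 1) 0 (2 ^ L - 1))\<^sup>2"
proof -
  let ?B = "Ind w2 Z0 J \<times> Ind w1 Z0 J"
  note w' = k0_sub[OF w(1)] k0_sub[OF w(2)]
  have A: "{s \<in> admissible n L (gen \<mu>). row_space (msum L s) = w1 \<and> col_space (msum L s) = w2} = mk L ` ?B"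
    by (rule admissible_fibre_k0[OF w])
  have fB: "finite ?B" using w' by (intro finite_SigmaI finite_Ind finite_Jset) auto
  have ce: "real (card (Ind w Z0 J)) = extc (2 ^ L - 1) 0 (2 ^ L - 1)" if "w \<in> set_pmf \<kappa>0" for w
    using card_Ind[OF _ _ subspace_Z0 Z0_subset finite_Jset[of L], of w] k0_sub[OF that] by (simp add: card_Jset del: Diff_iff)
  have cB: "real (card ?B) = (extc (2 ^ L - 1) 0 (2 ^ L - 1))\<^sup>2"
    unfolding card_cartesian_product of_nat_mult ce[OF w(1)] ce[OF w(2)] power2_eq_square ..
  have inj: "inj_on (mk L) ?B" by (rule inj_mk)
  have "extc (2 ^ L - 1) 0 (2 ^ L - 1) > 0" by (rule extc_pos) simp
  then have "card ?B \<noteq> 0" using cB by (metis less_irrefl of_nat_0 zero_less_power)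
  then have ne: "mk L ` ?B \<noteq> {}" by (metis card.empty image_is_empty)
  have "measure_pmf.prob (pmf_of_set (mk L ` ?B)) {s. P (hadamard_image L s)} =
      real (card (mk L ` ?B \<inter> {s. P (hadamard_image L s)})) / real (card (mk L ` ?B))"
    using ne fB by (intro measure_pmf_of_set finite_imageI)
  also have "real (card (mk L ` ?B \<inter> {s. P (hadamard_image L s)})) = (\<Sum>s\<in>mk L ` ?B. of_bool (P (hadamard_image L s)))"
    using fB by (simp add: of_bool_def sum.If_cases Int_def)
  also have "\<dots> = (\<Sum>\<omega>\<in>?B. of_bool (P (himg L \<omega>)))"
    unfolding sum.reindex[OF inj] comp_def hadamard_image_mk ..
  also have "\<dots> = (\<Sum>x\<in>Ind w2 Z0 J. \<Sum>y\<in>Ind w1 Z0 J. of_bool (P (himg L (x, y))))"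
    by (simp only: sum.cartesian_product case_prod_unfold prod.collapse)
  also have "real (card (mk L ` ?B)) = (extc (2 ^ L - 1) 0 (2 ^ L - 1))\<^sup>2" using card_image[OF inj] cB by simp
  finally show ?thesis unfolding A .
qed

text \<open>All faces of dimension \<open>2 ^ L - 1\<close> have equally many ordered bases, so
  sampling two faces and then \<open>s\<close> uniformly is, up to a constant, sampling
  \<open>x\<close> and \<open>y\<close> independently, each weighted by the containment probability
  of its span.\<close>

lemma nu_prob: "\<exists>c>0. \<forall>P. measure_pmf.prob \<nu> {W. P W} = c * (\<Sum>\<omega>\<in>Omg V L. Wt \<omega> * of_bool (P (himg L \<omega>)))"
proof -
  define e where "e = extc (2 ^ L - 1) 0 (2 ^ L - 1)"
  define g where "g = flagc (2 ^ L) (2 ^ L - 1) (2 ^ L - 1)"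
  have e: "e > 0" unfolding e_def by (rule extc_pos) simp
  have g: "g > 0" unfolding g_def by (rule flagc_pos) auto
  have T: "measure_pmf.prob M {x. Q x} = pmf (map_pmf Q M) True" for M :: "'c pmf" and Q
    by (simp add: pmf_map vimage_def)
  have "measure_pmf.prob \<nu> {W. P W} = g\<^sup>2 / e\<^sup>2 * (\<Sum>\<omega>\<in>Omg V L. Wt \<omega> * of_bool (P (himg L \<omega>)))" for P
  proof -
    let ?A = "\<lambda>w1 w2. {s \<in> admissible n L (gen \<mu>). row_space (msum L s) = w1 \<and> col_space (msum L s) = w2}"
    let ?pr = "\<lambda>w1 w2. measure_pmf.prob (pmf_of_set (?A w1 w2)) {s. P (hadamard_image L s)}"
    define Q :: "_ \<Rightarrow> _ \<Rightarrow> real" where "Q w1 w2 = (\<Sum>x\<in>Ind w2 Z0 J. \<Sum>y\<in>Ind w1 Z0 J. of_bool (P (himg L (x, y))))" for w1 w2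
    have "measure_pmf.prob \<nu> {W. P W} = measure_pmf.expectation \<kappa>0 (\<lambda>w1. measure_pmf.expectation \<kappa>0 (\<lambda>w2. ?pr w1 w2))"
      unfolding SP_dist_def prod.case T map_bind_pmf pmf_bind map_pmf_comp ..
    also have "\<dots> = (\<Sum>w1\<in>set_pmf \<kappa>0. pmf \<kappa>0 w1 * (\<Sum>w2\<in>set_pmf \<kappa>0. pmf \<kappa>0 w2 * ?pr w1 w2))"
      by (simp add: integral_measure_pmf[OF fin_k0])
    also have "\<dots> = (\<Sum>w1\<in>set_pmf \<kappa>0. g * Nm \<mu> w1 * (\<Sum>w2\<in>set_pmf \<kappa>0. g * Nm \<mu> w2 * (Q w1 w2 / e\<^sup>2)))"
    proof (intro sum.cong refl arg_cong2[where f = "(*)"])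
      fix w1 w2 assume w: "w1 \<in> set_pmf \<kappa>0" "w2 \<in> set_pmf \<kappa>0"
      show "pmf \<kappa>0 w1 = g * Nm \<mu> w1" "pmf \<kappa>0 w2 = g * Nm \<mu> w2" unfolding g_def by (intro k0_pmf w)+
      show "?pr w1 w2 = Q w1 w2 / e\<^sup>2" unfolding Q_def e_def by (rule prob_fibre[OF w])
    qed
    also have "\<dots> = g\<^sup>2 / e\<^sup>2 * (\<Sum>w1\<in>set_pmf \<kappa>0. Nm \<mu> w1 * (\<Sum>w2\<in>set_pmf \<kappa>0. Nm \<mu> w2 * Q w1 w2))"
      unfolding sum_distrib_left by (intro sum.cong refl) (simp add: power2_eq_square)
    also have "\<dots> = g\<^sup>2 / e\<^sup>2 * (\<Sum>w1\<in>set_pmf \<kappa>0. Nm \<mu> w1 *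
        (\<Sum>y\<in>Ind w1 Z0 J. \<Sum>x\<in>Ind V Z0 J. Nm \<mu> (ssp Z0 x J) * of_bool (P (himg L (x, y)))))"
    proof -
      have "(\<Sum>x\<in>Ind V Z0 J. Nm \<mu> (ssp Z0 x J) * (\<Sum>y\<in>Ind w1 Z0 J. of_bool (P (himg L (x, y))))) =
        (\<Sum>y\<in>Ind w1 Z0 J. \<Sum>x\<in>Ind V Z0 J. Nm \<mu> (ssp Z0 x J) * of_bool (P (himg L (x, y))))" for w1
        unfolding sum_distrib_left by (rule sum.swap)
      then show ?thesis unfolding Q_def sum_k0 by (simp only: sum_k0)
    qed
    also have "\<dots> = g\<^sup>2 / e\<^sup>2 * (\<Sum>y\<in>Ind V Z0 J. Nm \<mu> (ssp Z0 y J) * (\<Sum>x\<in>Ind V Z0 J. Nm \<mu> (ssp Z0 x J) * of_bool (P (himg L (x, y)))))"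
      unfolding sum_k0 ..
    also have "(\<Sum>y\<in>Ind V Z0 J. Nm \<mu> (ssp Z0 y J) * (\<Sum>x\<in>Ind V Z0 J. Nm \<mu> (ssp Z0 x J) * of_bool (P (himg L (x, y))))) =
       (\<Sum>x\<in>Ind V Z0 J. \<Sum>y\<in>Ind V Z0 J. Wt (x, y) * of_bool (P (himg L (x, y))))"
      unfolding sum_distrib_left
      by (subst sum.swap) (intro sum.cong refl, simp only: Wt_def fst_conv snd_conv mult.assoc mult.left_commute)
    also have "\<dots> = (\<Sum>\<omega>\<in>Omg V L. Wt \<omega> * of_bool (P (himg L \<omega>)))"
      unfolding Omg_def by (simp only: sum.cartesian_product case_prod_unfold prod.collapse)
    finally show ?thesis .
  qed
  moreover have "g\<^sup>2 / e\<^sup>2 > 0" using e g by simp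
  ultimately show ?thesis by (intro exI[of _ "g\<^sup>2 / e\<^sup>2"]) auto
qed

lemma set_nu: "set_pmf \<nu> = himg L ` {\<omega> \<in> Omg V L. Wt \<omega> > 0}"
proof -
  obtain c where c: "c > 0" "\<And>P. measure_pmf.prob \<nu> {W. P W} = c * (\<Sum>\<omega>\<in>Omg V L. Wt \<omega> * of_bool (P (himg L \<omega>)))"
    using nu_prob by blast
  have "W0 \<in> set_pmf \<nu> \<longleftrightarrow> W0 \<in> himg L ` {\<omega> \<in> Omg V L. Wt \<omega> > 0}" for W0
  proof -
    have "pmf \<nu> W0 = c * (\<Sum>\<omega>\<in>Omg V L. Wt \<omega> * of_bool (himg L \<omega> = W0))"
      using c(2)[of "\<lambda>W. W = W0"] by (simp add: measure_pmf_single)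
    then have "W0 \<in> set_pmf \<nu> \<longleftrightarrow> (\<Sum>\<omega>\<in>Omg V L. Wt \<omega> * of_bool (himg L \<omega> = W0)) \<noteq> 0"
      using c(1) by (simp only: set_pmf_iff mult_eq_0_iff) simp
    also have "\<dots> \<longleftrightarrow> \<not> (\<forall>\<omega>\<in>Omg V L. Wt \<omega> * of_bool (himg L \<omega> = W0) = 0)"
      by (subst sum_nonneg_eq_0_iff[OF fOmg]) (auto simp: Wt_nonneg)
    also have "\<dots> \<longleftrightarrow> (\<exists>\<omega>\<in>Omg V L. Wt \<omega> > 0 \<and> himg L \<omega> = W0)"
      using Wt_nonneg by (simp only: mult_eq_0_iff of_bool_eq_0_iff) (metis less_eq_real_def less_irrefl)
    finally show ?thesis by blast
  qed
  then show ?thesis by blast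
qed

lemma admissible_eq: "admissible n L (gen \<mu>) = mk L ` {\<omega> \<in> Omg V L. Wt \<omega> > 0}"
proof (intro equalityI subsetI)
  fix s assume s: "s \<in> admissible n L (gen \<mu>)"
  define w1 w2 where "w1 = row_space (msum L s)" and "w2 = col_space (msum L s)"
  have w: "w1 \<in> set_pmf \<kappa>0" "w2 \<in> set_pmf \<kappa>0" using s unfolding faces_k0[symmetric] by (auto simp: admissible_def w1_def w2_def)
  note w' = k0_sub[OF w(1)] k0_sub[OF w(2)]
  have "s \<in> {s \<in> admissible n L (gen \<mu>). row_space (msum L s) = w1 \<and> col_space (msum L s) = w2}" using s by (simp add: w1_def w2_def)
  also have "\<dots> = mk L ` (Ind w2 Z0 J \<times> Ind w1 Z0 J)" by (rule admissible_fibre_k0[OF w])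
  finally obtain x y where xy: "x \<in> Ind w2 Z0 J" "y \<in> Ind w1 Z0 J" "s = mk L (x, y)" by blast
  have "(x, y) \<in> Omg V L" "Wt (x, y) > 0"
    using xy(1,2) unfolding Ind_fibre[OF w(1), symmetric] Ind_fibre[OF w(2), symmetric] Omg_def Wt_pos_iff by auto
  then show "s \<in> mk L ` {\<omega> \<in> Omg V L. Wt \<omega> > 0}" using xy(3) by blast
next
  fix s assume "s \<in> mk L ` {\<omega> \<in> Omg V L. Wt \<omega> > 0}"
  then obtain x y where xy: "x \<in> Ind V Z0 J" "y \<in> Ind V Z0 J" "Wt (x, y) > 0" "s = mk L (x, y)" unfolding Omg_def by blast
  define w1 w2 where "w1 = ssp Z0 y J" and "w2 = ssp Z0 x J"
  have pos: "Nm \<mu> w1 > 0" "Nm \<mu> w2 > 0" using xy(3) unfolding Wt_pos_iff w1_def w2_def by auto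
  have w: "w1 \<in> set_pmf \<kappa>0" "w2 \<in> set_pmf \<kappa>0" using pos Ind_ssp_k0 xy unfolding w1_def w2_def by blast+
  note w' = k0_sub[OF w(1)] k0_sub[OF w(2)]
  have "x \<in> Ind w2 Z0 J" "y \<in> Ind w1 Z0 J"
    unfolding Ind_fibre[OF w(1), symmetric] Ind_fibre[OF w(2), symmetric] using xy pos by (auto simp: w1_def w2_def)
  then have "s \<in> mk L ` (Ind w2 Z0 J \<times> Ind w1 Z0 J)" using xy by blast
  also have "\<dots> = {s \<in> admissible n L (gen \<mu>). row_space (msum L s) = w1 \<and> col_space (msum L s) = w2}"
    by (rule admissible_fibre_k0[OF w, symmetric])
  finally show "s \<in> admissible n L (gen \<mu>)" by blast
qed

lemma SP_gen: "SP n L (gen \<mu>, \<mu>) = (gen \<nu>, \<nu>)"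
proof -
  have "(\<exists>s\<in>admissible n L (gen \<mu>). u \<subseteq> hadamard_image L s) \<longleftrightarrow> (\<exists>W\<in>set_pmf \<nu>. u \<subseteq> W)" for u
    unfolding admissible_eq set_nu by (auto simp: hadamard_image_mk)
  then show ?thesis unfolding SP_def gen_def[of \<nu>] fst_conv by simp
qed

lemma pure_nu: "pure V2 L \<nu>"
proof -
  have "finite V2" by (simp add: finite_F2)
  then show ?thesis unfolding pure_def set_nu using himg_subspace(1,3) himg_sub subspace_F2 by blast
qed

end

section \<open>Link weights of the construction as sums over rank decompositions\<close>

lemma indm_unitv: "finite C \<Longrightarrow> indm Z0 unitv C"
  unfolding indm_def
proof (intro allI impI)
  fix D assume "finite C" and D: "D \<subseteq> C" "D \<noteq> {}"
  then have True: "finite D" using finite_subset by blast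
  show "sum unitv D \<notin> Z0"
  proof -
    obtain t where t: "t \<in> D" using D by blast
    have "sum unitv D t = (\<Sum>k\<in>D. if k = t then 1 else 0)"
      unfolding sum_fun_app unitv_def by (intro sum.cong refl) simp
    also have "\<dots> = 1" using t True by simp
    finally have "sum unitv D \<noteq> 0" by (metis zero_fun_apply zero_neq_one)
    then show ?thesis by simp
  qed
qed

context sp_setup
begin

text \<open>Injectivity of the encoding allows at most one tuple of preimages for the basis
  \<open>B\<close>, and the independence of \<open>B\<close> carries over to it.\<close>

lemma subset_himg_count:
  fixes B :: "nat \<Rightarrow> nat \<times> nat \<Rightarrow> bit"
  assumes o: "\<omega> \<in> Omg V L" and B: "indm Z0 B {..<m}"
  shows "of_bool (ssp Z0 B {..<m} \<subseteq> himg L \<omega>) = (\<Sum>z\<in>Ind (F2 {..<L}) Z0 {..<m}. of_bool (\<forall>t<m. hz L (z t) \<omega> = B t) :: real)"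
proof (cases "ssp Z0 B {..<m} \<subseteq> himg L \<omega>")
  case True
  have "\<exists>z\<in>F2 {..<L}. hz L z \<omega> = B t" if "t < m" for t
  proof -
    have "B t \<in> ssp Z0 B {..<m}" using that by (intro ssp_gen) auto
    then have "B t \<in> himg L \<omega>" using True by blast
    then show ?thesis unfolding himg_def image_iff by metis
  qed
  then obtain z0 where z0: "\<And>t. t < m \<Longrightarrow> z0 t \<in> F2 {..<L} \<and> hz L (z0 t) \<omega> = B t" by metis
  define z where "z = restrict z0 {..<m}"
  have z: "z t \<in> F2 {..<L}" "hz L (z t) \<omega> = B t" if "t < m" for t using z0[OF that] that by (auto simp: z_def)
  have "indm Z0 (\<lambda>k. hz L (z k) \<omega>) {..<m}" using B z(2) indm_cong[of "{..<m}" "\<lambda>k. hz L (z k) \<omega>" B Z0] by blast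
  then have "indm Z0 z {..<m}" using indm_hz[OF o, of "{..<m}" z] z(1) by blast
  then have zI: "z \<in> Ind (F2 {..<L}) Z0 {..<m}" using z(1) unfolding Ind_def by (auto simp: z_def)
  have "(\<forall>t<m. hz L (z' t) \<omega> = B t) \<longleftrightarrow> z' = z" if z': "z' \<in> Ind (F2 {..<L}) Z0 {..<m}" for z'
  proof
    assume a: "\<forall>t<m. hz L (z' t) \<omega> = B t"
    have "z' t = z t" if "t \<in> {..<m}" for t
    proof (rule hz_inj[OF o])
      show "z' t \<in> F2 {..<L}" using Ind_mem[OF z' that] .
      show "z t \<in> F2 {..<L}" "hz L (z' t) \<omega> = hz L (z t) \<omega>" using that z a by auto
    qed
    then show "z' = z" using z' zI by (intro PiE_ext[of z' "{..<m}" "\<lambda>_. F2 {..<L}" z]) (auto simp: Ind_def)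
  qed (use z in auto)
  then have "(\<Sum>z'\<in>Ind (F2 {..<L}) Z0 {..<m}. of_bool (\<forall>t<m. hz L (z' t) \<omega> = B t) :: real) =
      (\<Sum>z'\<in>Ind (F2 {..<L}) Z0 {..<m}. if z' = z then 1 else 0)" by (intro sum.cong refl) simp
  also have "\<dots> = 1" using zI finite_Ind[OF finite_F2[OF finite_lessThan] finite_lessThan, of L Z0 m] by simp
  finally show ?thesis using True by simp
next
  case False
  have "\<not> (\<forall>t<m. hz L (z t) \<omega> = B t)" if z: "z \<in> Ind (F2 {..<L}) Z0 {..<m}" for z
  proof
    assume a: "\<forall>t<m. hz L (z t) \<omega> = B t"
    have "ssp Z0 B {..<m} \<subseteq> himg L \<omega>"
    proof (rule ssp_subset[OF himg_subspace(1)[OF o] Z0_subset[OF himg_subspace(1)[OF o]]])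
      fix t assume t: "t \<in> {..<m}"
      show "B t \<in> himg L \<omega>" unfolding himg_def using a t Ind_mem[OF z t] by (intro image_eqI[of _ _ "z t"]) auto
    qed
    then show False using False by blast
  qed
  then have "(\<Sum>z\<in>Ind (F2 {..<L}) Z0 {..<m}. of_bool (\<forall>t<m. hz L (z t) \<omega> = B t) :: real) = 0" by (intro sum.neutral) simp
  then show ?thesis using False by simp
qed

text \<open>Sum over all independent tuples of preimages. By \<open>dot_perm\<close> each
  contributes as much as the unit vectors do, so their number goes into the constant, and the
  unknown position of the face in the image is replaced by fixed coordinates.\<close>

lemma Nm_nu:
  assumes m: "m \<le> L"
  shows "\<exists>c>0. \<forall>B. indm Z0 B {..<m} \<longrightarrow>
    Nm \<nu> (ssp Z0 B {..<m}) = c * (\<Sum>\<omega>\<in>Omg V L. Wt \<omega> * of_bool (\<forall>t<m. vv L t \<omega> = B t))"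
proof -
  obtain c where c: "c > 0" "\<And>P. measure_pmf.prob \<nu> {W. P W} = c * (\<Sum>\<omega>\<in>Omg V L. Wt \<omega> * of_bool (P (himg L \<omega>)))"
    using nu_prob by blast
  let ?I = "Ind (F2 {..<L}) Z0 {..<m}"
  have F: "fvs.subspace (F2 {..<L})" "finite (F2 {..<L})" by (simp_all add: subspace_F2 finite_F2)
  have "fvs.dim (F2 {..<L}) = L" using card_subspace[OF F] by (simp add: card_F2)
  then have I: "real (card ?I) > 0" using card_Ind[OF F(2,1) subspace_Z0 Z0_subset[OF F(1)], of "{..<m}"] extc_pos[of 0 m L] m by simp
  have "Nm \<nu> (ssp Z0 B {..<m}) = c * real (card ?I) * (\<Sum>\<omega>\<in>Omg V L. Wt \<omega> * of_bool (\<forall>t<m. vv L t \<omega> = B t))"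
    if B: "indm Z0 B {..<m}" for B
  proof -
    have inner: "(\<Sum>\<omega>\<in>Omg V L. Wt \<omega> * of_bool (\<forall>t<m. hz L (z t) \<omega> = B t)) = (\<Sum>\<omega>\<in>Omg V L. Wt \<omega> * of_bool (\<forall>t<m. vv L t \<omega> = B t))"
      if z: "z \<in> ?I" for z
    proof -
      obtain M where M: "bij_betw M (Jset L) (Jset L)" "\<And>u t. t < m \<Longrightarrow> M u t = dot L (z t) u"
        using dot_perm[OF z] by blast
      have "Wt (reidx L M \<omega>) = Wt \<omega>" for \<omega>
        unfolding Wt_def reidx_def fst_conv snd_conv ssp_reidx[OF M(1)] ..
      moreover have "(\<forall>t<m. hz L (z t) (reidx L M \<omega>) = B t) \<longleftrightarrow> (\<forall>t<m. vv L t \<omega> = B t)" for \<omega>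
      proof -
        have "hz L (z t) (reidx L M \<omega>) = vv L t \<omega>" if "t < m" for t
          by (rule hz_reidx[OF M(1) M(2)[OF that]])
        then show ?thesis by auto
      qed
      ultimately have "(\<Sum>\<omega>\<in>Omg V L. Wt \<omega> * of_bool (\<forall>t<m. vv L t \<omega> = B t)) =
          (\<Sum>\<omega>\<in>Omg V L. Wt (reidx L M \<omega>) * of_bool (\<forall>t<m. hz L (z t) (reidx L M \<omega>) = B t))"
        by (simp only:)
      also have "\<dots> = (\<Sum>\<omega>\<in>Omg V L. Wt \<omega> * of_bool (\<forall>t<m. hz L (z t) \<omega> = B t))"
        by (rule sum.reindex_bij_betw[OF reidx_bij[OF M(1) V(2)]])
      finally show ?thesis by simp
    qed
    have "Nm \<nu> (ssp Z0 B {..<m}) = c * (\<Sum>\<omega>\<in>Omg V L. Wt \<omega> * of_bool (ssp Z0 B {..<m} \<subseteq> himg L \<omega>))"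
      unfolding Nm_def c(2) ..
    also have "(\<Sum>\<omega>\<in>Omg V L. Wt \<omega> * of_bool (ssp Z0 B {..<m} \<subseteq> himg L \<omega>)) =
        (\<Sum>\<omega>\<in>Omg V L. \<Sum>z\<in>?I. Wt \<omega> * of_bool (\<forall>t<m. hz L (z t) \<omega> = B t))"
      by (rule sum.cong[OF refl]) (simp only: subset_himg_count[OF _ B] sum_distrib_left)
    also have "\<dots> = (\<Sum>z\<in>?I. \<Sum>\<omega>\<in>Omg V L. Wt \<omega> * of_bool (\<forall>t<m. hz L (z t) \<omega> = B t))" by (rule sum.swap)
    also have "\<dots> = (\<Sum>z\<in>?I. \<Sum>\<omega>\<in>Omg V L. Wt \<omega> * of_bool (\<forall>t<m. vv L t \<omega> = B t))"
      by (rule sum.cong[OF refl]) (rule inner)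
    finally show ?thesis by simp
  qed
  then show ?thesis using c(1) I by (intro exI[of _ "c * real (card ?I)"]) auto
qed

text \<open>Apply \<open>Nm_nu\<close> to \<open>b\<close> extended by the two endpoints. Degenerate
  endpoints have weight zero on both sides, because the encodings of unit vectors are
  independent.\<close>

lemma n2_nu:
  assumes i: "i + 2 \<le> L" and b: "indm Z0 b {..<i}"
  shows "\<exists>c>0. \<forall>v v'. n2 (Nm \<nu>) (ssp Z0 b {..<i}) v v' =
    c * (\<Sum>\<omega>\<in>Omb V L i b. Wt \<omega> * of_bool (vv L i \<omega> = v \<and> vv L (i + 1) \<omega> = v'))"
proof -
  obtain c where c: "c > 0" "\<And>B. indm Z0 B {..<i + 2} \<Longrightarrow>
    Nm \<nu> (ssp Z0 B {..<i + 2}) = c * (\<Sum>\<omega>\<in>Omg V L. Wt \<omega> * of_bool (\<forall>t<i + 2. vv L t \<omega> = B t))"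
    using Nm_nu[OF i] by blast
  let ?w = "ssp Z0 b {..<i}"
  have w: "fvs.subspace ?w" by (simp add: subspace_ssp)
  have "n2 (Nm \<nu>) ?w v v' = c * (\<Sum>\<omega>\<in>Omb V L i b. Wt \<omega> * of_bool (vv L i \<omega> = v \<and> vv L (i + 1) \<omega> = v'))" for v v'
  proof -
    define B where "B = (\<lambda>t. if t < i then b t else if t = i then v else v')"
    have set2: "{..<i + 2} = insert (i + 1) (insert i {..<i})" by auto
    have sB: "ssp Z0 B {..<i} = ?w" by (rule ssp_cong) (simp add: B_def)
    have iB: "indm Z0 B {..<i}" using b indm_cong[of "{..<i}" B b Z0] by (simp add: B_def)
    have sB1: "ssp Z0 B (insert i {..<i}) = sp1 ?w v" by (subst ssp_insert_sp1) (simp_all add: sB, simp add: B_def)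
    have sB2: "ssp Z0 B {..<i + 2} = sp1 (sp1 ?w v) v'" unfolding set2 by (subst ssp_insert_sp1) (simp_all add: sB1, simp add: B_def)
    have ind: "indm Z0 B {..<i + 2} \<longleftrightarrow> v \<notin> ?w \<and> v' \<notin> sp1 ?w v"
      unfolding set2 using iB sB sB1 by (simp add: indm_insert B_def)
    have n2: "n2 (Nm \<nu>) ?w v v' = (if v \<notin> ?w \<and> v' \<notin> sp1 ?w v then Nm \<nu> (sp1 (sp1 ?w v) v') else 0)" by (simp add: n2_def n1_def)
    have all: "(\<forall>t<i + 2. vv L t \<omega> = B t) \<longleftrightarrow> (\<forall>t<i. vv L t \<omega> = b t) \<and> vv L i \<omega> = v \<and> vv L (i + 1) \<omega> = v'" for \<omega>
    proof -
      have "(\<forall>t<i + 2. Q t) \<longleftrightarrow> (\<forall>t<i. Q t) \<and> Q i \<and> Q (i + 1)" for Q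
        by (auto simp: less_Suc_eq numeral_2_eq_2)
      then show ?thesis by (simp add: B_def)
    qed
    have S: "(\<Sum>\<omega>\<in>Omg V L. Wt \<omega> * of_bool (\<forall>t<i + 2. vv L t \<omega> = B t)) =
        (\<Sum>\<omega>\<in>Omb V L i b. Wt \<omega> * of_bool (vv L i \<omega> = v \<and> vv L (i + 1) \<omega> = v'))"
    proof (rule sum.mono_neutral_cong_right[OF fOmg])
      show "Omb V L i b \<subseteq> Omg V L" unfolding Omb_def Omg_def by blast
      show "\<forall>\<omega>\<in>Omg V L - Omb V L i b. Wt \<omega> * of_bool (\<forall>t<i + 2. vv L t \<omega> = B t) = 0"
        unfolding all Omb_def Omg_def by auto
      show "Wt \<omega> * of_bool (\<forall>t<i + 2. vv L t \<omega> = B t) = Wt \<omega> * of_bool (vv L i \<omega> = v \<and> vv L (i + 1) \<omega> = v')" if "\<omega> \<in> Omb V L i b" for \<omega>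
        using that unfolding all Omb_def by simp
    qed
    show ?thesis
    proof (cases "indm Z0 B {..<i + 2}")
      case True
      then have "v \<notin> ?w \<and> v' \<notin> sp1 ?w v" using ind by blast
      then show ?thesis unfolding n2 using c(2)[OF True] unfolding sB2 S by simp
    next
      case False
      have "\<not> (\<forall>t<i + 2. vv L t \<omega> = B t)" if o: "\<omega> \<in> Omg V L" for \<omega>
      proof
        assume a: "\<forall>t<i + 2. vv L t \<omega> = B t"
        have "indm Z0 (\<lambda>t. hz L (unitv t) \<omega>) {..<i + 2}"
          using indm_hz[OF o, of "{..<i + 2}" unitv] unitv_mem[of _ L] i indm_unitv by auto
        moreover have "hz L (unitv t) \<omega> = B t" if "t \<in> {..<i + 2}" for t using a that vv_hz[of t L \<omega>] i by auto
        ultimately have "indm Z0 B {..<i + 2}" using indm_cong[of "{..<i + 2}" "\<lambda>t. hz L (unitv t) \<omega>" B Z0] by blast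
        then show False using False by blast
      qed
      then have "(\<Sum>\<omega>\<in>Omg V L. Wt \<omega> * of_bool (\<forall>t<i + 2. vv L t \<omega> = B t)) = 0" by (intro sum.neutral) simp
      moreover have "\<not> (v \<notin> ?w \<and> v' \<notin> sp1 ?w v)" using False ind by blast
      ultimately show ?thesis unfolding n2 S by (simp only: if_False mult_zero_right)
    qed
  qed
  then show ?thesis using c(1) by blast
qed

section \<open>Expansion of the construction\<close>

text \<open>By \<open>n2_nu\<close> an edge is the pair \<open>vv L i\<close>,
  \<open>vv L (i + 1)\<close> under the weight \<open>Wt\<close> on \<open>Omb\<close>, up to a
  constant that cancels. The walk operator is then a conditional expectation given the second
  endpoint, and \<open>Omb_core_bound\<close> estimates its squared norm on mean-zero
  functions.\<close>

lemma link_bound: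
  assumes k: "i + 2 \<le> k" "k \<le> L" and w: "w \<in> faces (gen (flag_marginal k \<nu>)) i"
    and eps: "0 \<le> eps"
    and exp: "\<And>S. fvs.subspace S \<Longrightarrow> S \<subseteq> V \<Longrightarrow> Nm \<mu> S > 0 \<Longrightarrow> fvs.dim S \<le> 2 ^ L - 2 * 2 ^ (L - i - 2) - 1 \<Longrightarrow> Exp V (2 ^ L) (Nm \<mu>) S eps"
    and \<rho>: "0 \<le> \<rho>" "\<rho> < 1" "4 * (2 ^ (i + 1) + 1) / 2 ^ (2 ^ (L - i - 2)) + 4 * 2 ^ (L - i - 2) * eps \<le> \<rho>\<^sup>2"
  shows "graph_lambda (link_verts (gen (flag_marginal k \<nu>)) w) (link_edge_pmf (flag_marginal k \<nu>) w) \<le> \<rho>"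
proof -
  let ?k = "flag_marginal k \<nu>"
  have pk: "pure V2 k ?k" by (rule pure_flag_marginal[OF pure_nu k(2)])
  have fV2: "finite V2" by (simp add: finite_F2)
  obtain W where W: "W \<in> set_pmf ?k" "w \<subseteq> W" and ws: "fvs.subspace w" and dw: "fvs.dim w = i"
    using w unfolding faces_def gen_def by blast
  have wV: "w \<subseteq> V2" using W pk unfolding pure_def by blast
  have fw: "finite w" using wV fV2 by (rule finite_subset)
  have Nw: "Nm ?k w > 0" unfolding Nm_pos_iff using W by blast
  obtain b where bI: "b \<in> Ind w Z0 {..<i}"
    using exists_Ind[OF ws fw subspace_Z0 Z0_subset[OF ws], of "{..<i}"] dw by auto
  have b: "indm Z0 b {..<i}" using bI by (simp add: Ind_def)
  have wb: "ssp Z0 b {..<i} = w"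
    by (rule ssp_Ind_full[OF ws fw subspace_Z0 Z0_subset[OF ws] bI]) (simp_all add: dw)
  define U where "U = {v \<in> V2. n1 (Nm ?k) w v > 0}"
  define E where "E = link_edge_pmf ?k w"
  define pE where "pE = pmf (map_pmf fst E)"
  have "fvs.dim w + 2 \<le> k" using dw k by simp
  from link_wgraph[OF pk ws wV this Nw]
  obtain c1 where c1: "c1 > 0" "\<And>v v'. pmf E (v, v') = c1 * n2 (Nm ?k) w v v'" and wg: "wgraph U E pE"
    unfolding E_def pE_def U_def by blast
  interpret wgraph U E pE by (rule wg)
  obtain c2 where c2: "c2 > 0" "\<And>u. fvs.subspace u \<Longrightarrow> fvs.dim u = i + 2 \<Longrightarrow> Nm ?k u = c2 * Nm \<nu> u"
    using Nm_flag_marginal[OF pure_nu k] by blast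
  have iL: "i + 2 \<le> L" using k by simp
  obtain c3 where c3: "c3 > 0" "\<And>v v'. n2 (Nm \<nu>) w v v' =
    c3 * (\<Sum>\<omega>\<in>Omb V L i b. Wt \<omega> * of_bool (vv L i \<omega> = v \<and> vv L (i + 1) \<omega> = v'))"
    using n2_nu[OF iL b] unfolding wb by blast
  define Om where "Om = Omb V L i b"
  define S where "S = (\<lambda>v v'. \<Sum>\<omega>\<in>Om. Wt \<omega> * of_bool (vv L i \<omega> = v \<and> vv L (i + 1) \<omega> = v'))"
  define c where "c = c1 * c2 * c3"
  have c: "c > 0" using c1 c2 c3 by (simp add: c_def)
  have n2k: "n2 (Nm ?k) w v v' = c2 * n2 (Nm \<nu>) w v v'" for v v'
  proof (cases "v \<notin> w \<and> v' \<notin> sp1 w v")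
    case True
    then have "fvs.dim (sp1 (sp1 w v) v') = i + 2" using dim_sp1_sp1[OF ws fw, of v v'] dw by simp
    then show ?thesis using c2(2)[of "sp1 (sp1 w v) v'"] True by (simp add: n2_def n1_def subspace_sp1 ws)
  qed (auto simp: n2_def n1_def)
  have ES: "pmf E (v, v') = c * S v v'" for v v'
    unfolding c1(2) n2k c3(2) c_def S_def Om_def by (simp only: mult.assoc)
  have OmO: "Om \<subseteq> Omg V L" unfolding Om_def Omb_def Omg_def by blast
  have fOm: "finite Om" using OmO fOmg by (rule finite_subset)
  have vvV: "vv L t \<omega> \<in> V2" if "\<omega> \<in> Om" "t < L" for \<omega> t
    unfolding vv_hz[OF that(2)] using that(1) OmO by (intro hz_mem) auto
  have UV: "U \<subseteq> V2" unfolding U_def by blast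
  have E0: "pmf E (u, v) = 0" if "u \<notin> U \<or> v \<notin> U" for u v
    using supp that by (auto simp: set_pmf_iff)
  have pick: "(\<Sum>u\<in>V2. h * of_bool (vv L t \<omega> = u)) = (h :: real)" if "\<omega> \<in> Om" "t < L" for h t \<omega>
    using vvV[OF that] fV2 by (simp add: of_bool_def if_distrib sum.delta' cong: if_cong)
  have pcol: "pE u = c * (\<Sum>\<omega>\<in>Om. Wt \<omega> * of_bool (vv L i \<omega> = u))" if u: "u \<in> U" for u
  proof -
    have "pE u = (\<Sum>v\<in>U. pmf E (u, v))" using row[OF u] by simp
    also have "\<dots> = (\<Sum>v\<in>V2. pmf E (u, v))" using UV fV2 E0 by (intro sum.mono_neutral_left) auto
    also have "\<dots> = c * (\<Sum>v\<in>V2. \<Sum>\<omega>\<in>Om. Wt \<omega> * of_bool (vv L i \<omega> = u) * of_bool (vv L (i + 1) \<omega> = v))"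
      unfolding ES S_def sum_distrib_left of_bool_conj by (simp only: mult.assoc)
    also have "(\<Sum>v\<in>V2. \<Sum>\<omega>\<in>Om. Wt \<omega> * of_bool (vv L i \<omega> = u) * of_bool (vv L (i + 1) \<omega> = v)) = (\<Sum>\<omega>\<in>Om. Wt \<omega> * of_bool (vv L i \<omega> = u))"
      by (subst sum.swap, rule sum.cong[OF refl], rule pick) (use iL in auto)
    finally show ?thesis .
  qed
  have prow: "pE v = c * (\<Sum>\<omega>\<in>{\<omega> \<in> Om. vv L (i + 1) \<omega> = v}. Wt \<omega>)" if v: "v \<in> U" for v
  proof -
    have "pE v = (\<Sum>u\<in>U. pmf E (u, v))" using row[OF v] sym by simp
    also have "\<dots> = (\<Sum>u\<in>V2. pmf E (u, v))" using UV fV2 E0 by (intro sum.mono_neutral_left) auto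
    also have "\<dots> = c * (\<Sum>u\<in>V2. \<Sum>\<omega>\<in>Om. Wt \<omega> * of_bool (vv L (i + 1) \<omega> = v) * of_bool (vv L i \<omega> = u))"
      unfolding ES S_def sum_distrib_left of_bool_conj by (simp only: mult.assoc mult.commute mult.left_commute)
    also have "(\<Sum>u\<in>V2. \<Sum>\<omega>\<in>Om. Wt \<omega> * of_bool (vv L (i + 1) \<omega> = v) * of_bool (vv L i \<omega> = u)) = (\<Sum>\<omega>\<in>Om. Wt \<omega> * of_bool (vv L (i + 1) \<omega> = v))"
      by (subst sum.swap, rule sum.cong[OF refl], rule pick) (use iL in auto)
    also have "\<dots> = (\<Sum>\<omega>\<in>{\<omega> \<in> Om. vv L (i + 1) \<omega> = v}. Wt \<omega>)"
      using fOm by (simp add: sum.inter_filter of_bool_def if_distrib cong: if_cong)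
    finally show ?thesis .
  qed
  have "graph_lambda U E \<le> \<rho>"
  proof (rule graph_lambda_le[OF \<rho>(1,2)])
    fix g assume g0: "(\<Sum>u\<in>U. pE u * g u) = 0"
    \<comment> \<open>Extension by zero, so that \<open>f\<close> can be evaluated at every first
      endpoint while only the vertices of the link count.\<close>
    define f where "f = (\<lambda>u. if u \<in> U then g u else 0)"
    have fin: "finite U" by (rule U)
    have pickU: "(\<Sum>u\<in>U. h * of_bool (vv L i \<omega> = u) * F u) = h * (if vv L i \<omega> \<in> U then F (vv L i \<omega>) else (0::real))" for h \<omega> F
      using fin by (simp add: of_bool_def if_distrib if_distribR sum.delta' cong: if_cong)
    have tot: "(\<Sum>u\<in>U. pE u * F u) = c * (\<Sum>\<omega>\<in>Om. Wt \<omega> * (if vv L i \<omega> \<in> U then F (vv L i \<omega>) else 0))" for F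
    proof -
      have "(\<Sum>u\<in>U. pE u * F u) = c * (\<Sum>u\<in>U. \<Sum>\<omega>\<in>Om. Wt \<omega> * of_bool (vv L i \<omega> = u) * F u)"
        unfolding sum_distrib_left by (rule sum.cong[OF refl]) (simp only: pcol sum_distrib_left sum_distrib_right mult.assoc)
      also have "\<dots> = c * (\<Sum>\<omega>\<in>Om. Wt \<omega> * (if vv L i \<omega> \<in> U then F (vv L i \<omega>) else 0))"
        by (subst sum.swap) (simp only: pickU)
      finally show ?thesis .
    qed
    have m: "(\<Sum>\<omega>\<in>Om. Wt \<omega> * f (vv L i \<omega>)) = 0"
      using tot[of g] g0 c unfolding f_def by simp
    have sq: "(\<Sum>u\<in>U. pE u * (g u)\<^sup>2) = c * (\<Sum>\<omega>\<in>Om. Wt \<omega> * (f (vv L i \<omega>))\<^sup>2)"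
      unfolding tot f_def by (intro arg_cong[of _ _ "(*) c"] sum.cong refl) simp
    define num den where "num = (\<lambda>v. \<Sum>\<omega>\<in>{\<omega> \<in> Om. vv L (i + 1) \<omega> = v}. Wt \<omega> * f (vv L i \<omega>))"
      and "den = (\<lambda>v. \<Sum>\<omega>\<in>{\<omega> \<in> Om. vv L (i + 1) \<omega> = v}. Wt \<omega>)"
    have nn: "(\<Sum>u\<in>U. pmf E (v, u) * g u) = c * num v" for v
    proof -
      have "(\<Sum>u\<in>U. pmf E (v, u) * g u) = (\<Sum>u\<in>U. pmf E (u, v) * g u)"
        by (rule sum.cong[OF refl]) (subst sym, rule refl)
      also have "\<dots> = c * (\<Sum>u\<in>U. \<Sum>\<omega>\<in>Om. (Wt \<omega> * of_bool (vv L (i + 1) \<omega> = v)) * of_bool (vv L i \<omega> = u) * g u)"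
        unfolding ES S_def sum_distrib_left sum_distrib_right of_bool_conj by (simp only: mult.assoc mult.commute mult.left_commute)
      also have "\<dots> = c * (\<Sum>\<omega>\<in>Om. (Wt \<omega> * of_bool (vv L (i + 1) \<omega> = v)) * f (vv L i \<omega>))"
        by (subst sum.swap) (simp only: pickU f_def)
      also have "\<dots> = c * num v" unfolding num_def
        using fOm by (simp add: sum.inter_filter of_bool_def if_distrib if_distribR cong: if_cong)
      finally show ?thesis .
    qed
    have "(\<Sum>v\<in>U. (\<Sum>u\<in>U. pmf E (v, u) * g u)\<^sup>2 / pE v) = c * (\<Sum>v\<in>U. (num v)\<^sup>2 / den v)"
      unfolding sum_distrib_left
    proof (rule sum.cong[OF refl])
      fix v assume v: "v \<in> U"
      have "pE v = c * den v" unfolding den_def by (rule prow[OF v])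
      then show "(\<Sum>u\<in>U. pmf E (v, u) * g u)\<^sup>2 / pE v = c * ((num v)\<^sup>2 / den v)"
        unfolding nn using c by (simp add: power2_eq_square)
    qed
    also have "\<dots> \<le> c * (\<rho>\<^sup>2 * (\<Sum>\<omega>\<in>Om. Wt \<omega> * (f (vv L i \<omega>))\<^sup>2))"
    proof (rule mult_left_mono)
      let ?I = "vv L (i + 1) ` Om"
      have den: "den v \<ge> 0" for v unfolding den_def by (intro sum_nonneg Wt_nonneg)
      have fI: "finite ?I" using fOm by simp
      have "(\<Sum>v\<in>U. (num v)\<^sup>2 / den v) = (\<Sum>v\<in>U \<inter> ?I. (num v)\<^sup>2 / den v)"
      proof (rule sum.mono_neutral_right[OF fin])
        show "\<forall>v\<in>U - U \<inter> ?I. (num v)\<^sup>2 / den v = 0"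
        proof
          fix v assume "v \<in> U - U \<inter> ?I"
          then have "{\<omega> \<in> Om. vv L (i + 1) \<omega> = v} = {}" by blast
          then show "(num v)\<^sup>2 / den v = 0" unfolding num_def by (simp only: sum.empty) simp
        qed
      qed blast
      also have "\<dots> \<le> (\<Sum>v\<in>?I. (num v)\<^sup>2 / den v)" using fI den by (intro sum_mono2) auto
      also have "\<dots> \<le> (4 * (2 ^ (i + 1) + 1) / 2 ^ (2 ^ (L - i - 2)) + 4 * 2 ^ (L - i - 2) * eps) * (\<Sum>\<omega>\<in>Om. Wt \<omega> * (f (vv L i \<omega>))\<^sup>2)"
        unfolding num_def den_def Om_def Wt_def
        by (rule Omb_core_bound[OF harm_Nm[OF p] iL eps exp]) (use m in \<open>simp_all add: Om_def Wt_def\<close>)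
      also have "\<dots> \<le> \<rho>\<^sup>2 * (\<Sum>\<omega>\<in>Om. Wt \<omega> * (f (vv L i \<omega>))\<^sup>2)"
        using \<rho>(3) by (intro mult_right_mono sum_nonneg mult_nonneg_nonneg Wt_nonneg) auto
      finally show "(\<Sum>v\<in>U. (num v)\<^sup>2 / den v) \<le> \<rho>\<^sup>2 * (\<Sum>\<omega>\<in>Om. Wt \<omega> * (f (vv L i \<omega>))\<^sup>2)" .
    qed (use c in simp)
    also have "\<dots> = \<rho>\<^sup>2 * (\<Sum>u\<in>U. pE u * (g u)\<^sup>2)" unfolding sq by simp
    finally show "(\<Sum>v\<in>U. (\<Sum>u\<in>U. pmf E (v, u) * g u)\<^sup>2 / pE v) \<le> \<rho>\<^sup>2 * (\<Sum>u\<in>U. pE u * (g u)\<^sup>2)" .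
  qed
  moreover have "link_verts (gen ?k) w = U" unfolding U_def by (rule link_verts_gen[OF pk ws wV])
  ultimately show ?thesis unfolding E_def by simp
qed

end

context sp_setup
begin

lemma gen_skeleton_nu:
  assumes k: "k \<le> L"
  shows "gen (flag_marginal k \<nu>) = {w \<in> gen \<nu>. fvs.dim w \<le> k}"
  using skeleton_gen[OF pure_nu k] by (simp add: skeleton_def)

lemma gen_nu_iff: "u \<in> gen \<nu> \<longleftrightarrow> fvs.subspace u \<and> (\<exists>\<omega>\<in>Omg V L. Wt \<omega> > 0 \<and> u \<subseteq> himg L \<omega>)"
  unfolding gen_def[of \<nu>] set_nu by auto

text \<open>A top face has dimension \<open>2 ^ L\<close>, so any of its nonzero vectors extends
  inside it to an independent family of \<open>2 ^ L - 1\<close> vectors, placed at the index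
  \<open>u\<close>.\<close>

lemma exists_Ind_through:
  assumes W: "W \<in> set_pmf \<mu>" and a: "a \<in> W" "a \<noteq> 0" and u: "u \<in> J"
  shows "\<exists>x\<in>Ind V Z0 J. x u = a \<and> Nm \<mu> (ssp Z0 x J) > 0"
proof -
  have Ws: "fvs.subspace W" "W \<subseteq> V" "fvs.dim W = 2 ^ L" using p W by (auto simp: pure_def)
  have fW: "finite W" using Ws(2) V(2) by (rule finite_subset)
  let ?S = "sp1 Z0 a"
  have S: "fvs.subspace ?S" "?S \<subseteq> W" "fvs.dim ?S = 1"
    using a Ws Z0_subset[OF Ws(1)] by (simp_all add: subspace_sp1 sp1_subset dim_sp1)
  have "card (J - {u}) = 2 ^ L - 1 - 1" using u by (simp only: card_Diff_singleton card_Jset)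
  moreover have "(1::nat) \<le> 2 ^ L" by simp
  ultimately have "fvs.dim ?S + card (J - {u}) \<le> fvs.dim W" unfolding S(3) Ws(3) by linarith
  then obtain z where z: "z \<in> Ind W ?S (J - {u})"
    using exists_Ind[OF Ws(1) fW S(1,2) finite_Diff[OF finite_Jset]] by blast
  define x where "x = z(u := a)"
  have xW: "x v \<in> W" if "v \<in> J" for v using that Ind_mem[OF z, of v] a by (cases "v = u") (auto simp: x_def)
  have "x \<in> Ind V Z0 J"
  proof -
    have "indm Z0 x ({u} \<union> (J - {u}))"
    proof (subst indm_union)
      have "indm Z0 x {u}" using a by (simp add: indm_single x_def)
      moreover have "ssp Z0 x {u} = ?S" by (simp add: ssp_single_sp1 x_def)
      moreover have "indm ?S x (J - {u})" using z indm_cong[of "J - {u}" x z ?S] by (simp add: x_def Ind_def)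
      ultimately show "indm Z0 x {u} \<and> indm (ssp Z0 x {u}) x (J - {u})" by simp
    qed (use finite_Jset in auto)
    moreover have "{u} \<union> (J - {u}) = J" using u by blast
    ultimately have "indm Z0 x J" by simp
    moreover have "x \<in> extensional J" using z u by (auto simp: Ind_def PiE_def extensional_def x_def)
    ultimately show ?thesis using xW Ws(2) unfolding Ind_def PiE_def Pi_def by blast
  qed
  moreover have "ssp Z0 x J \<subseteq> W" by (rule ssp_subset[OF Ws(1) Z0_subset[OF Ws(1)] xW])
  then have "Nm \<mu> (ssp Z0 x J) > 0" unfolding Nm_pos_iff using W by blast
  ultimately show ?thesis by (intro bexI[of _ x]) (auto simp: x_def)
qed

section \<open>Ambient space and size of the construction\<close>

text \<open>
  Replacing \<open>x u\<close> by \<open>x u + x v\<close> for some \<open>u\<close> in the support of an encoded element and \<open>v\<close> outside it changes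
  this element by \<open>x v \<otimes> y u\<close>, and these tensors span.
\<close>

lemma ambient_nu:
  assumes amb: "ambient_space (gen \<mu>) = V" and L: "2 \<le> L" and k: "1 \<le> k" "k \<le> L"
  shows "ambient_space (gen (flag_marginal k \<nu>)) = V2"
proof
  let ?T = "ambient_space (gen (flag_marginal k \<nu>))"
  have T: "fvs.subspace ?T" by (simp add: ambient_space_def)
  have pk: "pure V2 k (flag_marginal k \<nu>)" by (rule pure_flag_marginal[OF pure_nu k(2)])
  show "?T \<subseteq> V2"
    unfolding ambient_space_def
  proof (rule fvs.span_minimal[OF _ subspace_F2])
    show "\<Union> (faces (gen (flag_marginal k \<nu>)) 1) \<subseteq> V2"
      using poset_gen(1)[OF pk] unfolding grassmann_poset_def faces_def by blast
  qed
  have memT: "m \<in> ?T" if o: "\<omega> \<in> Omg V L" "Wt \<omega> > 0" and m: "m \<in> himg L \<omega>" for \<omega> m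
  proof (cases "m = 0")
    case True then show ?thesis using T by (simp add: fvs.subspace_0)
  next
    case False
    note h = himg_subspace[OF o(1)]
    have "sp1 Z0 m \<subseteq> himg L \<omega>" by (rule sp1_subset[OF h(1) Z0_subset[OF h(1)] m])
    moreover have d: "fvs.dim (sp1 Z0 m) = 1" using False by (simp add: dim_sp1)
    ultimately have "sp1 Z0 m \<in> gen (flag_marginal k \<nu>)"
      unfolding gen_skeleton_nu[OF k(2)] mem_Collect_eq gen_nu_iff using o k by (auto simp: subspace_sp1)
    then have "sp1 Z0 m \<in> faces (gen (flag_marginal k \<nu>)) 1" using d by (simp add: faces_def)
    moreover have "m \<in> sp1 Z0 m" by (simp add: mem_sp1)
    ultimately show ?thesis unfolding ambient_space_def by (intro fvs.span_base) blast
  qed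
  let ?G = "\<Union> (faces (gen \<mu>) 1)"
  have base: "outer a b \<in> ?T" if ab: "a \<in> ?G" "b \<in> ?G" for a b
  proof (cases "a = 0 \<or> b = 0")
    case True
    then have "outer a b = 0" by auto
    then show ?thesis using T by (simp add: fvs.subspace_0)
  next
    case False
    obtain W W' where W: "W \<in> set_pmf \<mu>" "a \<in> W" "W' \<in> set_pmf \<mu>" "b \<in> W'" using ab unfolding faces_def gen_def by blast
    define e0 e1 where "e0 = unitv 0" and "e1 = unitv 1"
    have e: "e0 \<in> J" "e1 \<in> J" unfolding e0_def e1_def using L by (auto intro!: unitv_mem simp del: Diff_iff)
    have "e1 0 \<noteq> e0 0" by (simp add: e0_def e1_def unitv_def)
    then have ne: "e0 \<noteq> e1" by metis
    obtain x where x: "x \<in> Ind V Z0 J" "x e1 = a" "Nm \<mu> (ssp Z0 x J) > 0" using exists_Ind_through[OF W(1,2) _ e(2)] False by blast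
    obtain y where y: "y \<in> Ind V Z0 J" "y e0 = b" "Nm \<mu> (ssp Z0 y J) > 0" using exists_Ind_through[OF W(3,4) _ e(1)] False by blast
    define x' where "x' = opx e0 {e1} x"
    have nin: "{e1} \<subseteq> J" "e0 \<notin> {e1}" using e ne by auto
    have x': "x' \<in> Ind V Z0 J" "ssp Z0 x' J = ssp Z0 x J"
      unfolding x'_def using Ind_opx[OF V(1) finite_Jset e(1) nin x(1)] ssp_opx[OF finite_Jset e(1) nin] by blast+
    have o: "(x, y) \<in> Omg V L" "(x', y) \<in> Omg V L" using x x' y unfolding Omg_def by blast+
    have w: "Wt (x, y) > 0" "Wt (x', y) > 0" unfolding Wt_pos_iff fst_conv snd_conv x'(2) using x y by blast+
    have hm: "vv L 0 \<omega> \<in> himg L \<omega>" for \<omega> :: "(nat \<Rightarrow> bit, nat) state"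
    proof -
      have "vv L 0 \<omega> = hz L (unitv 0) \<omega>" using L by (intro vv_hz) simp
      then show ?thesis unfolding himg_def using unitv_mem[of 0 L] L by (intro image_eqI[of _ _ "unitv 0"]) auto
    qed
    have m: "vv L 0 (x, y) \<in> ?T" "vv L 0 (x', y) \<in> ?T" using memT[OF o(1) w(1) hm] memT[OF o(2) w(2) hm] by blast+
    have eD: "e0 \<in> Dt L 0" unfolding Dt_def using e by (simp add: e0_def unitv_def)
    have fD: "finite (Dt L 0)" unfolding Dt_def by (rule finite_subset[OF _ finite_Jset[of L]]) blast
    have "vv L 0 (x', y) = (\<Sum>u\<in>Dt L 0. outer (x u) (y u) + (if u = e0 then outer a b else 0))"
      unfolding vv_def fst_conv snd_conv
    proof (rule sum.cong[OF refl])
      fix u show "outer (x' u) (y u) = outer (x u) (y u) + (if u = e0 then outer a b else 0)"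
        using x(2) y(2) by (cases "u = e0") (simp_all add: x'_def opx_def outer_add_left)
    qed
    also have "\<dots> = vv L 0 (x, y) + outer a b"
      unfolding sum.distrib vv_def fst_conv snd_conv using eD fD by (simp only: sum.delta if_True)
    finally have "outer a b = vv L 0 (x, y) + vv L 0 (x', y)" by (simp only: vadd_self_left)
    then show ?thesis using m T unfolding subspace_bit_iff by simp
  qed
  have V_eq: "V = fvs.span ?G" using amb unfolding ambient_space_def by simp
  \<comment> \<open>Bilinearity extends the claim from points of \<open>Y\<close> to all of
    \<open>V\<close>, in one factor at a time.\<close>
  have left: "outer a b \<in> ?T" if a: "a \<in> V" and b: "b \<in> ?G" for a b
  proof -
    have "fvs.subspace {a. outer a b \<in> ?T}"
      using T unfolding subspace_bit_iff by (auto simp: outer_add_left)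
    then have "fvs.span ?G \<subseteq> {a. outer a b \<in> ?T}" using base[OF _ b] by (intro fvs.span_minimal) blast+
    then show ?thesis using a V_eq by blast
  qed
  have all: "outer a b \<in> ?T" if a: "a \<in> V" and b: "b \<in> V" for a b
  proof -
    have "fvs.subspace {b. outer a b \<in> ?T}"
      using T unfolding subspace_bit_iff by (auto simp: outer_add_right)
    then have "fvs.span ?G \<subseteq> {b. outer a b \<in> ?T}" using left[OF a] by (intro fvs.span_minimal) blast+
    then show ?thesis using b V_eq by blast
  qed
  show "V2 \<subseteq> ?T"
  proof
    fix M assume M: "M \<in> V2"
    have "M = (\<Sum>i<n. outer (unitv i) (\<lambda>j. M (i, j)))"
    proof
      fix q :: "nat \<times> nat"
      obtain r s where q: "q = (r, s)" by (cases q)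
      have "(\<Sum>i<n. outer (unitv i) (\<lambda>j. M (i, j))) q = (\<Sum>i<n. if i = r then M (i, s) else 0)"
        unfolding sum_fun_app outer_def q unitv_def by (intro sum.cong refl) auto
      also have "\<dots> = M q" using M by (auto simp: q F2_def)
      finally show "M q = (\<Sum>i<n. outer (unitv i) (\<lambda>j. M (i, j))) q" by simp
    qed
    also have "\<dots> \<in> ?T"
    proof (rule subspace_sum_mem[OF T])
      fix i assume i: "i \<in> {..<n}"
      then have "unitv i \<in> V" using unitv_mem[of i n] by auto
      moreover have "(\<lambda>j. M (i, j)) \<in> V" using M by (auto simp: F2_def)
      ultimately show "outer (unitv i) (\<lambda>j. M (i, j)) \<in> ?T" by (rule all)
    qed
    finally show "M \<in> ?T" .
  qed
qed

lemma card_Dt: "1 \<le> L \<Longrightarrow> card (Dt L 0) = 2 ^ (L - 1)"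
proof -
  assume L: "1 \<le> L"
  have "Dt L 0 = F2 {..<L} - F2 {1..<L}"
  proof (intro equalityI subsetI)
    fix u assume "u \<in> Dt L 0"
    then have "u \<in> F2 {..<L}" "u 0 = 1" by (auto simp: Dt_def)
    then show "u \<in> F2 {..<L} - F2 {1..<L}" by (auto simp: F2_def)
  next
    fix u assume u: "u \<in> F2 {..<L} - F2 {1..<L}"
    have "u 0 = 1"
    proof (rule ccontr)
      assume "u 0 \<noteq> 1"
      then have "u i = 0" if "i \<notin> {1..<L}" for i using u that by (cases "i = 0") (auto simp: F2_def)
      then show False using u by (auto simp: F2_def)
    qed
    moreover have "u \<noteq> 0" using calculation by auto
    ultimately show "u \<in> Dt L 0" using u by (auto simp: Dt_def)
  qed
  moreover have "F2 {1..<L} \<subseteq> F2 {..<L}" by (auto simp: F2_def)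
  ultimately have "card (Dt L 0) = 2 ^ L - 2 ^ (L - 1)" by (simp add: card_Diff_subset finite_F2 card_F2)
  moreover have "(2::nat) ^ L = 2 * 2 ^ (L - 1)" using L by (cases L) auto
  ultimately show ?thesis by simp
qed

text \<open>Up to permuting indices (\<open>dot_perm\<close>), each nonzero element of the
  construction is the encoding of the unit vector at 0, a sum of \<open>2 ^ (L - 1)\<close> tensors.
  Its \<open>2 ^ L\<close> factors are nonzero vectors of top faces of \<open>Y\<close>, and a
  one-dimensional face contains only one nonzero vector.\<close>

lemma card_faces_nu:
  assumes L: "1 \<le> L" and k: "1 \<le> k" "k \<le> L"
  shows "card (faces (gen (flag_marginal k \<nu>)) 1) \<le> card (faces (gen \<mu>) 1) ^ 2 ^ L"
proof -
  define N1 where "N1 = {a. a \<noteq> 0 \<and> (\<exists>W\<in>set_pmf \<mu>. a \<in> W)}"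
  have WV: "W \<subseteq> V" "fvs.subspace W" if "W \<in> set_pmf \<mu>" for W using p that by (auto simp: pure_def)
  have fN1: "finite N1" using WV(1) unfolding N1_def by (intro finite_subset[OF _ V(2)]) blast
  have cN1: "card N1 \<le> card (faces (gen \<mu>) 1)"
  proof (rule card_inj_on_le)
    show "inj_on (sp1 Z0) N1"
    proof (rule inj_onI)
      fix a b assume ab: "a \<in> N1" "b \<in> N1" "sp1 Z0 a = sp1 Z0 b"
      have "a \<in> sp1 Z0 b" unfolding ab(3)[symmetric] by (simp add: mem_sp1)
      then show "a = b" using ab(1) by (auto simp: mem_sp1 N1_def vadd_eq_0_iff)
    qed
    show "sp1 Z0 ` N1 \<subseteq> faces (gen \<mu>) 1"
    proof (rule image_subsetI)
      fix a assume "a \<in> N1"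
      then obtain W where W: "W \<in> set_pmf \<mu>" "a \<in> W" "a \<noteq> 0" unfolding N1_def by blast
      have "sp1 Z0 a \<subseteq> W" by (rule sp1_subset[OF WV(2)[OF W(1)] Z0_subset[OF WV(2)[OF W(1)]] W(2)])
      then show "sp1 Z0 a \<in> faces (gen \<mu>) 1" using W by (auto simp: faces_def gen_def subspace_sp1 dim_sp1)
    qed
    have "gen \<mu> \<subseteq> Pow V" using WV(1) unfolding gen_def by blast
    then have "finite (gen \<mu>)" by (rule finite_subset) (simp add: V)
    then show "finite (faces (gen \<mu>) 1)" by (simp add: faces_def)
  qed
  let ?D = "Dt L 0"
  have fD: "finite ?D" unfolding Dt_def by (rule finite_subset[OF _ finite_Jset[of L]]) blast
  define P where "P = PiE ?D (\<lambda>_. N1) \<times> PiE ?D (\<lambda>_. N1)"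
  define G where "G = (\<lambda>\<omega> :: (nat \<Rightarrow> bit, nat) state. sp1 Z0 (vv L 0 \<omega>))"
  have fP: "finite P" unfolding P_def using fD fN1 by (intro finite_SigmaI finite_PiE) auto
  have "faces (gen (flag_marginal k \<nu>)) 1 \<subseteq> G ` P"
  proof
    fix f assume f: "f \<in> faces (gen (flag_marginal k \<nu>)) 1"
    then have fs: "fvs.subspace f" "fvs.dim f = 1" and "f \<in> gen \<nu>" unfolding gen_skeleton_nu[OF k(2)] faces_def gen_nu_iff by auto
    then obtain \<omega> where o: "\<omega> \<in> Omg V L" "Wt \<omega> > 0" "f \<subseteq> himg L \<omega>" unfolding gen_nu_iff by blast
    have ff: "finite f" using o(3) himg_subspace(2)[OF o(1)] by (rule finite_subset)
    obtain m where m: "m \<in> f" "m \<noteq> 0"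
    proof -
      have "card f = 2" using card_subspace[OF fs(1) ff] fs(2) by simp
      then have "\<not> f \<subseteq> {0}" using card_mono[of "{0}" f] by auto
      then show thesis using that by blast
    qed
    have fm: "f = sp1 Z0 m"
    proof (rule sym, rule subspace_eq_of_dim[OF _ fs(1) ff])
      show "fvs.subspace (sp1 Z0 m)" by (simp add: subspace_sp1)
      show "sp1 Z0 m \<subseteq> f" by (rule sp1_subset[OF fs(1) Z0_subset[OF fs(1)] m(1)])
      show "fvs.dim f \<le> fvs.dim (sp1 Z0 m)" using m fs by (simp add: dim_sp1)
    qed
    obtain z where z: "z \<in> F2 {..<L}" "m = hz L z \<omega>" using m(1) o(3) unfolding himg_def by blast
    have z0: "z \<noteq> 0" using m(2) z(2) hz_zero[of L \<omega>] by metis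
    define zz where "zz = restrict (\<lambda>_. z) {..<1::nat}"
    have s1: "{..<1::nat} = {0}" by auto
    have "indm Z0 zz {..<1}" unfolding s1 indm_single using z0 by (simp add: zz_def)
    moreover have "zz \<in> PiE {..<1} (\<lambda>_. F2 {..<L})" unfolding zz_def using z(1) by auto
    ultimately have "zz \<in> Ind (F2 {..<L}) Z0 {..<1}" unfolding Ind_def by blast
    then obtain M where M: "bij_betw M J J" "\<And>u t. t < 1 \<Longrightarrow> M u t = dot L (zz t) u" using dot_perm by blast
    have Mz: "M u 0 = dot L z u" for u using M(2)[of 0 u] by (simp add: zz_def)
    obtain \<omega>' where o': "\<omega>' \<in> Omg V L" "\<omega> = reidx L M \<omega>'"
      using reidx_bij[OF M(1) V(2)] o(1) unfolding bij_betw_def by blast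
    have mv: "m = vv L 0 \<omega>'" unfolding z(2) o'(2) by (rule hz_reidx[OF M(1) Mz])
    have "Wt \<omega>' > 0" using o(2) unfolding o'(2) Wt_def reidx_def fst_conv snd_conv ssp_reidx[OF M(1)] .
    then have pos: "Nm \<mu> (ssp Z0 (fst \<omega>') J) > 0" "Nm \<mu> (ssp Z0 (snd \<omega>') J) > 0" unfolding Wt_pos_iff by blast+
    have memN: "x u \<in> N1" if x: "x \<in> Ind V Z0 J" "Nm \<mu> (ssp Z0 x J) > 0" and u: "u \<in> ?D" for x u
    proof -
      have uJ: "u \<in> J" using u unfolding Dt_def by blast
      have "x u \<in> ssp Z0 x J" by (rule ssp_gen[OF subspace_Z0 finite_Jset uJ])
      then show ?thesis using Ind_nonzero[OF x(1) uJ] x(2) unfolding N1_def Nm_pos_iff by blast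
    qed
    have oI: "fst \<omega>' \<in> Ind V Z0 J" "snd \<omega>' \<in> Ind V Z0 J" using o'(1) unfolding Omg_def mem_Times_iff by blast+
    define \<omega>2 where "\<omega>2 = (restrict (fst \<omega>') ?D, restrict (snd \<omega>') ?D)"
    have "\<omega>2 \<in> P" unfolding P_def \<omega>2_def using memN[OF oI(1) pos(1)] memN[OF oI(2) pos(2)] by auto
    moreover have "vv L 0 \<omega>2 = vv L 0 \<omega>'" unfolding vv_def \<omega>2_def fst_conv snd_conv by (rule sum.cong[OF refl]) (simp only: restrict_apply')
    then have "f = G \<omega>2" unfolding G_def fm mv by simp
    ultimately show "f \<in> G ` P" by blast
  qed
  then have "card (faces (gen (flag_marginal k \<nu>)) 1) \<le> card (G ` P)" using fP by (intro card_mono) auto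
  also have "\<dots> \<le> card P" by (rule card_image_le[OF fP])
  also have "\<dots> = card N1 ^ (2 ^ (L - 1) + 2 ^ (L - 1))"
    unfolding P_def card_cartesian_product card_PiE[OF fD] prod_constant card_Dt[OF L] power_add ..
  also have "(2::nat) ^ (L - 1) + 2 ^ (L - 1) = 2 ^ L" using L by (cases L) auto
  also have "card N1 ^ 2 ^ L \<le> card (faces (gen \<mu>) 1) ^ 2 ^ L" using cN1 by (rule power_mono) simp
  finally show ?thesis .
qed

end

section \<open>Choice of parameters\<close>

text \<open>A base below 2 that absorbs the linear factor as soon as \<open>q = 4\<close>, where it
  reads \<open>13 \<le> (19 / 10) ^ 4\<close>.\<close>

lemma linear_le_power: "4 \<le> q \<Longrightarrow> 2 * real q + 5 \<le> (19 / 10) ^ q"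
proof (induction q rule: nat_induct_at_least)
  case base
  show ?case by (simp add: power_numeral_reduce)
next
  case (Suc q)
  have "2 * real (Suc q) + 5 \<le> 19 / 10 * (2 * real q + 5)" using Suc(1) by simp
  also have "\<dots> \<le> 19 / 10 * (19 / 10) ^ q" using Suc(2) by (intro mult_left_mono) auto
  finally show ?case by simp
qed

text \<open>The expansion of \<open>Y\<close> contributes at most \<open>1 / 2 ^ q\<close>: the
  factor \<open>1 / 2 ^ L\<close> absorbs \<open>4 * q\<close>, and
  \<open>(2 / 3) ^ 2 < 1 / 2\<close>. The classes contribute at most
  \<open>(2 * q + 4) / 2 ^ q\<close>. Absorbing the linear factor leaves
  \<open>(19 / 20) ^ q\<close>, and \<open>(19 / 20) ^ 16 \<le> 1 / 2\<close> gives the exponent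
  \<open>q / 16\<close>, halved by the square root.\<close>

lemma numeric_bound:
  fixes q i L :: nat
  assumes q: "4 \<le> q" and i: "2 * 2 ^ (i + 1) \<le> q" and d: "4 * q \<le> 2 ^ L"
  shows "4 * (2 ^ (i + 1) + 1) / 2 ^ q + 4 * real q * ((2 / 3) ^ (2 * q - 1) * (1 / (4 * 2 ^ L))) \<le> (2 powr (- real q / 32))\<^sup>2"
proof -
  have "real (2 * 2 ^ (i + 1)) \<le> real q" "real (4 * q) \<le> real (2 ^ L)" using i d by (simp_all only: of_nat_le_iff)
  then have i': "2 * 2 ^ (i + 1) \<le> real q" and d': "4 * real q \<le> 2 ^ L" by simp_all
  have "2 * q = Suc (2 * q - 1)" using q by simp
  then have "(2 / 3 :: real) ^ (2 * q) = 2 / 3 * (2 / 3) ^ (2 * q - 1)" by (metis power_Suc)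
  then have "(2 / 3 :: real) ^ (2 * q - 1) = 3 / 2 * (4 / 9) ^ q" by (simp add: power_mult power2_eq_square)
  also have "\<dots> \<le> 3 / 2 * (1 / 2) ^ q" by (intro mult_left_mono power_mono) auto
  also have "\<dots> \<le> 4 * (1 / 2) ^ q" by (intro mult_right_mono) auto
  finally have h: "(2 / 3 :: real) ^ (2 * q - 1) / 4 \<le> 1 / 2 ^ q" by (simp add: power_one_over)
  have "4 * real q * ((2 / 3) ^ (2 * q - 1) * (1 / (4 * 2 ^ L))) = (4 * real q / 2 ^ L) * ((2 / 3) ^ (2 * q - 1) / 4)" by simp
  also have "\<dots> \<le> 1 * ((2 / 3) ^ (2 * q - 1) / 4)" using d' by (intro mult_right_mono) auto
  also have "\<dots> \<le> 1 / 2 ^ q" using h by simp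
  finally have e: "4 * real q * ((2 / 3) ^ (2 * q - 1) * (1 / (4 * 2 ^ L))) \<le> 1 / 2 ^ q" .
  have "4 * (2 ^ (i + 1) + 1) / 2 ^ q \<le> (2 * real q + 4) / 2 ^ q" using i' by (intro divide_right_mono) auto
  then have "4 * (2 ^ (i + 1) + 1) / 2 ^ q + 4 * real q * ((2 / 3) ^ (2 * q - 1) * (1 / (4 * 2 ^ L))) \<le> (2 * real q + 4) / 2 ^ q + 1 / 2 ^ q"
    using e by (rule add_mono)
  also have "\<dots> = (2 * real q + 5) / 2 ^ q" by (simp add: add_divide_distrib[symmetric])
  also have "\<dots> \<le> (19 / 10) ^ q / 2 ^ q" using linear_le_power[OF q] by (intro divide_right_mono) auto
  also have "\<dots> = (19 / 20) ^ q" by (simp add: power_divide[symmetric])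
  also have "\<dots> \<le> (2 powr (- 1 / 16)) ^ q"
  proof (rule power_mono)
    show "19 / 20 \<le> (2 powr (- 1 / 16) :: real)"
    proof (rule power_le_imp_le_base[of _ 15])
      have "(2 powr (- 1 / 16) :: real) ^ Suc 15 = 2 powr (- 1)" by (simp only: powr_power) simp
      also have "\<dots> = 1 / 2" by (simp add: powr_minus_divide)
      finally show "(19 / 20) ^ Suc 15 \<le> (2 powr (- 1 / 16) :: real) ^ Suc 15" by (simp add: power_numeral_reduce)
    qed simp
  qed simp
  also have "\<dots> = (2 powr (- real q / 32))\<^sup>2" by (simp only: powr_power) simp
  finally show ?thesis .
qed

text \<open>The constant is \<open>K = 32\<close>, twice the 16 from \<open>numeric_bound\<close>:
  second eigenvalues of links are at most \<open>2 powr (- q / 32)\<close>, and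
  \<open>32 * log 2 (1 / lam') \<le> sqrt d \<le> q\<close>. The dimension \<open>d\<close> is the
  maximum rounded up to a power of two, as the construction demands.\<close>

theorem theorem3p10:
  shows "\<exists>K::real. K > 0 \<and>
    (\<forall>(lam'::real) (D::real) (d'::nat) (L::nat) (d::nat) (lam::real) (n::nat)
      (Y :: (nat \<Rightarrow> bit) set set) (\<mu> :: (nat \<Rightarrow> bit) set pmf).
      0 < lam' \<and> lam' < 1 \<and> 0 < D \<and> 0 < d' \<and>
      L = (LEAST l::nat. max (2 ^ (2 * d')) ((K * log 2 (1 / lam')) ^ 2) \<le> (2::real) ^ l) \<and>
      d = 2 ^ L \<and>
      lam \<le> 1 / (4 * real d) \<and>
      params_poset {..<n} d n D lam (Y, \<mu>)
      \<longrightarrow>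
      params_poset ({..<n} \<times> {..<n}) d' (n ^ 2) (real d * D) lam' (skeleton d' (SP n L (Y, \<mu>))))"
proof (intro exI[of _ "32::real"] conjI allI impI)
  fix lam' D :: real and d' L d :: nat and lam :: real and n :: nat
    and Y :: "(nat \<Rightarrow> bit) set set" and \<mu> :: "(nat \<Rightarrow> bit) set pmf"
  assume a: "0 < lam' \<and> lam' < 1 \<and> 0 < D \<and> 0 < d' \<and>
      L = (LEAST l::nat. max (2 ^ (2 * d')) ((32 * log 2 (1 / lam')) ^ 2) \<le> (2::real) ^ l) \<and>
      d = 2 ^ L \<and> lam \<le> 1 / (4 * real d) \<and> params_poset {..<n} d n D lam (Y, \<mu>)"
  have lam': "0 < lam'" "lam' < 1" and d': "0 < d'" and d: "d = 2 ^ L" and lam: "lam \<le> 1 / (4 * real d)"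
    and pp: "params_poset {..<n} d n D lam (Y, \<mu>)" using a by blast+
  have "\<exists>l. max (2 ^ (2 * d')) ((32 * log 2 (1 / lam')) ^ 2) \<le> (2::real) ^ l"
    using real_arch_pow[of 2 "max (2 ^ (2 * d')) ((32 * log 2 (1 / lam')) ^ 2)"] by (meson less_imp_le one_less_numeral_iff semiring_norm(76))
  then have "max (2 ^ (2 * d')) ((32 * log 2 (1 / lam')) ^ 2) \<le> (2::real) ^ L"
    using a LeastI_ex[of "\<lambda>l. max (2 ^ (2 * d')) ((32 * log 2 (1 / lam')) ^ 2) \<le> (2::real) ^ l"] by blast
  then have "(2::real) ^ (2 * d') \<le> 2 ^ L" and logL: "(32 * log 2 (1 / lam')) ^ 2 \<le> (2::real) ^ L" by simp_all
  then have L: "2 * d' \<le> L" by (simp add: power_increasing_iff)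
  have V: "fvs.subspace (F2 {..<n})" "finite (F2 {..<n})" by (simp_all add: subspace_F2 finite_F2)
  have gp: "grassmann_poset (F2 {..<n}) d Y" "set_pmf \<mu> = faces Y d" and ex: "poset_expander d lam (Y, \<mu>)"
    and amb: "ambient_space Y = F2 {..<n}" and cD: "real (card (faces Y 1)) \<le> 2 powr D"
    using pp by (simp_all add: params_poset_def)
  note g = gen_of_poset[OF V gp]
  have p: "pure (F2 {..<n}) (2 ^ L) \<mu>" using g(1) d by simp
  interpret sp_setup n L \<mu> by unfold_locales (rule p)
  have kL: "1 \<le> d'" "d' \<le> L" "2 \<le> L" "1 \<le> L" using d' L by auto
  \<comment> \<open>The largest value that the hypothesis allows for \<open>lam\<close>; trickling
    down starts from it.\<close>
  define e where "e = 1 / (4 * (2::real) ^ L)"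
  have e: "0 \<le> e" "e \<le> 1 / 4" by (simp_all add: e_def divide_simps)
  have Ebase: "Exp V (2 ^ L) (Nm \<mu>) S e" if S: "fvs.subspace S" "S \<subseteq> V" "Nm \<mu> S > 0" "fvs.dim S + 2 \<le> 2 ^ L" for S
  proof (rule Exp_of_graph_lambda[OF p S(1,2,4,3)])
    have "S \<in> faces Y (fvs.dim S)" using S(1,3) unfolding g(2) faces_def gen_def Nm_pos_iff by blast
    then have "graph_lambda (link_verts Y S) (link_edge_pmf \<mu> S) \<le> lam"
      using ex S(4) unfolding poset_expander_def prod.case d by blast
    moreover have "link_verts Y S = {v \<in> V. n1 (Nm \<mu>) S v > 0}" unfolding g(2) by (rule link_verts_gen[OF p S(1,2)])
    ultimately show "graph_lambda {v \<in> V. n1 (Nm \<mu>) S v > 0} (link_edge_pmf \<mu> S) \<le> e" using lam by (simp add: e_def d)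
  qed
  have EE: "Exp V (2 ^ L) (Nm \<mu>) S ((2 / 3) ^ m * e)"
    if S: "fvs.subspace S" "S \<subseteq> V" "Nm \<mu> S > 0" "fvs.dim S + 2 + m \<le> 2 ^ L" for S m
  proof -
    define k where "k = 2 ^ L - 2 - fvs.dim S"
    have "Exp V (2 ^ L) (Nm \<mu>) S ((2 / 3) ^ k * e)"
      by (rule Exp_iterate[OF harm_Nm[OF p] e Ebase S(1-3)]) (use S(4) in \<open>simp_all add: k_def\<close>)
    moreover have "2 * real (card S) \<le> 2 ^ (2 ^ L)"
    proof -
      have "finite S" using S(2) V(2) by (rule finite_subset)
      then have "2 * real (card S) = 2 ^ Suc (fvs.dim S)" by (simp add: card_subspace[OF S(1)])
      also have "\<dots> \<le> 2 ^ (2 ^ L)" using S(4) by (intro power_increasing) auto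
      finally show ?thesis .
    qed
    moreover have "(2 / 3) ^ k * e \<le> (2 / 3) ^ m * e"
      using S(4) e by (intro mult_right_mono power_decreasing) (auto simp: k_def)
    ultimately show ?thesis using Exp_mono[OF harm_Nm[OF p] S(1,2)] by blast
  qed
  let ?k = "flag_marginal d' \<nu>"
  have sk: "skeleton d' (SP n L (Y, \<mu>)) = (gen ?k, ?k)"
    unfolding g(2) SP_gen by (rule skeleton_gen[OF pure_nu kL(2)])
  have pk: "pure V2 d' ?k" by (rule pure_flag_marginal[OF pure_nu kL(2)])
  have expander: "graph_lambda (link_verts (gen ?k) w) (link_edge_pmf ?k w) \<le> lam'" if i: "i + 2 \<le> d'" and w: "w \<in> faces (gen ?k) i" for i w
  proof -
    define q :: nat where "q = 2 ^ (L - i - 2)"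
    have q4: "4 \<le> q"
    proof -
      have "(2::nat) ^ 2 \<le> q" unfolding q_def using i L by (intro power_increasing) auto
      then show ?thesis by simp
    qed
    have qi: "2 * 2 ^ (i + 1) \<le> q"
    proof -
      have "(2::nat) ^ (i + 2) \<le> q" unfolding q_def using i L by (intro power_increasing) auto
      then show ?thesis by simp
    qed
    have qL: "4 * q \<le> 2 ^ L"
    proof -
      have "(2::nat) ^ (L - i - 2 + 2) \<le> 2 ^ L" using i L by (intro power_increasing) auto
      then show ?thesis by (simp add: q_def)
    qed
    define \<rho> where "\<rho> = 2 powr (- real q / 32)"
    have "graph_lambda (link_verts (gen ?k) w) (link_edge_pmf ?k w) \<le> \<rho>"
    proof (rule link_bound[OF i kL(2) w])
      show "0 \<le> (2 / 3) ^ (2 * q - 1) * e" using e by simp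
      show "Exp V (2 ^ L) (Nm \<mu>) S ((2 / 3) ^ (2 * q - 1) * e)"
        if S: "fvs.subspace S" "S \<subseteq> V" "Nm \<mu> S > 0" "fvs.dim S \<le> 2 ^ L - 2 * 2 ^ (L - i - 2) - 1" for S
      proof (rule EE[OF S(1-3)])
        \<comment> \<open>The codimension of \<open>S\<close> is at least \<open>2 * q + 1\<close>,
          and trickling down starts at codimension 2, so \<open>2 * q - 1\<close> steps are
          available.\<close>
        have "fvs.dim S \<le> 2 ^ L - 2 * q - 1" using S(4) unfolding q_def .
        then show "fvs.dim S + 2 + (2 * q - 1) \<le> 2 ^ L" using q4 qL by linarith
      qed
      show "0 \<le> \<rho>" by (simp add: \<rho>_def)
      show "\<rho> < 1" unfolding \<rho>_def using q4 powr_less_mono[of "- real q / 32" 0 2] by simp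
      show "4 * (2 ^ (i + 1) + 1) / 2 ^ 2 ^ (L - i - 2) + 4 * 2 ^ (L - i - 2) * ((2 / 3) ^ (2 * q - 1) * e) \<le> \<rho>\<^sup>2"
      proof -
        have "real q = 2 ^ (L - i - 2)" by (simp add: q_def)
        then show ?thesis using numeric_bound[OF q4 qi qL] unfolding q_def[symmetric] e_def \<rho>_def by simp
      qed
    qed
    also have "\<rho> \<le> lam'"
    proof -
      \<comment> \<open>From \<open>i + 2 \<le> d'\<close> and \<open>2 * d' \<le> L\<close> follows
        \<open>L \<le> 2 * (L - i - 2)\<close>, that is \<open>sqrt d \<le> q\<close>.\<close>
      have "(2::real) ^ L \<le> 2 ^ (2 * (L - i - 2))" using i L by (intro power_increasing) auto
      also have "\<dots> = (real q)\<^sup>2" by (simp add: q_def power_mult[symmetric] mult.commute)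
      finally have "(32 * log 2 (1 / lam')) ^ 2 \<le> (real q)\<^sup>2" using logL by simp
      then have "32 * log 2 (1 / lam') \<le> real q" by (rule power2_le_imp_le) simp
      then have "- real q / 32 \<le> log 2 lam'" using lam' by (simp add: log_divide)
      then have "2 powr (- real q / 32) \<le> 2 powr (log 2 lam')" by (intro powr_mono) auto
      then show ?thesis using lam' by (simp add: \<rho>_def)
    qed
    finally show ?thesis .
  qed
  have cnt: "real (card (faces (gen ?k) 1)) \<le> 2 powr (real d * D)"
  proof -
    have "real (card (faces (gen ?k) 1)) \<le> real (card (faces (gen \<mu>) 1) ^ 2 ^ L)"
      using card_faces_nu[OF kL(4) kL(1,2)] by (simp only: of_nat_le_iff)
    also have "\<dots> \<le> (2 powr D) ^ d" using cD unfolding g(2) d of_nat_power by (intro power_mono) auto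
    also have "\<dots> = 2 powr (real d * D)" by (simp add: powr_power mult.commute)
    finally show ?thesis .
  qed
  show "params_poset ({..<n} \<times> {..<n}) d' (n ^ 2) (real d * D) lam' (skeleton d' (SP n L (Y, \<mu>)))"
    unfolding sk params_poset_def fst_conv snd_conv
  proof (intro conjI)
    show "card ({..<n} \<times> {..<n}) = n ^ 2" by (simp add: power2_eq_square)
    show "poset_expander d' lam' (gen ?k, ?k)" unfolding poset_expander_def prod.case using expander by blast
    show "ambient_space (gen ?k) = V2" using amb unfolding g(2) by (intro ambient_nu kL)
  qed (use poset_gen[OF pk] cnt in auto)
qed simp

end
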